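(* Assume the Objective Assumptions and the Stochastic-Update Assumptions (stated in the context) with parameters $m\ge2$, $\beta\in[1,2]$. Then there exist $\alpha_0>0$ and $c\in(0,1)$ such that, for every stepsize $0<\alpha\le\alpha_0$, one can choose a continuous weight function $V_\alpha:\mathsf Z\to[1,\infty)$ for which the augmented chain $Z_n=(X_n,\xi_n)$ admits a unique invariant law $\pi_\alpha\in\mathcal P_1(\mathsf Z,d_{V_\alpha,\alpha})$. Moreover, $$W_{V_\alpha,\alpha}(\mu P_\alpha^n,\nu P_\alpha^n)\le(1-c\alpha^{m-1})^n\,W_{V_\alpha,\alpha}(\mu,\nu),\qquad n\ge0,$$ for all initial laws $\mu,\nu$ on $\mathsf Z$ with $W_{V_\alpha,\alpha}(\mu,\nu)<\infty$.
   Context: Setup. $\|\cdot\|$ is the Euclidean norm, $\langle\cdot,\cdot\rangle$ the inner product, $\succeq$ the Loewner order. Data: $d,d_\Xi\ge1$; a nonempty closed convex set $\Xi\subseteq\mathbb R^{d_\Xi}$; a measurable space $\mathcal U$; i.i.d. $\mathcal U$-valued random variables $U_1,U_2,\dots$; a Borel measurable map $\Phi:\Xi\times\mathcal U\to\Xi$; $H:\mathbb R^d\to\mathbb R$ with $h:=\nabla H$; a Borel measurable map $g:\mathbb R^d\times\Xi\to\mathbb R^d$. For a stepsize $\alpha\in(0,1)$, SGD with Markovian noise is $\xi_{n+1}=\Phi(\xi_n,U_{n+1})$, $X_{n+1}=X_n-\alpha\{h(X_n)+g(X_n,\xi_{n+1})\}$. The augmented process $Z_n=(X_n,\xi_n)$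 on $\mathsf Z:=\mathbb R^d\times\Xi$ is the Markov chain $Z_{n+1}=F_{U_{n+1}}(Z_n)$ with $F_u(x,\xi):=(x-\alpha\{h(x)+g(x,\Phi(\xi,u))\},\Phi(\xi,u))$ and $Z_0$ independent of the innovations; its transition kernel is $P_\alpha$. Objective Assumptions (parameters $m\ge2$, $\beta\in[1,2]$). (Regularity) $H\in C^2(\mathbb R^d)$, $H$ is convex, $0\in\arg\min H$. (Local flatness) There are $R_H>0$ and $c_{\rm in},C_{\rm in}>0$ such that for all $0<\|x\|\le R_H$: $\nabla^2H(x)\succeq c_{\rm in}\|x\|^{m-2}I_d$ and $\|h(x)\|\le C_{\rm in}\|x\|^{m-1}$ (when $m=2$ extended to $x=0$ by continuity). (Tail) If $\beta=2$: there is $c_{\rm out}>0$ with $\nabla^2H(x)\succeq c_{\rm out}I_d$ for $\|x\|\ge R_H$. If $1\le\beta<2$: there are $c_{\rm out},C_{\rm out}>0$ with $\langle x,h(x)\rangle\ge c_{\rm out}\|x\|^\beta$ and $\|h(x)\|\le C_{\rm out}\|x\|^{\beta-1}$ for $\|x\|\ge R_H$. Stochastic-Update Assumptions (same $m,\beta,R_H$; convention $\|x\|^0=1$). (Driving-chain contraction) There is a measurable $L_\Phi:\mathcal U\to[0,1]$ with $\|\Phi(\xi,u)-\Phi(\eta,u)\|\le L_\Phi(u)\|\xi-\eta\|$ for all $\xi,\eta\in\Xi$, $u\in\mathcal U$, and $\mathbb E L_\Phi(U_1)<1$. (Lipschitz noise) There is $L_{g,\Phi}>0$ with $\|g(x,\Phi(\xi,u))-g(x,\Phi(\eta,u))\|\le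 L_{g,\Phi}\|\xi-\eta\|$ for all $x,\xi,\eta,u$. (Reference point) There is $\xi_\star\in\Xi$ with $\mathbb E\|\Phi(\xi_\star,U_1)-\xi_\star\|<\infty$; if $\beta=2$, also $\mathbb E\|g(0,\Phi(\xi_\star,U_1))\|<\infty$. (Tail dissipativity, only if $1\le\beta<2$) With $\bar g(x,\xi):=\mathbb E[g(x,\Phi(\xi,U_1))]$, there is $c_{\rm diss}>0$ with $\langle x,h(x)+\bar g(x,\xi)\rangle\ge c_{\rm diss}\|x\|^\beta$ for all $\|x\|\ge R_H$, $\xi\in\Xi$. (Exponential integrability, only if $1\le\beta<2$) There is $\lambda_0>0$ with $\sup_{x\in\mathbb R^d}\sup_{\xi\in\Xi}\mathbb E\exp\bigl(\lambda_0\|g(x,\Phi(\xi,U_1))\|/(1+\|x\|^{\beta-1})\bigr)<\infty$. (Nondegeneracy, only if $m>2$) There are $\varepsilon_g,p_g>0$ with $\inf_{\xi\in\Xi}\mathbb P(\|g(0,\Phi(\xi,U_1))\|\ge\varepsilon_g)\ge p_g$. (Co-coercivity and noise perturbation) With $\mathsf G(x,\xi):=h(x)+g(x,\xi)$, for every $\xi\in\Xi$ the map $x\mapsto\mathsf G(x,\xi)$ is $C^1$, and there are $L_{\mathsf G}\ge1$, $\theta\in[0,1)$ such that for all $x,y\in\mathbb R^d$, $\xi\in\Xi$: $\langle x-y,\mathsf G(x,\xi)-\mathsf G(y,\xi)\rangle\ge L_{\mathsf G}^{-1}\|\mathsf G(x,\xi)-\mathsf G(y,\xi)\|^2$ and $\langle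 x-y,\bar g(x,\xi)-\bar g(y,\xi)\rangle\ge-\theta\langle x-y,h(x)-h(y)\rangle$. Metrics. On $\mathbb R^d\times\mathbb R^{d_\Xi}$ put $|(x,\xi)|_\alpha:=\|x\|+\alpha^{-1}\|\xi\|$. For continuous $V:\mathsf Z\to[1,\infty)$, $d_{V,\alpha}(z,z'):=\inf_\gamma\int_0^1V(\gamma(t))|\dot\gamma(t)|_\alpha\,dt$ over absolutely continuous curves $\gamma:[0,1]\to\mathsf Z$ from $z$ to $z'$; $W_{V,\alpha}(\mu,\nu)$ is the Wasserstein-1 distance with cost $d_{V,\alpha}$ (infimum over couplings of $\int d_{V,\alpha}\,d\gamma$). $\mathcal P_1(E,d)$ is the set of probability laws $\mu$ on $E$ with $\int d(z,z_0)\,\mu(dz)<\infty$ for some $z_0\in E$. *)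

theory Defs
  imports "HOL-Probability.Probability"
begin

definition grad :: "('a::euclidean_space \<Rightarrow> real) \<Rightarrow> 'a \<Rightarrow> 'a" where
  "grad f x = (THE D. GDERIV f x :> D)"

definition C1_map :: "('a::euclidean_space \<Rightarrow> 'b::euclidean_space) \<Rightarrow> bool" where
  "C1_map f \<longleftrightarrow> (\<exists>f'. (\<forall>x. (f has_derivative blinfun_apply (f' x)) (at x)) \<and> continuous_on UNIV f')"

definition C2_fun :: "('a::euclidean_space \<Rightarrow> real) \<Rightarrow> bool" where
  "C2_fun f \<longleftrightarrow> (\<forall>x. f differentiable (at x)) \<and> C1_map (grad f)"

definition hessian :: "(real ^ 'd \<Rightarrow> real) \<Rightarrow> real ^ 'd \<Rightarrow> real ^ 'd ^ 'd" where
  "hessian f x = jacobian (grad f) (at x)"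

text \<open>Loewner order: \<open>loewner_ge A B\<close> says that \<open>A - B\<close> is positive semidefinite. All matrices
  compared below are symmetric (Hessians of \<open>C\<^sup>2\<close> functions, multiples of the identity).\<close>

definition loewner_ge :: "real ^ 'd ^ 'd \<Rightarrow> real ^ 'd ^ 'd \<Rightarrow> bool" where
  "loewner_ge A B \<longleftrightarrow> (\<forall>v. 0 \<le> v \<bullet> ((A - B) *v v))"

text \<open>Real power \<open>t\<^sup>a\<close> of \<open>t \<ge> 0\<close> with the convention \<open>t\<^sup>0 = 1\<close> also at \<open>t = 0\<close>
  (the library has \<open>0 powr 0 = 0\<close>).\<close>

definition rpow :: "real \<Rightarrow> real \<Rightarrow> real" where
  "rpow t a = (if a = 0 then 1 else t powr a)"

text \<open>The innovations \<open>U 1, U 2, \<dots>\<close> are random variables on the probability space \<open>M\<close> with values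
  in the measurable space \<open>\<U>\<close>; the index \<open>0\<close> is not used. The functions \<open>\<Phi>\<close> and \<open>g\<close> are total,
  but only their values for noise states in \<open>\<Xi>\<close> and innovations in \<open>\<U>\<close> matter.\<close>

definition iid_innovations :: "'w measure \<Rightarrow> 'u measure \<Rightarrow> (nat \<Rightarrow> 'w \<Rightarrow> 'u) \<Rightarrow> bool" where
  "iid_innovations M \<U> U \<longleftrightarrow>
     prob_space M \<and> prob_space.indep_vars M (\<lambda>_. \<U>) U {1..} \<and>
     (\<forall>n\<ge>1. distr M \<U> (U n) = distr M \<U> (U 1))"

definition sgd_data ::
  "(real ^ 'e) set \<Rightarrow> 'u measure \<Rightarrow> (real ^ 'e \<Rightarrow> 'u \<Rightarrow> real ^ 'e) \<Rightarrow>
   (real ^ 'd \<Rightarrow> real ^ 'e \<Rightarrow> real ^ 'd) \<Rightarrow> bool" where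
  "sgd_data \<Xi> \<U> \<Phi> g \<longleftrightarrow>
     \<Xi> \<noteq> {} \<and> closed \<Xi> \<and> convex \<Xi> \<and>
     (\<lambda>(\<xi>, u). \<Phi> \<xi> u) \<in> restrict_space borel \<Xi> \<Otimes>\<^sub>M \<U> \<rightarrow>\<^sub>M restrict_space borel \<Xi> \<and>
     (\<lambda>(x, \<xi>). g x \<xi>) \<in> borel_measurable (restrict_space borel (UNIV \<times> \<Xi>))"

definition aug_space :: "(real ^ 'e) set \<Rightarrow> ((real ^ 'd) \<times> (real ^ 'e)) measure" where
  "aug_space \<Xi> = restrict_space borel (UNIV \<times> \<Xi>)"

definition aug_map ::
  "real \<Rightarrow> (real ^ 'd \<Rightarrow> real) \<Rightarrow> (real ^ 'e \<Rightarrow> 'u \<Rightarrow> real ^ 'e) \<Rightarrow>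
   (real ^ 'd \<Rightarrow> real ^ 'e \<Rightarrow> real ^ 'd) \<Rightarrow> 'u \<Rightarrow> (real ^ 'd) \<times> (real ^ 'e) \<Rightarrow> (real ^ 'd) \<times> (real ^ 'e)" where
  "aug_map \<alpha> H \<Phi> g u = (\<lambda>(x, \<xi>). (x - \<alpha> *\<^sub>R (grad H x + g x (\<Phi> \<xi> u)), \<Phi> \<xi> u))"

text \<open>The transition kernel of \<open>Z\<^sub>n\<^sub>+\<^sub>1 = F (U\<^sub>n\<^sub>+\<^sub>1) Z\<^sub>n\<close> with \<open>Z\<^sub>0\<close> independent of the innovations:
  \<open>P(z, \<cdot>)\<close> is the law of \<open>F (U\<^sub>1) z\<close>. The law \<open>\<mu>P\<close> is then the Giry bind \<open>\<mu> \<bind> P\<close>.\<close>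

definition aug_kernel ::
  "'w measure \<Rightarrow> (nat \<Rightarrow> 'w \<Rightarrow> 'u) \<Rightarrow> (real ^ 'e) set \<Rightarrow> real \<Rightarrow> (real ^ 'd \<Rightarrow> real) \<Rightarrow>
   (real ^ 'e \<Rightarrow> 'u \<Rightarrow> real ^ 'e) \<Rightarrow> (real ^ 'd \<Rightarrow> real ^ 'e \<Rightarrow> real ^ 'd) \<Rightarrow>
   (real ^ 'd) \<times> (real ^ 'e) \<Rightarrow> ((real ^ 'd) \<times> (real ^ 'e)) measure" where
  "aug_kernel M U \<Xi> \<alpha> H \<Phi> g z = distr M (aug_space \<Xi>) (\<lambda>\<omega>. aug_map \<alpha> H \<Phi> g (U 1 \<omega>) z)"

definition regularity :: "(real ^ 'd \<Rightarrow> real) \<Rightarrow> bool" where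
  "regularity H \<longleftrightarrow> C2_fun H \<and> convex_on UNIV H \<and> (\<forall>x. H 0 \<le> H x)"

text \<open>For \<open>m = 2\<close> the bounds extend to \<open>x = 0\<close> by continuity, so they are stated there as well.\<close>

definition local_flatness :: "(real ^ 'd \<Rightarrow> real) \<Rightarrow> real \<Rightarrow> real \<Rightarrow> bool" where
  "local_flatness H m R \<longleftrightarrow> R > 0 \<and> (\<exists>c_in>0. \<exists>C_in>0.
     \<forall>x. norm x \<le> R \<and> (x \<noteq> 0 \<or> m = 2) \<longrightarrow>
       loewner_ge (hessian H x) ((c_in * rpow (norm x) (m - 2)) *\<^sub>R mat 1) \<and>
       norm (grad H x) \<le> C_in * rpow (norm x) (m - 1))"

definition tail_growth :: "(real ^ 'd \<Rightarrow> real) \<Rightarrow> real \<Rightarrow> real \<Rightarrow> bool" where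
  "tail_growth H \<beta> R \<longleftrightarrow>
     (\<beta> = 2 \<longrightarrow> (\<exists>c_out>0. \<forall>x. R \<le> norm x \<longrightarrow> loewner_ge (hessian H x) (c_out *\<^sub>R mat 1))) \<and>
     (1 \<le> \<beta> \<and> \<beta> < 2 \<longrightarrow> (\<exists>c_out>0. \<exists>C_out>0. \<forall>x. R \<le> norm x \<longrightarrow>
        c_out * rpow (norm x) \<beta> \<le> x \<bullet> grad H x \<and>
        norm (grad H x) \<le> C_out * rpow (norm x) (\<beta> - 1)))"

definition objective_assms :: "(real ^ 'd \<Rightarrow> real) \<Rightarrow> real \<Rightarrow> real \<Rightarrow> real \<Rightarrow> bool" where
  "objective_assms H m \<beta> R \<longleftrightarrow> regularity H \<and> local_flatness H m R \<and> tail_growth H \<beta> R"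

text \<open>In the assumptions below, \<open>U1\<close> stands for the innovation \<open>U 1\<close>.\<close>

definition driving_contraction ::
  "'w measure \<Rightarrow> 'u measure \<Rightarrow> ('w \<Rightarrow> 'u) \<Rightarrow> (real ^ 'e) set \<Rightarrow>
   (real ^ 'e \<Rightarrow> 'u \<Rightarrow> real ^ 'e) \<Rightarrow> bool" where
  "driving_contraction M \<U> U1 \<Xi> \<Phi> \<longleftrightarrow> (\<exists>L \<in> borel_measurable \<U>.
     (\<forall>u\<in>space \<U>. 0 \<le> L u \<and> L u \<le> 1) \<and>
     (\<forall>\<xi>\<in>\<Xi>. \<forall>\<eta>\<in>\<Xi>. \<forall>u\<in>space \<U>. norm (\<Phi> \<xi> u - \<Phi> \<eta> u) \<le> L u * norm (\<xi> - \<eta>)) \<and>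
     (\<integral>\<omega>. L (U1 \<omega>) \<partial>M) < 1)"

definition lipschitz_noise ::
  "'u measure \<Rightarrow> (real ^ 'e) set \<Rightarrow> (real ^ 'e \<Rightarrow> 'u \<Rightarrow> real ^ 'e) \<Rightarrow>
   (real ^ 'd \<Rightarrow> real ^ 'e \<Rightarrow> real ^ 'd) \<Rightarrow> bool" where
  "lipschitz_noise \<U> \<Xi> \<Phi> g \<longleftrightarrow> (\<exists>L>0. \<forall>x. \<forall>\<xi>\<in>\<Xi>. \<forall>\<eta>\<in>\<Xi>. \<forall>u\<in>space \<U>.
     norm (g x (\<Phi> \<xi> u) - g x (\<Phi> \<eta> u)) \<le> L * norm (\<xi> - \<eta>))"

definition reference_point ::
  "'w measure \<Rightarrow> ('w \<Rightarrow> 'u) \<Rightarrow> (real ^ 'e) set \<Rightarrow> (real ^ 'e \<Rightarrow> 'u \<Rightarrow> real ^ 'e) \<Rightarrow>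
   (real ^ 'd \<Rightarrow> real ^ 'e \<Rightarrow> real ^ 'd) \<Rightarrow> real \<Rightarrow> bool" where
  "reference_point M U1 \<Xi> \<Phi> g \<beta> \<longleftrightarrow> (\<exists>\<xi>s\<in>\<Xi>.
     integrable M (\<lambda>\<omega>. norm (\<Phi> \<xi>s (U1 \<omega>) - \<xi>s)) \<and>
     (\<beta> = 2 \<longrightarrow> integrable M (\<lambda>\<omega>. norm (g 0 (\<Phi> \<xi>s (U1 \<omega>))))))"

text \<open>The integral below exists for all \<open>x\<close> and all \<open>\<xi> \<in> \<Xi>\<close> under the assumptions of the theorem:
  for \<open>\<beta> < 2\<close> by exponential integrability; for \<open>\<beta> = 2\<close> by the reference point, the Lipschitz bound
  and the Lipschitz continuity in \<open>x\<close> that co-coercivity implies.\<close>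

definition noise_mean ::
  "'w measure \<Rightarrow> ('w \<Rightarrow> 'u) \<Rightarrow> (real ^ 'e \<Rightarrow> 'u \<Rightarrow> real ^ 'e) \<Rightarrow>
   (real ^ 'd \<Rightarrow> real ^ 'e \<Rightarrow> real ^ 'd) \<Rightarrow> real ^ 'd \<Rightarrow> real ^ 'e \<Rightarrow> real ^ 'd" where
  "noise_mean M U1 \<Phi> g x \<xi> = (\<integral>\<omega>. g x (\<Phi> \<xi> (U1 \<omega>)) \<partial>M)"

definition tail_dissipativity ::
  "'w measure \<Rightarrow> ('w \<Rightarrow> 'u) \<Rightarrow> (real ^ 'e) set \<Rightarrow> (real ^ 'e \<Rightarrow> 'u \<Rightarrow> real ^ 'e) \<Rightarrow>
   (real ^ 'd \<Rightarrow> real ^ 'e \<Rightarrow> real ^ 'd) \<Rightarrow> (real ^ 'd \<Rightarrow> real) \<Rightarrow> real \<Rightarrow> real \<Rightarrow> bool" where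
  "tail_dissipativity M U1 \<Xi> \<Phi> g H \<beta> R \<longleftrightarrow> (\<exists>c_diss>0. \<forall>x. \<forall>\<xi>\<in>\<Xi>. R \<le> norm x \<longrightarrow>
     c_diss * rpow (norm x) \<beta> \<le> x \<bullet> (grad H x + noise_mean M U1 \<Phi> g x \<xi>))"

definition exponential_integrability ::
  "'w measure \<Rightarrow> ('w \<Rightarrow> 'u) \<Rightarrow> (real ^ 'e) set \<Rightarrow> (real ^ 'e \<Rightarrow> 'u \<Rightarrow> real ^ 'e) \<Rightarrow>
   (real ^ 'd \<Rightarrow> real ^ 'e \<Rightarrow> real ^ 'd) \<Rightarrow> real \<Rightarrow> bool" where
  "exponential_integrability M U1 \<Xi> \<Phi> g \<beta> \<longleftrightarrow> (\<exists>lam>0.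
     (SUP x. SUP \<xi>\<in>\<Xi>. \<integral>\<^sup>+\<omega>. ennreal (exp (lam *
        (norm (g x (\<Phi> \<xi> (U1 \<omega>))) / (1 + rpow (norm x) (\<beta> - 1))))) \<partial>M) < \<infinity>)"

definition nondegeneracy ::
  "'w measure \<Rightarrow> ('w \<Rightarrow> 'u) \<Rightarrow> (real ^ 'e) set \<Rightarrow> (real ^ 'e \<Rightarrow> 'u \<Rightarrow> real ^ 'e) \<Rightarrow>
   (real ^ 'd \<Rightarrow> real ^ 'e \<Rightarrow> real ^ 'd) \<Rightarrow> bool" where
  "nondegeneracy M U1 \<Xi> \<Phi> g \<longleftrightarrow> (\<exists>\<epsilon>>0. \<exists>p>0.
     p \<le> (INF \<xi>\<in>\<Xi>. measure M {\<omega>\<in>space M. \<epsilon> \<le> norm (g 0 (\<Phi> \<xi> (U1 \<omega>)))}))"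

definition cocoercivity ::
  "'w measure \<Rightarrow> ('w \<Rightarrow> 'u) \<Rightarrow> (real ^ 'e) set \<Rightarrow> (real ^ 'e \<Rightarrow> 'u \<Rightarrow> real ^ 'e) \<Rightarrow>
   (real ^ 'd \<Rightarrow> real ^ 'e \<Rightarrow> real ^ 'd) \<Rightarrow> (real ^ 'd \<Rightarrow> real) \<Rightarrow> bool" where
  "cocoercivity M U1 \<Xi> \<Phi> g H \<longleftrightarrow>
     (let G = (\<lambda>x \<xi>. grad H x + g x \<xi>); gbar = noise_mean M U1 \<Phi> g in
       (\<forall>\<xi>\<in>\<Xi>. C1_map (\<lambda>x. G x \<xi>)) \<and>
       (\<exists>L\<ge>1. \<exists>\<theta>\<in>{0..<1}. \<forall>x y. \<forall>\<xi>\<in>\<Xi>.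
          inverse L * (norm (G x \<xi> - G y \<xi>))\<^sup>2 \<le> (x - y) \<bullet> (G x \<xi> - G y \<xi>) \<and>
          - \<theta> * ((x - y) \<bullet> (grad H x - grad H y)) \<le> (x - y) \<bullet> (gbar x \<xi> - gbar y \<xi>)))"

definition stochastic_update_assms ::
  "'w measure \<Rightarrow> 'u measure \<Rightarrow> ('w \<Rightarrow> 'u) \<Rightarrow> (real ^ 'e) set \<Rightarrow>
   (real ^ 'e \<Rightarrow> 'u \<Rightarrow> real ^ 'e) \<Rightarrow> (real ^ 'd \<Rightarrow> real ^ 'e \<Rightarrow> real ^ 'd) \<Rightarrow>
   (real ^ 'd \<Rightarrow> real) \<Rightarrow> real \<Rightarrow> real \<Rightarrow> real \<Rightarrow> bool" where
  "stochastic_update_assms M \<U> U1 \<Xi> \<Phi> g H m \<beta> R \<longleftrightarrow>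
     driving_contraction M \<U> U1 \<Xi> \<Phi> \<and>
     lipschitz_noise \<U> \<Xi> \<Phi> g \<and>
     reference_point M U1 \<Xi> \<Phi> g \<beta> \<and>
     (1 \<le> \<beta> \<and> \<beta> < 2 \<longrightarrow>
        tail_dissipativity M U1 \<Xi> \<Phi> g H \<beta> R \<and> exponential_integrability M U1 \<Xi> \<Phi> g \<beta>) \<and>
     (m > 2 \<longrightarrow> nondegeneracy M U1 \<Xi> \<Phi> g) \<and>
     cocoercivity M U1 \<Xi> \<Phi> g H"

text \<open>Absolute continuity of a curve on \<open>[a, b]\<close>: the increments over any finite family of
  non-overlapping subintervals of small total length have small sum.\<close>

definition abs_continuous_curve :: "real \<Rightarrow> real \<Rightarrow> (real \<Rightarrow> 'a::real_normed_vector) \<Rightarrow> bool" where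
  "abs_continuous_curve a b \<gamma> \<longleftrightarrow> (\<forall>\<epsilon>>0. \<exists>\<delta>>0. \<forall>(n::nat) s t.
     (\<forall>i<n. a \<le> s i \<and> s i \<le> t i \<and> t i \<le> b) \<and>
     disjoint_family_on (\<lambda>i. {s i<..<t i}) {..<n} \<and>
     (\<Sum>i<n. t i - s i) < \<delta> \<longrightarrow> (\<Sum>i<n. norm (\<gamma> (t i) - \<gamma> (s i))) < \<epsilon>)"

definition scaled_norm ::
  "real \<Rightarrow> 'a::real_normed_vector \<times> 'b::real_normed_vector \<Rightarrow> real" where
  "scaled_norm \<alpha> = (\<lambda>(x, \<xi>). norm x + inverse \<alpha> * norm \<xi>)"

text \<open>Curves only matter on \<open>[0, 1]\<close>. An absolutely continuous curve is differentiable almost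
  everywhere there, and the arbitrary value that \<open>vector_derivative\<close> takes elsewhere does not
  affect the integral.\<close>

definition path_metric ::
  "(real ^ 'e) set \<Rightarrow> ((real ^ 'd) \<times> (real ^ 'e) \<Rightarrow> real) \<Rightarrow> real \<Rightarrow>
   (real ^ 'd) \<times> (real ^ 'e) \<Rightarrow> (real ^ 'd) \<times> (real ^ 'e) \<Rightarrow> ennreal" where
  "path_metric \<Xi> V \<alpha> z z' =
     (INF \<gamma> \<in> {\<gamma>. abs_continuous_curve 0 1 \<gamma> \<and> \<gamma> ` {0..1} \<subseteq> UNIV \<times> \<Xi> \<and> \<gamma> 0 = z \<and> \<gamma> 1 = z'}.
        \<integral>\<^sup>+t\<in>{0..1}. ennreal (V (\<gamma> t) *
          scaled_norm \<alpha> (vector_derivative \<gamma> (at t within {0..1}))) \<partial>lborel)"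

definition laws :: "'a measure \<Rightarrow> 'a measure set" where
  "laws S = {\<mu>. prob_space \<mu> \<and> sets \<mu> = sets S}"

definition couplings :: "'a measure \<Rightarrow> 'a measure \<Rightarrow> ('a \<times> 'a) measure set" where
  "couplings \<mu> \<nu> = {\<gamma>. prob_space \<gamma> \<and> sets \<gamma> = sets (\<mu> \<Otimes>\<^sub>M \<nu>) \<and>
     distr \<gamma> \<mu> fst = \<mu> \<and> distr \<gamma> \<nu> snd = \<nu>}"

definition wasserstein1 ::
  "('a \<Rightarrow> 'a \<Rightarrow> ennreal) \<Rightarrow> 'a measure \<Rightarrow> 'a measure \<Rightarrow> ennreal" where
  "wasserstein1 d \<mu> \<nu> = (INF \<gamma> \<in> couplings \<mu> \<nu>. \<integral>\<^sup>+p. d (fst p) (snd p) \<partial>\<gamma>)"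

definition laws1 :: "'a measure \<Rightarrow> ('a \<Rightarrow> 'a \<Rightarrow> ennreal) \<Rightarrow> 'a measure set" where
  "laws1 S d = {\<mu> \<in> laws S. \<exists>z0 \<in> space S. (\<integral>\<^sup>+z. d z z0 \<partial>\<mu>) < \<infinity>}"

end

theory Submission
  imports Defs
begin

text \<open>The cost \<open>d\<^sub>V\<close> is a length metric, so it suffices to show that the synchronous coupling of two chains
  contracts infinitesimally. Starting at \<open>(x, \<xi>)\<close>, a displacement \<open>v\<close> of the first coordinate costs \<open>V x * norm v\<close>, and after one step
  it costs \<open>V(X\<^sub>1)\<close> times the length of its image. By co-coercivity that length never grows, and where the Hessian
  of \<open>H\<close> is at least \<open>\<lambda>\<close>, its mean shrinks by the factor \<open>1 - \<alpha> \<lambda> (1 - \<theta>) / 2\<close>. Where the curvature is missing, the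
  mean of the weight itself decreases: in the subquadratic tail by the drift of a Lyapunov function, and near a flat
  minimum (\<open>m > 2\<close>) because the noise throws \<open>X\<^sub>1\<close> out of a small bump of height \<open>\<kappa> \<alpha>\<^sup>m\<^sup>-\<^sup>1\<close> added to the weight there.
  Displacements of the noise state are contracted by \<open>L\<^sub>\<Phi>\<close>, and the factor \<open>\<alpha>\<^sup>-\<^sup>1\<close> in the norm makes their effect on the first
  coordinate negligible. The invariant law is the law of the limit of the backward iterates of the random maps.\<close>

text \<open>The exponent \<open>m - 1\<close> comes from a balance of scales. Near the minimum one
  step moves the chain by order \<open>\<alpha>\<close>, so the noise can leave a ball of that
  radius; at its boundary the Hessian is bounded below by order
  \<open>\<alpha> powr (m - 2)\<close>, and a step turns this into a gain of order
  \<open>\<alpha> powr (m - 1)\<close>. The bump has the same order of height: leaving the ball must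
  gain as much, but outside it the chain may fall back, and there the curvature pays. Hence the
  order of the constants: height factor \<open>\<kappa>\<close>, rate \<open>c\<close>, stepsize.

  Weight and displacement after a step are dependent, so the mean of their product does not factor.
  The weight is split at a level \<open>s\<close>: below it the displacement shrinks in mean, above
  it one uses only that it never grows.

  The expected distance of the images is symmetric and satisfies the triangle inequality, which
  suffices to integrate infinitesimal bounds along a curve; no image curve is built. This needs the
  cost of a short curve to be bounded below by its increment, hence the fundamental theorem of
  calculus for absolutely continuous curves.\<close>

section \<open>Absolutely continuous curves\<close>

text \<open>The definition indexes the subintervals by an initial segment of the naturals. The
  covers and divisions below are finite sets, and with an arbitrary finite index set their members
  serve as indices.\<close>

lemma abs_continuous_curve_family:
  fixes f :: "real \<Rightarrow> 'a::real_normed_vector"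
  assumes "abs_continuous_curve a b f" "0 < e"
  shows "\<exists>d>0. \<forall>(I::'i set) s t. finite I \<and> (\<forall>i\<in>I. a \<le> s i \<and> s i \<le> t i \<and> t i \<le> b) \<and>
       disjoint_family_on (\<lambda>i. {s i<..<t i}) I \<and> (\<Sum>i\<in>I. t i - s i) < d \<longrightarrow>
       (\<Sum>i\<in>I. norm (f (t i) - f (s i))) < e"
proof -
  obtain d where d: "d > 0" "\<And>(n::nat) s t.
     (\<forall>i<n. a \<le> s i \<and> s i \<le> t i \<and> t i \<le> b) \<and>
     disjoint_family_on (\<lambda>i. {s i<..<t i}) {..<n} \<and>
     (\<Sum>i<n. t i - s i) < d \<Longrightarrow> (\<Sum>i<n. norm (f (t i) - f (s i))) < e"
    using assms unfolding abs_continuous_curve_def by meson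
  show ?thesis
  proof (intro exI[of _ d] conjI d(1) allI impI, elim conjE)
    fix I :: "'i set" and s t
    assume I: "finite I" "\<forall>i\<in>I. a \<le> s i \<and> s i \<le> t i \<and> t i \<le> b"
      "disjoint_family_on (\<lambda>i. {s i<..<t i}) I" "(\<Sum>i\<in>I. t i - s i) < d"
    obtain h where h: "bij_betw h {..<card I} I"
      using ex_bij_betw_nat_finite[OF I(1)] by (auto simp: atLeast0LessThan)
    have "disjoint_family_on (\<lambda>i. {s (h i)<..<t (h i)}) {..<card I}"
      using I(3) h unfolding disjoint_family_on_def bij_betw_def inj_on_def by blast
    moreover have "\<forall>i<card I. a \<le> s (h i) \<and> s (h i) \<le> t (h i) \<and> t (h i) \<le> b"
      using I(2) bij_betwE[OF h] by auto
    moreover have "(\<Sum>i<card I. t (h i) - s (h i)) < d"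
      using I(4) by (simp add: sum.reindex_bij_betw[OF h, of "\<lambda>i. t i - s i"])
    ultimately have "(\<Sum>i<card I. norm (f (t (h i)) - f (s (h i)))) < e"
      by (intro d(2)) simp
    then show "(\<Sum>i\<in>I. norm (f (t i) - f (s i))) < e"
      by (simp add: sum.reindex_bij_betw[OF h, of "\<lambda>i. norm (f (t i) - f (s i))"])
  qed
qed

lemma abs_continuous_curve_imp_continuous:
  fixes f :: "real \<Rightarrow> 'a::real_normed_vector"
  assumes "abs_continuous_curve a b f"
  shows "continuous_on {a..b} f"
  unfolding continuous_on_iff
proof safe
  fix x e :: real assume x: "x \<in> {a..b}" and e: "0 < e"
  obtain d where d: "0 < d" "\<forall>(I::unit set) s t. finite I \<and> (\<forall>i\<in>I. a \<le> s i \<and> s i \<le> t i \<and> t i \<le> b) \<and>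
       disjoint_family_on (\<lambda>i. {s i<..<t i}) I \<and> (\<Sum>i\<in>I. t i - s i) < d \<longrightarrow>
       (\<Sum>i\<in>I. norm (f (t i) - f (s i))) < e"
    using abs_continuous_curve_family[OF assms e] by blast
  have "dist (f y) (f x) < e" if y: "y \<in> {a..b}" "dist y x < d" for y
    using d(2)[rule_format, of "{()}" "\<lambda>_. min x y" "\<lambda>_. max x y"] x y
    by (cases "x \<le> y") (auto simp: disjoint_family_on_def dist_real_def dist_norm norm_minus_commute)
  then show "\<exists>d>0. \<forall>x'\<in>{a..b}. dist x' x < d \<longrightarrow> dist (f x') (f x) < e"
    using d(1) by blast
qed

section \<open>Vitali coverings of the line by intervals\<close>

lemma measure_Union_Icc:
  fixes C :: "(real \<times> real) set"
  assumes "finite C" "\<And>l u. (l, u) \<in> C \<Longrightarrow> l \<le> u"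
    and "pairwise (\<lambda>i j. disjnt {fst i..snd i} {fst j..snd j}) C"
  shows "measure lebesgue (\<Union>(l, u)\<in>C. {l..u}) = (\<Sum>(l, u)\<in>C. u - l)"
proof -
  have "measure lebesgue (\<Union>i\<in>C. {fst i..snd i}) = (\<Sum>i\<in>C. measure lebesgue {fst i..snd i})"
  proof (rule measure_finite_Union)
    show "disjoint_family_on (\<lambda>i. {fst i..snd i}) C"
      using assms(3) unfolding disjoint_family_on_def pairwise_def disjnt_def by blast
  qed (use assms in auto)
  also have "\<dots> = (\<Sum>i\<in>C. snd i - fst i)"
    by (rule sum.cong) (use assms(2) in \<open>auto simp: content_real split: prod.splits\<close>)
  finally show ?thesis by (simp add: case_prod_unfold)
qed

text \<open>Closed intervals are closed balls of the line, so Vitali's theorem gives a countable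
  disjoint subfamily that covers \<open>S\<close> up to a null set. Its union has finite measure
  because it lies in \<open>T\<close>, so finitely many members already carry the measure of
  \<open>S\<close> up to \<open>e\<close>.\<close>

lemma Vitali_covering_intervals:
  fixes S T :: "real set"
  assumes S: "S \<in> lmeasurable" "S \<subseteq> T" and T: "open T" "T \<in> lmeasurable"
    and cov: "\<And>t d. t \<in> S \<Longrightarrow> 0 < d \<Longrightarrow> \<exists>l u. l < t \<and> t < u \<and> u - l < d \<and> P l u"
    and e: "0 < e"
  obtains C where "finite C" "\<And>l u. (l, u) \<in> C \<Longrightarrow> l < u \<and> {l..u} \<subseteq> T \<and> P l u"
    "pairwise (\<lambda>i j. disjnt {fst i..snd i} {fst j..snd j}) C"
    "measure lebesgue S - e < (\<Sum>(l, u)\<in>C. u - l)"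
proof -
  define K where "K = {(l, u). l < u \<and> {l..u} \<subseteq> T \<and> P l u}"
  define a r where "a = (\<lambda>p::real\<times>real. (fst p + snd p) / 2)" and "r = (\<lambda>p::real\<times>real. (snd p - fst p) / 2)"
  have ball: "cball (a p) (r p) = {fst p..snd p}" for p
    by (auto simp: cball_eq_atLeastAtMost a_def r_def field_simps)
  have K: "0 < r p" if "p \<in> K" for p
    using that by (auto simp: K_def r_def)
  have fine: "\<exists>p. p \<in> K \<and> t \<in> cball (a p) (r p) \<and> r p < d" if t: "t \<in> S" "0 < d" for t d
  proof -
    obtain h where h: "h > 0" "cball t h \<subseteq> T"
      using S T t open_contains_cball by blast
    obtain l u where lu: "l < t" "t < u" "u - l < min d h" "P l u"
      using cov[OF t(1), of "min d h"] t h by auto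
    have "{l..u} \<subseteq> cball t h"
      using lu by (auto simp: dist_real_def)
    then show ?thesis
      using lu h by (intro exI[of _ "(l, u)"] conjI, simp_all only: ball) (auto simp: K_def r_def)
  qed
  obtain C where C: "countable C" "C \<subseteq> K"
     "pairwise (\<lambda>i j. disjnt (cball (a i) (r i)) (cball (a j) (r j))) C"
     "negligible (S - (\<Union>i \<in> C. cball (a i) (r i)))"
    using Vitali_covering_theorem_cballs[of K r S a, OF K fine] by blast
  let ?D = "(\<lambda>p. {fst p..snd p}) ` C"
  have inj: "inj_on (\<lambda>p. {fst p..snd p}) C"
  proof (rule inj_onI)
    fix p p' assume "p \<in> C" "p' \<in> C" and eq: "{fst p..snd p} = {fst p'..snd p'}"
    then have "fst p < snd p" "fst p' < snd p'" using C(2) by (auto simp: K_def)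
    then show "p = p'" using eq by (simp add: Icc_eq_Icc prod_eq_iff)
  qed
  have sub: "\<Union>?D \<subseteq> T"
    using C(2) by (fastforce simp: K_def subset_iff)
  have le: "measure lebesgue (\<Union>D') \<le> measure lebesgue T" if "D' \<subseteq> ?D" "finite D'" for D'
    using that sub T by (intro measure_mono_fmeasurable) (auto intro!: sets.finite_Union)
  obtain D' where D': "D' \<subseteq> ?D" "finite D'" "measure lebesgue (\<Union>?D) - e < measure lebesgue (\<Union>D')"
    using measure_countable_Union_approachable[of ?D e "measure lebesgue T"] C(1) e le by auto
  then obtain C' where C': "C' \<subseteq> C" "finite C'" "D' = (\<lambda>p. {fst p..snd p}) ` C'"
    by (metis (no_types, lifting) finite_subset_image)
  have UD: "\<Union>?D \<in> lmeasurable"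
    using C(1) sub T by (intro fmeasurableI2[OF T(2) sub] sets.countable_Union) auto
  have "measure lebesgue S \<le> measure lebesgue (\<Union>?D)"
  proof -
    have "S - (S - \<Union>?D) = S \<inter> \<Union>?D" by auto
    moreover have "measure lebesgue (S - (S - \<Union>?D)) = measure lebesgue S"
      using C(4) S(1) by (intro measure_Diff_null_set) (auto simp: ball negligible_iff_null_sets)
    ultimately have "measure lebesgue S = measure lebesgue (S \<inter> \<Union>?D)" by simp
    also have "\<dots> \<le> measure lebesgue (\<Union>?D)"
      using S UD by (intro measure_mono_fmeasurable) (auto simp: fmeasurableD)
    finally show ?thesis .
  qed
  moreover have "pairwise (\<lambda>i j. disjnt {fst i..snd i} {fst j..snd j}) C'"
    using C(3) C'(1) by (auto simp: ball intro: pairwise_subset)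
  moreover have "measure lebesgue (\<Union>D') = (\<Sum>(l, u)\<in>C'. u - l)"
  proof -
    have "\<Union>D' = (\<Union>(l, u)\<in>C'. {l..u})" using C' by auto
    then show ?thesis
      using measure_Union_Icc[of C'] C' C(2) calculation(2) by (auto simp: K_def subset_iff less_imp_le)
  qed
  ultimately show thesis
    using C' C(2) D'(3) by (intro that[of C']) (auto simp: K_def)
qed

section \<open>Differentiability almost everywhere\<close>

text \<open>The points at which \<open>f\<close> has slope above \<open>q\<close> over arbitrarily small surrounding intervals.
  Working with intervals around the point makes the set a countable intersection of open sets.\<close>

definition steep_points :: "(real \<Rightarrow> real) \<Rightarrow> real \<Rightarrow> real \<Rightarrow> real \<Rightarrow> real set" where
  "steep_points f a b q =
     {t. \<forall>d>0. \<exists>l u. a < l \<and> l < t \<and> t < u \<and> u < b \<and> u - l < d \<and> q * (u - l) < f u - f l}"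

lemma steep_points_subset: "steep_points f a b q \<subseteq> {a<..<b}"
  unfolding steep_points_def by (auto dest!: spec[of _ 1])

lemma steep_points_antimono: "p \<le> q \<Longrightarrow> steep_points f a b q \<subseteq> steep_points f a b p"
proof
  fix t assume pq: "p \<le> q" and t: "t \<in> steep_points f a b q"
  show "t \<in> steep_points f a b p"
    unfolding steep_points_def
  proof safe
    fix d :: real assume "0 < d"
    then obtain l u where lu: "a < l \<and> l < t \<and> t < u \<and> u < b \<and> u - l < d \<and> q * (u - l) < f u - f l"
      using t unfolding steep_points_def by blast
    moreover have "p * (u - l) \<le> q * (u - l)"
      using pq lu by (intro mult_right_mono) auto
    ultimately show "\<exists>l u. a < l \<and> l < t \<and> t < u \<and> u < b \<and> u - l < d \<and> p * (u - l) < f u - f l"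
      by (intro exI[of _ l] exI[of _ u]) linarith
  qed
qed

lemma steep_points_borel: "steep_points f a b q \<in> sets borel"
proof -
  have "steep_points f a b q = (\<Inter>n::nat. \<Union>{{l<..<u} |l u. a < l \<and> u < b \<and> u - l < 1 / Suc n \<and> q * (u - l) < f u - f l})"
    (is "_ = ?R")
  proof safe
    fix t n assume "t \<in> steep_points f a b q"
    then obtain l u where "a < l \<and> l < t \<and> t < u \<and> u < b \<and> u - l < 1 / Suc n \<and> q * (u - l) < f u - f l"
      unfolding steep_points_def by (auto dest!: spec[of _ "1 / real (Suc n)"])
    then show "t \<in> \<Union>{{l<..<u} |l u. a < l \<and> u < b \<and> u - l < 1 / Suc n \<and> q * (u - l) < f u - f l}"
      by (intro UnionI[of "{l<..<u}"]) auto
  next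
    fix t assume t: "t \<in> ?R"
    show "t \<in> steep_points f a b q"
      unfolding steep_points_def
    proof safe
      fix d :: real assume "0 < d"
      then obtain n :: nat where n: "1 / Suc n < d"
        using nat_approx_posE by blast
      from t have "t \<in> \<Union>{{l<..<u} |l u. a < l \<and> u < b \<and> u - l < 1 / Suc n \<and> q * (u - l) < f u - f l}" by blast
      then obtain l u where "a < l \<and> u < b \<and> u - l < 1 / Suc n \<and> q * (u - l) < f u - f l" "l < t" "t < u"
        by auto
      then show "\<exists>l u. a < l \<and> l < t \<and> t < u \<and> u < b \<and> u - l < d \<and> q * (u - l) < f u - f l"
        using n by (intro exI[of _ l] exI[of _ u]) auto
    qed
  qed
  moreover have "?R \<in> sets borel"
    by (intro sets.countable_INT image_subsetI borel_open open_Union) auto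
  ultimately show ?thesis by simp
qed

text \<open>Any point of each piece may serve as its tag, which reduces the claim to telescoping
  over a tagged division, where the tags do not enter.\<close>

lemma sum_division_endpoints:
  fixes f :: "real \<Rightarrow> 'a::real_normed_vector"
  assumes "D division_of {a..b}" "a \<le> b"
  shows "(\<Sum>K\<in>D. f (Sup K) - f (Inf K)) = f b - f a"
proof -
  let ?t = "\<lambda>K::real set. SOME x. x \<in> K"
  have t: "?t K \<in> K" if "K \<in> D" for K
    using division_ofD(3)[OF assms(1) that] by (simp add: some_in_eq)
  have "(\<lambda>K. (?t K, K)) ` D tagged_division_of {a..b}"
  proof (rule tagged_division_ofI)
    show "finite ((\<lambda>K. (?t K, K)) ` D)" using division_of_finite[OF assms(1)] by simp
    show "\<Union>{K. \<exists>x. (x, K) \<in> (\<lambda>K. (?t K, K)) ` D} = {a..b}"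
      using division_ofD(6)[OF assms(1)] by blast
  next
    fix x K assume "(x, K) \<in> (\<lambda>K. (?t K, K)) ` D"
    then have K: "K \<in> D" "x = ?t K" by auto
    show "x \<in> K" using t[OF K(1)] K(2) by simp
    show "K \<subseteq> {a..b}" "\<exists>a b. K = cbox a b"
      using division_ofD(2,4)[OF assms(1) K(1)] by auto
    fix y L assume "(y, L) \<in> (\<lambda>K. (?t K, K)) ` D" "(x, K) \<noteq> (y, L)"
    then show "interior K \<inter> interior L = {}"
      using division_ofD(5)[OF assms(1) K(1), of L] K by auto
  qed
  from additive_tagged_division_1[OF assms(2) this, of f]
  show ?thesis
    by (subst (asm) sum.reindex) (auto simp: inj_on_def)
qed

text \<open>These are the points where the upper derivative is infinite. Absolute continuity gives a
  \<open>d\<close> such that disjoint intervals of total length below \<open>d\<close> carry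
  variation below 1, so a Vitali cover of a part of the set by intervals of slope above
  \<open>q\<close> has total length below \<open>1 / q\<close>, and \<open>q\<close> is arbitrary.
  Windows of length \<open>d / 2\<close> keep the total length below \<open>d\<close>; negligibility
  is a local property, so windows suffice.\<close>

lemma negligible_steep_points_everywhere:
  assumes f: "abs_continuous_curve a b f"
  shows "negligible (\<Inter>q. steep_points f a b q)"
proof -
  let ?E = "\<Inter>q. steep_points f a b q"
  obtain d where d: "0 < d" "\<forall>(I::(real\<times>real) set) s t. finite I \<and> (\<forall>i\<in>I. a \<le> s i \<and> s i \<le> t i \<and> t i \<le> b) \<and>
       disjoint_family_on (\<lambda>i. {s i<..<t i}) I \<and> (\<Sum>i\<in>I. t i - s i) < d \<longrightarrow>
       (\<Sum>i\<in>I. norm (f (t i) - f (s i))) < 1"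
    using abs_continuous_curve_family[OF f zero_less_one] by blast
  have E: "?E \<inter> {c<..<c + d/2} \<in> lmeasurable" for c
  proof -
    \<comment> \<open>Monotonicity in \<open>q\<close> reduces the intersection to integer slopes,
      so it is countable and the set is Borel.\<close>
    have "?E = (\<Inter>n::nat. steep_points f a b n)"
    proof -
      have "(\<Inter>n::nat. steep_points f a b n) \<subseteq> steep_points f a b q" for q
      proof -
        obtain n :: nat where "q \<le> n" using real_arch_simple by blast
        then show ?thesis using steep_points_antimono[of q n f a b] by blast
      qed
      then show ?thesis by blast
    qed
    moreover have "(\<Inter>n::nat. steep_points f a b n) \<in> sets borel"
      using steep_points_borel by (intro sets.countable_INT image_subsetI) auto
    ultimately have Eb: "?E \<in> sets borel" by simp
    show ?thesis
      by (rule fmeasurableI2[of "{c<..<c + d/2}"]) (use Eb in auto)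
  qed
  have null: "negligible (?E \<inter> {c<..<c + d/2})" for c
  proof -
    let ?S = "?E \<inter> {c<..<c + d/2}"
    have le: "measure lebesgue ?S \<le> 1 / q + e" if q: "0 < q" and e: "0 < e" for q e :: real
    proof -
      have cov: "\<exists>l u. l < t \<and> t < u \<and> u - l < h \<and> (a < l \<and> u < b \<and> q * (u - l) < f u - f l)"
        if "t \<in> ?S" "0 < h" for t h
        using that unfolding steep_points_def by blast
      obtain C where C: "finite C"
        "\<And>l u. (l, u) \<in> C \<Longrightarrow> l < u \<and> {l..u} \<subseteq> {c<..<c + d/2} \<and> (a < l \<and> u < b \<and> q * (u - l) < f u - f l)"
        "pairwise (\<lambda>i j. disjnt {fst i..snd i} {fst j..snd j}) C"
        "measure lebesgue ?S - e < (\<Sum>(l, u)\<in>C. u - l)"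
        using Vitali_covering_intervals[OF E[of c] Int_lower2 open_greaterThanLessThan _ cov e] lmeasurable_interval(2)[of c "c + d/2"] by blast
      have "(\<Sum>(l, u)\<in>C. u - l) = measure lebesgue (\<Union>(l, u)\<in>C. {l..u})"
        using C by (intro measure_Union_Icc[symmetric]) force+
      also have "\<dots> \<le> measure lebesgue {c<..<c + d/2}"
        using C(1,2) by (intro measure_mono_fmeasurable) (auto simp: subset_iff intro!: sets.finite_UN)
      also have "\<dots> < d" using d(1) by simp
      finally have len: "(\<Sum>i\<in>C. snd i - fst i) < d" by (simp add: case_prod_unfold)
      have dis: "disjoint_family_on (\<lambda>i. {fst i<..<snd i}) C"
        unfolding disjoint_family_on_def
      proof (intro ballI impI)
        fix i j assume "i \<in> C" "j \<in> C" "i \<noteq> j"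
        then have "disjnt {fst i..snd i} {fst j..snd j}" using C(3) by (simp add: pairwise_def)
        then show "{fst i<..<snd i} \<inter> {fst j<..<snd j} = {}"
          unfolding disjnt_def by (meson disjoint_iff greaterThanLessThan_iff atLeastAtMost_iff less_imp_le)
      qed
      have "q * (measure lebesgue ?S - e) \<le> q * (\<Sum>(l, u)\<in>C. u - l)"
        using C(4) q by (intro mult_left_mono) auto
      also have "\<dots> \<le> (\<Sum>i\<in>C. norm (f (snd i) - f (fst i)))"
        unfolding sum_distrib_left using C(2) by (intro sum_mono) force
      also have "\<dots> < 1"
        using C(1,2) dis len by (intro d(2)[rule_format] conjI ballI) force+
      finally show ?thesis using q by (simp add: field_simps)
    qed
    have "measure lebesgue ?S \<le> 0"
    proof (rule field_le_epsilon)
      fix e :: real assume "0 < e"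
      then show "measure lebesgue ?S \<le> 0 + e"
        using le[of "2 / e" "e / 2"] by simp
    qed
    then show ?thesis
      using E by (simp add: negligible_iff_measure measure_le_0_iff)
  qed
  show ?thesis
  proof (subst locally_negligible_alt, intro ballI)
    fix x assume "x \<in> ?E"
    with d(1) show "\<exists>U. openin (top_of_set ?E) U \<and> x \<in> U \<and> negligible U"
      by (intro exI[of _ "?E \<inter> {x - d/4<..<x - d/4 + d/2}"] conjI null openin_open_Int) auto
  qed
qed

text \<open>At a point of this set some small surrounding intervals have slope above
  \<open>q\<close> and others slope below \<open>p\<close>. Cover the set, of measure
  \<open>s\<close>, by intervals \<open>C\<close> of slope below \<open>p\<close> inside a slightly
  larger open set, and cover it again, inside each of them, by intervals \<open>D\<close> of slope
  above \<open>q\<close>. Both families have total length close to \<open>s\<close>, so the gaps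
  that \<open>D\<close> leaves in \<open>C\<close> are short and carry little variation. Comparing
  increments bounds \<open>q * s\<close> by \<open>p * s\<close> up to a small error.\<close>

lemma negligible_steep_points_oscillating:
  assumes f: "abs_continuous_curve a b f" and pq: "p < q"
  shows "negligible (steep_points f a b q \<inter> steep_points (\<lambda>t. - f t) a b (- p))" (is "negligible ?E")
proof -
  have Eab: "?E \<subseteq> {a<..<b}" using steep_points_subset by blast
  have Eborel: "?E \<in> sets borel" by (intro sets.Int steep_points_borel)
  have E: "?E \<in> lmeasurable"
    by (rule fmeasurableI2[of "{a<..<b}"]) (use Eborel Eab in auto)
  define s where "s = measure lebesgue ?E"
  have key: "(q - p) * s \<le> h + (3 * \<bar>p\<bar> + 5 * \<bar>q\<bar>) * h" if h: "0 < h" for h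
  proof -
    obtain d where d: "0 < d" "\<forall>(I::((real\<times>real) \<times> real set) set) s t. finite I \<and> (\<forall>i\<in>I. a \<le> s i \<and> s i \<le> t i \<and> t i \<le> b) \<and>
       disjoint_family_on (\<lambda>i. {s i<..<t i}) I \<and> (\<Sum>i\<in>I. t i - s i) < d \<longrightarrow>
       (\<Sum>i\<in>I. norm (f (t i) - f (s i))) < h"
      using abs_continuous_curve_family[OF f h] by blast
    \<comment> \<open>The gaps will have total length at most \<open>4 * e\<close>: \<open>C\<close>
      has length at most \<open>s + e\<close> and \<open>D\<close> at least
      \<open>s - 3 * e\<close>. The divisor 5 keeps this below \<open>d\<close>.\<close>
    define e where "e = min h (d / 5)"
    have e: "0 < e" "e \<le> h" "4 * e < d" using h d(1) by (auto simp: e_def)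
    obtain T0 where T0: "open T0" "?E \<subseteq> T0" "T0 - ?E \<in> lmeasurable" "emeasure lebesgue (T0 - ?E) < ennreal e"
      using sets_lebesgue_outer_open[OF fmeasurableD[OF E] e(1)] by metis
    define T where "T = T0 \<inter> {a<..<b}"
    have T: "open T" "?E \<subseteq> T" "T \<in> lmeasurable" "T \<subseteq> {a<..<b}"
      using T0 Eab by (auto simp: T_def intro: fmeasurableI2[of "{a<..<b}"])
    have mT: "measure lebesgue T < s + e"
    proof -
      have "emeasure lebesgue (T - ?E) \<le> emeasure lebesgue (T0 - ?E)"
        using T0 by (intro emeasure_mono) (auto simp: T_def)
      then have "emeasure lebesgue (T - ?E) < ennreal e" using T0(4) by simp
      moreover have "T - ?E \<in> lmeasurable" using T E by (intro fmeasurable.Diff)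
      ultimately have "measure lebesgue (T - ?E) < e"
        using e(1) by (simp add: emeasure_eq_measure2 ennreal_less_iff)
      then show ?thesis
        using measurable_measure_Diff[OF T(3) fmeasurableD[OF E] T(2)] by (simp add: s_def)
    qed
    have covC: "\<exists>l u. l < t \<and> t < u \<and> u - l < k \<and> f u - f l < p * (u - l)"
      if "t \<in> ?E" "0 < k" for t k
    proof -
      from that obtain l u where "l < t" "t < u" "u - l < k" "- p * (u - l) < - f u - - f l"
        unfolding steep_points_def by blast
      then show ?thesis by (intro exI[of _ l] exI[of _ u]) auto
    qed
    obtain C where C: "finite C"
      "\<And>l u. (l, u) \<in> C \<Longrightarrow> l < u \<and> {l..u} \<subseteq> T \<and> f u - f l < p * (u - l)"
      "pairwise (\<lambda>i j. disjnt {fst i..snd i} {fst j..snd j}) C"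
      "measure lebesgue ?E - e < (\<Sum>(l, u)\<in>C. u - l)"
      using Vitali_covering_intervals[OF E T(2,1,3) covC e(1)] by auto
    \<comment> \<open>An error \<open>e / N\<close> for each interval of \<open>C\<close> adds up to
      at most \<open>e\<close>; the summand 1 excludes division by zero.\<close>
    define N where "N = real (card C) + 1"
    have N: "0 < N" by (simp add: N_def)
    define S where "S = (\<lambda>i. ?E \<inter> {fst i<..<snd i})"
    have S: "S i \<in> lmeasurable" for i
      unfolding S_def by (rule fmeasurableI2[of "{fst i<..<snd i}"]) (use Eborel in auto)
    have "\<exists>D. finite D \<and> (\<forall>(l, u)\<in>D. l < u \<and> {l..u} \<subseteq> {fst i<..<snd i} \<and> q * (u - l) < f u - f l) \<and>
        pairwise (\<lambda>i j. disjnt {fst i..snd i} {fst j..snd j}) D \<and>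
        measure lebesgue (S i) - e / N < (\<Sum>(l, u)\<in>D. u - l)" for i
    proof -
      have cov: "\<exists>l u. l < t \<and> t < u \<and> u - l < k \<and> q * (u - l) < f u - f l"
        if "t \<in> S i" "0 < k" for t k
        using that unfolding S_def steep_points_def by blast
      show ?thesis
        by (rule Vitali_covering_intervals[OF S _ open_greaterThanLessThan _ cov, of i "fst i" "snd i" "e / N"])
           (use e N in \<open>auto simp: S_def\<close>)
    qed
    then have "\<exists>D. \<forall>i. finite (D i) \<and> (\<forall>(l, u)\<in>D i. l < u \<and> {l..u} \<subseteq> {fst i<..<snd i} \<and> q * (u - l) < f u - f l) \<and>
        pairwise (\<lambda>i j. disjnt {fst i..snd i} {fst j..snd j}) (D i) \<and>
        measure lebesgue (S i) - e / N < (\<Sum>(l, u)\<in>D i. u - l)"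
      by (intro choice allI)
    then obtain D where D: "\<And>i. finite (D i)"
      "\<And>i. (\<forall>(l, u)\<in>D i. l < u \<and> {l..u} \<subseteq> {fst i<..<snd i} \<and> q * (u - l) < f u - f l)"
      "\<And>i. pairwise (\<lambda>i j. disjnt {fst i..snd i} {fst j..snd j}) (D i)"
      "\<And>i. measure lebesgue (S i) - e / N < (\<Sum>(l, u)\<in>D i. u - l)"
      by blast
    define K where "K = (\<lambda>i. (\<lambda>j. {fst j..snd j}) ` D i)"
    have inj: "inj_on (\<lambda>j. {fst j..snd j}) (D i)" for i
    proof (rule inj_onI)
      fix p p' assume "p \<in> D i" "p' \<in> D i" and eq: "{fst p..snd p} = {fst p'..snd p'}"
      then have "fst p < snd p" "fst p' < snd p'" using D(2)[of i] by auto
      then show "p = p'" using eq by (simp add: Icc_eq_Icc prod_eq_iff)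
    qed
    have sumK: "(\<Sum>k\<in>K i. F (Sup k) - F (Inf k)) = (\<Sum>(l, u)\<in>D i. F u - F l)" for i and F :: "real \<Rightarrow> real"
      unfolding K_def using D(2)[of i]
      by (subst sum.reindex[OF inj]) (auto intro!: sum.cong)
    \<comment> \<open>The disjoint intervals in \<open>K i\<close> are completed to a division of
      the whole interval \<open>i\<close>. The added pieces are the gaps collected in
      \<open>G\<close>, and telescoping over the division relates the increments over
      \<open>C\<close>, \<open>D\<close> and \<open>G\<close>.\<close>
    have "\<exists>Q. K i \<subseteq> Q \<and> Q division_of {fst i..snd i}" if "i \<in> C" for i
    proof -
      have "K i division_of \<Union>(K i)"
        unfolding division_of_def
      proof (intro conjI ballI impI)
        fix k1 k2 assume "k1 \<in> K i" "k2 \<in> K i" "k1 \<noteq> k2"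
        then have "disjnt k1 k2"
          using D(3)[of i] by (auto simp: K_def pairwise_def)
        then show "interior k1 \<inter> interior k2 = {}"
          using interior_subset unfolding disjnt_def by blast
      next
        fix k assume k: "k \<in> K i"
        then obtain j where j: "j \<in> D i" "k = {fst j..snd j}" unfolding K_def by blast
        then show "k \<noteq> {}" using D(2)[of i] by (auto simp: case_prod_unfold)
        show "k \<subseteq> \<Union>(K i)" using k by blast
        show "\<exists>a b. k = cbox a b" using j by auto
      qed (use D(1) in \<open>auto simp: K_def\<close>)
      moreover have "\<Union>(K i) \<subseteq> cbox (fst i) (snd i)"
      proof -
        have "{fst j..snd j} \<subseteq> {fst i..snd i}" if "j \<in> D i" for j
        proof -
          have "{fst j..snd j} \<subseteq> {fst i<..<snd i}" using D(2)[of i] that by (auto simp: case_prod_unfold)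
          also have "\<dots> \<subseteq> {fst i..snd i}" by auto
          finally show ?thesis .
        qed
        then show ?thesis unfolding K_def by (simp add: UN_subset_iff)
      qed
      ultimately show ?thesis
        using partial_division_extend_interval[of "K i" "fst i" "snd i"] by (metis box_real(2))
    qed
    then obtain Q where Q: "\<And>i. i \<in> C \<Longrightarrow> K i \<subseteq> Q i" "\<And>i. i \<in> C \<Longrightarrow> Q i division_of {fst i..snd i}"
      by metis
    have Cle: "fst i < snd i" "{fst i..snd i} \<subseteq> T" if "i \<in> C" for i
      using C(2)[of "fst i" "snd i"] that by auto
    have split: "F (snd i) - F (fst i) = (\<Sum>(l, u)\<in>D i. F u - F l) + (\<Sum>k\<in>Q i - K i. F (Sup k) - F (Inf k))"
      if "i \<in> C" for i and F :: "real \<Rightarrow> real"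
    proof -
      have "F (snd i) - F (fst i) = (\<Sum>k\<in>Q i. F (Sup k) - F (Inf k))"
        using sum_division_endpoints[OF Q(2)[OF that], of F, symmetric] Cle[OF that] by (simp only: less_imp_le)
      also have "\<dots> = (\<Sum>k\<in>K i. F (Sup k) - F (Inf k)) + (\<Sum>k\<in>Q i - K i. F (Sup k) - F (Inf k))"
        by (subst sum.subset_diff[OF Q(1)[OF that] division_of_finite[OF Q(2)[OF that]]]) (rule add.commute)
      finally show ?thesis by (simp only: sumK)
    qed
    define G where "G = Sigma C (\<lambda>i. Q i - K i)"
    have fG: "finite G"
      unfolding G_def using C(1) Q(2) by (intro finite_SigmaI) (auto dest: division_of_finite)
    have G: "a \<le> Inf k \<and> Inf k \<le> Sup k \<and> Sup k \<le> b" "{Inf k<..<Sup k} = interior k"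
      "interior k \<subseteq> {fst i<..<snd i}" if "(i, k) \<in> G" for i k
    proof -
      have ik: "i \<in> C" "k \<in> Q i" using that by (auto simp: G_def)
      obtain l u where lu: "k = {l..u}" "l \<le> u"
        using division_ofD(3,4)[OF Q(2)[OF ik(1)] ik(2)] by auto
      have sub: "k \<subseteq> {fst i..snd i}" using division_ofD(2)[OF Q(2)[OF ik(1)] ik(2)] .
      then have "k \<subseteq> {a<..<b}" using Cle[OF ik(1)] T(4) by blast
      then show "a \<le> Inf k \<and> Inf k \<le> Sup k \<and> Sup k \<le> b" using lu by (auto simp: subset_iff)
      show "{Inf k<..<Sup k} = interior k" using lu by simp
      show "interior k \<subseteq> {fst i<..<snd i}"
        using interior_mono[OF sub] by simp
    qed
    have sumG: "(\<Sum>x\<in>G. F (Sup (snd x)) - F (Inf (snd x))) = (\<Sum>(l, u)\<in>C. F u - F l) - (\<Sum>i\<in>C. \<Sum>(l, u)\<in>D i. F u - F l)"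
      for F :: "real \<Rightarrow> real"
    proof -
      have "(\<Sum>x\<in>G. F (Sup (snd x)) - F (Inf (snd x))) = (\<Sum>i\<in>C. \<Sum>k\<in>Q i - K i. F (Sup k) - F (Inf k))"
        unfolding G_def using C(1) Q(2) by (subst sum.Sigma) (auto dest: division_of_finite simp: case_prod_unfold)
      also have "\<dots> = (\<Sum>i\<in>C. (F (snd i) - F (fst i)) - (\<Sum>(l, u)\<in>D i. F u - F l))"
        using split[of _ F] by (intro sum.cong) auto
      finally show ?thesis by (simp add: sum_subtractf case_prod_unfold)
    qed
    define sC sD where "sC = (\<Sum>(l, u)\<in>C. u - l)" and "sD = (\<Sum>i\<in>C. \<Sum>(l, u)\<in>D i. u - l)"
    have UC: "measure lebesgue (\<Union>(l, u)\<in>C. {l..u}) = sC"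
      unfolding sC_def using C by (intro measure_Union_Icc) force+
    have UCT: "(\<Union>(l, u)\<in>C. {l..u}) \<subseteq> T" using C(2) by auto
    have UCm: "(\<Union>(l, u)\<in>C. {l..u}) \<in> lmeasurable"
      by (rule fmeasurableI2[OF T(3) UCT]) (use C(1) in auto)
    have sC: "sC \<le> s + e" "s - e < sC"
      using measure_mono_fmeasurable[OF UCT fmeasurableD[OF UCm] T(3)] UC mT C(4) by (auto simp: sC_def s_def)
    \<comment> \<open>A point of \<open>?E\<close> lies inside an interval of \<open>C\<close>, is
      an endpoint of one, or lies in the part of \<open>T\<close> that \<open>C\<close> misses. This
      last part has measure below \<open>2 * e\<close>, the endpoints are null, and the second cover
      loses at most \<open>e\<close> in all.\<close>
    have sD: "s - 3 * e \<le> sD"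
    proof -
      have end_lm: "fst ` C \<in> lmeasurable" "snd ` C \<in> lmeasurable"
        using C(1) by (intro lmeasurable_compact finite_imp_compact; simp)+
      have "measure lebesgue ?E \<le> measure lebesgue ((\<Union>i\<in>C. S i) \<union> ((T - (\<Union>(l, u)\<in>C. {l..u})) \<union> (fst ` C \<union> snd ` C)))"
      proof (rule measure_mono_fmeasurable)
        show "?E \<subseteq> (\<Union>i\<in>C. S i) \<union> ((T - (\<Union>(l, u)\<in>C. {l..u})) \<union> (fst ` C \<union> snd ` C))"
        proof
          fix x assume x: "x \<in> ?E"
          show "x \<in> (\<Union>i\<in>C. S i) \<union> ((T - (\<Union>(l, u)\<in>C. {l..u})) \<union> (fst ` C \<union> snd ` C))"
          proof (cases "x \<in> (\<Union>(l, u)\<in>C. {l..u})")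
            case True
            then obtain i where "i \<in> C" "fst i \<le> x" "x \<le> snd i" by auto
            then have "x \<in> S i \<or> x \<in> fst ` C \<union> snd ` C" using x by (auto simp: S_def less_le)
            then show ?thesis using \<open>i \<in> C\<close> by blast
          qed (use x T(2) in blast)
        qed
        show "(\<Union>i\<in>C. S i) \<union> ((T - (\<Union>(l, u)\<in>C. {l..u})) \<union> (fst ` C \<union> snd ` C)) \<in> lmeasurable"
          using C(1) S T(3) UCm end_lm by (intro fmeasurable.Un fmeasurable.Diff fmeasurable.finite_UN) auto
      qed (use E in auto)
      also have "\<dots> \<le> measure lebesgue (\<Union>i\<in>C. S i) + measure lebesgue ((T - (\<Union>(l, u)\<in>C. {l..u})) \<union> (fst ` C \<union> snd ` C))"
        using C(1) S T(3) UCm end_lm by (intro measure_Un_le sets.finite_UN sets.Un sets.Diff) (auto intro: fmeasurableD)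
      also have "measure lebesgue ((T - (\<Union>(l, u)\<in>C. {l..u})) \<union> (fst ` C \<union> snd ` C)) \<le>
          measure lebesgue (T - (\<Union>(l, u)\<in>C. {l..u})) + measure lebesgue (fst ` C \<union> snd ` C)"
        using C(1) T(3) UCm end_lm by (intro measure_Un_le sets.Un sets.Diff) (auto intro: fmeasurableD)
      also have "measure lebesgue (fst ` C \<union> snd ` C) = 0"
        using C(1) by (intro negligible_imp_measure0 negligible_finite) auto
      also have "measure lebesgue (T - (\<Union>(l, u)\<in>C. {l..u})) = measure lebesgue T - sC"
        using measurable_measure_Diff[OF T(3) fmeasurableD[OF UCm] UCT] UC by simp
      also have "measure lebesgue (\<Union>i\<in>C. S i) \<le> (\<Sum>i\<in>C. measure lebesgue (S i))"
        using C(1) S by (intro measure_UNION_le) auto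
      also have "\<dots> \<le> (\<Sum>i\<in>C. (\<Sum>(l, u)\<in>D i. u - l) + e / N)"
        using D(4) by (intro sum_mono) (simp add: algebra_simps less_imp_le)
      also have "\<dots> = sD + card C * (e / N)" by (simp add: sum.distrib sD_def)
      also have "card C * (e / N) \<le> e"
        using e N by (simp add: N_def field_simps)
      finally show ?thesis using mT sC by (simp add: s_def)
    qed
    have gap: "sC - sD < d" using sC sD e by linarith
    have dis: "disjoint_family_on (\<lambda>x. {Inf (snd x)<..<Sup (snd x)}) G"
      unfolding disjoint_family_on_def
    proof (intro ballI impI)
      fix x y assume xy: "x \<in> G" "y \<in> G" "x \<noteq> y"
      obtain i k j l where ij: "x = (i, k)" "y = (j, l)" by (metis surj_pair)
      have int: "{Inf k<..<Sup k} = interior k" "{Inf l<..<Sup l} = interior l"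
        "interior k \<subseteq> {fst i<..<snd i}" "interior l \<subseteq> {fst j<..<snd j}"
        using G[of i k] G[of j l] xy ij by auto
      show "{Inf (snd x)<..<Sup (snd x)} \<inter> {Inf (snd y)<..<Sup (snd y)} = {}"
      proof (cases "i = j")
        case True
        then have "k \<noteq> l" "k \<in> Q i" "l \<in> Q i" "i \<in> C" using xy ij by (auto simp: G_def)
        then show ?thesis using division_ofD(5)[OF Q(2)] int ij by auto
      next
        case False
        then have "disjnt {fst i..snd i} {fst j..snd j}"
          using C(3) xy ij by (auto simp: G_def pairwise_def)
        moreover have "{fst i<..<snd i} \<subseteq> {fst i..snd i}" "{fst j<..<snd j} \<subseteq> {fst j..snd j}"
          by auto
        ultimately show ?thesis using int ij unfolding disjnt_def by (simp, blast)
      qed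
    qed
    have "(\<Sum>x\<in>G. norm (f (Sup (snd x)) - f (Inf (snd x)))) < h"
      using fG dis gap sumG[of "\<lambda>t. t"] G(1)
      by (intro d(2)[rule_format] conjI ballI) (auto simp: sC_def sD_def)
    then have "\<bar>\<Sum>x\<in>G. f (Sup (snd x)) - f (Inf (snd x))\<bar> < h"
      by (intro le_less_trans[OF sum_abs]) simp
    then have "(\<Sum>i\<in>C. \<Sum>(l, u)\<in>D i. f u - f l) < (\<Sum>(l, u)\<in>C. f u - f l) + h"
      unfolding sumG by linarith
    moreover have "(\<Sum>(l, u)\<in>C. f u - f l) \<le> p * sC"
      unfolding sC_def sum_distrib_left using C(2) by (intro sum_mono) (auto simp: less_imp_le)
    moreover have "q * sD \<le> (\<Sum>i\<in>C. \<Sum>(l, u)\<in>D i. f u - f l)"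
      unfolding sD_def sum_distrib_left using D(2) by (intro sum_mono) (force simp: less_imp_le)
    ultimately have qp: "q * sD < p * sC + h" by linarith
    have sDu: "sD \<le> s + e"
    proof -
      have "0 \<le> (\<Sum>x\<in>G. Sup (snd x) - Inf (snd x))" using G(1) by (intro sum_nonneg) auto
      then show ?thesis using sumG[of "\<lambda>t. t"] sC by (simp add: sC_def sD_def)
    qed
    have "q * s - \<bar>q\<bar> * (3 * e) \<le> q * sD"
    proof -
      have "\<bar>q * (s - sD)\<bar> \<le> \<bar>q\<bar> * (3 * e)"
        unfolding abs_mult using sD sDu e by (intro mult_left_mono) auto
      then show ?thesis by (simp add: algebra_simps abs_le_iff)
    qed
    moreover have "p * sC \<le> p * s + \<bar>p\<bar> * e"
    proof -
      have "\<bar>p * (sC - s)\<bar> \<le> \<bar>p\<bar> * e"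
        unfolding abs_mult using sC e by (intro mult_left_mono) auto
      then show ?thesis by (simp add: algebra_simps abs_le_iff)
    qed
    moreover have "\<bar>q\<bar> * (3 * e) \<le> \<bar>q\<bar> * (5 * h)" "\<bar>p\<bar> * e \<le> \<bar>p\<bar> * (3 * h)"
      using e h by (intro mult_left_mono; simp)+
    ultimately show ?thesis using qp by (simp add: algebra_simps)
  qed
  have "(q - p) * s \<le> 0"
  proof (rule field_le_epsilon)
    fix r :: real assume r: "0 < r"
    let ?c = "1 + (3 * \<bar>p\<bar> + 5 * \<bar>q\<bar>)"
    have c: "0 < ?c" by (simp add: add_pos_nonneg)
    obtain k where k: "0 < k" "k * ?c = r" using r c by (intro that[of "r / ?c"]) simp_all
    then show "(q - p) * s \<le> 0 + r" using key[of k] by (simp add: algebra_simps)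
  qed
  then have "s \<le> 0" using pq by (simp add: mult_le_0_iff)
  then show ?thesis
    using E by (simp add: s_def negligible_iff_measure measure_le_0_iff)
qed

text \<open>The derivative is the supremum \<open>L\<close> of all \<open>q\<close> for which
  \<open>t\<close> is steep. Slopes over small intervals around \<open>t\<close> are at most
  \<open>L + e\<close>; since \<open>t\<close> is steep at a rational just below \<open>L\<close>,
  the exclusion of oscillation with a smaller rational bounds them below by \<open>L - e\<close>.
  Difference quotients at \<open>t\<close> are limits of such slopes when one endpoint tends to
  \<open>t\<close>.\<close>

lemma has_vector_derivative_if_not_steep:
  fixes f :: "real \<Rightarrow> real"
  assumes f: "continuous_on {a..b} f" and t: "a < t" "t < b"
    and ne: "t \<notin> (\<Inter>q. steep_points f a b q)" "t \<notin> (\<Inter>q. steep_points (\<lambda>t. - f t) a b q)"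
    and osc: "\<And>p q. p \<in> \<rat> \<Longrightarrow> q \<in> \<rat> \<Longrightarrow> p < q \<Longrightarrow> t \<notin> steep_points f a b q \<inter> steep_points (\<lambda>t. - f t) a b (- p)"
  shows "\<exists>D. (f has_real_derivative D) (at t)"
proof -
  have up: "\<exists>d>0. \<forall>l u. a < l \<and> l < t \<and> t < u \<and> u < b \<and> u - l < d \<longrightarrow> f u - f l \<le> q * (u - l)"
    if "t \<notin> steep_points f a b q" for q
    using that unfolding steep_points_def mem_Collect_eq not_le[symmetric] by blast
  have lo: "\<exists>d>0. \<forall>l u. a < l \<and> l < t \<and> t < u \<and> u < b \<and> u - l < d \<longrightarrow> p * (u - l) \<le> f u - f l"
    if "t \<notin> steep_points (\<lambda>t. - f t) a b (- p)" for p
  proof -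
    have eq: "- p * (u - l) < - f u - - f l \<longleftrightarrow> \<not> p * (u - l) \<le> f u - f l" for u l
      by (simp add: not_le) linarith
    show ?thesis
      using that unfolding steep_points_def mem_Collect_eq eq by blast
  qed
  obtain q0 where q0: "t \<notin> steep_points f a b q0" using ne(1) by blast
  obtain p0 where p0: "t \<notin> steep_points (\<lambda>t. - f t) a b p0" using ne(2) by blast
  define A where "A = {q. t \<in> steep_points f a b q}"
  have bdd: "x \<le> q0" if "x \<in> A" for x
    using that q0 steep_points_antimono[of q0 x f a b] by (auto simp: A_def not_le dest: less_imp_le) (meson linear subsetD)
  have Abdd: "bdd_above A" using bdd by (auto simp: bdd_above_def)
  \<comment> \<open>If \<open>A\<close> missed this value, slopes near \<open>t\<close> would be at
    most \<open>- p0 - 1\<close>, whereas the choice of \<open>p0\<close> makes them at least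
    \<open>- p0\<close>.\<close>
  have "- p0 - 1 \<in> A"
  proof (rule ccontr)
    assume "- p0 - 1 \<notin> A"
    then have "t \<notin> steep_points f a b (- p0 - 1)" by (simp add: A_def)
    from up[OF this] obtain d where d: "d > 0" "\<forall>l u. a < l \<and> l < t \<and> t < u \<and> u < b \<and> u - l < d \<longrightarrow> f u - f l \<le> (- p0 - 1) * (u - l)"
      by blast
    obtain d' where d': "d' > 0" "\<forall>l u. a < l \<and> l < t \<and> t < u \<and> u < b \<and> u - l < d' \<longrightarrow> - p0 * (u - l) \<le> f u - f l"
      using lo[of "- p0"] p0 by auto
    define h where "h = min (min d d' / 4) (min (t - a) (b - t) / 2)"
    have h: "0 < h" "h \<le> d / 4" "h \<le> d' / 4" "h < t - a" "h < b - t"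
      using d(1) d'(1) t by (auto simp: h_def min_def)
    have "- p0 * (t + h - (t - h)) \<le> f (t + h) - f (t - h)"
      by (rule d'(2)[rule_format]) (use h d'(1) in auto)
    also have "\<dots> \<le> (- p0 - 1) * (t + h - (t - h))"
      by (rule d(2)[rule_format]) (use h d(1) in auto)
    finally have "- p0 * (2 * h) \<le> (- p0 - 1) * (2 * h)" by simp
    then show False using h(1) by (simp add: algebra_simps)
  qed
  then have Ane: "A \<noteq> {}" by blast
  define L where "L = Sup A"
  have slope: "\<exists>d>0. \<forall>l u. a < l \<and> l < t \<and> t < u \<and> u < b \<and> u - l < d \<longrightarrow>
      (L - e) * (u - l) \<le> f u - f l \<and> f u - f l \<le> (L + e) * (u - l)" if e: "0 < e" for e
  proof -
    have "L + e \<notin> A" using cSup_upper[OF _ Abdd, of "L + e"] e by (auto simp: L_def)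
    then have "t \<notin> steep_points f a b (L + e)" by (simp add: A_def)
    from up[OF this] obtain d where d: "d > 0" "\<forall>l u. a < l \<and> l < t \<and> t < u \<and> u < b \<and> u - l < d \<longrightarrow> f u - f l \<le> (L + e) * (u - l)"
      by blast
    obtain x where x: "x \<in> A" "L - e / 3 < x"
      using less_cSupE[of "L - e/3" A] Ane e by (auto simp: L_def)
    obtain q where q: "q \<in> \<rat>" "L - 2 * e / 3 < q" "q < L - e / 3"
      using Rats_dense_in_real[of "L - 2 * e / 3" "L - e / 3"] e by auto
    obtain p where p: "p \<in> \<rat>" "L - e < p" "p < L - 2 * e / 3"
      using Rats_dense_in_real[of "L - e" "L - 2 * e / 3"] e by auto
    have "t \<in> steep_points f a b q"
      using steep_points_antimono[of q x f a b] x q by (auto simp: A_def)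
    then have "t \<notin> steep_points (\<lambda>t. - f t) a b (- p)"
      using osc[OF p(1) q(1)] p q by auto
    then obtain d' where d': "d' > 0" "\<forall>l u. a < l \<and> l < t \<and> t < u \<and> u < b \<and> u - l < d' \<longrightarrow> p * (u - l) \<le> f u - f l"
      using lo by blast
    show ?thesis
    proof (intro exI[of _ "min d d'"] conjI allI impI)
      fix l u assume lu: "a < l \<and> l < t \<and> t < u \<and> u < b \<and> u - l < min d d'"
      have "(L - e) * (u - l) \<le> p * (u - l)" using p lu by (intro mult_right_mono) auto
      then show "(L - e) * (u - l) \<le> f u - f l" using d'(2)[rule_format, of l u] lu by linarith
      show "f u - f l \<le> (L + e) * (u - l)" using d(2)[rule_format, of l u] lu by auto
    qed (use d d' in auto)
  qed
  have cont: "isCont f t"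
    using continuous_on_interior[OF f, of t] t by (simp add: interior_atLeastAtMost_real)
  have "(f has_real_derivative L) (at t)"
    unfolding has_field_derivative_iff LIM_def
  proof (intro allI impI)
    fix r :: real assume r: "0 < r"
    obtain d where d: "d > 0" "\<forall>l u. a < l \<and> l < t \<and> t < u \<and> u < b \<and> u - l < d \<longrightarrow>
      (L - r/2) * (u - l) \<le> f u - f l \<and> f u - f l \<le> (L + r/2) * (u - l)"
      using slope[of "r/2"] r by auto
    define h where "h = min (d / 2) (min (t - a) (b - t))"
    have h: "0 < h" "h \<le> d / 2" "h \<le> t - a" "h \<le> b - t" using d(1) t unfolding h_def by linarith+
    have "dist ((f y - f t) / (y - t)) L < r" if y: "y \<noteq> t" "dist y t < h" for y
    proof (cases "t < y")
      case True
      \<comment> \<open>The slope bounds concern intervals with \<open>t\<close> in their interior;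
        letting the left endpoint tend to \<open>t\<close> extends them to the interval from
        \<open>t\<close> to \<open>y\<close>.\<close>
      have c: "((\<lambda>l. f y - f l) \<longlongrightarrow> f y - f t) (at_left t)" for y
        using cont by (intro tendsto_intros) (auto simp: isCont_def intro: tendsto_within_subset)
      have ev: "\<forall>\<^sub>F l in at_left t. (L - r/2) * (y - l) \<le> f y - f l \<and> f y - f l \<le> (L + r/2) * (y - l)"
        unfolding eventually_at_left[OF t(1)]
        using d h y True t by (intro exI[of _ "t - h"]) (auto simp: dist_real_def)
      have "(L - r/2) * (y - t) \<le> f y - f t"
        by (rule tendsto_le[where F="at_left t" and f="\<lambda>l. f y - f l" and g="\<lambda>l. (L - r/2) * (y - l)"])
          (use ev c in \<open>auto intro!: tendsto_intros elim: eventually_mono\<close>)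
      moreover have "f y - f t \<le> (L + r/2) * (y - t)"
        by (rule tendsto_le[where F="at_left t" and g="\<lambda>l. f y - f l" and f="\<lambda>l. (L + r/2) * (y - l)"])
          (use ev c in \<open>auto intro!: tendsto_intros elim: eventually_mono\<close>)
      ultimately have "L - r/2 \<le> (f y - f t) / (y - t)" "(f y - f t) / (y - t) \<le> L + r/2"
        using True by (simp_all add: pos_le_divide_eq pos_divide_le_eq)
      then show ?thesis using r by (simp add: dist_real_def abs_le_iff abs_less_iff)
    next
      case False
      then have yt: "y < t" using y by simp
      have c: "((\<lambda>u. f u - f y) \<longlongrightarrow> f t - f y) (at_right t)" for y
        using cont by (intro tendsto_intros) (auto simp: isCont_def intro: tendsto_within_subset)
      have ev: "\<forall>\<^sub>F u in at_right t. (L - r/2) * (u - y) \<le> f u - f y \<and> f u - f y \<le> (L + r/2) * (u - y)"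
        unfolding eventually_at_right[OF t(2)]
        using d h y yt t by (intro exI[of _ "t + h"]) (auto simp: dist_real_def)
      have "(L - r/2) * (t - y) \<le> f t - f y"
        by (rule tendsto_le[where F="at_right t" and f="\<lambda>u. f u - f y" and g="\<lambda>u. (L - r/2) * (u - y)"])
          (use ev c in \<open>auto intro!: tendsto_intros elim: eventually_mono\<close>)
      moreover have "f t - f y \<le> (L + r/2) * (t - y)"
        by (rule tendsto_le[where F="at_right t" and g="\<lambda>u. f u - f y" and f="\<lambda>u. (L + r/2) * (u - y)"])
          (use ev c in \<open>auto intro!: tendsto_intros elim: eventually_mono\<close>)
      moreover have "(f y - f t) / (y - t) = (f t - f y) / (t - y)"
        by (metis minus_diff_eq minus_divide_divide)
      ultimately have "L - r/2 \<le> (f y - f t) / (y - t)" "(f y - f t) / (y - t) \<le> L + r/2"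
        using yt by (simp_all add: pos_le_divide_eq pos_divide_le_eq)
      then show ?thesis using r by (simp add: dist_real_def abs_le_iff abs_less_iff)
    qed
    then show "\<exists>s>0. \<forall>x. x \<noteq> t \<and> dist x t < s \<longrightarrow> dist ((f x - f t) / (x - t)) L < r"
      using h(1) by blast
  qed
  then show ?thesis by blast
qed

text \<open>Only increments are compared, so \<open>f\<close> need not be a composition of
  \<open>g\<close> with a Lipschitz map. Negatives, components, straight segments and curves that
  agree on \<open>{a..b}\<close> are all treated by this one bound.\<close>

lemma abs_continuous_curve_Lipschitz_image:
  assumes "abs_continuous_curve a b g" and L: "0 \<le> L"
    and "\<And>s t. s \<in> {a..b} \<Longrightarrow> t \<in> {a..b} \<Longrightarrow> norm (f t - f s) \<le> L * norm (g t - g s)"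
  shows "abs_continuous_curve a b f"
  unfolding abs_continuous_curve_def
proof (intro allI impI)
  fix e :: real assume e: "0 < e"
  then have "0 < e / (L + 1)" using L by simp
  then obtain d where d: "d > 0" "\<And>(n::nat) s t.
     (\<forall>i<n. a \<le> s i \<and> s i \<le> t i \<and> t i \<le> b) \<and>
     disjoint_family_on (\<lambda>i. {s i<..<t i}) {..<n} \<and>
     (\<Sum>i<n. t i - s i) < d \<Longrightarrow> (\<Sum>i<n. norm (g (t i) - g (s i))) < e / (L + 1)"
    using assms(1) unfolding abs_continuous_curve_def by meson
  show "\<exists>\<delta>>0. \<forall>(n::nat) s t. (\<forall>i<n. a \<le> s i \<and> s i \<le> t i \<and> t i \<le> b) \<and>
     disjoint_family_on (\<lambda>i. {s i<..<t i}) {..<n} \<and> (\<Sum>i<n. t i - s i) < \<delta> \<longrightarrow> (\<Sum>i<n. norm (f (t i) - f (s i))) < e"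
  proof (intro exI[of _ d] conjI d(1) allI impI)
    fix n :: nat and s t
    assume *: "(\<forall>i<n. a \<le> s i \<and> s i \<le> t i \<and> t i \<le> b) \<and>
      disjoint_family_on (\<lambda>i. {s i<..<t i}) {..<n} \<and> (\<Sum>i<n. t i - s i) < d"
    have "(\<Sum>i<n. norm (f (t i) - f (s i))) \<le> L * (\<Sum>i<n. norm (g (t i) - g (s i)))"
      unfolding sum_distrib_left using * by (intro sum_mono assms(3)) (auto intro: order_trans)
    also have "\<dots> \<le> L * (e / (L + 1))"
      using d(2)[OF *] L by (intro mult_left_mono) auto
    also have "\<dots> < e" using L e by (simp add: field_simps)
    finally show "(\<Sum>i<n. norm (f (t i) - f (s i))) < e" .
  qed
qed

text \<open>An interior point fails to be differentiable only if the upper derivative is infinite,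
  the lower one is minus infinity, or the slopes oscillate across some pair of rationals; rational
  pairs keep the union countable. The endpoints are added because steep points are interior.\<close>

lemma abs_continuous_real_differentiable:
  fixes f :: "real \<Rightarrow> real"
  assumes f: "abs_continuous_curve a b f"
  shows "negligible {t \<in> {a..b}. \<not> (\<exists>D. (f has_real_derivative D) (at t))}"
proof -
  have mf: "abs_continuous_curve a b (\<lambda>t. - f t)"
    by (rule abs_continuous_curve_Lipschitz_image[OF f, of 1]) auto
  let ?N = "(\<Inter>q. steep_points f a b q) \<union> (\<Inter>q. steep_points (\<lambda>t. - f t) a b q) \<union>
    \<Union>((\<lambda>(p, q). steep_points f a b q \<inter> steep_points (\<lambda>t. - f t) a b (- p)) ` {(p, q) \<in> \<rat> \<times> \<rat>. p < q}) \<union> {a, b}"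
  have "countable {(p, q) \<in> \<rat> \<times> \<rat> :: (real \<times> real) set. p < q}"
    by (rule countable_subset[of _ "\<rat> \<times> \<rat>"]) (auto intro: countable_rat)
  then have "negligible ?N"
    using negligible_steep_points_everywhere[OF f] negligible_steep_points_everywhere[OF mf]
      negligible_steep_points_oscillating[OF f]
    by (intro negligible_Un negligible_countable_Union countable_image) auto
  moreover have "{t \<in> {a..b}. \<not> (\<exists>D. (f has_real_derivative D) (at t))} \<subseteq> ?N"
  proof
    fix t assume t: "t \<in> {t \<in> {a..b}. \<not> (\<exists>D. (f has_real_derivative D) (at t))}"
    show "t \<in> ?N"
    proof (rule ccontr)
      assume n: "t \<notin> ?N"
      then have "a < t" "t < b" using t by (auto simp: less_le)
      then have "\<exists>D. (f has_real_derivative D) (at t)"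
        using n by (intro has_vector_derivative_if_not_steep[OF abs_continuous_curve_imp_continuous[OF f]]) auto
      then show False using t by blast
    qed
  qed
  ultimately show ?thesis using negligible_subset by blast
qed

lemma abs_continuous_curve_differentiable:
  fixes f :: "real \<Rightarrow> 'a::euclidean_space"
  assumes f: "abs_continuous_curve a b f"
  shows "negligible {t \<in> {a..b}. \<not> f differentiable (at t)}"
proof -
  have "abs_continuous_curve a b (\<lambda>t. f t \<bullet> i)" if "i \<in> Basis" for i
    using that by (intro abs_continuous_curve_Lipschitz_image[OF f, of 1])
      (auto simp: inner_diff_left[symmetric] Basis_le_norm)
  then have "negligible (\<Union>i\<in>Basis. {t \<in> {a..b}. \<not> (\<exists>D. ((\<lambda>t. f t \<bullet> i) has_real_derivative D) (at t))})"
    by (intro negligible_Union finite_imageI finite_Basis) (clarify, rule abs_continuous_real_differentiable, blast)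
  moreover have "{t \<in> {a..b}. \<not> f differentiable (at t)} \<subseteq>
      (\<Union>i\<in>Basis. {t \<in> {a..b}. \<not> (\<exists>D. ((\<lambda>t. f t \<bullet> i) has_real_derivative D) (at t))})"
  proof
    fix t assume t: "t \<in> {t \<in> {a..b}. \<not> f differentiable (at t)}"
    then obtain i :: 'a where i: "i \<in> Basis" "\<not> (\<lambda>t. f t \<bullet> i) differentiable (at t)"
      using differentiable_componentwise_within[of f t UNIV] by auto
    then have "\<not> (\<exists>D. ((\<lambda>t. f t \<bullet> i) has_real_derivative D) (at t))"
      by (auto simp: real_differentiable_def)
    then show "t \<in> (\<Union>i\<in>Basis. {t \<in> {a..b}. \<not> (\<exists>D. ((\<lambda>t. f t \<bullet> i) has_real_derivative D) (at t))})"
      using i t by auto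
  qed
  ultimately show ?thesis using negligible_subset by blast
qed

section \<open>The fundamental theorem of calculus for absolutely continuous curves\<close>

text \<open>At tags outside \<open>Z\<close> the derivative controls the increment over each piece.
  Pieces with tags in \<open>Z\<close> are confined to an open set of small measure, so absolute
  continuity makes the sum of their increments small, which matches the value 0 given to the
  integrand there.\<close>

lemma abs_continuous_curve_has_integral:
  fixes f :: "real \<Rightarrow> 'a::euclidean_space"
  assumes f: "abs_continuous_curve a b f" and "a \<le> b"
    and Z: "negligible Z" and f': "\<And>t. t \<in> {a..b} - Z \<Longrightarrow> (f has_vector_derivative f' t) (at t within {a..b})"
  shows "((\<lambda>t. if t \<in> Z then 0 else f' t) has_integral (f b - f a)) {a..b}"
  unfolding has_integral_real
proof (intro allI impI)
  fix e :: real assume e: "0 < e"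
  define r where "r = e / (2 * (b - a + 1))"
  have r: "0 < r" "r * (b - a) < e / 2"
    using e \<open>a \<le> b\<close> by (auto simp: r_def field_simps)
  obtain d where d: "0 < d" "\<forall>(I::(real \<times> real set) set) s t. finite I \<and> (\<forall>i\<in>I. a \<le> s i \<and> s i \<le> t i \<and> t i \<le> b) \<and>
       disjoint_family_on (\<lambda>i. {s i<..<t i}) I \<and> (\<Sum>i\<in>I. t i - s i) < d \<longrightarrow>
       (\<Sum>i\<in>I. norm (f (t i) - f (s i))) < e / 2"
    using abs_continuous_curve_family[OF f, of "e/2"] e by auto
  have Zs: "Z \<in> sets lebesgue" using Z by (simp add: negligible_imp_sets)
  obtain T where T: "open T" "Z \<subseteq> T" "(T - Z) \<in> lmeasurable" "emeasure lebesgue (T - Z) < ennreal d"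
    using sets_lebesgue_outer_open[OF Zs d(1)] by metis
  have Tm: "T \<in> lmeasurable" "measure lebesgue T < d"
  proof -
    have eq: "emeasure lebesgue T = emeasure lebesgue (T - Z)"
      using Z T(1) by (intro emeasure_Diff_null_set[symmetric]) (auto simp: negligible_iff_null_sets)
    have lt: "emeasure lebesgue T < ennreal d" unfolding eq by (rule T(4))
    show Tm: "T \<in> lmeasurable"
      using T(1) less_trans[OF lt ennreal_less_top] by (intro fmeasurableI) auto
    have "ennreal (measure lebesgue T) < ennreal d"
      using lt emeasure_eq_measure2[OF Tm] by simp
    then show "measure lebesgue T < d"
      by (simp add: ennreal_less_iff)
  qed
  have "\<exists>h>0. \<forall>y\<in>{a..b}. \<bar>y - t\<bar> < h \<longrightarrow> norm (f y - f t - (y - t) *\<^sub>R f' t) \<le> r * \<bar>y - t\<bar>"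
    if "t \<in> {a..b} - Z" for t
    using f'[OF that] r(1) unfolding has_vector_derivative_def has_derivative_within_alt by (simp add: mult.commute)
  then obtain h where h: "\<And>t. t \<in> {a..b} - Z \<Longrightarrow> 0 < h t"
    "\<And>t y. t \<in> {a..b} - Z \<Longrightarrow> y \<in> {a..b} \<Longrightarrow> \<bar>y - t\<bar> < h t \<Longrightarrow> norm (f y - f t - (y - t) *\<^sub>R f' t) \<le> r * \<bar>y - t\<bar>"
    by metis
  define G where "G = (\<lambda>t. if t \<in> Z then T else if t \<in> {a..b} then ball t (h t) else UNIV)"
  have G: "gauge G"
    using T h(1) by (auto simp: gauge_def G_def)
  show "\<exists>G. gauge G \<and> (\<forall>p. p tagged_division_of {a..b} \<and> G fine p \<longrightarrow>
      norm ((\<Sum>(x, K)\<in>p. measure lborel K *\<^sub>R (if x \<in> Z then 0 else f' x)) - (f b - f a)) < e)"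
  proof (intro exI[of _ G] conjI G allI impI, elim conjE)
    fix p assume p: "p tagged_division_of {a..b}" and fine: "G fine p"
    have fp: "finite p" using p by blast
    have K: "\<exists>l u. K = {l..u} \<and> l \<le> x \<and> x \<le> u \<and> a \<le> l \<and> u \<le> b" if xK: "(x, K) \<in> p" for x K
    proof -
      obtain l u where lu: "K = {l..u}" using tagged_division_ofD(4)[OF p xK] by auto
      then show ?thesis using tagged_division_ofD(2,3)[OF p xK] by (intro exI[of _ l] exI[of _ u]) auto
    qed
    define q where "q = {x \<in> p. fst x \<in> Z}"
    have q: "q \<subseteq> p" "finite q" using fp by (auto simp: q_def)
    have part1: "norm (measure lborel K *\<^sub>R f' x - (f (Sup K) - f (Inf K))) \<le> r * measure lborel K" if xK: "(x, K) \<in> p - q" for x K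
    proof -
      obtain l u where lu: "K = {l..u}" "l \<le> x" "x \<le> u" "a \<le> l" "u \<le> b"
        using K[of x K] xK by (auto simp: q_def)
      have x: "x \<in> {a..b} - Z" using lu xK by (auto simp: q_def)
      have "K \<subseteq> ball x (h x)" using fineD[OF fine, of x K] x xK by (auto simp: G_def)
      moreover have "l \<in> K" "u \<in> K" using lu by auto
      ultimately have "l \<in> ball x (h x)" "u \<in> ball x (h x)" by blast+
      then have "\<bar>l - x\<bar> < h x" "\<bar>u - x\<bar> < h x" by (auto simp: dist_real_def)
      then have "norm (f u - f x - (u - x) *\<^sub>R f' x) \<le> r * (u - x)" "norm (f l - f x - (l - x) *\<^sub>R f' x) \<le> r * (x - l)"
        using h(2)[OF x, of u] h(2)[OF x, of l] lu by auto
      \<comment> \<open>The tag lies between the endpoints, so the two one-sided errors add up to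
        \<open>r\<close> times the length of the piece.\<close>
      then have "norm ((f l - f x - (l - x) *\<^sub>R f' x) - (f u - f x - (u - x) *\<^sub>R f' x)) \<le> r * (x - l) + r * (u - x)"
        by (meson add_mono norm_triangle_ineq4 order_trans)
      moreover have "(f l - f x - (l - x) *\<^sub>R f' x) - (f u - f x - (u - x) *\<^sub>R f' x) = (u - l) *\<^sub>R f' x - (f u - f l)"
        by (simp add: algebra_simps)
      ultimately show ?thesis using lu by (simp add: algebra_simps)
    qed
    have len: "(\<Sum>(x, K)\<in>p. measure lborel K) = b - a"
      using additive_content_tagged_division[of p a b] p \<open>a \<le> b\<close> by simp
    have small: "(\<Sum>x\<in>q. norm (f (Sup (snd x)) - f (Inf (snd x)))) < e / 2"
    proof (rule d(2)[rule_format], intro conjI ballI)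
      show "finite q" by (rule q)
      show "a \<le> Inf (snd x)" "Inf (snd x) \<le> Sup (snd x)" "Sup (snd x) \<le> b" if "x \<in> q" for x
        using K[of "fst x" "snd x"] subsetD[OF q(1) that] by auto
      show dis: "disjoint_family_on (\<lambda>i. {Inf (snd i)<..<Sup (snd i)}) q"
        unfolding disjoint_family_on_def
      proof (intro ballI impI)
        fix x y assume xy: "x \<in> q" "y \<in> q" "x \<noteq> y"
        have "interior (snd x) \<inter> interior (snd y) = {}"
          using tagged_division_ofD(5)[OF p, of "fst x" "snd x" "fst y" "snd y"] xy q(1) by auto
        moreover have "interior (snd x) = {Inf (snd x)<..<Sup (snd x)}" if "x \<in> q" for x
          using K[of "fst x" "snd x"] subsetD[OF q(1) that] by auto
        ultimately show "{Inf (snd x)<..<Sup (snd x)} \<inter> {Inf (snd y)<..<Sup (snd y)} = {}"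
          using xy by simp
      qed
      have "(\<Sum>x\<in>q. Sup (snd x) - Inf (snd x)) = (\<Sum>x\<in>q. measure lebesgue {Inf (snd x)<..<Sup (snd x)})"
        using K q(1) by (intro sum.cong refl) fastforce
      also have "\<dots> = measure lebesgue (\<Union>x\<in>q. {Inf (snd x)<..<Sup (snd x)})"
      proof (rule measure_finite_Union[symmetric])
        fix x :: "real \<times> real set"
        have "{Inf (snd x)<..<Sup (snd x)} \<in> lmeasurable" by simp
        then show "emeasure lebesgue {Inf (snd x)<..<Sup (snd x)} \<noteq> \<infinity>" unfolding infinity_ennreal_def by (rule fmeasurableD2)
      qed (use q(2) dis in auto)
      also have "\<dots> \<le> measure lebesgue T"
      proof (rule measure_mono_fmeasurable)
        show "(\<Union>x\<in>q. {Inf (snd x)<..<Sup (snd x)}) \<subseteq> T"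
        proof (intro UN_least)
          fix x assume x: "x \<in> q"
          then obtain l u where lu: "snd x = {l..u}" "l \<le> u" using K[of "fst x" "snd x"] q(1) by force
          have "snd x \<subseteq> T" using fineD[OF fine, of "fst x" "snd x"] x by (auto simp: G_def q_def)
          then show "{Inf (snd x)<..<Sup (snd x)} \<subseteq> T" using lu by (auto simp: subset_iff)
        qed
      qed (use Tm q(2) in auto)
      finally show "(\<Sum>x\<in>q. Sup (snd x) - Inf (snd x)) < d" using Tm by simp
    qed
    have "(\<Sum>(x, K)\<in>p. measure lborel K *\<^sub>R (if x \<in> Z then 0 else f' x)) - (f b - f a)
        = (\<Sum>(x, K)\<in>p. measure lborel K *\<^sub>R (if x \<in> Z then 0 else f' x) - (f (Sup K) - f (Inf K)))"
      using additive_tagged_division_1[OF \<open>a \<le> b\<close> p, of f] by (simp add: sum_subtractf case_prod_unfold)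
    also have "\<dots> = (\<Sum>(x, K)\<in>p - q. measure lborel K *\<^sub>R (if x \<in> Z then 0 else f' x) - (f (Sup K) - f (Inf K))) +
        (\<Sum>(x, K)\<in>q. measure lborel K *\<^sub>R (if x \<in> Z then 0 else f' x) - (f (Sup K) - f (Inf K)))"
      by (rule sum.subset_diff[OF q(1) fp])
    also have "norm \<dots> \<le> (\<Sum>(x, K)\<in>p - q. r * measure lborel K) + (\<Sum>x\<in>q. norm (f (Sup (snd x)) - f (Inf (snd x))))"
    proof (rule order_trans[OF norm_triangle_ineq add_mono])
      show "norm (\<Sum>(x, K)\<in>p - q. measure lborel K *\<^sub>R (if x \<in> Z then 0 else f' x) - (f (Sup K) - f (Inf K)))
          \<le> (\<Sum>(x, K)\<in>p - q. r * measure lborel K)"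
        using part1 by (intro sum_norm_le) (auto simp: q_def split: if_splits)
      show "norm (\<Sum>(x, K)\<in>q. measure lborel K *\<^sub>R (if x \<in> Z then 0 else f' x) - (f (Sup K) - f (Inf K)))
          \<le> (\<Sum>x\<in>q. norm (f (Sup (snd x)) - f (Inf (snd x))))"
        by (intro sum_norm_le) (auto simp: q_def norm_minus_commute)
    qed
    also have "(\<Sum>(x, K)\<in>p - q. r * measure lborel K) \<le> (\<Sum>(x, K)\<in>p. r * measure lborel K)"
      using fp r(1) by (intro sum_mono2) auto
    also have "\<dots> = r * (b - a)" by (simp add: len[symmetric] sum_distrib_left case_prod_unfold)
    finally show "norm ((\<Sum>(x, K)\<in>p. measure lborel K *\<^sub>R (if x \<in> Z then 0 else f' x)) - (f b - f a)) < e"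
      using small r(2) by linarith
  qed
qed

section \<open>The scaled norm of an increment\<close>

lemma scaled_norm_nonneg: "0 < \<alpha> \<Longrightarrow> 0 \<le> scaled_norm \<alpha> z"
  by (auto simp: scaled_norm_def split: prod.splits)

text \<open>A supporting functional of the scaled norm at \<open>z\<close>. It turns the vector
  identity between an increment and the integral of the derivative into a scalar bound by the
  integral of the scaled norm.\<close>

lemma scaled_norm_linear_functional:
  fixes z :: "'a::real_inner \<times> 'b::real_inner"
  assumes "0 < \<alpha>"
  obtains l where "bounded_linear l" "l z = scaled_norm \<alpha> z" "\<And>w. l w \<le> scaled_norm \<alpha> w"
proof
  let ?l = "\<lambda>w. sgn (fst z) \<bullet> fst w + inverse \<alpha> * (sgn (snd z) \<bullet> snd w)"
  show "bounded_linear ?l"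
    by (intro bounded_linear_add bounded_linear_compose[OF bounded_linear_mult_right]
        bounded_linear_compose[OF bounded_linear_inner_right] bounded_linear_fst bounded_linear_snd)
  have eq: "sgn x \<bullet> x = norm x" for x :: "'c::real_inner"
    by (cases "x = 0") (simp_all add: sgn_div_norm power2_norm_eq_inner[symmetric] power2_eq_square)
  show "?l z = scaled_norm \<alpha> z"
    by (simp add: scaled_norm_def eq split: prod.splits)
  have le: "sgn x \<bullet> y \<le> norm y" for x y :: "'c::real_inner"
    using norm_cauchy_schwarz[of "sgn x" y] by (cases "x = 0") (auto simp: norm_sgn)
  show "?l w \<le> scaled_norm \<alpha> w" for w
    using assms by (auto simp: scaled_norm_def split: prod.splits intro!: add_mono le mult_left_mono)
qed

theorem scaled_norm_le_nn_integral:
  fixes f :: "real \<Rightarrow> 'a::euclidean_space \<times> 'b::euclidean_space"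
  assumes f: "abs_continuous_curve a b f" and "a \<le> s" "s \<le> t" "t \<le> b" and \<alpha>: "0 < \<alpha>"
  shows "ennreal (scaled_norm \<alpha> (f t - f s)) \<le>
    (\<integral>\<^sup>+r\<in>{s..t}. ennreal (scaled_norm \<alpha> (vector_derivative f (at r within {a..b}))) \<partial>lborel)"
proof (cases "s = t")
  case True
  then show ?thesis by (simp add: scaled_norm_def zero_prod_def)
next
  case False
  define Z where "Z = {t \<in> {a..b}. \<not> f differentiable (at t)} \<union> {s, t}"
  have Z: "negligible Z"
    using abs_continuous_curve_differentiable[OF f] by (auto simp: Z_def)
  define f' where "f' = (\<lambda>r. vector_derivative f (at r within {a..b}))"
  have f': "(f has_vector_derivative f' r) (at r within {s..t})" if "r \<in> {s..t} - Z" for r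
  proof -
    have "f differentiable (at r within {a..b})"
      using that assms by (auto simp: Z_def intro: differentiable_at_withinI)
    then have "(f has_vector_derivative f' r) (at r within {a..b})"
      by (simp add: f'_def vector_derivative_works)
    then show ?thesis
      by (rule has_vector_derivative_within_subset) (use assms in auto)
  qed
  have fst: "abs_continuous_curve s t f"
    unfolding abs_continuous_curve_def
  proof (intro allI impI)
    fix e :: real assume "0 < e"
    then obtain d where d: "d > 0" "\<And>(n::nat) s t.
     (\<forall>i<n. a \<le> s i \<and> s i \<le> t i \<and> t i \<le> b) \<and>
     disjoint_family_on (\<lambda>i. {s i<..<t i}) {..<n} \<and>
     (\<Sum>i<n. t i - s i) < d \<Longrightarrow> (\<Sum>i<n. norm (f (t i) - f (s i))) < e"
      using f unfolding abs_continuous_curve_def by meson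
    show "\<exists>\<delta>>0. \<forall>(n::nat) s' t'. (\<forall>i<n. s \<le> s' i \<and> s' i \<le> t' i \<and> t' i \<le> t) \<and>
     disjoint_family_on (\<lambda>i. {s' i<..<t' i}) {..<n} \<and> (\<Sum>i<n. t' i - s' i) < \<delta> \<longrightarrow> (\<Sum>i<n. norm (f (t' i) - f (s' i))) < e"
    proof (intro exI[of _ d] conjI d(1) allI impI)
      fix n :: nat and s' t'
      assume "(\<forall>i<n. s \<le> s' i \<and> s' i \<le> t' i \<and> t' i \<le> t) \<and>
        disjoint_family_on (\<lambda>i. {s' i<..<t' i}) {..<n} \<and> (\<Sum>i<n. t' i - s' i) < d"
      then show "(\<Sum>i<n. norm (f (t' i) - f (s' i))) < e"
        using assms by (intro d(2)) (auto intro: order_trans)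
    qed
  qed
  define F where "F = (\<lambda>r. if r \<in> Z then 0 else f' r)"
  have int: "(F has_integral (f t - f s)) {s..t}"
    unfolding F_def using \<open>s \<le> t\<close> by (intro abs_continuous_curve_has_integral[OF fst _ Z f'])
  obtain l where l: "bounded_linear l" "l (f t - f s) = scaled_norm \<alpha> (f t - f s)" "\<And>w. l w \<le> scaled_norm \<alpha> w"
    using scaled_norm_linear_functional[OF \<alpha>, of "f t - f s"] by blast
  have il: "((\<lambda>r. l (F r)) has_integral (scaled_norm \<alpha> (f t - f s))) {s..t}"
    using has_integral_linear[OF int l(1)] l(2) by (simp add: o_def)
  have meas: "(\<lambda>r. scaled_norm \<alpha> (F r)) \<in> borel_measurable (lebesgue_on {s..t})"
  proof -
    have "F \<in> borel_measurable (lebesgue_on {s..t})"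
      using integrable_imp_measurable has_integral_integrable[OF int] by blast
    moreover have "scaled_norm \<alpha> \<in> borel_measurable borel"
      unfolding scaled_norm_def case_prod_unfold
      by (intro borel_measurable_continuous_onI continuous_intros)
    ultimately show ?thesis by (rule measurable_compose)
  qed
  \<comment> \<open>The derivative is known to be Lebesgue measurable only. Nonnegative integrals
    have the same value for \<open>lborel\<close> and its completion, so the estimate is made in the
    completion, where the integrand may also be changed on the null set \<open>Z\<close>.\<close>
  let ?I = "\<integral>\<^sup>+r. ennreal (scaled_norm \<alpha> (F r)) \<partial>lebesgue_on {s..t}"
  have "?I = (\<integral>\<^sup>+r\<in>{s..t}. ennreal (scaled_norm \<alpha> (F r)) \<partial>lebesgue)"
    by (subst nn_integral_restrict_space) (auto simp: mult.commute)
  also have "\<dots> = (\<integral>\<^sup>+r\<in>{s..t}. ennreal (scaled_norm \<alpha> (f' r)) \<partial>lebesgue)"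
    using AE_not_in[of Z lebesgue] Z
    by (intro nn_integral_cong_AE) (auto simp: F_def negligible_iff_null_sets elim!: eventually_mono)
  also have "\<dots> = (\<integral>\<^sup>+r\<in>{s..t}. ennreal (scaled_norm \<alpha> (f' r)) \<partial>lborel)"
    by (rule nn_integral_completion)
  finally have I: "?I = (\<integral>\<^sup>+r\<in>{s..t}. ennreal (scaled_norm \<alpha> (f' r)) \<partial>lborel)" .
  show ?thesis
  proof (cases "?I < \<infinity>")
    case True
    have integ: "integrable (lebesgue_on {s..t}) (\<lambda>r. scaled_norm \<alpha> (F r))"
      using True meas by (intro integrableI_nonneg) (auto intro!: scaled_norm_nonneg \<alpha>)
    then have "((\<lambda>r. scaled_norm \<alpha> (F r)) has_integral (\<integral>r. scaled_norm \<alpha> (F r) \<partial>lebesgue_on {s..t})) {s..t}"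
      by (intro has_integral_integral_lebesgue_on) auto
    then have "scaled_norm \<alpha> (f t - f s) \<le> (\<integral>r. scaled_norm \<alpha> (F r) \<partial>lebesgue_on {s..t})"
      by (rule has_integral_le[OF il]) (rule l(3))
    then have "ennreal (scaled_norm \<alpha> (f t - f s)) \<le> ?I"
      using integ by (subst nn_integral_eq_integral) (auto intro!: scaled_norm_nonneg \<alpha> ennreal_leI)
    then show ?thesis unfolding I by (simp add: f'_def)
  next
    case False
    then have "?I = \<infinity>" by (simp add: not_less top_unique)
    then have "(\<integral>\<^sup>+r\<in>{s..t}. ennreal (scaled_norm \<alpha> (f' r)) \<partial>lborel) = \<infinity>"
      using I by (simp only:)
    then show ?thesis unfolding f'_def by (simp only: infinity_ennreal_def top_greatest)
  qed
qed

section \<open>Weighted path metrics\<close>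

text \<open>A negligible set need not be Borel; the affine change of variables is applied to a Borel
  null set that contains it.\<close>

lemma negligible_imp_AE_affine:
  fixes Z :: "real set"
  assumes Z: "negligible Z" and "c \<noteq> 0"
  shows "AE t in lebesgue. p + c * t \<notin> Z"
proof -
  have "Z \<in> null_sets (completion lborel)" using Z by (simp add: negligible_iff_null_sets)
  then obtain N where N: "Z \<subseteq> N" "N \<in> null_sets lborel"
    by (auto simp: null_sets_completion_iff2)
  then have [measurable]: "N \<in> sets borel" by auto
  have "AE t in lborel. t \<notin> N" using N by (intro AE_not_in)
  then have "AE t in lborel. p + c * t \<notin> N"
    by (intro AE_borel_affine \<open>c \<noteq> 0\<close>) auto
  then have "AE t in lebesgue. p + c * t \<notin> N" by (rule AE_completion)
  then show ?thesis by eventually_elim (use N in auto)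
qed

lemma abs_continuous_curve_cong:
  assumes "\<And>t. t \<in> {a..b} \<Longrightarrow> f t = g t"
  shows "abs_continuous_curve a b f \<longleftrightarrow> abs_continuous_curve a b g"
  using abs_continuous_curve_Lipschitz_image[of a b f 1 g] abs_continuous_curve_Lipschitz_image[of a b g 1 f] assms
  by auto

lemma abs_continuous_curve_affine:
  fixes f :: "real \<Rightarrow> 'a::real_normed_vector"
  assumes f: "abs_continuous_curve a b f" and c: "c \<noteq> 0"
    and T: "\<And>t. t \<in> {a'..b'} \<Longrightarrow> p + c * t \<in> {a..b}"
  shows "abs_continuous_curve a' b' (\<lambda>t. f (p + c * t))"
  unfolding abs_continuous_curve_def
proof (intro allI impI)
  fix e :: real assume e: "0 < e"
  obtain d where d: "d > 0" "\<And>(n::nat) s t.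
     (\<forall>i<n. a \<le> s i \<and> s i \<le> t i \<and> t i \<le> b) \<and>
     disjoint_family_on (\<lambda>i. {s i<..<t i}) {..<n} \<and>
     (\<Sum>i<n. t i - s i) < d \<Longrightarrow> (\<Sum>i<n. norm (f (t i) - f (s i))) < e"
    using f e unfolding abs_continuous_curve_def by meson
  show "\<exists>\<delta>>0. \<forall>(n::nat) s t. (\<forall>i<n. a' \<le> s i \<and> s i \<le> t i \<and> t i \<le> b') \<and>
     disjoint_family_on (\<lambda>i. {s i<..<t i}) {..<n} \<and> (\<Sum>i<n. t i - s i) < \<delta> \<longrightarrow>
     (\<Sum>i<n. norm (f (p + c * t i) - f (p + c * s i))) < e"
  proof (intro exI[of _ "d / \<bar>c\<bar>"] conjI allI impI)
    show "0 < d / \<bar>c\<bar>" using d c by simp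
    fix n :: nat and s t
    assume *: "(\<forall>i<n. a' \<le> s i \<and> s i \<le> t i \<and> t i \<le> b') \<and>
      disjoint_family_on (\<lambda>i. {s i<..<t i}) {..<n} \<and> (\<Sum>i<n. t i - s i) < d / \<bar>c\<bar>"
    then have A: "\<forall>i<n. a' \<le> s i \<and> s i \<le> t i \<and> t i \<le> b'"
      and D: "disjoint_family_on (\<lambda>i. {s i<..<t i}) {..<n}" and S: "(\<Sum>i<n. t i - s i) < d / \<bar>c\<bar>"
      by blast+
    \<comment> \<open>\<open>c\<close> may be negative, as for a reversed curve, so the images of
      the endpoints are sorted.\<close>
    define s' t' where "s' = (\<lambda>i. p + min (c * s i) (c * t i))" and "t' = (\<lambda>i. p + max (c * s i) (c * t i))"
    have st: "s i \<le> t i" "p + c * s i \<in> {a..b}" "p + c * t i \<in> {a..b}" if "i < n" for i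
      using A T that by (auto intro: order_trans)
    have len: "t' i - s' i = \<bar>c\<bar> * (t i - s i)" if "i < n" for i
      using st(1)[OF that] mult_left_mono[of "s i" "t i" "\<bar>c\<bar>"]
      by (cases "c > 0") (auto simp: t'_def s'_def min_def max_def algebra_simps)
    have sub: "x \<in> {s' i<..<t' i} \<Longrightarrow> (x - p) / c \<in> {s i<..<t i}" if "i < n" for i x
      using st(1)[OF that] c
      by (cases "c > 0") (auto simp: t'_def s'_def min_def max_def field_simps split: if_splits)
    have "(\<Sum>i<n. norm (f (t' i) - f (s' i))) < e"
    proof (intro d(2) conjI allI impI)
      show "a \<le> s' i" "s' i \<le> t' i" "t' i \<le> b" if "i < n" for i
        using st[OF that] by (auto simp: s'_def t'_def min_def max_def)
      show "disjoint_family_on (\<lambda>i. {s' i<..<t' i}) {..<n}"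
        unfolding disjoint_family_on_def
      proof (intro ballI impI, rule ccontr)
        fix i j assume ij: "i \<in> {..<n}" "j \<in> {..<n}" "i \<noteq> j" "{s' i<..<t' i} \<inter> {s' j<..<t' j} \<noteq> {}"
        then obtain x where "x \<in> {s' i<..<t' i}" "x \<in> {s' j<..<t' j}" by blast
        then have "(x - p) / c \<in> {s i<..<t i} \<inter> {s j<..<t j}" using sub ij by blast
        then show False using D ij unfolding disjoint_family_on_def by blast
      qed
      have "(\<Sum>i<n. t' i - s' i) = \<bar>c\<bar> * (\<Sum>i<n. t i - s i)"
        using len by (simp add: sum_distrib_left)
      also have "\<dots> < \<bar>c\<bar> * (d / \<bar>c\<bar>)" using S c by (intro mult_strict_left_mono) auto
      finally show "(\<Sum>i<n. t' i - s' i) < d" using c by simp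
    qed
    moreover have "norm (f (t' i) - f (s' i)) = norm (f (p + c * t i) - f (p + c * s i))" for i
      by (auto simp: s'_def t'_def min_def max_def norm_minus_commute)
    ultimately show "(\<Sum>i<n. norm (f (p + c * t i) - f (p + c * s i))) < e" by simp
  qed
qed

lemma abs_continuous_curve_join:
  fixes f :: "real \<Rightarrow> 'a::real_normed_vector"
  assumes f1: "abs_continuous_curve a c f" and f2: "abs_continuous_curve c b f" and "a \<le> c" "c \<le> b"
  shows "abs_continuous_curve a b f"
  unfolding abs_continuous_curve_def
proof (intro allI impI)
  fix e :: real assume "0 < e"
  then have e: "0 < e / 2" by simp
  obtain d1 where d1: "d1 > 0" "\<And>(n::nat) s t.
     (\<forall>i<n. a \<le> s i \<and> s i \<le> t i \<and> t i \<le> c) \<and>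
     disjoint_family_on (\<lambda>i. {s i<..<t i}) {..<n} \<and>
     (\<Sum>i<n. t i - s i) < d1 \<Longrightarrow> (\<Sum>i<n. norm (f (t i) - f (s i))) < e / 2"
    using f1 e unfolding abs_continuous_curve_def by meson
  obtain d2 where d2: "d2 > 0" "\<And>(n::nat) s t.
     (\<forall>i<n. c \<le> s i \<and> s i \<le> t i \<and> t i \<le> b) \<and>
     disjoint_family_on (\<lambda>i. {s i<..<t i}) {..<n} \<and>
     (\<Sum>i<n. t i - s i) < d2 \<Longrightarrow> (\<Sum>i<n. norm (f (t i) - f (s i))) < e / 2"
    using f2 e unfolding abs_continuous_curve_def by meson
  show "\<exists>\<delta>>0. \<forall>(n::nat) s t. (\<forall>i<n. a \<le> s i \<and> s i \<le> t i \<and> t i \<le> b) \<and>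
     disjoint_family_on (\<lambda>i. {s i<..<t i}) {..<n} \<and> (\<Sum>i<n. t i - s i) < \<delta> \<longrightarrow>
     (\<Sum>i<n. norm (f (t i) - f (s i))) < e"
  proof (intro exI[of _ "min d1 d2"] conjI allI impI)
    show "0 < min d1 d2" using d1 d2 by simp
    fix n :: nat and s t
    assume "(\<forall>i<n. a \<le> s i \<and> s i \<le> t i \<and> t i \<le> b) \<and>
      disjoint_family_on (\<lambda>i. {s i<..<t i}) {..<n} \<and> (\<Sum>i<n. t i - s i) < min d1 d2"
    then have A: "\<forall>i<n. a \<le> s i \<and> s i \<le> t i \<and> t i \<le> b"
      and D: "disjoint_family_on (\<lambda>i. {s i<..<t i}) {..<n}" and S: "(\<Sum>i<n. t i - s i) < min d1 d2"
      by blast+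
    \<comment> \<open>Each subinterval is cut at \<open>c\<close>: clipping both ends by
      \<open>min\<close> or \<open>max\<close> leaves its part on one side, and a subinterval on the
      other side collapses to a point.\<close>
    have le: "(\<Sum>i<n. min (t i) c - min (s i) c) \<le> (\<Sum>i<n. t i - s i)"
        "(\<Sum>i<n. max (t i) c - max (s i) c) \<le> (\<Sum>i<n. t i - s i)"
      using A by (intro sum_mono; force simp: min_def max_def)+
    have sub: "{min (s i) c<..<min (t i) c} \<subseteq> {s i<..<t i}" "{max (s i) c<..<max (t i) c} \<subseteq> {s i<..<t i}" for i
      by (auto simp: min_def max_def split: if_splits)
    have dis: "disjoint_family_on (\<lambda>i. {min (s i) c<..<min (t i) c}) {..<n}"
      "disjoint_family_on (\<lambda>i. {max (s i) c<..<max (t i) c}) {..<n}"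
      using D sub unfolding disjoint_family_on_def by (meson disjoint_iff subsetD)+
    have "(\<Sum>i<n. norm (f (min (t i) c) - f (min (s i) c))) < e / 2"
    proof (intro d1(2) conjI allI impI dis)
      show "a \<le> min (s i) c" "min (s i) c \<le> min (t i) c" "min (t i) c \<le> c" if "i < n" for i
        using A that \<open>a \<le> c\<close> by (auto simp: min_def)
    qed (use S le in linarith)
    moreover have "(\<Sum>i<n. norm (f (max (t i) c) - f (max (s i) c))) < e / 2"
    proof (intro d2(2) conjI allI impI dis)
      show "c \<le> max (s i) c" "max (s i) c \<le> max (t i) c" "max (t i) c \<le> b" if "i < n" for i
        using A that \<open>c \<le> b\<close> by (auto simp: max_def)
    qed (use S le in linarith)
    moreover have "norm (f (t i) - f (s i)) \<le> norm (f (min (t i) c) - f (min (s i) c)) + norm (f (max (t i) c) - f (max (s i) c))"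
      if "i < n" for i
      using A that norm_triangle_ineq[of "f (t i) - f c" "f c - f (s i)"]
      by (auto simp: min_def max_def)
    then have "(\<Sum>i<n. norm (f (t i) - f (s i))) \<le>
        (\<Sum>i<n. norm (f (min (t i) c) - f (min (s i) c)) + norm (f (max (t i) c) - f (max (s i) c)))"
      by (intro sum_mono) auto
    ultimately show "(\<Sum>i<n. norm (f (t i) - f (s i))) < e"
      by (simp add: sum.distrib)
  qed
qed

lemma scaled_norm_scaleR: "scaled_norm \<alpha> (c *\<^sub>R z) = \<bar>c\<bar> * scaled_norm \<alpha> z"
  by (simp add: scaled_norm_def case_prod_unfold algebra_simps)

lemma scaled_norm_minus_commute: "scaled_norm \<alpha> (z - w) = scaled_norm \<alpha> (w - z)"
  by (simp add: scaled_norm_def case_prod_unfold norm_minus_commute)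

lemma continuous_on_scaled_norm: "continuous_on S (scaled_norm \<alpha>)"
  unfolding scaled_norm_def case_prod_unfold by (intro continuous_intros)

section \<open>The cost of a curve\<close>

definition curve_density ::
  "('a::real_normed_vector \<times> 'b::real_normed_vector \<Rightarrow> real) \<Rightarrow> real \<Rightarrow> (real \<Rightarrow> 'a \<times> 'b) \<Rightarrow> real \<Rightarrow> ennreal" where
  "curve_density V \<alpha> \<gamma> t =
     ennreal (V (\<gamma> t) * scaled_norm \<alpha> (vector_derivative \<gamma> (at t within {0..1}))) * indicator {0..1} t"

text \<open>Where there is no derivative, \<open>vector_derivative\<close> is arbitrary, so the
  density is only compared almost everywhere with one that is built from an integrable derivative.
  This is why costs are integrated against the complete measure \<open>lebesgue\<close>.\<close>

lemma curve_density_measurable: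
  fixes \<gamma> :: "real \<Rightarrow> 'a::euclidean_space \<times> 'b::euclidean_space"
  assumes \<gamma>: "abs_continuous_curve 0 1 \<gamma>" "\<gamma> ` {0..1} \<subseteq> S" and V: "continuous_on S V"
  shows "curve_density V \<alpha> \<gamma> \<in> borel_measurable lebesgue"
proof -
  define Z where "Z = {t \<in> {0..1}. \<not> \<gamma> differentiable (at t)}"
  have Z: "negligible Z" unfolding Z_def by (rule abs_continuous_curve_differentiable[OF \<gamma>(1)])
  let ?D = "\<lambda>t. vector_derivative \<gamma> (at t within {0..1})"
  have "((\<lambda>t. if t \<in> Z then 0 else ?D t) has_integral (\<gamma> 1 - \<gamma> 0)) {0..1}"
  proof (rule abs_continuous_curve_has_integral[OF \<gamma>(1) zero_le_one Z])
    fix t assume "t \<in> {0..1} - Z"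
    then have "\<gamma> differentiable (at t within {0..1})"
      by (auto simp: Z_def intro: differentiable_at_withinI)
    then show "(\<gamma> has_vector_derivative ?D t) (at t within {0..1})"
      by (simp add: vector_derivative_works)
  qed
  then have F: "(\<lambda>t. if t \<in> Z then 0 else ?D t) \<in> borel_measurable (lebesgue_on {0..1})"
    using integrable_imp_measurable has_integral_integrable by blast
  have "continuous_on {0..1} (\<lambda>t. V (\<gamma> t))"
    using \<gamma> by (intro continuous_on_compose2[OF V] abs_continuous_curve_imp_continuous) auto
  then have "(\<lambda>t. V (\<gamma> t)) \<in> borel_measurable (lebesgue_on {0..1})"
    by (intro continuous_imp_measurable_on_sets_lebesgue) auto
  moreover have "(\<lambda>t. scaled_norm \<alpha> (if t \<in> Z then 0 else ?D t)) \<in> borel_measurable (lebesgue_on {0..1})"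
    by (rule measurable_compose[OF F borel_measurable_continuous_onI[OF continuous_on_scaled_norm]])
  ultimately have "(\<lambda>t. V (\<gamma> t) * scaled_norm \<alpha> (if t \<in> Z then 0 else ?D t)) \<in> borel_measurable (lebesgue_on {0..1})"
    by (rule borel_measurable_times)
  then have "(\<lambda>t. indicator {0..1} t *\<^sub>R (V (\<gamma> t) * scaled_norm \<alpha> (if t \<in> Z then 0 else ?D t))) \<in> borel_measurable lebesgue"
    by (subst (asm) borel_measurable_restrict_space_iff) auto
  moreover have "AE t in lebesgue. indicator {0..1} t *\<^sub>R (V (\<gamma> t) * scaled_norm \<alpha> (if t \<in> Z then 0 else ?D t)) =
      indicator {0..1} t *\<^sub>R (V (\<gamma> t) * scaled_norm \<alpha> (?D t))"
    using AE_not_in[of Z lebesgue] Z by (auto simp: negligible_iff_null_sets elim!: eventually_mono)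
  ultimately have "(\<lambda>t. indicator {0..1} t *\<^sub>R (V (\<gamma> t) * scaled_norm \<alpha> (?D t))) \<in> borel_measurable lebesgue"
    by (rule borel_measurable_AE)
  then have "(\<lambda>t. ennreal (indicator {0..1} t *\<^sub>R (V (\<gamma> t) * scaled_norm \<alpha> (?D t)))) \<in> borel_measurable lebesgue"
    by (rule measurable_compose[OF _ measurable_ennreal])
  moreover have "(\<lambda>t. ennreal (indicator {0..1} t *\<^sub>R (V (\<gamma> t) * scaled_norm \<alpha> (?D t)))) = curve_density V \<alpha> \<gamma>"
    by (auto simp: curve_density_def fun_eq_iff indicator_def)
  ultimately show ?thesis by simp
qed

text \<open>The chain rule contributes a factor \<open>\<bar>c\<bar>\<close>, which the change of
  variables removes. The interval is open because a concatenated curve may have corners at the ends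
  of its pieces.\<close>

lemma curve_density_affine:
  fixes \<gamma> \<gamma>1 :: "real \<Rightarrow> 'a::euclidean_space \<times> 'b::euclidean_space"
  assumes \<gamma>1: "abs_continuous_curve 0 1 \<gamma>1" "\<gamma>1 ` {0..1} \<subseteq> S" and V: "continuous_on S V"
    and c: "c \<noteq> 0" and ab: "{a<..<b} \<subseteq> {0..1}"
    and T: "\<And>t. t \<in> {a<..<b} \<Longrightarrow> p + c * t \<in> {0<..<1}"
    and eq: "\<And>t. t \<in> {a<..<b} \<Longrightarrow> \<gamma> t = \<gamma>1 (p + c * t)"
  shows "(\<integral>\<^sup>+t\<in>{a<..<b}. curve_density V \<alpha> \<gamma> t \<partial>lebesgue) \<le> (\<integral>\<^sup>+t. curve_density V \<alpha> \<gamma>1 t \<partial>lebesgue)"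
proof -
  define Z where "Z = {t \<in> {0..1}. \<not> \<gamma>1 differentiable (at t)}"
  have Z: "negligible Z" unfolding Z_def by (rule abs_continuous_curve_differentiable[OF \<gamma>1(1)])
  have "AE t in lebesgue. curve_density V \<alpha> \<gamma> t * indicator {a<..<b} t \<le> ennreal \<bar>c\<bar> * curve_density V \<alpha> \<gamma>1 (p + c * t)"
    using negligible_imp_AE_affine[OF Z c, of p]
  proof eventually_elim
    case (elim t)
    show ?case
    proof (cases "t \<in> {a<..<b}")
      case True
      have t01: "t \<in> {0<..<1}"
        using True interior_mono[OF ab] by auto
      have T01: "p + c * t \<in> {0<..<1}" by (rule T[OF True])
      then have diff: "\<gamma>1 differentiable (at (p + c * t))" using elim by (auto simp: Z_def)
      then have d1: "(\<gamma>1 has_vector_derivative vector_derivative \<gamma>1 (at (p + c * t))) (at (p + c * t))"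
        by (simp add: vector_derivative_works)
      have "((\<lambda>t. p + c * t) has_real_derivative c) (at t)"
        by (auto intro!: derivative_eq_intros)
      then have "((\<lambda>t. p + c * t) has_vector_derivative c) (at t)"
        by (simp add: has_real_derivative_iff_has_vector_derivative)
      from vector_diff_chain_at[OF this d1]
      have "((\<lambda>t. \<gamma>1 (p + c * t)) has_vector_derivative c *\<^sub>R vector_derivative \<gamma>1 (at (p + c * t))) (at t)"
        by (simp add: o_def)
      then have "(\<gamma> has_vector_derivative c *\<^sub>R vector_derivative \<gamma>1 (at (p + c * t))) (at t)"
        by (rule has_vector_derivative_transform_within_open[of _ _ _ "{a<..<b}"]) (use True eq in auto)
      then have "vector_derivative \<gamma> (at t within {0..1}) = c *\<^sub>R vector_derivative \<gamma>1 (at (p + c * t))"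
        by (rule vector_derivative_at_within_ivl) (use t01 in auto)
      moreover have "vector_derivative \<gamma>1 (at (p + c * t) within {0..1}) = vector_derivative \<gamma>1 (at (p + c * t))"
        by (rule vector_derivative_at_within_ivl[OF d1]) (use T01 in auto)
      ultimately show ?thesis
        using True T01 t01 eq[OF True]
        by (simp add: curve_density_def scaled_norm_scaleR ennreal_mult'[symmetric] mult_ac)
    qed simp
  qed
  then have "(\<integral>\<^sup>+t\<in>{a<..<b}. curve_density V \<alpha> \<gamma> t \<partial>lebesgue) \<le> (\<integral>\<^sup>+t. ennreal \<bar>c\<bar> * curve_density V \<alpha> \<gamma>1 (p + c * t) \<partial>lebesgue)"
    by (rule nn_integral_mono_AE)
  also have "\<dots> = ennreal \<bar>c\<bar> * (\<integral>\<^sup>+t. curve_density V \<alpha> \<gamma>1 (p + c * t) \<partial>lebesgue)"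
  proof (rule nn_integral_cmult)
    have "(\<lambda>t::real. p + c * t) \<in> lebesgue \<rightarrow>\<^sub>M lebesgue"
      using lebesgue_affine_measurable[where c="\<lambda>_::real. c" and t=p] c by simp
    then show "(\<lambda>t. curve_density V \<alpha> \<gamma>1 (p + c * t)) \<in> borel_measurable lebesgue"
      by (rule measurable_compose) (rule curve_density_measurable[OF \<gamma>1 V])
  qed
  also have "\<dots> = (\<integral>\<^sup>+t. curve_density V \<alpha> \<gamma>1 t \<partial>lebesgue)"
    by (rule nn_integral_real_affine_lebesgue[OF curve_density_measurable[OF \<gamma>1 V] c, symmetric])
  finally show ?thesis .
qed

lemma path_metric_eq_lebesgue:
  "path_metric \<Xi> V \<alpha> z z' =
     (INF \<gamma> \<in> {\<gamma>. abs_continuous_curve 0 1 \<gamma> \<and> \<gamma> ` {0..1} \<subseteq> UNIV \<times> \<Xi> \<and> \<gamma> 0 = z \<and> \<gamma> 1 = z'}.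
        \<integral>\<^sup>+t. curve_density V \<alpha> \<gamma> t \<partial>lebesgue)"
  by (simp add: path_metric_def curve_density_def[abs_def] nn_integral_completion)

lemma path_metric_le:
  assumes "abs_continuous_curve 0 1 \<gamma>" "\<gamma> ` {0..1} \<subseteq> UNIV \<times> \<Xi>" "\<gamma> 0 = z" "\<gamma> 1 = z'"
  shows "path_metric \<Xi> V \<alpha> z z' \<le> (\<integral>\<^sup>+t. curve_density V \<alpha> \<gamma> t \<partial>lebesgue)"
  unfolding path_metric_eq_lebesgue by (rule INF_lower) (use assms in auto)

lemma path_metric_geI:
  assumes "\<And>\<gamma>. abs_continuous_curve 0 1 \<gamma> \<Longrightarrow> \<gamma> ` {0..1} \<subseteq> UNIV \<times> \<Xi> \<Longrightarrow> \<gamma> 0 = z \<Longrightarrow> \<gamma> 1 = z' \<Longrightarrow>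
    B \<le> (\<integral>\<^sup>+t. curve_density V \<alpha> \<gamma> t \<partial>lebesgue)"
  shows "B \<le> path_metric \<Xi> V \<alpha> z z'"
  unfolding path_metric_eq_lebesgue by (rule INF_greatest) (use assms in auto)

lemma AE_not_eq_lebesgue: "AE t in lebesgue. (t::real) \<noteq> c"
  using AE_not_in[of "{c}" lebesgue] negligible_sing[of c] by (simp add: negligible_iff_null_sets)

section \<open>The weighted path metric and its triangle inequality\<close>

locale weighted_path_metric =
  fixes \<Xi> :: "(real ^ 'e) set" and V :: "(real ^ 'd) \<times> (real ^ 'e) \<Rightarrow> real" and \<alpha> :: real
  assumes convex: "convex \<Xi>" and V_cont: "continuous_on (UNIV \<times> \<Xi>) V"
    and V_ge_1: "z \<in> UNIV \<times> \<Xi> \<Longrightarrow> 1 \<le> V z" and \<alpha>_pos: "0 < \<alpha>"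
begin

abbreviation "N \<equiv> scaled_norm \<alpha> :: (real ^ 'd) \<times> (real ^ 'e) \<Rightarrow> real"
abbreviation "d \<equiv> path_metric \<Xi> V \<alpha>"
abbreviation "Zs \<equiv> UNIV \<times> \<Xi> :: ((real ^ 'd) \<times> (real ^ 'e)) set"

lemma convex_Zs: "convex Zs" by (intro convex_Times convex_UNIV convex)

lemma N_nonneg: "0 \<le> N z" by (rule scaled_norm_nonneg[OF \<alpha>_pos])

lemma d_sym_le: "d z' z \<le> d z z'"
proof (rule path_metric_geI)
  fix \<gamma> assume \<gamma>: "abs_continuous_curve 0 1 \<gamma>" "\<gamma> ` {0..1} \<subseteq> Zs" "\<gamma> 0 = z" "\<gamma> 1 = z'"
  define \<gamma>' where "\<gamma>' = (\<lambda>t. \<gamma> (1 + (-1) * t))"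
  have ac: "abs_continuous_curve 0 1 \<gamma>'"
    unfolding \<gamma>'_def by (rule abs_continuous_curve_affine[OF \<gamma>(1)]) auto
  have im: "\<gamma>' ` {0..1} \<subseteq> Zs" using \<gamma>(2) by (auto simp: \<gamma>'_def image_subset_iff)
  have "d z' z \<le> (\<integral>\<^sup>+t. curve_density V \<alpha> \<gamma>' t \<partial>lebesgue)"
    by (rule path_metric_le[OF ac im]) (use \<gamma> in \<open>auto simp: \<gamma>'_def\<close>)
  also have "\<dots> = (\<integral>\<^sup>+t\<in>{0<..<1}. curve_density V \<alpha> \<gamma>' t \<partial>lebesgue)"
    using AE_not_eq_lebesgue[of 0] AE_not_eq_lebesgue[of 1]
    by (intro nn_integral_cong_AE, eventually_elim) (auto simp: curve_density_def indicator_def)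
  also have "\<dots> \<le> (\<integral>\<^sup>+t. curve_density V \<alpha> \<gamma> t \<partial>lebesgue)"
    by (rule curve_density_affine[OF \<gamma>(1,2) V_cont, where c="-1" and p=1]) (auto simp: \<gamma>'_def)
  finally show "d z' z \<le> (\<integral>\<^sup>+t. curve_density V \<alpha> \<gamma> t \<partial>lebesgue)" .
qed

lemma d_sym: "d z' z = d z z'" by (intro antisym d_sym_le)

lemma d_triangle: "d z z'' \<le> d z z' + d z' z''"
proof -
  have main: "d z z'' \<le> (\<integral>\<^sup>+t. curve_density V \<alpha> \<gamma>1 t \<partial>lebesgue) + (\<integral>\<^sup>+t. curve_density V \<alpha> \<gamma>2 t \<partial>lebesgue)"
    if g1: "abs_continuous_curve 0 1 \<gamma>1" "\<gamma>1 ` {0..1} \<subseteq> Zs" "\<gamma>1 0 = z" "\<gamma>1 1 = z'"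
    and g2: "abs_continuous_curve 0 1 \<gamma>2" "\<gamma>2 ` {0..1} \<subseteq> Zs" "\<gamma>2 0 = z'" "\<gamma>2 1 = z''" for \<gamma>1 \<gamma>2
  proof -
    define \<gamma> where "\<gamma> = (\<lambda>t. if t \<le> 1/2 then \<gamma>1 (0 + 2 * t) else \<gamma>2 (-1 + 2 * t))"
    have "abs_continuous_curve 0 (1/2) (\<lambda>t. \<gamma>1 (0 + 2 * t))"
      by (rule abs_continuous_curve_affine[OF g1(1)]) auto
    then have ac1: "abs_continuous_curve 0 (1/2) \<gamma>"
      by (subst abs_continuous_curve_cong[where g="\<lambda>t. \<gamma>1 (0 + 2 * t)"]) (auto simp: \<gamma>_def)
    have "abs_continuous_curve (1/2) 1 (\<lambda>t. \<gamma>2 (-1 + 2 * t))"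
      by (rule abs_continuous_curve_affine[OF g2(1)]) auto
    then have ac2: "abs_continuous_curve (1/2) 1 \<gamma>"
    proof (subst abs_continuous_curve_cong[where g="\<lambda>t. \<gamma>2 (-1 + 2 * t)"])
      show "\<gamma> t = \<gamma>2 (-1 + 2 * t)" if "t \<in> {1/2..1}" for t
      proof (cases "t = 1/2")
        case True
        show ?thesis unfolding True \<gamma>_def using g1(4) g2(3) by simp
      next
        case False
        with that show ?thesis by (auto simp: \<gamma>_def)
      qed
    qed
    have ac: "abs_continuous_curve 0 1 \<gamma>"
      by (rule abs_continuous_curve_join[OF ac1 ac2]) auto
    have im: "\<gamma> ` {0..1} \<subseteq> Zs"
    proof (rule image_subsetI)
      fix t :: real assume "t \<in> {0..1}"
      then show "\<gamma> t \<in> Zs"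
        using subsetD[OF g1(2) imageI, of "2 * t"] subsetD[OF g2(2) imageI, of "-1 + 2 * t"]
        by (cases "t \<le> 1/2") (auto simp: \<gamma>_def simp del: mem_Times_iff)
    qed
    have [measurable]: "curve_density V \<alpha> \<gamma> \<in> borel_measurable lebesgue"
      by (rule curve_density_measurable[OF ac im V_cont])
    have "d z z'' \<le> (\<integral>\<^sup>+t. curve_density V \<alpha> \<gamma> t \<partial>lebesgue)"
      by (rule path_metric_le[OF ac im]) (use g1 g2 in \<open>auto simp: \<gamma>_def\<close>)
    also have "\<dots> = (\<integral>\<^sup>+t. curve_density V \<alpha> \<gamma> t * indicator {0<..<1/2} t + curve_density V \<alpha> \<gamma> t * indicator {1/2<..<1} t \<partial>lebesgue)"
      using AE_not_eq_lebesgue[of 0] AE_not_eq_lebesgue[of 1] AE_not_eq_lebesgue[of "1/2"]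
      by (intro nn_integral_cong_AE, eventually_elim) (auto simp: curve_density_def indicator_def)
    also have "\<dots> = (\<integral>\<^sup>+t\<in>{0<..<1/2}. curve_density V \<alpha> \<gamma> t \<partial>lebesgue) + (\<integral>\<^sup>+t\<in>{1/2<..<1}. curve_density V \<alpha> \<gamma> t \<partial>lebesgue)"
      by (rule nn_integral_add) (auto intro!: borel_measurable_times_ennreal borel_measurable_indicator)
    also have "\<dots> \<le> (\<integral>\<^sup>+t. curve_density V \<alpha> \<gamma>1 t \<partial>lebesgue) + (\<integral>\<^sup>+t. curve_density V \<alpha> \<gamma>2 t \<partial>lebesgue)"
    proof (rule add_mono)
      show "(\<integral>\<^sup>+t\<in>{0<..<1/2}. curve_density V \<alpha> \<gamma> t \<partial>lebesgue) \<le> (\<integral>\<^sup>+t. curve_density V \<alpha> \<gamma>1 t \<partial>lebesgue)"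
        by (rule curve_density_affine[OF g1(1,2) V_cont, where c=2 and p=0]) (auto simp: \<gamma>_def)
      show "(\<integral>\<^sup>+t\<in>{1/2<..<1}. curve_density V \<alpha> \<gamma> t \<partial>lebesgue) \<le> (\<integral>\<^sup>+t. curve_density V \<alpha> \<gamma>2 t \<partial>lebesgue)"
        by (rule curve_density_affine[OF g2(1,2) V_cont, where c=2 and p="-1"]) (auto simp: \<gamma>_def)
    qed
    finally show ?thesis .
  qed
  show ?thesis
  proof (cases "d z z' = \<infinity> \<or> d z' z'' = \<infinity>")
    case True
    then show ?thesis by auto
  next
    case False
    show ?thesis
    proof (rule ennreal_le_epsilon)
      fix e :: real assume e: "0 < e"
      have "\<exists>\<gamma>. abs_continuous_curve 0 1 \<gamma> \<and> \<gamma> ` {0..1} \<subseteq> Zs \<and> \<gamma> 0 = w \<and> \<gamma> 1 = w' \<and>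
        (\<integral>\<^sup>+t. curve_density V \<alpha> \<gamma> t \<partial>lebesgue) < d w w' + ennreal (e/2)" if "d w w' \<noteq> \<infinity>" for w w'
      proof -
        have "d w w' < d w w' + ennreal (e/2)"
          using that e by (simp add: ennreal_less_iff less_top[symmetric])
        then show ?thesis
          by (subst (asm) (1) path_metric_eq_lebesgue) (auto simp: INF_less_iff)
      qed
      with False obtain \<gamma>1 \<gamma>2 where g1: "abs_continuous_curve 0 1 \<gamma>1" "\<gamma>1 ` {0..1} \<subseteq> Zs" "\<gamma>1 0 = z" "\<gamma>1 1 = z'"
          "(\<integral>\<^sup>+t. curve_density V \<alpha> \<gamma>1 t \<partial>lebesgue) < d z z' + ennreal (e/2)"
        and g2: "abs_continuous_curve 0 1 \<gamma>2" "\<gamma>2 ` {0..1} \<subseteq> Zs" "\<gamma>2 0 = z'" "\<gamma>2 1 = z''"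
          "(\<integral>\<^sup>+t. curve_density V \<alpha> \<gamma>2 t \<partial>lebesgue) < d z' z'' + ennreal (e/2)"
        by meson
      have "d z z'' \<le> (d z z' + ennreal (e/2)) + (d z' z'' + ennreal (e/2))"
        using main[OF g1(1-4) g2(1-4)] add_mono[OF less_imp_le[OF g1(5)] less_imp_le[OF g2(5)]] by (rule order_trans)
      also have "\<dots> = d z z' + d z' z'' + (ennreal (e/2) + ennreal (e/2))"
        by (simp only: add_ac)
      also have "ennreal (e/2) + ennreal (e/2) = ennreal e"
        using e by (simp flip: ennreal_plus)
      finally show "d z z'' \<le> d z z' + d z' z'' + ennreal e" .
    qed
  qed
qed

lemma d_segment_le:
  assumes z: "z \<in> Zs" "z' \<in> Zs" and B: "\<And>y. y \<in> closed_segment z z' \<Longrightarrow> V y \<le> B"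
  shows "d z z' \<le> ennreal (B * N (z' - z))"
proof -
  define \<gamma> where "\<gamma> = (\<lambda>t. z + t *\<^sub>R (z' - z))"
  have "abs_continuous_curve 0 1 (\<lambda>t::real. t)"
    unfolding abs_continuous_curve_def by (intro allI impI, rule_tac x=\<epsilon> in exI) auto
  then have ac: "abs_continuous_curve 0 1 \<gamma>"
    by (rule abs_continuous_curve_Lipschitz_image[where L="norm (z' - z)"])
      (auto simp: \<gamma>_def simp flip: scaleR_diff_left)
  have seg: "\<gamma> t \<in> closed_segment z z'" if "t \<in> {0..1}" for t
    using that unfolding closed_segment_def \<gamma>_def by (auto intro!: exI[of _ t] simp: algebra_simps)
  then have im: "\<gamma> ` {0..1} \<subseteq> Zs"
    using closed_segment_subset[OF z convex_Zs] by blast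
  have vd: "vector_derivative \<gamma> (at t within {0..1}) = z' - z" if "t \<in> {0..1}" for t
    unfolding \<gamma>_def
    by (rule vector_derivative_at_within_ivl) (use that in \<open>auto intro!: derivative_eq_intros\<close>)
  have "d z z' \<le> (\<integral>\<^sup>+t. curve_density V \<alpha> \<gamma> t \<partial>lebesgue)"
    by (rule path_metric_le[OF ac im]) (auto simp: \<gamma>_def)
  also have "\<dots> \<le> (\<integral>\<^sup>+t. ennreal (B * N (z' - z)) * indicator {0..1::real} t \<partial>lebesgue)"
  proof (rule nn_integral_mono)
    fix t
    show "curve_density V \<alpha> \<gamma> t \<le> ennreal (B * N (z' - z)) * indicator {0..1} t"
    proof (cases "t \<in> {0..1}")
      case True
      then show ?thesis
        using mult_right_mono[OF B[OF seg[OF True]] N_nonneg[of "z' - z"]] vd[OF True]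
        by (simp add: curve_density_def ennreal_leI)
    qed (simp add: curve_density_def)
  qed
  also have "\<dots> = ennreal (B * N (z' - z))"
    by (subst nn_integral_cmult_indicator) auto
  finally show ?thesis .
qed

lemma d_refl: "z \<in> Zs \<Longrightarrow> d z z = 0"
  using d_segment_le[of z z "V z"] by (simp add: scaled_norm_def zero_prod_def)

text \<open>The counterpart of \<open>d_segment_le\<close>. Together they compare the distance of
  two nearby points of a curve with the cost of the curve between them.\<close>

lemma curve_cost_ge:
  assumes \<gamma>: "abs_continuous_curve 0 1 \<gamma>" and im: "\<gamma> ` {0..1} \<subseteq> Zs" and st: "0 \<le> s" "s \<le> t" "t \<le> 1"
    and v: "0 \<le> v" "\<And>r. r \<in> {s..t} \<Longrightarrow> v \<le> V (\<gamma> r)"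
  shows "ennreal (v * N (\<gamma> t - \<gamma> s)) \<le> (\<integral>\<^sup>+r\<in>{s..t}. curve_density V \<alpha> \<gamma> r \<partial>lebesgue)"
proof (cases "v = 0")
  case False
  then have v0: "0 < v" using v by simp
  let ?D = "\<lambda>r. vector_derivative \<gamma> (at r within {0..1})"
  have "ennreal (N (\<gamma> t - \<gamma> s)) \<le> (\<integral>\<^sup>+r\<in>{s..t}. ennreal (N (?D r)) \<partial>lborel)"
    by (rule scaled_norm_le_nn_integral[OF \<gamma> st \<alpha>_pos])
  also have "\<dots> = (\<integral>\<^sup>+r\<in>{s..t}. ennreal (N (?D r)) \<partial>lebesgue)"
    by (rule nn_integral_completion[symmetric])
  also have "\<dots> \<le> (\<integral>\<^sup>+r. ennreal (inverse v) * (curve_density V \<alpha> \<gamma> r * indicator {s..t} r) \<partial>lebesgue)"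
  proof (rule nn_integral_mono)
    fix r
    show "ennreal (N (?D r)) * indicator {s..t} r \<le> ennreal (inverse v) * (curve_density V \<alpha> \<gamma> r * indicator {s..t} r)"
    proof (cases "r \<in> {s..t}")
      case True
      then have "inverse v * (V (\<gamma> r) * N (?D r)) \<ge> inverse v * (v * N (?D r))"
        using v v0 N_nonneg by (intro mult_left_mono mult_right_mono) auto
      then have "N (?D r) \<le> inverse v * (V (\<gamma> r) * N (?D r))" using v0 by (simp add: field_simps)
      then show ?thesis
        using True st v0 by (simp add: curve_density_def ennreal_mult'[symmetric] ennreal_leI)
    qed simp
  qed
  also have "\<dots> = ennreal (inverse v) * (\<integral>\<^sup>+r\<in>{s..t}. curve_density V \<alpha> \<gamma> r \<partial>lebesgue)"
    using curve_density_measurable[OF \<gamma> im V_cont] by (intro nn_integral_cmult borel_measurable_times_ennreal borel_measurable_indicator) auto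
  finally have "ennreal v * ennreal (N (\<gamma> t - \<gamma> s)) \<le> ennreal v * (ennreal (inverse v) * (\<integral>\<^sup>+r\<in>{s..t}. curve_density V \<alpha> \<gamma> r \<partial>lebesgue))"
    by (intro mult_left_mono) auto
  also have "\<dots> = (\<integral>\<^sup>+r\<in>{s..t}. curve_density V \<alpha> \<gamma> r \<partial>lebesgue)"
    using v0 by (simp add: mult.assoc[symmetric] ennreal_mult'[symmetric])
  finally show ?thesis using v by (simp add: ennreal_mult')
qed simp

end

section \<open>Comparison with the norm, continuity and measurability\<close>

context weighted_path_metric
begin

lemma d_ge: "ennreal (N (z' - z)) \<le> d z z'"
proof (rule path_metric_geI)
  fix \<gamma> assume \<gamma>: "abs_continuous_curve 0 1 \<gamma>" "\<gamma> ` {0..1} \<subseteq> Zs" "\<gamma> 0 = z" "\<gamma> 1 = z'"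
  have "ennreal (1 * N (\<gamma> 1 - \<gamma> 0)) \<le> (\<integral>\<^sup>+r\<in>{0..1}. curve_density V \<alpha> \<gamma> r \<partial>lebesgue)"
    using \<gamma> by (intro curve_cost_ge V_ge_1) auto
  also have "\<dots> \<le> (\<integral>\<^sup>+r. curve_density V \<alpha> \<gamma> r \<partial>lebesgue)"
    by (intro nn_integral_mono) (auto simp: indicator_def)
  finally show "ennreal (N (z' - z)) \<le> (\<integral>\<^sup>+t. curve_density V \<alpha> \<gamma> t \<partial>lebesgue)"
    using \<gamma> by simp
qed

lemma N_ge_dist: "\<exists>C>0. \<forall>z. norm z \<le> C * N z"
proof (intro exI[of _ "1 + \<alpha>"] conjI allI)
  show "0 < 1 + \<alpha>" using \<alpha>_pos by simp
  fix z :: "(real ^ 'd) \<times> (real ^ 'e)"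
  have "norm z \<le> norm (fst z) + norm (snd z)"
    by (metis norm_Pair_le prod.collapse)
  also have "norm (snd z) = \<alpha> * (inverse \<alpha> * norm (snd z))" using \<alpha>_pos by simp
  also have "norm (fst z) + \<alpha> * (inverse \<alpha> * norm (snd z)) \<le> (1 + \<alpha>) * (norm (fst z) + inverse \<alpha> * norm (snd z))"
    using \<alpha>_pos by (simp add: algebra_simps)
  finally show "norm z \<le> (1 + \<alpha>) * N z" by (simp add: scaled_norm_def case_prod_unfold)
qed

lemma d_finite:
  assumes "z \<in> Zs" "z' \<in> Zs"
  shows "d z z' < \<infinity>"
proof -
  have sub: "closed_segment z z' \<subseteq> Zs" using closed_segment_subset[OF assms convex_Zs] .
  have "compact (V ` closed_segment z z')"
    by (intro compact_continuous_image continuous_on_subset[OF V_cont sub] compact_segment)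
  then obtain B where "\<And>y. y \<in> closed_segment z z' \<Longrightarrow> V y \<le> B"
    by (meson bounded_imp_bdd_above bdd_above.E compact_imp_bounded imageI)
  from d_segment_le[OF assms this] show ?thesis
    by (metis ennreal_less_top infinity_ennreal_def order_le_less_trans)
qed

lemma d_locally_le:
  assumes z0: "z0 \<in> Zs"
  obtains r B where "0 < r" "0 < B" "\<And>z. z \<in> Zs \<Longrightarrow> dist z z0 < r \<Longrightarrow> d z0 z \<le> ennreal (B * N (z - z0))"
proof -
  obtain r where r: "0 < r" "\<And>z. z \<in> Zs \<Longrightarrow> dist z z0 < r \<Longrightarrow> dist (V z) (V z0) < 1"
    using V_cont[unfolded continuous_on_iff, rule_format, OF z0, of 1] by auto
  show thesis
  proof (rule that[OF r(1), of "V z0 + 1"])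
    show "0 < V z0 + 1" using V_ge_1[OF z0] by simp
    fix z assume z: "z \<in> Zs" "dist z z0 < r"
    show "d z0 z \<le> ennreal ((V z0 + 1) * N (z - z0))"
    proof (rule d_segment_le[OF z0 z(1)])
      fix y assume y: "y \<in> closed_segment z0 z"
      have "y \<in> Zs" using closed_segment_subset[OF z0 z(1) convex_Zs] y by blast
      moreover have "y \<in> ball z0 r"
        using closed_segment_subset[OF _ _ convex_ball, of z0 z0 r z] y z r(1) by (auto simp: dist_commute)
      ultimately show "V y \<le> V z0 + 1"
        using r(2)[of y] by (auto simp: dist_real_def dist_commute)
    qed
  qed
qed

text \<open>\<open>d\<close> is finite on \<open>Zs\<close> and locally bounded by the scaled norm,
  so the triangle inequality gives continuity in both arguments. Measurability of the cost on pairs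
  and convergence in \<open>d\<close> along convergent sequences are read off from it.\<close>

lemma continuous_on_enn2real_d: "continuous_on (Zs \<times> Zs) (\<lambda>p. enn2real (d (fst p) (snd p)))"
  unfolding continuous_on_def
proof (rule ballI)
  fix p assume "p \<in> Zs \<times> Zs"
  then obtain z0 w0 where p: "p = (z0, w0)" "z0 \<in> Zs" "w0 \<in> Zs" by auto
  obtain r B where r: "0 < r" "0 < B" "\<And>z. z \<in> Zs \<Longrightarrow> dist z z0 < r \<Longrightarrow> d z0 z \<le> ennreal (B * N (z - z0))"
    using d_locally_le[OF p(2)] by blast
  obtain r' B' where r': "0 < r'" "0 < B'" "\<And>z. z \<in> Zs \<Longrightarrow> dist z w0 < r' \<Longrightarrow> d w0 z \<le> ennreal (B' * N (z - w0))"
    using d_locally_le[OF p(3)] by blast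
  have fin: "d z w = ennreal (enn2real (d z w))" if "z \<in> Zs" "w \<in> Zs" for z w
    using d_finite[OF that] by (simp add: less_top)
  have tri: "enn2real (d z w) \<le> enn2real (d z z') + enn2real (d z' w') + enn2real (d w' w)"
    if "z \<in> Zs" "w \<in> Zs" "z' \<in> Zs" "w' \<in> Zs" for z w z' w'
  proof -
    have "d z w \<le> d z z' + d z' w' + d w' w"
      using order_trans[OF d_triangle[of z w w'] add_right_mono[OF d_triangle[of z w' z']]] .
    also have "\<dots> = ennreal (enn2real (d z z') + enn2real (d z' w') + enn2real (d w' w))"
      using fin that by (simp add: ennreal_plus)
    finally show ?thesis by (intro enn2real_leI) auto
  qed
  let ?b = "\<lambda>q. B * N (fst q - z0) + B' * N (snd q - w0)"
  have b: "(?b \<longlongrightarrow> 0) (at p within Zs \<times> Zs)"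
  proof -
    have "continuous_on UNIV ?b"
      by (intro continuous_intros continuous_on_compose2[OF continuous_on_scaled_norm[of UNIV]]) auto
    then have "isCont ?b p" using continuous_on_eq_continuous_at[OF open_UNIV, of ?b] by blast
    then have "(?b \<longlongrightarrow> ?b p) (at p within Zs \<times> Zs)"
      unfolding isCont_def by (rule tendsto_within_subset) simp
    moreover have "?b p = 0" by (simp add: p(1) scaled_norm_def zero_prod_def)
    ultimately show ?thesis by simp
  qed
  have near: "\<forall>\<^sub>F q in at p within Zs \<times> Zs. dist q p < min r r'"
    using r(1) r'(1) unfolding eventually_at by (intro exI[of _ "min r r'"]) simp
  have inZ: "\<forall>\<^sub>F q in at p within Zs \<times> Zs. q \<in> Zs \<times> Zs"
    by (auto simp: eventually_at_filter)
  have "\<forall>\<^sub>F q in at p within Zs \<times> Zs. norm (enn2real (d (fst q) (snd q)) - enn2real (d z0 w0)) \<le> ?b q"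
    using near inZ
  proof eventually_elim
    case (elim q)
    obtain z w where q: "q = (z, w)" "z \<in> Zs" "w \<in> Zs" using elim(2) by auto
    have "dist z z0 < r" "dist w w0 < r'"
      using elim(1) dist_fst_le[of q p] dist_snd_le[of q p] by (auto simp: q(1) p(1))
    then have "d z0 z \<le> ennreal (B * N (z - z0))" "d w0 w \<le> ennreal (B' * N (w - w0))"
      using r(3)[OF q(2)] r'(3)[OF q(3)] by blast+
    then have "enn2real (d z0 z) \<le> B * N (z - z0)" "enn2real (d w0 w) \<le> B' * N (w - w0)"
      using less_imp_le[OF r(2)] less_imp_le[OF r'(2)] by (auto intro!: enn2real_leI mult_nonneg_nonneg N_nonneg simp del: split_paired_all)
    moreover have "enn2real (d z w) \<le> enn2real (d z z0) + enn2real (d z0 w0) + enn2real (d w0 w)"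
      by (rule tri[OF q(2,3) p(2,3)])
    moreover have "enn2real (d z0 w0) \<le> enn2real (d z0 z) + enn2real (d z w) + enn2real (d w w0)"
      by (rule tri[OF p(2,3) q(2,3)])
    ultimately show ?case
      unfolding q(1) fst_conv snd_conv real_norm_def abs_le_iff d_sym[of z z0] d_sym[of w w0] by linarith
  qed
  then have "((\<lambda>q. enn2real (d (fst q) (snd q)) - enn2real (d z0 w0)) \<longlongrightarrow> 0) (at p within Zs \<times> Zs)"
    by (rule Lim_null_comparison[OF _ b])
  then show "((\<lambda>q. enn2real (d (fst q) (snd q))) \<longlongrightarrow> enn2real (d (fst p) (snd p))) (at p within Zs \<times> Zs)"
    by (simp add: p(1) Lim_null[symmetric])
qed

lemma d_eq_ennreal: "z \<in> Zs \<Longrightarrow> z' \<in> Zs \<Longrightarrow> d z z' = ennreal (enn2real (d z z'))"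
  using d_finite[of z z'] by (simp add: less_top)

lemma measurable_d:
  "(\<lambda>p. d (fst p) (snd p)) \<in> borel_measurable (restrict_space borel Zs \<Otimes>\<^sub>M restrict_space borel Zs)"
proof -
  let ?M = "restrict_space borel Zs \<Otimes>\<^sub>M restrict_space borel Zs"
  have sp: "space ?M = Zs \<times> Zs" by (simp add: space_pair_measure space_restrict_space)
  have f: "(\<lambda>z. z) \<in> restrict_space borel Zs \<rightarrow>\<^sub>M borel"
    by (rule measurable_restrict_space1) simp
  have "(\<lambda>p. (fst p, snd p)) \<in> ?M \<rightarrow>\<^sub>M borel \<Otimes>\<^sub>M borel"
    by (rule measurable_Pair[OF measurable_compose[OF measurable_fst f] measurable_compose[OF measurable_snd f]])
  then have "(\<lambda>p. p) \<in> ?M \<rightarrow>\<^sub>M borel"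
    by (simp only: borel_prod prod.collapse)
  then have "(\<lambda>p. p) \<in> ?M \<rightarrow>\<^sub>M restrict_space borel (Zs \<times> Zs)"
    by (rule measurable_restrict_space2[rotated]) (auto simp: sp)
  from measurable_compose[OF this borel_measurable_continuous_on_restrict[OF continuous_on_enn2real_d]]
  have "(\<lambda>p. ennreal (enn2real (d (fst p) (snd p)))) \<in> borel_measurable ?M"
    by (rule measurable_compose[OF _ measurable_ennreal])
  then show ?thesis
    by (rule measurable_cong[THEN iffD1, rotated]) (auto simp: sp d_eq_ennreal[symmetric])
qed

section \<open>From infinitesimal to global contraction\<close>

text \<open>A cost that contracts infinitesimally, in every direction at every point, contracts globally:
  first along segments, and then along absolutely continuous curves, which are locally close to
  segments.\<close>

lemma local_contraction_segment:
  fixes K :: "(real ^ 'd) \<times> (real ^ 'e) \<Rightarrow> (real ^ 'd) \<times> (real ^ 'e) \<Rightarrow> ennreal"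
  assumes \<rho>: "0 < \<rho>"
    and K_tri: "\<And>z z' z''. z \<in> Zs \<Longrightarrow> z' \<in> Zs \<Longrightarrow> z'' \<in> Zs \<Longrightarrow> K z z'' \<le> K z z' + K z' z''"
    and K_sym: "\<And>z z'. K z z' = K z' z"
    and local: "\<And>z w e. z \<in> Zs \<Longrightarrow> 0 < e \<Longrightarrow>
      \<exists>\<delta>>0. \<forall>h. 0 \<le> h \<and> h < \<delta> \<and> z + h *\<^sub>R w \<in> Zs \<longrightarrow> K z (z + h *\<^sub>R w) \<le> ennreal (h * (\<rho> * V z * N w + e))"
    and z: "z \<in> Zs" "z' \<in> Zs" and B: "\<And>y. y \<in> closed_segment z z' \<Longrightarrow> V y \<le> B"
  shows "K z z' \<le> ennreal (\<rho> * B * N (z' - z))"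
proof (rule ennreal_le_epsilon)
  fix e :: real assume e: "0 < e"
  define \<gamma> where "\<gamma> = (\<lambda>t. z + t *\<^sub>R (z' - z))"
  have seg: "\<gamma> t \<in> closed_segment z z'" if "0 \<le> t" "t \<le> 1" for t
    using that unfolding closed_segment_def \<gamma>_def by (auto intro!: exI[of _ t] simp: algebra_simps)
  have inZ: "\<gamma> t \<in> Zs" if "0 \<le> t" "t \<le> 1" for t
    using closed_segment_subset[OF z convex_Zs] seg[OF that] by blast
  have B0: "0 \<le> B" using V_ge_1[OF z(1)] B[of z] by simp
  define c where "c = \<rho> * B * N (z' - z) + e"
  have c: "0 \<le> c" using \<rho> B0 N_nonneg e by (auto simp: c_def)
  \<comment> \<open>Bolzano's bisection principle: a bound proportional to the length passes to
    unions of adjacent intervals, so it suffices to have it on all small intervals around each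
    point.\<close>
  have P: "0 \<le> (0::real) \<and> (1::real) \<le> 1 \<longrightarrow> K (\<gamma> 0) (\<gamma> 1) \<le> ennreal ((1 - 0) * c)"
    using zero_le_one[where 'a=real]
  proof (induct rule: Bolzano[where P="\<lambda>a b. 0 \<le> a \<and> b \<le> 1 \<longrightarrow> K (\<gamma> a) (\<gamma> b) \<le> ennreal ((b - a) * c)"])
    case (trans a b d)
    show ?case
    proof
      assume ad: "0 \<le> a \<and> d \<le> 1"
      have "K (\<gamma> a) (\<gamma> d) \<le> K (\<gamma> a) (\<gamma> b) + K (\<gamma> b) (\<gamma> d)"
        using ad trans by (intro K_tri inZ) auto
      also have "\<dots> \<le> ennreal ((b - a) * c) + ennreal ((d - b) * c)"
        using ad trans by (intro add_mono) auto
      also have "\<dots> = ennreal ((b - a) * c + (d - b) * c)"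
        using trans(3,4) c by (intro ennreal_plus[symmetric] mult_nonneg_nonneg) simp_all
      also have "(b - a) * c + (d - b) * c = (d - a) * c" by (simp add: algebra_simps)
      finally show "K (\<gamma> a) (\<gamma> d) \<le> ennreal ((d - a) * c)" .
    qed
  next
    case (local x)
    let ?w = "z' - z"
    have x: "\<gamma> x \<in> Zs" "V (\<gamma> x) \<le> B" using local inZ seg B by auto
    have le: "\<rho> * V (\<gamma> x) * N ?w + e \<le> c" "\<rho> * V (\<gamma> x) * N (- ?w) + e \<le> c"
      using x(2) \<rho> N_nonneg[of "z' - z"] scaled_norm_minus_commute[of \<alpha> z z']
      by (auto simp: c_def intro!: mult_right_mono mult_left_mono)
    \<comment> \<open>The hypothesis has \<open>0 \<le> h\<close>, so it is applied in the
      directions \<open>?w\<close> and \<open>- ?w\<close> to reach both ends of an interval around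
      \<open>x\<close>.\<close>
    obtain d1 where d1: "d1 > 0" "\<forall>h. 0 \<le> h \<and> h < d1 \<and> \<gamma> x + h *\<^sub>R ?w \<in> Zs \<longrightarrow> K (\<gamma> x) (\<gamma> x + h *\<^sub>R ?w) \<le> ennreal (h * (\<rho> * V (\<gamma> x) * N ?w + e))"
      using assms(4)[OF x(1) e, of ?w] by (elim exE conjE) (rule that)
    obtain d2 where d2: "d2 > 0" "\<forall>h. 0 \<le> h \<and> h < d2 \<and> \<gamma> x + h *\<^sub>R (- ?w) \<in> Zs \<longrightarrow> K (\<gamma> x) (\<gamma> x + h *\<^sub>R (- ?w)) \<le> ennreal (h * (\<rho> * V (\<gamma> x) * N (- ?w) + e))"
      using assms(4)[OF x(1) e, of "- ?w"] by (elim exE conjE) (rule that)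
    show ?case
    proof (intro exI[of _ "min d1 d2"] conjI allI impI)
      show "0 < min d1 d2" using d1 d2 by simp
      fix a b assume ab: "a \<le> x \<and> x \<le> b \<and> b - a < min d1 d2" "0 \<le> a \<and> b \<le> 1"
      have ea: "\<gamma> a = \<gamma> x + (x - a) *\<^sub>R (- ?w)" and eb: "\<gamma> b = \<gamma> x + (b - x) *\<^sub>R ?w"
        by (simp_all add: \<gamma>_def algebra_simps)
      have "K (\<gamma> a) (\<gamma> b) \<le> K (\<gamma> x) (\<gamma> a) + K (\<gamma> x) (\<gamma> b)"
        using K_tri[of "\<gamma> a" "\<gamma> x" "\<gamma> b"] K_sym[of "\<gamma> a" "\<gamma> x"] ab inZ by auto
      also have "\<dots> \<le> ennreal ((x - a) * c) + ennreal ((b - x) * c)"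
      proof (rule add_mono)
        have "K (\<gamma> x) (\<gamma> a) \<le> ennreal ((x - a) * (\<rho> * V (\<gamma> x) * N (- ?w) + e))"
          unfolding ea using ab inZ[of a] ea by (intro d2(2)[rule_format] conjI; simp)
        also have "\<dots> \<le> ennreal ((x - a) * c)"
          using le ab by (intro ennreal_leI mult_left_mono) auto
        finally show "K (\<gamma> x) (\<gamma> a) \<le> ennreal ((x - a) * c)" .
        have "K (\<gamma> x) (\<gamma> b) \<le> ennreal ((b - x) * (\<rho> * V (\<gamma> x) * N ?w + e))"
          unfolding eb using ab inZ[of b] eb by (intro d1(2)[rule_format] conjI; simp)
        also have "\<dots> \<le> ennreal ((b - x) * c)"
          using le ab by (intro ennreal_leI mult_left_mono) auto
        finally show "K (\<gamma> x) (\<gamma> b) \<le> ennreal ((b - x) * c)" .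
      qed
      also have "\<dots> = ennreal ((x - a) * c + (b - x) * c)"
        using ab c by (intro ennreal_plus[symmetric] mult_nonneg_nonneg) simp_all
      also have "(x - a) * c + (b - x) * c = (b - a) * c" by (simp add: algebra_simps)
      finally show "K (\<gamma> a) (\<gamma> b) \<le> ennreal ((b - a) * c)" .
    qed
  qed
  have "K z z' \<le> ennreal c" using P by (simp add: \<gamma>_def)
  also have "\<dots> = ennreal (\<rho> * B * N (z' - z)) + ennreal e"
    using \<rho> B0 N_nonneg e by (simp add: c_def ennreal_plus)
  finally show "K z z' \<le> ennreal (\<rho> * B * N (z' - z)) + ennreal e" .
qed

text \<open>Near a time \<open>x\<close> the weight along the curve and along the chord stays
  between \<open>1 - \<eta>\<close> and \<open>1 + \<eta>\<close> times
  \<open>V (\<gamma> x)\<close>. The chord bounds \<open>K\<close> from above,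
  \<open>curve_cost_ge\<close> bounds the cost of the curve from below, and the loss is the factor
  \<open>1 + e\<close>. Bisection adds up the pieces.\<close>

lemma local_contraction_curve:
  fixes K :: "(real ^ 'd) \<times> (real ^ 'e) \<Rightarrow> (real ^ 'd) \<times> (real ^ 'e) \<Rightarrow> ennreal"
  assumes \<rho>: "0 < \<rho>"
    and K_tri: "\<And>z z' z''. z \<in> Zs \<Longrightarrow> z' \<in> Zs \<Longrightarrow> z'' \<in> Zs \<Longrightarrow> K z z'' \<le> K z z' + K z' z''"
    and segment: "\<And>z z' B. z \<in> Zs \<Longrightarrow> z' \<in> Zs \<Longrightarrow> (\<And>y. y \<in> closed_segment z z' \<Longrightarrow> V y \<le> B) \<Longrightarrow> K z z' \<le> ennreal (\<rho> * B * N (z' - z))"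
    and \<gamma>: "abs_continuous_curve 0 1 \<gamma>" "\<gamma> ` {0..1} \<subseteq> Zs" and e: "0 < e"
  shows "K (\<gamma> 0) (\<gamma> 1) \<le> ennreal (\<rho> * (1 + e)) * (\<integral>\<^sup>+t. curve_density V \<alpha> \<gamma> t \<partial>lebesgue)"
proof -
  define I where "I = (\<lambda>a b. \<integral>\<^sup>+t\<in>{a..b}. curve_density V \<alpha> \<gamma> t \<partial>lebesgue)"
  have [measurable]: "curve_density V \<alpha> \<gamma> \<in> borel_measurable lebesgue"
    by (rule curve_density_measurable[OF \<gamma> V_cont])
  have I_add: "I a b + I b c = I a c" if "a \<le> b" "b \<le> c" for a b c
  proof -
    have "I a b + I b c = (\<integral>\<^sup>+t. curve_density V \<alpha> \<gamma> t * indicator {a..b} t + curve_density V \<alpha> \<gamma> t * indicator {b..c} t \<partial>lebesgue)"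
      unfolding I_def by (rule nn_integral_add[symmetric]) (auto intro!: borel_measurable_times_ennreal borel_measurable_indicator)
    also have "\<dots> = I a c"
      unfolding I_def using AE_not_eq_lebesgue[of b]
      by (intro nn_integral_cong_AE, eventually_elim) (use that in \<open>auto simp: indicator_def\<close>)
    finally show ?thesis .
  qed
  have inZ: "\<gamma> t \<in> Zs" if "0 \<le> t" "t \<le> 1" for t using \<gamma>(2) that by (auto simp del: mem_Times_iff)
  define c where "c = ennreal (\<rho> * (1 + e))"
  \<comment> \<open>Chosen so that \<open>(1 + \<eta>) / (1 - \<eta>) = 1 + e\<close>.\<close>
  define \<eta> where "\<eta> = e / (2 + e)"
  have \<eta>: "0 < \<eta>" "\<eta> < 1" "1 + \<eta> = (1 + e) * (1 - \<eta>)"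
    using e by (auto simp: \<eta>_def field_simps)
  have "0 \<le> (0::real) \<and> (1::real) \<le> 1 \<longrightarrow> K (\<gamma> 0) (\<gamma> 1) \<le> c * I 0 1"
    using zero_le_one[where 'a=real]
  proof (induct rule: Bolzano[where P="\<lambda>a b. 0 \<le> a \<and> b \<le> 1 \<longrightarrow> K (\<gamma> a) (\<gamma> b) \<le> c * I a b"])
    case (trans a b d)
    show ?case
    proof
      assume ad: "0 \<le> a \<and> d \<le> 1"
      have "K (\<gamma> a) (\<gamma> d) \<le> K (\<gamma> a) (\<gamma> b) + K (\<gamma> b) (\<gamma> d)"
        using ad trans by (intro K_tri inZ) auto
      also have "\<dots> \<le> c * I a b + c * I b d"
        using ad trans by (intro add_mono) auto
      also have "\<dots> = c * I a d"
        using trans by (simp add: distrib_left[symmetric] I_add)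
      finally show "K (\<gamma> a) (\<gamma> d) \<le> c * I a d" .
    qed
  next
    case (local x)
    then have x: "\<gamma> x \<in> Zs" by (intro inZ) auto
    have V0: "0 < V (\<gamma> x)" using V_ge_1[OF x] by simp
    obtain r where r: "0 < r" "\<And>z. z \<in> Zs \<Longrightarrow> dist z (\<gamma> x) < r \<Longrightarrow> dist (V z) (V (\<gamma> x)) < \<eta> * V (\<gamma> x)"
      using V_cont[unfolded continuous_on_iff, rule_format, OF x, of "\<eta> * V (\<gamma> x)"] \<eta> V0 by auto
    obtain s where s: "0 < s" "\<And>t. t \<in> {0..1} \<Longrightarrow> dist t x < s \<Longrightarrow> dist (\<gamma> t) (\<gamma> x) < r"
      using abs_continuous_curve_imp_continuous[OF \<gamma>(1), unfolded continuous_on_iff, rule_format, of x r] local r(1) by auto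
    show ?case
    proof (intro exI[of _ s] conjI allI impI s(1))
      fix a b assume ab: "a \<le> x \<and> x \<le> b \<and> b - a < s" "0 \<le> a \<and> b \<le> 1"
      have near: "\<gamma> t \<in> ball (\<gamma> x) r" if "t \<in> {a..b}" for t
        using s(2)[of t] that ab by (auto simp: dist_real_def dist_commute)
      have Vlow: "(1 - \<eta>) * V (\<gamma> x) \<le> V (\<gamma> t)" if "t \<in> {a..b}" for t
        using r(2)[OF inZ[of t]] near[OF that] that ab by (auto simp: dist_real_def dist_commute algebra_simps)
      have ab': "a \<in> {a..b}" "b \<in> {a..b}" using ab by auto
      have Vup: "V y \<le> (1 + \<eta>) * V (\<gamma> x)" if y: "y \<in> closed_segment (\<gamma> a) (\<gamma> b)" for y
      proof -
        have "\<gamma> a \<in> Zs" "\<gamma> b \<in> Zs" using ab by (intro inZ; linarith)+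
        then have "y \<in> Zs" by (rule subsetD[OF closed_segment_subset[OF _ _ convex_Zs] y])
        moreover have "y \<in> ball (\<gamma> x) r"
          using closed_segment_subset[OF near[OF ab'(1)] near[OF ab'(2)] convex_ball] y by blast
        ultimately show ?thesis
          using r(2)[of y] by (auto simp: dist_real_def dist_commute algebra_simps)
      qed
      have "K (\<gamma> a) (\<gamma> b) \<le> ennreal (\<rho> * ((1 + \<eta>) * V (\<gamma> x)) * N (\<gamma> b - \<gamma> a))"
        using ab by (intro segment inZ Vup) auto
      also have "\<rho> * ((1 + \<eta>) * V (\<gamma> x)) * N (\<gamma> b - \<gamma> a) = (\<rho> * (1 + e)) * ((1 - \<eta>) * V (\<gamma> x) * N (\<gamma> b - \<gamma> a))"
        unfolding \<eta>(3) by (simp only: mult_ac)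
      also have "ennreal \<dots> = c * ennreal ((1 - \<eta>) * V (\<gamma> x) * N (\<gamma> b - \<gamma> a))"
        unfolding c_def using \<rho> e by (intro ennreal_mult') auto
      also have "\<dots> \<le> c * I a b"
        unfolding I_def using \<gamma> ab Vlow V0 \<eta>
        by (intro mult_left_mono curve_cost_ge) auto
      finally show "K (\<gamma> a) (\<gamma> b) \<le> c * I a b" .
    qed
  qed
  moreover have "I 0 1 = (\<integral>\<^sup>+t. curve_density V \<alpha> \<gamma> t \<partial>lebesgue)"
    unfolding I_def by (intro nn_integral_cong) (auto simp: curve_density_def indicator_def)
  ultimately show ?thesis by (simp add: c_def)
qed

text \<open>\<open>K\<close> will be the mean distance of the images under one random map. It
  inherits symmetry and the triangle inequality from \<open>d\<close> but is not a path metric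
  itself, so it is estimated along curves of the original space.\<close>

theorem local_to_global_contraction:
  fixes K :: "(real ^ 'd) \<times> (real ^ 'e) \<Rightarrow> (real ^ 'd) \<times> (real ^ 'e) \<Rightarrow> ennreal"
  assumes \<rho>: "0 < \<rho>"
    and K_tri: "\<And>z z' z''. z \<in> Zs \<Longrightarrow> z' \<in> Zs \<Longrightarrow> z'' \<in> Zs \<Longrightarrow> K z z'' \<le> K z z' + K z' z''"
    and K_sym: "\<And>z z'. K z z' = K z' z"
    and local: "\<And>z w e. z \<in> Zs \<Longrightarrow> 0 < e \<Longrightarrow>
      \<exists>\<delta>>0. \<forall>h. 0 \<le> h \<and> h < \<delta> \<and> z + h *\<^sub>R w \<in> Zs \<longrightarrow> K z (z + h *\<^sub>R w) \<le> ennreal (h * (\<rho> * V z * N w + e))"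
    and z: "z \<in> Zs" "z' \<in> Zs"
  shows "K z z' \<le> ennreal \<rho> * d z z'"
proof -
  \<comment> \<open>With \<open>\<rho>\<close> moved to the left, the right-hand side is the bare
    infimum over curves, and the bound can be proved curve by curve.\<close>
  have "K z z' * ennreal (inverse \<rho>) \<le> d z z'"
  proof (rule path_metric_geI)
    fix \<gamma> assume \<gamma>: "abs_continuous_curve 0 1 \<gamma>" "\<gamma> ` {0..1} \<subseteq> Zs" "\<gamma> 0 = z" "\<gamma> 1 = z'"
    let ?C = "\<integral>\<^sup>+t. curve_density V \<alpha> \<gamma> t \<partial>lebesgue"
    have K: "K z z' * ennreal (inverse \<rho>) \<le> ennreal (1 + e) * ?C" if e: "0 < e" for e
    proof -
      have "K (\<gamma> 0) (\<gamma> 1) \<le> ennreal (\<rho> * (1 + e)) * ?C"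
      proof (rule local_contraction_curve)
        fix z z' B assume "z \<in> Zs" "z' \<in> Zs" "\<And>y. y \<in> closed_segment z z' \<Longrightarrow> V y \<le> B"
        show "K z z' \<le> ennreal (\<rho> * B * N (z' - z))"
          by (rule local_contraction_segment[where K=K]; fact)
      qed fact+
      then have "K z z' \<le> ennreal (\<rho> * (1 + e)) * ?C" by (simp only: \<gamma>)
      then have "K z z' * ennreal (inverse \<rho>) \<le> ennreal (\<rho> * (1 + e)) * ?C * ennreal (inverse \<rho>)"
        by (rule mult_right_mono) simp
      also have "\<dots> = ennreal (inverse \<rho>) * ennreal (\<rho> * (1 + e)) * ?C"
        by (simp only: ac_simps)
      also have "ennreal (inverse \<rho>) * ennreal (\<rho> * (1 + e)) = ennreal (inverse \<rho> * (\<rho> * (1 + e)))"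
        using \<rho> by (intro ennreal_mult'[symmetric]) simp
      also have "inverse \<rho> * (\<rho> * (1 + e)) = 1 + e" using \<rho> by simp
      finally show ?thesis .
    qed
    show "K z z' * ennreal (inverse \<rho>) \<le> ?C"
    proof (rule ennreal_le_epsilon)
      fix e :: real assume e: "?C < top" "0 < e"
      then obtain c where c: "?C = ennreal c" "0 \<le> c" by (cases ?C) auto
      have "K z z' * ennreal (inverse \<rho>) \<le> ennreal (1 + e / (1 + c)) * ?C"
        using e c by (intro K) auto
      also have "\<dots> = ennreal ((1 + e / (1 + c)) * c)"
        unfolding c(1) using c e by (intro ennreal_mult'[symmetric]) auto
      also have "\<dots> \<le> ennreal (c + e)"
        using c e by (intro ennreal_leI) (auto simp: field_simps)
      also have "\<dots> = ?C + ennreal e" using c e by (simp add: ennreal_plus)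
      finally show "K z z' * ennreal (inverse \<rho>) \<le> ?C + ennreal e" .
    qed
  qed
  then have "ennreal \<rho> * (K z z' * ennreal (inverse \<rho>)) \<le> ennreal \<rho> * d z z'"
    by (rule mult_left_mono) simp
  moreover have "ennreal \<rho> * (K z z' * ennreal (inverse \<rho>)) = K z z'"
  proof -
    have "ennreal \<rho> * ennreal (inverse \<rho>) = 1"
      using \<rho> by (simp add: ennreal_mult'[symmetric])
    then show ?thesis by (metis mult.assoc mult.commute mult.right_neutral)
  qed
  ultimately show ?thesis by simp
qed

end

section \<open>Random maps that contract in mean\<close>

lemma (in prob_space) AE_lim_in_closed:
  fixes B :: "nat \<Rightarrow> 'a \<Rightarrow> 'b::euclidean_space"
  assumes "closed Zs" "\<And>n. B n \<in> borel_measurable M" "\<And>n \<omega>. \<omega> \<in> space M \<Longrightarrow> B n \<omega> \<in> Zs"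
    and "AE \<omega> in M. Cauchy (\<lambda>n. B n \<omega>)"
  obtains X where "X \<in> borel_measurable M" "\<And>\<omega>. \<omega> \<in> space M \<Longrightarrow> X \<omega> \<in> Zs" "AE \<omega> in M. (\<lambda>n. B n \<omega>) \<longlonglongrightarrow> X \<omega>"
proof -
  note [measurable] = assms(2)
  \<comment> \<open>Where the sequence does not converge, the value \<open>B 0 \<omega>\<close>
    keeps \<open>X\<close> inside \<open>Zs\<close>, as a map into the restricted space
    requires.\<close>
  define X where "X = (\<lambda>\<omega>. if Cauchy (\<lambda>n. B n \<omega>) then lim (\<lambda>n. B n \<omega>) else B 0 \<omega>)"
  have lim: "(\<lambda>n. B n \<omega>) \<longlonglongrightarrow> X \<omega>" if "Cauchy (\<lambda>n. B n \<omega>)" for \<omega>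
    using that by (simp add: X_def Cauchy_convergent convergent_LIMSEQ_iff[symmetric])
  show thesis
  proof (rule that[of X])
    show "X \<in> borel_measurable M"
      unfolding X_def by measurable
    show "X \<omega> \<in> Zs" if "\<omega> \<in> space M" for \<omega>
    proof (cases "Cauchy (\<lambda>n. B n \<omega>)")
      case True
      show ?thesis by (rule closed_sequentially[OF assms(1) _ lim[OF True]]) (use assms(3) that in auto)
    next
      case False
      then show ?thesis using assms(3)[OF that] by (simp add: X_def)
    qed
    show "AE \<omega> in M. (\<lambda>n. B n \<omega>) \<longlonglongrightarrow> X \<omega>"
      using assms(4) by eventually_elim (rule lim)
  qed
qed

lemma Cauchy_if_summable_dist:
  fixes X :: "nat \<Rightarrow> 'a::banach"
  assumes "summable (\<lambda>n. dist (X n) (X (Suc n)))"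
  shows "Cauchy X"
proof -
  have "summable (\<lambda>n. X (Suc n) - X n)"
    using assms by (intro summable_norm_cancel[of "\<lambda>n. X (Suc n) - X n"]) (simp add: dist_norm norm_minus_commute)
  then have "convergent (\<lambda>n. \<Sum>i<n. X (Suc i) - X i)"
    by (simp add: summable_iff_convergent)
  then have "convergent (\<lambda>n. X n - X 0)" by (simp add: sum_lessThan_telescope)
  then have "convergent X" by (simp add: convergent_diff_const_right_iff)
  then show ?thesis by (rule convergent_Cauchy)
qed

text \<open>Closed sets are stable under intersection and generate the Borel sets, and the indicator
  of a closed set \<open>A\<close> is the pointwise limit of the Lipschitz functions
  \<open>max 0 (1 - real k * infdist x A)\<close>.\<close>

lemma measure_eqI_Lipschitz:
  fixes \<mu> \<nu> :: "'a::euclidean_space measure"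
  assumes \<mu>: "prob_space \<mu>" "sets \<mu> = sets (restrict_space borel Zs)"
    and \<nu>: "prob_space \<nu>" "sets \<nu> = sets (restrict_space borel Zs)"
    and Zs: "closed Zs"
    and eq: "\<And>f k. f \<in> borel_measurable borel \<Longrightarrow> (\<And>x y. \<bar>f x - f y\<bar> \<le> real k * dist x y) \<Longrightarrow> (\<And>x. 0 \<le> f x \<and> f x \<le> 1) \<Longrightarrow>
      (\<integral>\<^sup>+x. ennreal (f x) \<partial>\<mu>) = (\<integral>\<^sup>+x. ennreal (f x) \<partial>\<nu>)"
  shows "\<mu> = \<nu>"
proof -
  interpret \<mu>: prob_space \<mu> by fact
  interpret \<nu>: prob_space \<nu> by fact
  have Zb: "Zs \<in> sets borel" using Zs by auto
  have id: "(\<lambda>x. x) \<in> \<kappa> \<rightarrow>\<^sub>M borel" if "sets \<kappa> = sets (restrict_space borel Zs)" for \<kappa> :: "'a measure"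
    unfolding measurable_cong_sets[OF that refl] by (rule measurable_restrict_space1) simp
  have eqA: "emeasure (distr \<mu> borel (\<lambda>x. x)) A = emeasure (distr \<nu> borel (\<lambda>x. x)) A" if A: "closed A" for A
  proof (cases "A = {}")
    case False
    define f where "f = (\<lambda>(k::nat) x. max 0 (1 - real k * infdist x A))"
    have fm [measurable]: "f k \<in> borel_measurable borel" for k
      unfolding f_def by (intro borel_measurable_continuous_onI continuous_intros)
    have f01: "0 \<le> f k x \<and> f k x \<le> 1" for k x
      by (auto simp: f_def infdist_nonneg)
    have Lip: "\<bar>f k x - f k y\<bar> \<le> real k * dist x y" for k x y
    proof -
      have "\<bar>f k x - f k y\<bar> \<le> \<bar>real k * infdist x A - real k * infdist y A\<bar>"
        by (auto simp: f_def max_def)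
      also have "\<dots> = real k * \<bar>infdist x A - infdist y A\<bar>"
        by (simp add: abs_mult right_diff_distrib[symmetric])
      also have "\<dots> \<le> real k * dist x y"
        by (intro mult_left_mono infdist_triangle_abs) simp
      finally show ?thesis .
    qed
    have lim: "(\<lambda>k. f k x) \<longlonglongrightarrow> indicator A x" for x
    proof (cases "x \<in> A")
      case True
      then show ?thesis by (simp add: f_def)
    next
      case False
      then have pos: "0 < infdist x A"
        using infdist_pos_not_in_closed[OF A \<open>A \<noteq> {}\<close>] by simp
      obtain K :: nat where K: "1 < real K * infdist x A"
        using reals_Archimedean3[OF pos] by blast
      have "f k x = 0" if "K \<le> k" for k
      proof -
        have "real K * infdist x A \<le> real k * infdist x A" using that pos by (intro mult_right_mono) auto
        then show ?thesis using K by (simp add: f_def)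
      qed
      then have "\<forall>\<^sub>F k in sequentially. f k x = 0"
        by (auto simp: eventually_sequentially)
      then show ?thesis using False by (simp add: tendsto_eventually)
    qed
    have conv: "(\<lambda>k. \<integral>\<^sup>+x. ennreal (f k x) \<partial>\<kappa>) \<longlonglongrightarrow> emeasure (distr \<kappa> borel (\<lambda>x. x)) A"
      if \<kappa>: "prob_space \<kappa>" "sets \<kappa> = sets (restrict_space borel Zs)" for \<kappa>
    proof -
      interpret \<kappa>: prob_space \<kappa> by fact
      note [measurable] = id[OF \<kappa>(2)]
      have fm': "f k \<in> borel_measurable \<kappa>" for k
        using measurable_compose[OF id[OF \<kappa>(2)] fm] by simp
      have im: "(indicator A :: 'a \<Rightarrow> real) \<in> borel_measurable \<kappa>"
        by (rule measurable_compose[OF id[OF \<kappa>(2)]]) (use A in auto)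
      have "(\<lambda>k. \<integral>\<^sup>+x. ennreal (f k x) \<partial>\<kappa>) \<longlonglongrightarrow> (\<integral>\<^sup>+x. ennreal (indicator A x) \<partial>\<kappa>)"
      proof (rule nn_integral_dominated_convergence[where w="\<lambda>_. 1"])
        show "AE x in \<kappa>. (\<lambda>k. ennreal (f k x)) \<longlonglongrightarrow> ennreal (indicator A x)"
          using lim by (auto intro!: AE_I2 tendsto_ennrealI)
      qed (use fm' im f01 in \<open>auto simp: \<kappa>.emeasure_space_1\<close>)
      also have "(\<integral>\<^sup>+x. ennreal (indicator A x) \<partial>\<kappa>) = (\<integral>\<^sup>+x. indicator A x \<partial>distr \<kappa> borel (\<lambda>x. x))"
        using A by (subst nn_integral_distr[OF id[OF \<kappa>(2)]]) (auto simp: ennreal_indicator)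
      also have "\<dots> = emeasure (distr \<kappa> borel (\<lambda>x. x)) A"
        using A by simp
      finally show ?thesis .
    qed
    show ?thesis
      using conv[OF \<mu>] conv[OF \<nu>] eq[OF fm Lip f01] by (auto intro: LIMSEQ_unique)
  qed simp
  have "distr \<mu> borel (\<lambda>x. x) = distr \<nu> borel (\<lambda>x. x)"
  proof (rule measure_eqI_generator_eq[where E="Collect closed" and \<Omega>=UNIV and A="\<lambda>_. UNIV"])
    show "Int_stable (Collect closed)" by (auto simp: Int_stable_def)
    show "emeasure (distr \<mu> borel (\<lambda>x. x)) UNIV \<noteq> \<infinity>"
      using emeasure_distr[OF id[OF \<mu>(2)], of UNIV] \<mu>.emeasure_finite by simp
  qed (use eqA in \<open>auto simp: borel_eq_closed\<close>)
  then have *: "emeasure (distr \<mu> borel (\<lambda>x. x)) A = emeasure (distr \<nu> borel (\<lambda>x. x)) A" for A by simp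
  show ?thesis
  proof (rule measure_eqI)
    show "sets \<mu> = sets \<nu>" using \<mu>(2) \<nu>(2) by simp
    fix A assume "A \<in> sets \<mu>"
    then have A: "A \<in> sets (restrict_space borel Zs)" using \<mu>(2) by simp
    then have Ab: "A \<in> sets borel" "A \<subseteq> Zs"
      using Zb by (auto simp: sets_restrict_space)
    have sp: "space \<mu> = Zs" "space \<nu> = Zs"
      using sets_eq_imp_space_eq[OF \<mu>(2)] sets_eq_imp_space_eq[OF \<nu>(2)] by (auto simp: space_restrict_space)
    show "emeasure \<mu> A = emeasure \<nu> A"
      using *[of A] Ab sp by (simp add: emeasure_distr id[OF \<mu>(2)] id[OF \<nu>(2)] Int_absorb2)
  qed
qed

section \<open>The Markov kernel and synchronous couplings\<close>

text \<open>The path metric enters only through these properties. \<open>dist_le\<close> carries the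
  Cauchy property of the iterates to the norm, where limits exist; \<open>d_lim\<close> brings the
  limit back to \<open>d\<close>; \<open>start\<close> makes the first increment of the iterates
  integrable.\<close>

locale contracting_random_maps = prob_space N for N :: "'u measure" +
  fixes Zs :: "'a::euclidean_space set" and F :: "'u \<Rightarrow> 'a \<Rightarrow> 'a"
    and d :: "'a \<Rightarrow> 'a \<Rightarrow> ennreal" and \<rho> C :: real and z0 :: 'a
  assumes closed_Zs: "closed Zs" and z0: "z0 \<in> Zs"
    and F_meas: "(\<lambda>(z, u). F u z) \<in> restrict_space borel Zs \<Otimes>\<^sub>M N \<rightarrow>\<^sub>M restrict_space borel Zs"
    and d_meas: "(\<lambda>p. d (fst p) (snd p)) \<in> borel_measurable (restrict_space borel Zs \<Otimes>\<^sub>M restrict_space borel Zs)"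
    and d_sym: "d z z' = d z' z" and d_tri: "d z z'' \<le> d z z' + d z' z''"
    and d_refl: "z \<in> Zs \<Longrightarrow> d z z = 0"
    and d_fin: "z \<in> Zs \<Longrightarrow> z' \<in> Zs \<Longrightarrow> d z z' < \<infinity>"
    and C: "0 \<le> C" and dist_le: "ennreal (dist z z') \<le> ennreal C * d z z'"
    and d_lim: "(\<And>n. zs n \<in> Zs) \<Longrightarrow> z \<in> Zs \<Longrightarrow> zs \<longlonglongrightarrow> z \<Longrightarrow> (\<lambda>n. d (zs n) z) \<longlonglongrightarrow> 0"
    and \<rho>: "0 \<le> \<rho>" "\<rho> < 1"
    and contraction: "z \<in> Zs \<Longrightarrow> z' \<in> Zs \<Longrightarrow> (\<integral>\<^sup>+u. d (F u z) (F u z') \<partial>N) \<le> ennreal \<rho> * d z z'"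
    and start: "(\<integral>\<^sup>+u. d z0 (F u z0) \<partial>N) < \<infinity>"
begin

abbreviation "S \<equiv> restrict_space borel Zs :: 'a measure"

definition P :: "'a \<Rightarrow> 'a measure" where "P z = distr N S (\<lambda>u. F u z)"

lemma space_S [simp]: "space S = Zs" by (simp add: space_restrict_space)

lemma F_meas1 [measurable]: "z \<in> Zs \<Longrightarrow> (\<lambda>u. F u z) \<in> N \<rightarrow>\<^sub>M S"
  using measurable_compose[OF measurable_Pair1'[of z S N] F_meas] by simp

lemma F_comp [measurable (raw)]:
  assumes "f \<in> K \<rightarrow>\<^sub>M S" "g \<in> K \<rightarrow>\<^sub>M N"
  shows "(\<lambda>x. F (g x) (f x)) \<in> K \<rightarrow>\<^sub>M S"
  using measurable_compose[OF measurable_Pair[OF assms] F_meas] by simp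

lemma d_comp [measurable (raw)]:
  assumes "f \<in> K \<rightarrow>\<^sub>M S" "g \<in> K \<rightarrow>\<^sub>M S"
  shows "(\<lambda>x. d (f x) (g x)) \<in> borel_measurable K"
  using measurable_compose[OF measurable_Pair[OF assms] d_meas] by simp

lemma P_meas [measurable]: "P \<in> S \<rightarrow>\<^sub>M subprob_algebra S"
proof -
  have "N \<in> space (subprob_algebra N)"
    by (simp add: space_subprob_algebra) unfold_locales
  then have "(\<lambda>z. distr N S (\<lambda>u. F u z)) \<in> S \<rightarrow>\<^sub>M subprob_algebra S"
    by (intro measurable_distr2[where M=N] F_meas measurable_const)
  then show ?thesis by (simp add: P_def[abs_def])
qed

lemma laws_space: "\<mu> \<in> laws S \<Longrightarrow> space \<mu> = Zs"
  using sets_eq_imp_space_eq[of \<mu> S] by (simp add: laws_def)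

lemma laws_sets: "\<mu> \<in> laws S \<Longrightarrow> sets \<mu> = sets S"
  by (simp add: laws_def)

lemma laws_bind: assumes "\<mu> \<in> laws S" shows "\<mu> \<bind> P \<in> laws S"
proof -
  have \<mu>: "prob_space \<mu>" "sets \<mu> = sets S" using assms by (auto simp: laws_def)
  have P': "P \<in> \<mu> \<rightarrow>\<^sub>M subprob_algebra S"
    using P_meas by (simp cong: measurable_cong_sets add: measurable_cong_sets[OF \<mu>(2) refl])
  have "prob_space (\<mu> \<bind> P)"
  proof (rule prob_space.prob_space_bind[OF \<mu>(1) _ P'])
    show "AE x in \<mu>. prob_space (P x)"
    proof (rule AE_I2)
      fix x assume "x \<in> space \<mu>"
      then have "x \<in> Zs" using laws_space[OF assms] by simp
      then show "prob_space (P x)" unfolding P_def by (intro prob_space_distr F_meas1)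
    qed
  qed
  moreover have "sets (\<mu> \<bind> P) = sets S"
    using z0 laws_space[OF assms] by (intro sets_bind) (auto simp: P_def)
  ultimately show ?thesis by (simp add: laws_def)
qed

lemma emeasure_bind_P:
  assumes "\<mu> \<in> laws S" "A \<in> sets S"
  shows "emeasure (\<mu> \<bind> P) A = (\<integral>\<^sup>+z. (\<integral>\<^sup>+u. indicator A (F u z) \<partial>N) \<partial>\<mu>)"
proof -
  have P': "P \<in> \<mu> \<rightarrow>\<^sub>M subprob_algebra S"
    using P_meas by (simp add: measurable_cong_sets[OF laws_sets[OF assms(1)] refl])
  have "emeasure (\<mu> \<bind> P) A = (\<integral>\<^sup>+z. emeasure (P z) A \<partial>\<mu>)"
    using z0 laws_space[OF assms(1)] assms(2) by (intro emeasure_bind[OF _ P']) auto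
  also have "\<dots> = (\<integral>\<^sup>+z. (\<integral>\<^sup>+u. indicator A (F u z) \<partial>N) \<partial>\<mu>)"
  proof (rule nn_integral_cong)
    fix z assume "z \<in> space \<mu>"
    then have z: "z \<in> Zs" using laws_space[OF assms(1)] by simp
    have "emeasure (P z) A = (\<integral>\<^sup>+y. indicator A y \<partial>P z)"
      using assms(2) by (simp add: P_def)
    also have "\<dots> = (\<integral>\<^sup>+u. indicator A (F u z) \<partial>N)"
      unfolding P_def using assms(2) z by (intro nn_integral_distr) auto
    finally show "emeasure (P z) A = (\<integral>\<^sup>+u. indicator A (F u z) \<partial>N)" .
  qed
  finally show ?thesis .
qed

lemma coupling_meas:
  assumes "\<gamma> \<in> couplings \<mu> \<nu>" "\<mu> \<in> laws S" "\<nu> \<in> laws S"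
  shows "sets \<gamma> = sets (S \<Otimes>\<^sub>M S)" "prob_space \<gamma>" "fst \<in> \<gamma> \<rightarrow>\<^sub>M S" "snd \<in> \<gamma> \<rightarrow>\<^sub>M S"
    "space \<gamma> = Zs \<times> Zs" "distr \<gamma> S fst = \<mu>" "distr \<gamma> S snd = \<nu>"
proof -
  have g: "sets \<gamma> = sets (\<mu> \<Otimes>\<^sub>M \<nu>)" "prob_space \<gamma>" "distr \<gamma> \<mu> fst = \<mu>" "distr \<gamma> \<nu> snd = \<nu>"
    using assms(1) by (auto simp: couplings_def)
  show s: "sets \<gamma> = sets (S \<Otimes>\<^sub>M S)"
    using g(1) sets_pair_measure_cong[OF laws_sets[OF assms(2)] laws_sets[OF assms(3)]] by simp
  show "prob_space \<gamma>" by fact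
  show "fst \<in> \<gamma> \<rightarrow>\<^sub>M S" "snd \<in> \<gamma> \<rightarrow>\<^sub>M S"
    using measurable_cong_sets[OF s refl, of S] by auto
  show "space \<gamma> = Zs \<times> Zs"
    using sets_eq_imp_space_eq[OF s] by (simp add: space_pair_measure)
  show "distr \<gamma> S fst = \<mu>"
    using g(3) distr_cong[OF refl laws_sets[OF assms(2)], of \<gamma> fst fst] by simp
  show "distr \<gamma> S snd = \<nu>"
    using g(4) distr_cong[OF refl laws_sets[OF assms(3)], of \<gamma> snd snd] by simp
qed

lemma couplingI:
  assumes "prob_space \<gamma>" "sets \<gamma> = sets (S \<Otimes>\<^sub>M S)" "distr \<gamma> S fst = \<mu>" "distr \<gamma> S snd = \<nu>"
    "\<mu> \<in> laws S" "\<nu> \<in> laws S"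
  shows "\<gamma> \<in> couplings \<mu> \<nu>"
proof -
  have "sets \<gamma> = sets (\<mu> \<Otimes>\<^sub>M \<nu>)"
    using assms(2) sets_pair_measure_cong[OF laws_sets[OF assms(5)] laws_sets[OF assms(6)]] by simp
  moreover have "distr \<gamma> \<mu> fst = distr \<gamma> S fst" "distr \<gamma> \<nu> snd = distr \<gamma> S snd"
    using laws_sets[OF assms(5)] laws_sets[OF assms(6)] by (auto intro: distr_cong)
  ultimately show ?thesis using assms by (simp add: couplings_def)
qed

lemma product_coupling:
  assumes "\<mu> \<in> laws S" "\<nu> \<in> laws S"
  shows "\<mu> \<Otimes>\<^sub>M \<nu> \<in> couplings \<mu> \<nu>"
proof -
  interpret \<mu>: prob_space \<mu> using assms by (simp add: laws_def)
  interpret \<nu>: prob_space \<nu> using assms by (simp add: laws_def)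
  interpret pp: pair_prob_space \<mu> \<nu> ..
  have "distr (\<mu> \<Otimes>\<^sub>M \<nu>) \<nu> snd = \<nu>"
  proof (rule measure_eqI)
    fix A assume "A \<in> sets (distr (\<mu> \<Otimes>\<^sub>M \<nu>) \<nu> snd)"
    then have A: "A \<in> sets \<nu>" by simp
    then have "snd -` A \<inter> space (\<mu> \<Otimes>\<^sub>M \<nu>) = space \<mu> \<times> A"
      using sets.sets_into_space by (auto simp: space_pair_measure)
    with A show "emeasure (distr (\<mu> \<Otimes>\<^sub>M \<nu>) \<nu> snd) A = emeasure \<nu> A"
      by (simp add: emeasure_distr \<nu>.emeasure_pair_measure_Times \<mu>.emeasure_space_1)
  qed simp
  then show ?thesis
    by (simp add: couplings_def pp.P.prob_space_axioms \<nu>.distr_pair_fst)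
qed

text \<open>Both coordinates are updated with the same innovation.\<close>

lemma wasserstein_bind_le:
  assumes \<mu>: "\<mu> \<in> laws S" and \<nu>: "\<nu> \<in> laws S"
  shows "wasserstein1 d (\<mu> \<bind> P) (\<nu> \<bind> P) \<le> ennreal \<rho> * wasserstein1 d \<mu> \<nu>"
proof -
  have key: "wasserstein1 d (\<mu> \<bind> P) (\<nu> \<bind> P) \<le> ennreal \<rho> * (\<integral>\<^sup>+p. d (fst p) (snd p) \<partial>\<gamma>)"
    if \<gamma>: "\<gamma> \<in> couplings \<mu> \<nu>" for \<gamma>
  proof -
    note g = coupling_meas[OF \<gamma> \<mu> \<nu>]
    note [measurable] = g(3,4)
    interpret \<gamma>: prob_space \<gamma> by (rule g)
    interpret pp: pair_prob_space \<gamma> N ..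
    define T where "T = (\<lambda>q. (F (snd q) (fst (fst q)), F (snd q) (snd (fst q))))"
    have T [measurable]: "T \<in> \<gamma> \<Otimes>\<^sub>M N \<rightarrow>\<^sub>M S \<Otimes>\<^sub>M S" unfolding T_def by measurable
    define \<gamma>' where "\<gamma>' = distr (\<gamma> \<Otimes>\<^sub>M N) (S \<Otimes>\<^sub>M S) T"
    have p': "prob_space \<gamma>'" unfolding \<gamma>'_def by (rule pp.P.prob_space_distr[OF T])
    have marg: "distr \<gamma>' S \<pi> = \<kappa> \<bind> P"
      if \<pi>: "\<pi> \<in> S \<Otimes>\<^sub>M S \<rightarrow>\<^sub>M S" "\<And>q. \<pi> (T q) = F (snd q) (\<pi> (fst q))" and \<kappa>: "\<kappa> \<in> laws S" "distr \<gamma> S \<pi> = \<kappa>" for \<pi> \<kappa>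
    proof (rule measure_eqI)
      note [measurable] = \<pi>(1)
      have \<pi>'[measurable]: "\<pi> \<in> \<gamma> \<rightarrow>\<^sub>M S" using \<pi>(1) measurable_cong_sets[OF g(1) refl] by blast
      show "sets (distr \<gamma>' S \<pi>) = sets (\<kappa> \<bind> P)" using laws_sets[OF laws_bind[OF \<kappa>(1)]] by simp
      fix A assume "A \<in> sets (distr \<gamma>' S \<pi>)"
      then have A [measurable]: "A \<in> sets S" by simp
      have "emeasure (distr \<gamma>' S \<pi>) A = (\<integral>\<^sup>+y. indicator A y \<partial>distr \<gamma>' S \<pi>)" by simp
      also have "\<dots> = (\<integral>\<^sup>+p. indicator A (\<pi> p) \<partial>\<gamma>')"
        unfolding \<gamma>'_def by (subst nn_integral_distr) auto
      also have "\<dots> = (\<integral>\<^sup>+q. indicator A (\<pi> (T q)) \<partial>(\<gamma> \<Otimes>\<^sub>M N))"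
        unfolding \<gamma>'_def by (subst nn_integral_distr) auto
      also have "\<dots> = (\<integral>\<^sup>+q. indicator A (F (snd q) (\<pi> (fst q))) \<partial>(\<gamma> \<Otimes>\<^sub>M N))"
        by (simp add: \<pi>(2))
      also have "\<dots> = (\<integral>\<^sup>+p. (\<integral>\<^sup>+u. indicator A (F u (\<pi> p)) \<partial>N) \<partial>\<gamma>)"
        by (subst nn_integral_fst[symmetric]) auto
      also have "\<dots> = (\<integral>\<^sup>+z. (\<integral>\<^sup>+u. indicator A (F u z) \<partial>N) \<partial>distr \<gamma> S \<pi>)"
        by (subst nn_integral_distr) auto
      also have "\<dots> = emeasure (\<kappa> \<bind> P) A"
        unfolding \<kappa>(2) by (rule emeasure_bind_P[OF \<kappa>(1) A, symmetric])
      finally show "emeasure (distr \<gamma>' S \<pi>) A = emeasure (\<kappa> \<bind> P) A" .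
    qed
    have "\<gamma>' \<in> couplings (\<mu> \<bind> P) (\<nu> \<bind> P)"
    proof (rule couplingI[OF p'])
      show "distr \<gamma>' S fst = \<mu> \<bind> P" by (rule marg) (auto simp: T_def \<mu> g)
      show "distr \<gamma>' S snd = \<nu> \<bind> P" by (rule marg) (auto simp: T_def \<nu> g)
    qed (auto simp: \<gamma>'_def laws_bind \<mu> \<nu>)
    then have "wasserstein1 d (\<mu> \<bind> P) (\<nu> \<bind> P) \<le> (\<integral>\<^sup>+p. d (fst p) (snd p) \<partial>\<gamma>')"
      unfolding wasserstein1_def by (rule INF_lower)
    also have "\<dots> = (\<integral>\<^sup>+q. d (F (snd q) (fst (fst q))) (F (snd q) (snd (fst q))) \<partial>(\<gamma> \<Otimes>\<^sub>M N))"
      unfolding \<gamma>'_def by (subst nn_integral_distr) (auto simp: T_def)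
    also have "\<dots> = (\<integral>\<^sup>+p. (\<integral>\<^sup>+u. d (F u (fst p)) (F u (snd p)) \<partial>N) \<partial>\<gamma>)"
      by (subst nn_integral_fst[symmetric]) auto
    also have "\<dots> \<le> (\<integral>\<^sup>+p. ennreal \<rho> * d (fst p) (snd p) \<partial>\<gamma>)"
    proof (rule nn_integral_mono)
      fix p assume "p \<in> space \<gamma>"
      then have "fst p \<in> Zs" "snd p \<in> Zs" unfolding g(5) by auto
      then show "(\<integral>\<^sup>+u. d (F u (fst p)) (F u (snd p)) \<partial>N) \<le> ennreal \<rho> * d (fst p) (snd p)"
        by (rule contraction)
    qed
    also have "\<dots> = ennreal \<rho> * (\<integral>\<^sup>+p. d (fst p) (snd p) \<partial>\<gamma>)"
      by (rule nn_integral_cmult[OF d_comp[OF g(3,4)]])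
    finally show ?thesis .
  qed
  show ?thesis
  \<comment> \<open>The infimum over couplings is taken after division by \<open>\<rho>\<close>. For
    \<open>\<rho> = 0\<close> a single coupling suffices, because 0 times infinity is 0 in
    \<open>ennreal\<close>.\<close>
  proof (cases "\<rho> = 0")
    case True
    from key[OF product_coupling[OF \<mu> \<nu>]] show ?thesis using True by simp
  next
    case False
    have "ennreal (inverse \<rho>) * wasserstein1 d (\<mu> \<bind> P) (\<nu> \<bind> P) \<le> wasserstein1 d \<mu> \<nu>"
      unfolding wasserstein1_def[of d \<mu> \<nu>]
    proof (rule INF_greatest)
      fix \<gamma> assume "\<gamma> \<in> couplings \<mu> \<nu>"
      from mult_left_mono[OF key[OF this], of "ennreal (inverse \<rho>)"]
      show "ennreal (inverse \<rho>) * wasserstein1 d (\<mu> \<bind> P) (\<nu> \<bind> P) \<le> (\<integral>\<^sup>+p. d (fst p) (snd p) \<partial>\<gamma>)"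
        using False \<rho> by (simp add: mult.assoc[symmetric] ennreal_mult'[symmetric])
    qed
    then have "ennreal \<rho> * (ennreal (inverse \<rho>) * wasserstein1 d (\<mu> \<bind> P) (\<nu> \<bind> P)) \<le> ennreal \<rho> * wasserstein1 d \<mu> \<nu>"
      by (rule mult_left_mono) simp
    then show ?thesis
      using False \<rho> by (simp add: mult.assoc[symmetric] ennreal_mult'[symmetric])
  qed
qed

lemma wasserstein_iterate_le:
  assumes \<mu>: "\<mu> \<in> laws S" and \<nu>: "\<nu> \<in> laws S"
  shows "((\<lambda>\<kappa>. \<kappa> \<bind> P) ^^ n) \<mu> \<in> laws S" "((\<lambda>\<kappa>. \<kappa> \<bind> P) ^^ n) \<nu> \<in> laws S"
    "wasserstein1 d (((\<lambda>\<kappa>. \<kappa> \<bind> P) ^^ n) \<mu>) (((\<lambda>\<kappa>. \<kappa> \<bind> P) ^^ n) \<nu>) \<le> ennreal (\<rho> ^ n) * wasserstein1 d \<mu> \<nu>"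
proof (induction n)
  case 0
  show "((\<lambda>\<kappa>. \<kappa> \<bind> P) ^^ 0) \<mu> \<in> laws S" "((\<lambda>\<kappa>. \<kappa> \<bind> P) ^^ 0) \<nu> \<in> laws S" using \<mu> \<nu> by auto
  show "wasserstein1 d (((\<lambda>\<kappa>. \<kappa> \<bind> P) ^^ 0) \<mu>) (((\<lambda>\<kappa>. \<kappa> \<bind> P) ^^ 0) \<nu>) \<le> ennreal (\<rho> ^ 0) * wasserstein1 d \<mu> \<nu>"
    by simp
next
  case (Suc n)
  show "((\<lambda>\<kappa>. \<kappa> \<bind> P) ^^ Suc n) \<mu> \<in> laws S" "((\<lambda>\<kappa>. \<kappa> \<bind> P) ^^ Suc n) \<nu> \<in> laws S"
    using Suc by (auto intro: laws_bind)
  have "wasserstein1 d (((\<lambda>\<kappa>. \<kappa> \<bind> P) ^^ Suc n) \<mu>) (((\<lambda>\<kappa>. \<kappa> \<bind> P) ^^ Suc n) \<nu>)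
      \<le> ennreal \<rho> * wasserstein1 d (((\<lambda>\<kappa>. \<kappa> \<bind> P) ^^ n) \<mu>) (((\<lambda>\<kappa>. \<kappa> \<bind> P) ^^ n) \<nu>)"
    using wasserstein_bind_le[OF Suc(1,2)] by simp
  also have "\<dots> \<le> ennreal \<rho> * (ennreal (\<rho> ^ n) * wasserstein1 d \<mu> \<nu>)"
    by (intro mult_left_mono Suc) simp
  also have "\<dots> = ennreal (\<rho> ^ Suc n) * wasserstein1 d \<mu> \<nu>"
    using \<rho> by (simp add: mult.assoc[symmetric] ennreal_mult')
  finally show "wasserstein1 d (((\<lambda>\<kappa>. \<kappa> \<bind> P) ^^ Suc n) \<mu>) (((\<lambda>\<kappa>. \<kappa> \<bind> P) ^^ Suc n) \<nu>) \<le> ennreal (\<rho> ^ Suc n) * wasserstein1 d \<mu> \<nu>" .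
qed

section \<open>Laws tested with Lipschitz functions\<close>

text \<open>The easy half of Kantorovich duality: the pointwise Lipschitz bound is integrated
  against a coupling. Both orders are given, so symmetry of \<open>wasserstein1\<close> is never
  invoked.\<close>

lemma Lipschitz_integral_le:
  assumes \<mu>: "\<mu> \<in> laws S" and \<nu>: "\<nu> \<in> laws S"
    and f: "f \<in> borel_measurable borel" "\<And>x y. \<bar>f x - f y\<bar> \<le> real k * dist x y" "\<And>x. 0 \<le> f x \<and> f x \<le> 1"
  shows "(\<integral>\<^sup>+x. ennreal (f x) \<partial>\<mu>) \<le> (\<integral>\<^sup>+x. ennreal (f x) \<partial>\<nu>) + ennreal (real k * C) * wasserstein1 d \<mu> \<nu>" (is ?A)
    and "(\<integral>\<^sup>+x. ennreal (f x) \<partial>\<nu>) \<le> (\<integral>\<^sup>+x. ennreal (f x) \<partial>\<mu>) + ennreal (real k * C) * wasserstein1 d \<mu> \<nu>" (is ?B)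
proof -
  have fS[measurable]: "f \<in> borel_measurable S"
    by (rule measurable_restrict_space1[OF f(1)])
  have key: "(\<integral>\<^sup>+x. ennreal (f x) \<partial>\<mu>) \<le> (\<integral>\<^sup>+x. ennreal (f x) \<partial>\<nu>) + ennreal (real k * C) * (\<integral>\<^sup>+p. d (fst p) (snd p) \<partial>\<gamma>) \<and>
     (\<integral>\<^sup>+x. ennreal (f x) \<partial>\<nu>) \<le> (\<integral>\<^sup>+x. ennreal (f x) \<partial>\<mu>) + ennreal (real k * C) * (\<integral>\<^sup>+p. d (fst p) (snd p) \<partial>\<gamma>)"
    if \<gamma>: "\<gamma> \<in> couplings \<mu> \<nu>" for \<gamma>
  proof -
    note g = coupling_meas[OF \<gamma> \<mu> \<nu>]
    note [measurable] = g(3,4)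
    have i\<mu>: "(\<integral>\<^sup>+x. ennreal (f x) \<partial>\<mu>) = (\<integral>\<^sup>+p. ennreal (f (fst p)) \<partial>\<gamma>)"
      by (subst g(6)[symmetric], subst nn_integral_distr) auto
    have i\<nu>: "(\<integral>\<^sup>+x. ennreal (f x) \<partial>\<nu>) = (\<integral>\<^sup>+p. ennreal (f (snd p)) \<partial>\<gamma>)"
      by (subst g(7)[symmetric], subst nn_integral_distr) auto
    have pt: "ennreal (f x) \<le> ennreal (f y) + ennreal (real k * C) * d x y" for x y
    proof -
      have "ennreal (f x) \<le> ennreal (f y + real k * dist x y)"
        using f(2)[of x y] by (intro ennreal_leI) (simp add: abs_le_iff)
      also have "\<dots> = ennreal (f y) + ennreal (real k) * ennreal (dist x y)"
        using f(3)[of y] by (simp add: ennreal_plus ennreal_mult')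
      also have "\<dots> \<le> ennreal (f y) + ennreal (real k) * (ennreal C * d x y)"
        by (intro add_left_mono mult_left_mono dist_le) simp
      also have "ennreal (real k) * (ennreal C * d x y) = ennreal (real k * C) * d x y"
        by (simp add: ennreal_mult' mult.assoc)
      finally show ?thesis .
    qed
    have "(\<integral>\<^sup>+p. ennreal (f (fst p)) \<partial>\<gamma>) \<le> (\<integral>\<^sup>+p. ennreal (f (snd p)) + ennreal (real k * C) * d (fst p) (snd p) \<partial>\<gamma>)"
      by (intro nn_integral_mono pt)
    also have "\<dots> = (\<integral>\<^sup>+p. ennreal (f (snd p)) \<partial>\<gamma>) + ennreal (real k * C) * (\<integral>\<^sup>+p. d (fst p) (snd p) \<partial>\<gamma>)"
      by (subst nn_integral_add) (auto simp: nn_integral_cmult)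
    finally have 1: "(\<integral>\<^sup>+p. ennreal (f (fst p)) \<partial>\<gamma>) \<le> \<dots>" .
    have "(\<integral>\<^sup>+p. ennreal (f (snd p)) \<partial>\<gamma>) \<le> (\<integral>\<^sup>+p. ennreal (f (fst p)) + ennreal (real k * C) * d (fst p) (snd p) \<partial>\<gamma>)"
      using pt[of "snd _" "fst _"] by (intro nn_integral_mono) (subst d_sym, rule pt)
    also have "\<dots> = (\<integral>\<^sup>+p. ennreal (f (fst p)) \<partial>\<gamma>) + ennreal (real k * C) * (\<integral>\<^sup>+p. d (fst p) (snd p) \<partial>\<gamma>)"
      by (subst nn_integral_add) (auto simp: nn_integral_cmult)
    finally show ?thesis using 1 by (simp add: i\<mu> i\<nu>)
  qed
  \<comment> \<open>Passage from all couplings to the infimum. If the infimum is infinite,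
    finiteness of the right-hand side forces \<open>c = 0\<close>, and then a single coupling
    suffices.\<close>
  have lim: "a \<le> b + c * wasserstein1 d \<mu> \<nu>"
    if all: "\<And>\<gamma>. \<gamma> \<in> couplings \<mu> \<nu> \<Longrightarrow> a \<le> b + c * (\<integral>\<^sup>+p. d (fst p) (snd p) \<partial>\<gamma>)" and cfin: "c < \<infinity>" for a b c :: ennreal
  proof (rule ennreal_le_epsilon)
    fix e :: real assume e: "b + c * wasserstein1 d \<mu> \<nu> < top" "0 < e"
    obtain c' where c': "c = ennreal c'" "0 \<le> c'" using cfin by (cases c) auto
    show "a \<le> b + c * wasserstein1 d \<mu> \<nu> + ennreal e"
    proof (cases "wasserstein1 d \<mu> \<nu> = \<infinity>")
      case True
      have "c' = 0"
      proof (rule ccontr)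
        assume "c' \<noteq> 0"
        then show False using e(1) c' True by (simp add: ennreal_mult_top)
      qed
      then show ?thesis using all[OF product_coupling[OF \<mu> \<nu>]] c' by (simp add: add_increasing2)
    next
      case False
      define h where "h = e / (1 + c')"
      have h: "0 < h" "c' * h \<le> e" using e c' by (auto simp: h_def field_simps)
      have "wasserstein1 d \<mu> \<nu> < wasserstein1 d \<mu> \<nu> + ennreal h"
        using False h by (simp add: less_top[symmetric])
      then obtain \<gamma> where \<gamma>: "\<gamma> \<in> couplings \<mu> \<nu>" "(\<integral>\<^sup>+p. d (fst p) (snd p) \<partial>\<gamma>) < wasserstein1 d \<mu> \<nu> + ennreal h"
        by (subst (asm) (1) wasserstein1_def) (auto simp: INF_less_iff)
      have "a \<le> b + c * (\<integral>\<^sup>+p. d (fst p) (snd p) \<partial>\<gamma>)" by (rule all[OF \<gamma>(1)])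
      also have "\<dots> \<le> b + c * (wasserstein1 d \<mu> \<nu> + ennreal h)"
        using \<gamma>(2) by (intro add_left_mono mult_left_mono) auto
      also have "\<dots> = b + c * wasserstein1 d \<mu> \<nu> + ennreal (c' * h)"
        using c' h by (simp add: distrib_left add.assoc ennreal_mult')
      also have "\<dots> \<le> b + c * wasserstein1 d \<mu> \<nu> + ennreal e"
        using h by (intro add_left_mono ennreal_leI)
      finally show ?thesis .
    qed
  qed
  show ?A by (rule lim) (use key in auto)
  show ?B by (rule lim) (use key in auto)
qed

text \<open>This takes the place of the triangle inequality for \<open>wasserstein1\<close>, which
  would require gluing couplings: both laws are compared with \<open>\<kappa>\<close> through
  Lipschitz test functions, whose integrals do obey a triangle inequality.\<close>

lemma laws_eqI:
  assumes \<mu>: "\<mu> \<in> laws S" and \<nu>: "\<nu> \<in> laws S"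
    and approx: "\<And>e. 0 < e \<Longrightarrow> \<exists>\<kappa>\<in>laws S. wasserstein1 d \<kappa> \<mu> \<le> ennreal e \<and> wasserstein1 d \<kappa> \<nu> \<le> ennreal e"
  shows "\<mu> = \<nu>"
proof (rule measure_eqI_Lipschitz[where Zs=Zs])
  fix f :: "'a \<Rightarrow> real" and k :: nat
  assume f: "f \<in> borel_measurable borel" "\<And>x y. \<bar>f x - f y\<bar> \<le> real k * dist x y" "\<And>x. 0 \<le> f x \<and> f x \<le> 1"
  have le: "(\<integral>\<^sup>+x. ennreal (f x) \<partial>\<mu>') \<le> (\<integral>\<^sup>+x. ennreal (f x) \<partial>\<nu>')"
    if m: "\<mu>' \<in> laws S" "\<nu>' \<in> laws S"
      and approx: "\<And>e. 0 < e \<Longrightarrow> \<exists>\<kappa>\<in>laws S. wasserstein1 d \<kappa> \<mu>' \<le> ennreal e \<and> wasserstein1 d \<kappa> \<nu>' \<le> ennreal e" for \<mu>' \<nu>'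
  proof (rule ennreal_le_epsilon)
    fix e :: real assume e: "0 < e"
    define h where "h = e / (2 * (1 + real k * C))"
    have kC: "0 \<le> real k * C" using C by simp
    have h: "0 < h" "2 * (real k * C * h) \<le> e"
      using e kC by (auto simp: h_def field_simps)
    obtain \<kappa> where \<kappa>: "\<kappa> \<in> laws S" "wasserstein1 d \<kappa> \<mu>' \<le> ennreal h" "wasserstein1 d \<kappa> \<nu>' \<le> ennreal h"
      using approx[OF h(1)] by blast
    have "(\<integral>\<^sup>+x. ennreal (f x) \<partial>\<mu>') \<le> (\<integral>\<^sup>+x. ennreal (f x) \<partial>\<kappa>) + ennreal (real k * C) * wasserstein1 d \<kappa> \<mu>'"
      by (rule Lipschitz_integral_le(2)[OF \<kappa>(1) m(1) f])
    also have "\<dots> \<le> (\<integral>\<^sup>+x. ennreal (f x) \<partial>\<kappa>) + ennreal (real k * C) * ennreal h"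
      by (intro add_left_mono mult_left_mono \<kappa>) simp
    also have "(\<integral>\<^sup>+x. ennreal (f x) \<partial>\<kappa>) \<le> (\<integral>\<^sup>+x. ennreal (f x) \<partial>\<nu>') + ennreal (real k * C) * wasserstein1 d \<kappa> \<nu>'"
      by (rule Lipschitz_integral_le(1)[OF \<kappa>(1) m(2) f])
    also have "\<dots> \<le> (\<integral>\<^sup>+x. ennreal (f x) \<partial>\<nu>') + ennreal (real k * C) * ennreal h"
      by (intro add_left_mono mult_left_mono \<kappa>) simp
    finally have "(\<integral>\<^sup>+x. ennreal (f x) \<partial>\<mu>') \<le> (\<integral>\<^sup>+x. ennreal (f x) \<partial>\<nu>') + (ennreal (real k * C) * ennreal h + ennreal (real k * C) * ennreal h)"
      by (simp add: add.assoc add_right_mono)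
    also have "ennreal (real k * C) * ennreal h + ennreal (real k * C) * ennreal h = ennreal (2 * (real k * C * h))"
    proof -
      have "ennreal (real k * C) * ennreal h = ennreal (real k * C * h)"
        using kC by (rule ennreal_mult'[symmetric])
      moreover have "0 \<le> real k * C * h" using kC h by simp
      ultimately show ?thesis by (simp only: ennreal_plus[symmetric] mult_2)
    qed
    also have "(\<integral>\<^sup>+x. ennreal (f x) \<partial>\<nu>') + \<dots> \<le> (\<integral>\<^sup>+x. ennreal (f x) \<partial>\<nu>') + ennreal e"
      using h by (intro add_left_mono ennreal_leI)
    finally show "(\<integral>\<^sup>+x. ennreal (f x) \<partial>\<mu>') \<le> (\<integral>\<^sup>+x. ennreal (f x) \<partial>\<nu>') + ennreal e" .
  qed
  show "(\<integral>\<^sup>+x. ennreal (f x) \<partial>\<mu>) = (\<integral>\<^sup>+x. ennreal (f x) \<partial>\<nu>)"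
    using approx by (intro antisym le \<mu> \<nu>) blast+
qed (use \<mu> \<nu> closed_Zs in \<open>auto simp: laws_def\<close>)

end

section \<open>Backward iterates and the invariant law\<close>

context contracting_random_maps
begin

text \<open>The backward iterates \<open>F\<^bsub>\<omega> 0\<^esub> \<circ> \<dots> \<circ> F\<^bsub>\<omega> (n - 1)\<^esub>\<close>, applied to \<open>z0\<close>: unlike the forward chain, which has the
  same law at time \<open>n\<close>, they converge almost surely.\<close>

primrec backward :: "nat \<Rightarrow> (nat \<Rightarrow> 'u) \<Rightarrow> 'a" where
  "backward 0 \<omega> = z0"
| "backward (Suc n) \<omega> = F (\<omega> 0) (backward n (\<lambda>i. \<omega> (Suc i)))"

abbreviation "\<Omega> \<equiv> \<Pi>\<^sub>M i\<in>UNIV::nat set. N"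

lemma prob_space_\<Omega>: "prob_space \<Omega>"
  by (intro prob_space_PiM prob_space_axioms)

lemma backward_meas [measurable]: "backward n \<in> \<Omega> \<rightarrow>\<^sub>M S"
proof (induction n)
  case 0
  have "backward 0 = (\<lambda>_. z0)" by (rule ext) simp
  then show ?case using z0 by simp
next
  case (Suc n)
  have "(\<lambda>\<omega> i. \<omega> (Suc i)) \<in> \<Omega> \<rightarrow>\<^sub>M \<Omega>"
    by (rule measurable_PiM_single') (auto simp: space_PiM PiE_iff)
  from measurable_compose[OF this Suc] have "(\<lambda>\<omega>. backward n (\<lambda>i. \<omega> (Suc i))) \<in> \<Omega> \<rightarrow>\<^sub>M S" .
  then have "(\<lambda>\<omega>. F (\<omega> 0) (backward n (\<lambda>i. \<omega> (Suc i)))) \<in> \<Omega> \<rightarrow>\<^sub>M S"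
    by (rule F_comp) simp
  then show ?case by (simp add: backward.simps(2)[abs_def])
qed

text \<open>The first coordinate carries the outermost map of \<open>backward\<close>. Integrating
  it with the other innovations fixed is the order in which \<open>contraction\<close>
  applies.\<close>

lemma nn_integral_unroll:
  assumes f: "f \<in> borel_measurable \<Omega>"
  shows "(\<integral>\<^sup>+\<omega>. f \<omega> \<partial>\<Omega>) = (\<integral>\<^sup>+\<omega>. (\<integral>\<^sup>+u. f (case_nat u \<omega>) \<partial>N) \<partial>\<Omega>)"
proof -
  interpret S: sequence_space N ..
  interpret O: prob_space \<Omega> by (rule prob_space_\<Omega>)
  interpret pp: pair_prob_space N \<Omega> ..
  have m: "(\<lambda>(s, \<omega>). case_nat s \<omega>) \<in> N \<Otimes>\<^sub>M \<Omega> \<rightarrow>\<^sub>M \<Omega>" by measurable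
  have fm: "(\<lambda>p. f (case_nat (fst p) (snd p))) \<in> borel_measurable (N \<Otimes>\<^sub>M \<Omega>)"
    using measurable_compose[OF m f] by (simp add: case_prod_unfold)
  have "(\<integral>\<^sup>+\<omega>. f \<omega> \<partial>\<Omega>) = (\<integral>\<^sup>+\<omega>. f \<omega> \<partial>distr (N \<Otimes>\<^sub>M \<Omega>) \<Omega> (\<lambda>(s, \<omega>). case_nat s \<omega>))"
    by (simp only: S.PiM_iter)
  also have "\<dots> = (\<integral>\<^sup>+p. f (case_nat (fst p) (snd p)) \<partial>(N \<Otimes>\<^sub>M \<Omega>))"
    using f by (subst nn_integral_distr[OF m]) (simp_all add: case_prod_unfold)
  also have "\<dots> = (\<integral>\<^sup>+\<omega>. (\<integral>\<^sup>+u. f (case_nat u \<omega>) \<partial>N) \<partial>\<Omega>)"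
    using pp.nn_integral_snd[of "\<lambda>p. f (case_nat (fst p) (snd p))"] fm by (simp add: case_prod_unfold)
  finally show ?thesis .
qed

definition law :: "nat \<Rightarrow> 'a measure" where "law n = distr \<Omega> S (backward n)"

lemma law_laws: "law n \<in> laws S"
  using prob_space.prob_space_distr[OF prob_space_\<Omega> backward_meas] by (simp add: law_def laws_def)

text \<open>The outermost innovation is independent of the shifted sequence that drives the inner
  iterate, so adding it amounts to one step of the kernel.\<close>

lemma law_Suc: "law (Suc n) = law n \<bind> P"
proof (rule measure_eqI)
  show "sets (law (Suc n)) = sets (law n \<bind> P)"
    using laws_sets[OF laws_bind[OF law_laws[of n]]] by (simp add: law_def)
  fix A assume "A \<in> sets (law (Suc n))"
  then have A[measurable]: "A \<in> sets S" by (simp add: law_def)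
  have "emeasure (law (Suc n)) A = (\<integral>\<^sup>+y. indicator A y \<partial>law (Suc n))"
    by (simp add: law_def)
  also have "\<dots> = (\<integral>\<^sup>+\<omega>. indicator A (backward (Suc n) \<omega>) \<partial>\<Omega>)"
    unfolding law_def by (rule nn_integral_distr[OF backward_meas]) simp
  also have "\<dots> = (\<integral>\<^sup>+\<omega>. (\<integral>\<^sup>+u. indicator A (backward (Suc n) (case_nat u \<omega>)) \<partial>N) \<partial>\<Omega>)"
    by (rule nn_integral_unroll[OF measurable_compose[OF backward_meas]]) simp
  also have "\<dots> = (\<integral>\<^sup>+\<omega>. (\<integral>\<^sup>+u. indicator A (F u (backward n \<omega>)) \<partial>N) \<partial>\<Omega>)"
    by simp
  also have "\<dots> = (\<integral>\<^sup>+z. (\<integral>\<^sup>+u. indicator A (F u z) \<partial>N) \<partial>law n)"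
    unfolding law_def by (subst nn_integral_distr[OF backward_meas]) auto
  also have "\<dots> = emeasure (law n \<bind> P) A"
    by (rule emeasure_bind_P[OF law_laws A, symmetric])
  finally show "emeasure (law (Suc n)) A = emeasure (law n \<bind> P) A" .
qed

definition D where "D = (\<integral>\<^sup>+u. d z0 (F u z0) \<partial>N)"

text \<open>Consecutive iterates share their \<open>n\<close> outer maps and differ only in the
  innermost argument, \<open>z0\<close> against one image of it. Each common map contributes a
  factor \<open>\<rho>\<close>.\<close>

lemma step_integral_le: "(\<integral>\<^sup>+\<omega>. d (backward n \<omega>) (backward (Suc n) \<omega>) \<partial>\<Omega>) \<le> ennreal (\<rho> ^ n) * D"
proof (induction n)
  case 0
  interpret O: prob_space \<Omega> by (rule prob_space_\<Omega>)
  have "(\<integral>\<^sup>+\<omega>. d (backward 0 \<omega>) (backward (Suc 0) \<omega>) \<partial>\<Omega>) =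
      (\<integral>\<^sup>+\<omega>. (\<integral>\<^sup>+u. d (backward 0 (case_nat u \<omega>)) (backward (Suc 0) (case_nat u \<omega>)) \<partial>N) \<partial>\<Omega>)"
    by (intro nn_integral_unroll d_comp backward_meas)
  also have "\<dots> = D" by (simp add: D_def O.emeasure_space_1)
  finally show ?case by simp
next
  case (Suc n)
  have "(\<integral>\<^sup>+\<omega>. d (backward (Suc n) \<omega>) (backward (Suc (Suc n)) \<omega>) \<partial>\<Omega>) =
      (\<integral>\<^sup>+\<omega>. (\<integral>\<^sup>+u. d (backward (Suc n) (case_nat u \<omega>)) (backward (Suc (Suc n)) (case_nat u \<omega>)) \<partial>N) \<partial>\<Omega>)"
    by (intro nn_integral_unroll d_comp backward_meas)
  also have "\<dots> = (\<integral>\<^sup>+\<omega>. (\<integral>\<^sup>+u. d (F u (backward n \<omega>)) (F u (backward (Suc n) \<omega>)) \<partial>N) \<partial>\<Omega>)"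
    by simp
  also have "\<dots> \<le> (\<integral>\<^sup>+\<omega>. ennreal \<rho> * d (backward n \<omega>) (backward (Suc n) \<omega>) \<partial>\<Omega>)"
  proof (rule nn_integral_mono)
    fix \<omega> assume "\<omega> \<in> space \<Omega>"
    then have "backward n \<omega> \<in> Zs" "backward (Suc n) \<omega> \<in> Zs"
      using measurable_space[OF backward_meas, of \<omega>] unfolding space_S by blast+
    then show "(\<integral>\<^sup>+u. d (F u (backward n \<omega>)) (F u (backward (Suc n) \<omega>)) \<partial>N) \<le> ennreal \<rho> * d (backward n \<omega>) (backward (Suc n) \<omega>)"
      by (rule contraction)
  qed
  also have "\<dots> = ennreal \<rho> * (\<integral>\<^sup>+\<omega>. d (backward n \<omega>) (backward (Suc n) \<omega>) \<partial>\<Omega>)"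
    by (intro nn_integral_cmult d_comp backward_meas)
  also have "\<dots> \<le> ennreal \<rho> * (ennreal (\<rho> ^ n) * D)"
    by (intro mult_left_mono Suc) simp
  also have "\<dots> = ennreal (\<rho> ^ Suc n) * D"
    using \<rho> by (simp add: mult.assoc[symmetric] ennreal_mult')
  finally show ?case .
qed

lemma tail_integral_le:
  "(\<integral>\<^sup>+\<omega>. (\<Sum>k. d (backward (n + k) \<omega>) (backward (Suc (n + k)) \<omega>)) \<partial>\<Omega>) \<le> ennreal (\<rho> ^ n) * (ennreal (1 / (1 - \<rho>)) * D)"
proof -
  have "(\<integral>\<^sup>+\<omega>. (\<Sum>k. d (backward (n + k) \<omega>) (backward (Suc (n + k)) \<omega>)) \<partial>\<Omega>) =
      (\<Sum>k. \<integral>\<^sup>+\<omega>. d (backward (n + k) \<omega>) (backward (Suc (n + k)) \<omega>) \<partial>\<Omega>)"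
    by (intro nn_integral_suminf d_comp backward_meas)
  also have "\<dots> \<le> (\<Sum>k. ennreal (\<rho> ^ n * \<rho> ^ k) * D)"
    using step_integral_le by (intro suminf_le) (auto simp: power_add[symmetric])
  also have "\<dots> = (\<Sum>k. ennreal (\<rho> ^ n * \<rho> ^ k)) * D" by (rule ennreal_suminf_multc)
  also have "(\<Sum>k. ennreal (\<rho> ^ n * \<rho> ^ k)) = ennreal (\<rho> ^ n * (1 / (1 - \<rho>)))"
    using \<rho> by (intro suminf_ennreal_eq sums_mult geometric_sums) auto
  also have "ennreal (\<rho> ^ n * (1 / (1 - \<rho>))) * D = ennreal (\<rho> ^ n) * (ennreal (1 / (1 - \<rho>)) * D)"
    using \<rho> by (simp only: ennreal_mult' zero_le_power mult.assoc)
  finally show ?thesis .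
qed

text \<open>The increments have finite total mean, so almost surely they are summable, first in
  \<open>d\<close> and through \<open>dist_le\<close> in the norm. The distance from
  \<open>backward n\<close> to the norm limit is bounded by the tail of the increments, since the
  remaining term tends to 0 by \<open>d_lim\<close>.\<close>

lemma limit_exists:
  obtains X where "X \<in> \<Omega> \<rightarrow>\<^sub>M S"
    "\<And>n. (\<integral>\<^sup>+\<omega>. d (backward n \<omega>) (X \<omega>) \<partial>\<Omega>) \<le> ennreal (\<rho> ^ n) * (ennreal (1 / (1 - \<rho>)) * D)"
proof -
  interpret O: prob_space \<Omega> by (rule prob_space_\<Omega>)
  have in_Zs: "backward n \<omega> \<in> Zs" if "\<omega> \<in> space \<Omega>" for n \<omega>
    using measurable_space[OF backward_meas that] by simp
  have id: "(\<lambda>z. z) \<in> S \<rightarrow>\<^sub>M borel" by (rule measurable_restrict_space1) simp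
  have bm: "backward n \<in> borel_measurable \<Omega>" for n
    using measurable_compose[OF backward_meas id] by simp
  have Dfin: "D < \<infinity>" using start by (simp add: D_def)
  have fin: "AE \<omega> in \<Omega>. (\<Sum>k. d (backward (0 + k) \<omega>) (backward (Suc (0 + k)) \<omega>)) \<noteq> \<infinity>"
  proof (rule nn_integral_PInf_AE)
    show "(\<lambda>\<omega>. \<Sum>k. d (backward (0 + k) \<omega>) (backward (Suc (0 + k)) \<omega>)) \<in> borel_measurable \<Omega>"
      by (intro borel_measurable_suminf_order d_comp backward_meas)
    have "ennreal (\<rho> ^ 0) * (ennreal (1 / (1 - \<rho>)) * D) < \<infinity>"
      using Dfin by (simp add: ennreal_mult_less_top)
    then show "(\<integral>\<^sup>+\<omega>. (\<Sum>k. d (backward (0 + k) \<omega>) (backward (Suc (0 + k)) \<omega>)) \<partial>\<Omega>) \<noteq> \<infinity>"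
      using tail_integral_le[of 0] by (auto simp: top_unique)
  qed
  have cauchy: "AE \<omega> in \<Omega>. Cauchy (\<lambda>n. backward n \<omega>)"
    using fin
  proof eventually_elim
    case (elim \<omega>)
    have "(\<Sum>k. ennreal (dist (backward k \<omega>) (backward (Suc k) \<omega>))) \<le> (\<Sum>k. ennreal C * d (backward k \<omega>) (backward (Suc k) \<omega>))"
      by (intro suminf_le dist_le) auto
    also have "\<dots> = ennreal C * (\<Sum>k. d (backward k \<omega>) (backward (Suc k) \<omega>))"
      by (rule ennreal_suminf_cmult)
    also have "\<dots> < top" using elim by (simp add: ennreal_mult_less_top less_top)
    finally show ?case
      by (intro Cauchy_if_summable_dist summable_suminf_not_top) auto
  qed
  obtain X where X: "X \<in> borel_measurable \<Omega>" "\<And>\<omega>. \<omega> \<in> space \<Omega> \<Longrightarrow> X \<omega> \<in> Zs" "AE \<omega> in \<Omega>. (\<lambda>n. backward n \<omega>) \<longlonglongrightarrow> X \<omega>"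
    using O.AE_lim_in_closed[OF closed_Zs bm in_Zs cauchy] by blast
  have XS: "X \<in> \<Omega> \<rightarrow>\<^sub>M S"
    using X(1,2) by (intro measurable_restrict_space2) auto
  show thesis
  proof (rule that[OF XS])
    fix n
    have "AE \<omega> in \<Omega>. d (backward n \<omega>) (X \<omega>) \<le> (\<Sum>k. d (backward (n + k) \<omega>) (backward (Suc (n + k)) \<omega>))"
      using X(3) AE_space
    proof eventually_elim
      case (elim \<omega>)
      let ?s = "\<Sum>k. d (backward (n + k) \<omega>) (backward (Suc (n + k)) \<omega>)"
      have part: "d (backward n \<omega>) (backward (n + k) \<omega>) \<le> (\<Sum>i<k. d (backward (n + i) \<omega>) (backward (Suc (n + i)) \<omega>))" for k
      proof (induction k)
        case 0
        then show ?case using in_Zs[OF elim(2)] by (simp add: d_refl)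
      next
        case (Suc k)
        have "d (backward n \<omega>) (backward (n + Suc k) \<omega>) \<le> d (backward n \<omega>) (backward (n + k) \<omega>) + d (backward (n + k) \<omega>) (backward (Suc (n + k)) \<omega>)"
          using d_tri by (simp del: backward.simps)
        also have "\<dots> \<le> (\<Sum>i<Suc k. d (backward (n + i) \<omega>) (backward (Suc (n + i)) \<omega>))"
          using Suc by (simp add: add_right_mono del: backward.simps)
        finally show ?case .
      qed
      have "d (backward n \<omega>) (X \<omega>) \<le> ?s + d (backward (n + k) \<omega>) (X \<omega>)" for k
      proof -
        have "d (backward n \<omega>) (X \<omega>) \<le> d (backward n \<omega>) (backward (n + k) \<omega>) + d (backward (n + k) \<omega>) (X \<omega>)"
          by (rule d_tri)
        also have "d (backward n \<omega>) (backward (n + k) \<omega>) \<le> ?s"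
          by (rule order_trans[OF part sum_le_suminf]) auto
        finally show ?thesis by (simp add: add_right_mono)
      qed
      moreover have "(\<lambda>k. ?s + d (backward (n + k) \<omega>) (X \<omega>)) \<longlonglongrightarrow> ?s + 0"
      proof (intro tendsto_add tendsto_const)
        have "(\<lambda>k. backward (n + k) \<omega>) \<longlonglongrightarrow> X \<omega>"
          using LIMSEQ_ignore_initial_segment[OF elim(1), of n] by (simp add: add.commute)
        then show "(\<lambda>k. d (backward (n + k) \<omega>) (X \<omega>)) \<longlonglongrightarrow> 0"
          using in_Zs[OF elim(2)] X(2)[OF elim(2)] by (intro d_lim)
      qed
      ultimately show ?case
        by (intro LIMSEQ_le_const[of _ "?s" "d (backward n \<omega>) (X \<omega>)"]) auto
    qed
    then have "(\<integral>\<^sup>+\<omega>. d (backward n \<omega>) (X \<omega>) \<partial>\<Omega>) \<le> (\<integral>\<^sup>+\<omega>. (\<Sum>k. d (backward (n + k) \<omega>) (backward (Suc (n + k)) \<omega>)) \<partial>\<Omega>)"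
      by (rule nn_integral_mono_AE)
    also note tail_integral_le
    finally show "(\<integral>\<^sup>+\<omega>. d (backward n \<omega>) (X \<omega>) \<partial>\<Omega>) \<le> ennreal (\<rho> ^ n) * (ennreal (1 / (1 - \<rho>)) * D)" .
  qed
qed

text \<open>Existence: \<open>law (Suc n)\<close> is close both to the law \<open>\<pi>\<close> of
  the limit and to \<open>\<pi> \<bind> P\<close>. Uniqueness: first moments make the distance of
  two invariant laws finite, so contraction forces it to be 0.\<close>

theorem unique_invariant_law: "\<exists>!\<pi>. \<pi> \<in> laws1 S d \<and> \<pi> \<bind> P = \<pi>"
proof -
  interpret O: prob_space \<Omega> by (rule prob_space_\<Omega>)
  obtain X where X: "X \<in> \<Omega> \<rightarrow>\<^sub>M S"
    "\<And>n. (\<integral>\<^sup>+\<omega>. d (backward n \<omega>) (X \<omega>) \<partial>\<Omega>) \<le> ennreal (\<rho> ^ n) * (ennreal (1 / (1 - \<rho>)) * D)"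
    using limit_exists by blast
  note [measurable] = X(1)
  define E where "E = enn2real (ennreal (1 / (1 - \<rho>)) * D)"
  have E: "ennreal (1 / (1 - \<rho>)) * D = ennreal E" "0 \<le> E"
  proof -
    have "ennreal (1 / (1 - \<rho>)) * D < top" using start by (simp add: ennreal_mult_less_top D_def)
    then show "ennreal (1 / (1 - \<rho>)) * D = ennreal E" by (simp add: E_def)
    show "0 \<le> E" by (simp add: E_def)
  qed
  define \<pi> where "\<pi> = distr \<Omega> S X"
  have \<pi>: "\<pi> \<in> laws S"
    using O.prob_space_distr[OF X(1)] by (simp add: \<pi>_def laws_def)
  have W: "wasserstein1 d (law n) \<pi> \<le> ennreal (\<rho> ^ n * E)" for n
  proof -
    let ?\<gamma> = "distr \<Omega> (S \<Otimes>\<^sub>M S) (\<lambda>\<omega>. (backward n \<omega>, X \<omega>))"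
    have m: "(\<lambda>\<omega>. (backward n \<omega>, X \<omega>)) \<in> \<Omega> \<rightarrow>\<^sub>M S \<Otimes>\<^sub>M S" by measurable
    have "?\<gamma> \<in> couplings (law n) \<pi>"
    proof (rule couplingI)
      show "prob_space ?\<gamma>" by (rule O.prob_space_distr[OF m])
      show "distr ?\<gamma> S fst = law n" "distr ?\<gamma> S snd = \<pi>"
        using m by (simp_all add: distr_distr law_def \<pi>_def comp_def)
    qed (auto simp: law_laws \<pi>)
    then have "wasserstein1 d (law n) \<pi> \<le> (\<integral>\<^sup>+p. d (fst p) (snd p) \<partial>?\<gamma>)"
      unfolding wasserstein1_def by (rule INF_lower)
    also have "\<dots> = (\<integral>\<^sup>+\<omega>. d (backward n \<omega>) (X \<omega>) \<partial>\<Omega>)"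
      using d_meas by (subst nn_integral_distr[OF m]) simp_all
    also have "\<dots> \<le> ennreal (\<rho> ^ n) * ennreal E" using X(2)[of n] by (simp only: E)
    also have "\<dots> = ennreal (\<rho> ^ n * E)" using \<rho> by (simp add: ennreal_mult')
    finally show ?thesis .
  qed
  have to0: "\<exists>n. \<rho> ^ n * E \<le> e" if "0 < e" for e
  proof -
    have "(\<lambda>n. \<rho> ^ n * E) \<longlonglongrightarrow> 0 * E"
      using \<rho> by (intro tendsto_mult LIMSEQ_realpow_zero tendsto_const)
    then have "\<forall>\<^sub>F n in sequentially. \<rho> ^ n * E < e"
      using that by (intro order_tendstoD(2)) auto
    then show ?thesis by (auto simp: eventually_sequentially intro: less_imp_le)
  qed
  have inv: "\<pi> \<bind> P = \<pi>"
  proof (rule laws_eqI[OF laws_bind[OF \<pi>] \<pi>])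
    fix e :: real assume "0 < e"
    then obtain n where n: "\<rho> ^ n * E \<le> e" using to0 by blast
    have "wasserstein1 d (law (Suc n)) (\<pi> \<bind> P) \<le> ennreal \<rho> * wasserstein1 d (law n) \<pi>"
      unfolding law_Suc by (rule wasserstein_bind_le[OF law_laws \<pi>])
    also have "\<dots> \<le> ennreal \<rho> * ennreal (\<rho> ^ n * E)" by (intro mult_left_mono W) simp
    also have "\<dots> = ennreal (\<rho> * (\<rho> ^ n * E))" using \<rho> by (simp add: ennreal_mult')
    also have "\<rho> * (\<rho> ^ n * E) \<le> 1 * (\<rho> ^ n * E)" using \<rho> E by (intro mult_right_mono) auto
    also have "\<dots> \<le> e" using n by simp
    finally have 1: "wasserstein1 d (law (Suc n)) (\<pi> \<bind> P) \<le> ennreal e" by (simp add: ennreal_leI)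
    have "\<rho> ^ Suc n * E \<le> 1 * (\<rho> ^ n * E)"
      using \<rho> E by (simp add: mult.assoc mult_left_le_one_le)
    then have "wasserstein1 d (law (Suc n)) \<pi> \<le> ennreal e"
      using n by (intro order_trans[OF W ennreal_leI]) linarith
    with 1 show "\<exists>\<kappa>\<in>laws S. wasserstein1 d \<kappa> (\<pi> \<bind> P) \<le> ennreal e \<and> wasserstein1 d \<kappa> \<pi> \<le> ennreal e"
      using law_laws by blast
  qed
  have "(\<integral>\<^sup>+z. d z z0 \<partial>\<pi>) = (\<integral>\<^sup>+\<omega>. d (X \<omega>) z0 \<partial>\<Omega>)"
    unfolding \<pi>_def using z0 by (intro nn_integral_distr X d_comp) auto
  also have "\<dots> = (\<integral>\<^sup>+\<omega>. d (backward 0 \<omega>) (X \<omega>) \<partial>\<Omega>)" by (simp add: d_sym)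
  also have "\<dots> \<le> ennreal (\<rho> ^ 0) * ennreal E" using X(2)[of 0] by (simp only: E)
  also have "\<dots> < \<infinity>" by simp
  finally have \<pi>1: "\<pi> \<in> laws1 S d" using \<pi> z0 by (auto simp: laws1_def)
  have unique: "\<pi>' = \<pi>" if \<pi>': "\<pi>' \<in> laws1 S d" "\<pi>' \<bind> P = \<pi>'" for \<pi>'
  proof -
    obtain z1 where z1: "z1 \<in> Zs" "(\<integral>\<^sup>+z. d z z1 \<partial>\<pi>') < \<infinity>" and \<pi>'l: "\<pi>' \<in> laws S"
      using \<pi>'(1) by (auto simp: laws1_def)
    obtain z2 where z2: "z2 \<in> Zs" "(\<integral>\<^sup>+z. d z z2 \<partial>\<pi>) < \<infinity>"
      using \<pi>1 by (auto simp: laws1_def)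
    note c = coupling_meas[OF product_coupling[OF \<pi>'l \<pi>] \<pi>'l \<pi>]
    interpret \<gamma>: prob_space "\<pi>' \<Otimes>\<^sub>M \<pi>" by (rule c)
    have m: "(\<lambda>p. d (fst p) z1) \<in> borel_measurable (\<pi>' \<Otimes>\<^sub>M \<pi>)" "(\<lambda>p. d (snd p) z2) \<in> borel_measurable (\<pi>' \<Otimes>\<^sub>M \<pi>)"
      using z1 z2 c(3,4) by (auto intro!: d_comp measurable_const)
    have "wasserstein1 d \<pi>' \<pi> \<le> (\<integral>\<^sup>+p. d (fst p) (snd p) \<partial>(\<pi>' \<Otimes>\<^sub>M \<pi>))"
      unfolding wasserstein1_def by (rule INF_lower) (rule product_coupling[OF \<pi>'l \<pi>])
    also have "\<dots> \<le> (\<integral>\<^sup>+p. d (fst p) z1 + d (snd p) z2 + d z1 z2 \<partial>(\<pi>' \<Otimes>\<^sub>M \<pi>))"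
    proof (rule nn_integral_mono)
      fix p
      have "d (fst p) (snd p) \<le> d (fst p) z1 + (d z1 z2 + d z2 (snd p))"
        by (rule order_trans[OF d_tri add_left_mono[OF d_tri]])
      then show "d (fst p) (snd p) \<le> d (fst p) z1 + d (snd p) z2 + d z1 z2"
        by (simp add: d_sym[of z2] add_ac)
    qed
    also have "\<dots> = (\<integral>\<^sup>+p. d (fst p) z1 \<partial>(\<pi>' \<Otimes>\<^sub>M \<pi>)) + (\<integral>\<^sup>+p. d (snd p) z2 \<partial>(\<pi>' \<Otimes>\<^sub>M \<pi>)) + d z1 z2"
      using m by (simp add: nn_integral_add \<gamma>.emeasure_space_1)
    also have "(\<integral>\<^sup>+p. d (fst p) z1 \<partial>(\<pi>' \<Otimes>\<^sub>M \<pi>)) = (\<integral>\<^sup>+z. d z z1 \<partial>\<pi>')"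
      using z1(1) by (subst c(6)[symmetric], subst nn_integral_distr[OF c(3)]) (auto intro!: d_comp measurable_const)
    also have "(\<integral>\<^sup>+p. d (snd p) z2 \<partial>(\<pi>' \<Otimes>\<^sub>M \<pi>)) = (\<integral>\<^sup>+z. d z z2 \<partial>\<pi>)"
      using z2(1) by (subst c(7)[symmetric], subst nn_integral_distr[OF c(4)]) (auto intro!: d_comp measurable_const)
    also have "(\<integral>\<^sup>+z. d z z1 \<partial>\<pi>') + (\<integral>\<^sup>+z. d z z2 \<partial>\<pi>) + d z1 z2 < \<infinity>"
      using z1 z2 d_fin[OF z1(1) z2(1)] by simp
    finally obtain w where w: "wasserstein1 d \<pi>' \<pi> = ennreal w" "0 \<le> w"
      by (cases "wasserstein1 d \<pi>' \<pi>") auto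
    have "ennreal w \<le> ennreal (\<rho> * w)"
      using wasserstein_bind_le[OF \<pi>'l \<pi>] \<rho> by (simp add: \<pi>'(2) inv w ennreal_mult')
    then have "w \<le> \<rho> * w" using w \<rho> by (simp add: ennreal_le_iff)
    then have "w = 0" using \<rho> w by (metis antisym mult_left_le_one_le mult_cancel_right1 less_irrefl less_imp_le)
    then have W0: "wasserstein1 d \<pi>' \<pi> = 0" using w by simp
    show "\<pi>' = \<pi>"
    proof (rule laws_eqI[OF \<pi>'l \<pi>])
      fix e :: real assume "0 < e"
      \<comment> \<open>\<open>laws_eqI\<close> asks for a law close to both. Here
        \<open>\<pi>'\<close> itself serves: the diagonal coupling puts it at distance 0 from
        itself.\<close>
      have m': "(\<lambda>z. (z, z)) \<in> \<pi>' \<rightarrow>\<^sub>M S \<Otimes>\<^sub>M S"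
        using measurable_cong_sets[OF laws_sets[OF \<pi>'l] refl, of "S \<Otimes>\<^sub>M S"] by simp
      have "distr \<pi>' (S \<Otimes>\<^sub>M S) (\<lambda>z. (z, z)) \<in> couplings \<pi>' \<pi>'"
      proof (rule couplingI)
        show "prob_space (distr \<pi>' (S \<Otimes>\<^sub>M S) (\<lambda>z. (z, z)))"
          using \<pi>'l m' by (auto simp: laws_def intro: prob_space.prob_space_distr)
        show "distr (distr \<pi>' (S \<Otimes>\<^sub>M S) (\<lambda>z. (z, z))) S fst = \<pi>'" "distr (distr \<pi>' (S \<Otimes>\<^sub>M S) (\<lambda>z. (z, z))) S snd = \<pi>'"
          using m' laws_sets[OF \<pi>'l] by (simp_all add: distr_distr comp_def distr_id2)
      qed (auto simp: \<pi>'l)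
      then have "wasserstein1 d \<pi>' \<pi>' \<le> (\<integral>\<^sup>+p. d (fst p) (snd p) \<partial>distr \<pi>' (S \<Otimes>\<^sub>M S) (\<lambda>z. (z, z)))"
        unfolding wasserstein1_def by (rule INF_lower)
      also have "\<dots> = (\<integral>\<^sup>+z. d z z \<partial>\<pi>')"
        using d_meas by (subst nn_integral_distr[OF m']) simp_all
      also have "\<dots> = (\<integral>\<^sup>+z. 0 \<partial>\<pi>')"
        using laws_space[OF \<pi>'l] by (intro nn_integral_cong) (simp add: d_refl)
      finally show "\<exists>\<kappa>\<in>laws S. wasserstein1 d \<kappa> \<pi>' \<le> ennreal e \<and> wasserstein1 d \<kappa> \<pi> \<le> ennreal e"
        using \<pi>'l W0 by (intro bexI[of _ \<pi>']) auto
    qed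
  qed
  show ?thesis using \<pi>1 inv unique by blast
qed

end

section \<open>One step of the augmented chain\<close>

text \<open>The assumptions common to both kinds of tail, with their constants fixed and all
  randomness expressed through the law \<open>N\<close> of one innovation. \<open>h' x\<close>
  stands for the Hessian of the objective acting on vectors.\<close>

locale sgd = prob_space N for N :: "'u measure" +
  fixes \<Xi> :: "(real ^ 'e) set" and \<Phi> :: "real ^ 'e \<Rightarrow> 'u \<Rightarrow> real ^ 'e"
    and g :: "real ^ 'd \<Rightarrow> real ^ 'e \<Rightarrow> real ^ 'd" and h :: "real ^ 'd \<Rightarrow> real ^ 'd"
    and h' :: "real ^ 'd \<Rightarrow> real ^ 'd \<Rightarrow> real ^ 'd"
    and L\<Phi> :: "'u \<Rightarrow> real" and Lg L \<theta> :: real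
  assumes \<Xi>: "closed \<Xi>" "convex \<Xi>"
    and \<Phi>_meas: "(\<lambda>(\<xi>, u). \<Phi> \<xi> u) \<in> restrict_space borel \<Xi> \<Otimes>\<^sub>M N \<rightarrow>\<^sub>M restrict_space borel \<Xi>"
    and g_meas: "(\<lambda>(x, \<xi>). g x \<xi>) \<in> borel_measurable (restrict_space borel (UNIV \<times> \<Xi>))"
    and h_deriv: "(h has_derivative h' x) (at x)" and h_0: "h 0 = 0"
    and L\<Phi>_meas: "L\<Phi> \<in> borel_measurable N"
    and L\<Phi>: "u \<in> space N \<Longrightarrow> 0 \<le> L\<Phi> u \<and> L\<Phi> u \<le> 1" "expectation L\<Phi> < 1"
    and \<Phi>_lip: "\<xi> \<in> \<Xi> \<Longrightarrow> \<eta> \<in> \<Xi> \<Longrightarrow> u \<in> space N \<Longrightarrow> norm (\<Phi> \<xi> u - \<Phi> \<eta> u) \<le> L\<Phi> u * norm (\<xi> - \<eta>)"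
    and Lg: "0 < Lg" "\<xi> \<in> \<Xi> \<Longrightarrow> \<eta> \<in> \<Xi> \<Longrightarrow> u \<in> space N \<Longrightarrow> norm (g x (\<Phi> \<xi> u) - g x (\<Phi> \<eta> u)) \<le> Lg * norm (\<xi> - \<eta>)"
    and L: "1 \<le> L" and \<theta>: "0 \<le> \<theta>" "\<theta> < 1"
    and cocoercive: "\<xi> \<in> \<Xi> \<Longrightarrow> inverse L * (norm ((h x + g x \<xi>) - (h y + g y \<xi>)))\<^sup>2 \<le> (x - y) \<bullet> ((h x + g x \<xi>) - (h y + g y \<xi>))"
    and perturbation: "\<xi> \<in> \<Xi> \<Longrightarrow> - \<theta> * ((x - y) \<bullet> (h x - h y)) \<le> (x - y) \<bullet> (expectation (\<lambda>u. g x (\<Phi> \<xi> u)) - expectation (\<lambda>u. g y (\<Phi> \<xi> u)))"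
    and g_integrable: "\<xi> \<in> \<Xi> \<Longrightarrow> integrable N (\<lambda>u. g x (\<Phi> \<xi> u))"
begin

definition X1 :: "real \<Rightarrow> real ^ 'd \<Rightarrow> real ^ 'e \<Rightarrow> 'u \<Rightarrow> real ^ 'd" where
  "X1 \<alpha> x \<xi> u = x - \<alpha> *\<^sub>R (h x + g x (\<Phi> \<xi> u))"

definition F :: "real \<Rightarrow> 'u \<Rightarrow> (real ^ 'd) \<times> (real ^ 'e) \<Rightarrow> (real ^ 'd) \<times> (real ^ 'e)" where
  "F \<alpha> u z = (X1 \<alpha> (fst z) (snd z) u, \<Phi> (snd z) u)"

abbreviation "Zs \<equiv> UNIV \<times> \<Xi> :: ((real ^ 'd) \<times> (real ^ 'e)) set"

definition kernel :: "real \<Rightarrow> (real ^ 'd) \<times> (real ^ 'e) \<Rightarrow> ((real ^ 'd) \<times> (real ^ 'e)) measure" where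
  "kernel \<alpha> z = distr N (aug_space \<Xi>) (\<lambda>u. F \<alpha> u z)"

text \<open>The iterates are recorded as laws because \<open>kernel\<close> will be compared with
  the kernel of the given chain on the augmented space only, and the two are exchanged under a bind
  one step at a time.\<close>

definition contracting_weight :: "real \<Rightarrow> real \<Rightarrow> ((real ^ 'd) \<times> (real ^ 'e) \<Rightarrow> real) \<Rightarrow> bool" where
  "contracting_weight \<alpha> \<rho> V \<longleftrightarrow> continuous_on Zs V \<and> (\<forall>z\<in>Zs. 1 \<le> V z) \<and>
    (\<exists>!\<pi>. \<pi> \<in> laws1 (aug_space \<Xi>) (path_metric \<Xi> V \<alpha>) \<and> \<pi> \<bind> kernel \<alpha> = \<pi>) \<and>
    (\<forall>\<mu>\<in>laws (aug_space \<Xi>). \<forall>\<nu>\<in>laws (aug_space \<Xi>). \<forall>n.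
      ((\<lambda>\<mu>. \<mu> \<bind> kernel \<alpha>) ^^ n) \<mu> \<in> laws (aug_space \<Xi>) \<and>
      wasserstein1 (path_metric \<Xi> V \<alpha>) (((\<lambda>\<mu>. \<mu> \<bind> kernel \<alpha>) ^^ n) \<mu>) (((\<lambda>\<mu>. \<mu> \<bind> kernel \<alpha>) ^^ n) \<nu>)
        \<le> ennreal (\<rho> ^ n) * wasserstein1 (path_metric \<Xi> V \<alpha>) \<mu> \<nu>)"

lemma \<Phi>_comp [measurable (raw)]:
  assumes "f \<in> K \<rightarrow>\<^sub>M restrict_space borel \<Xi>" "k \<in> K \<rightarrow>\<^sub>M N"
  shows "(\<lambda>x. \<Phi> (f x) (k x)) \<in> K \<rightarrow>\<^sub>M restrict_space borel \<Xi>"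
  using measurable_compose[OF measurable_Pair[OF assms] \<Phi>_meas] by simp

lemma \<Phi>_meas1: "\<xi> \<in> \<Xi> \<Longrightarrow> (\<lambda>u. \<Phi> \<xi> u) \<in> N \<rightarrow>\<^sub>M restrict_space borel \<Xi>"
  by (rule \<Phi>_comp) (auto simp: space_restrict_space)

lemma \<Phi>_in: "\<xi> \<in> \<Xi> \<Longrightarrow> u \<in> space N \<Longrightarrow> \<Phi> \<xi> u \<in> \<Xi>"
  using measurable_space[OF \<Phi>_meas1, of \<xi> u] by (simp add: space_restrict_space)

lemma to_borel: "f \<in> K \<rightarrow>\<^sub>M restrict_space borel A \<Longrightarrow> f \<in> K \<rightarrow>\<^sub>M borel"
  by (simp add: measurable_restrict_space2_iff)

lemma g_comp:
  assumes f: "f \<in> K \<rightarrow>\<^sub>M borel" and k: "k \<in> K \<rightarrow>\<^sub>M restrict_space borel \<Xi>"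
  shows "(\<lambda>x. g (f x) (k x)) \<in> borel_measurable K"
proof -
  have "(\<lambda>x. (f x, k x)) \<in> K \<rightarrow>\<^sub>M borel \<Otimes>\<^sub>M borel"
    by (intro measurable_Pair f to_borel[OF k])
  then have "(\<lambda>x. (f x, k x)) \<in> K \<rightarrow>\<^sub>M restrict_space borel (UNIV \<times> \<Xi>)"
    using measurable_space[OF k] by (intro measurable_restrict_space2) (auto simp: borel_prod space_restrict_space)
  from measurable_compose[OF this g_meas] show ?thesis by simp
qed

lemma g_meas1 [measurable]: "\<xi> \<in> \<Xi> \<Longrightarrow> (\<lambda>u. g x (\<Phi> \<xi> u)) \<in> borel_measurable N"
  by (intro g_comp \<Phi>_meas1) simp

lemma h_cont: "continuous_on UNIV h"
  by (intro continuous_at_imp_continuous_on ballI has_derivative_continuous[OF h_deriv])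

lemma X1_meas [measurable]: "\<xi> \<in> \<Xi> \<Longrightarrow> X1 \<alpha> x \<xi> \<in> borel_measurable N"
  unfolding X1_def[abs_def] by measurable

lemma F_meas: "(\<lambda>(z, u). F \<alpha> u z) \<in> restrict_space borel Zs \<Otimes>\<^sub>M N \<rightarrow>\<^sub>M restrict_space borel Zs"
proof (rule measurable_restrict_space2)
  let ?K = "restrict_space borel Zs \<Otimes>\<^sub>M N"
  have sp: "space ?K = Zs \<times> space N" by (simp add: space_pair_measure space_restrict_space)
  have m0: "fst \<in> ?K \<rightarrow>\<^sub>M borel" by (rule to_borel[OF measurable_fst])
  have m: "(\<lambda>p. fst (fst p)) \<in> ?K \<rightarrow>\<^sub>M borel" "(\<lambda>p. snd (fst p)) \<in> ?K \<rightarrow>\<^sub>M borel"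
    by (rule measurable_compose[OF m0 borel_measurable_continuous_onI[OF continuous_on_fst[OF continuous_on_id]]])
      (rule measurable_compose[OF m0 borel_measurable_continuous_onI[OF continuous_on_snd[OF continuous_on_id]]])
  have m2: "(\<lambda>p. snd (fst p)) \<in> ?K \<rightarrow>\<^sub>M restrict_space borel \<Xi>"
    using m(2) by (intro measurable_restrict_space2) (auto simp: sp)
  have \<Phi>m: "(\<lambda>p. \<Phi> (snd (fst p)) (snd p)) \<in> ?K \<rightarrow>\<^sub>M restrict_space borel \<Xi>"
    by (rule \<Phi>_comp[OF m2 measurable_snd])
  have hm: "(\<lambda>p. h (fst (fst p))) \<in> borel_measurable ?K"
    by (rule measurable_compose[OF m(1) borel_measurable_continuous_onI[OF h_cont]])
  have "(\<lambda>p. fst (fst p) - \<alpha> *\<^sub>R (h (fst (fst p)) + g (fst (fst p)) (\<Phi> (snd (fst p)) (snd p)))) \<in> borel_measurable ?K"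
    by (intro borel_measurable_diff borel_measurable_scaleR borel_measurable_add borel_measurable_const m hm g_comp \<Phi>m)
  from measurable_Pair[OF this to_borel[OF \<Phi>m]]
  show "(\<lambda>(z, u). F \<alpha> u z) \<in> borel_measurable ?K"
    by (simp add: borel_prod F_def X1_def case_prod_unfold)
  show "(\<lambda>(z, u). F \<alpha> u z) \<in> space ?K \<rightarrow> Zs"
    by (auto simp: sp F_def \<Phi>_in)
qed

section \<open>One step of two copies with the same innovation\<close>

text \<open>Expand the square of the new distance: co-coercivity and
  \<open>\<alpha> * L \<le> 1\<close> bound the quadratic term
  \<open>\<alpha>\<^sup>2 * (norm k)\<^sup>2\<close> by \<open>\<alpha> * D\<close>, so half of the
  linear gain \<open>2 * \<alpha> * D\<close> survives. The third bound removes the squares by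
  \<open>2 * a * b \<le> a\<^sup>2 + b\<^sup>2\<close>.\<close>

lemma step_nonexpansive:
  fixes x y :: "real ^ 'd"
  assumes \<alpha>: "0 < \<alpha>" "\<alpha> * L \<le> 1" and \<xi>: "\<xi> \<in> \<Xi>" and u: "u \<in> space N"
  defines "D \<equiv> (x - y) \<bullet> ((h x + g x (\<Phi> \<xi> u)) - (h y + g y (\<Phi> \<xi> u)))"
  shows "0 \<le> D" "norm (X1 \<alpha> x \<xi> u - X1 \<alpha> y \<xi> u) \<le> norm (x - y)"
    "norm (X1 \<alpha> x \<xi> u - X1 \<alpha> y \<xi> u) \<le> norm (x - y) - \<alpha> / 2 * D / norm (x - y)"
proof -
  define k where "k = (h x + g x (\<Phi> \<xi> u)) - (h y + g y (\<Phi> \<xi> u))"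
  have co: "inverse L * (norm k)\<^sup>2 \<le> D"
    using cocoercive[OF \<Phi>_in[OF \<xi> u], of x y] by (simp add: D_def k_def)
  moreover have "0 \<le> inverse L * (norm k)\<^sup>2" using L by simp
  ultimately show D0: "0 \<le> D" by linarith
  have eq: "X1 \<alpha> x \<xi> u - X1 \<alpha> y \<xi> u = (x - y) - \<alpha> *\<^sub>R k"
    by (simp add: X1_def k_def algebra_simps)
  have "(norm (x - y - \<alpha> *\<^sub>R k))\<^sup>2 = (norm (x - y))\<^sup>2 - 2 * \<alpha> * D + \<alpha>\<^sup>2 * (norm k)\<^sup>2"
    unfolding power2_norm_eq_inner D_def k_def[symmetric]
    by (simp add: inner_diff_left inner_diff_right inner_commute power2_eq_square algebra_simps)
  moreover have "\<alpha>\<^sup>2 * (norm k)\<^sup>2 \<le> \<alpha> * D"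
  proof -
    have "(norm k)\<^sup>2 \<le> L * D" using co L by (simp add: field_simps)
    then have "\<alpha> * (norm k)\<^sup>2 \<le> \<alpha> * (L * D)" using \<alpha> by (intro mult_left_mono) auto
    also have "\<dots> \<le> 1 * D" unfolding mult.assoc[symmetric] using \<alpha> D0 by (intro mult_right_mono) auto
    finally show ?thesis using \<alpha> by (simp add: power2_eq_square mult.assoc)
  qed
  ultimately have sq: "(norm (x - y - \<alpha> *\<^sub>R k))\<^sup>2 \<le> (norm (x - y))\<^sup>2 - \<alpha> * D" by linarith
  have "0 \<le> \<alpha> * D" using \<alpha> D0 by simp
  then have "(norm (x - y - \<alpha> *\<^sub>R k))\<^sup>2 \<le> (norm (x - y))\<^sup>2" using sq by linarith
  then show "norm (X1 \<alpha> x \<xi> u - X1 \<alpha> y \<xi> u) \<le> norm (x - y)"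
    unfolding eq by (rule power2_le_imp_le) simp
  show "norm (X1 \<alpha> x \<xi> u - X1 \<alpha> y \<xi> u) \<le> norm (x - y) - \<alpha> / 2 * D / norm (x - y)"
  proof (cases "x = y")
    case True
    then show ?thesis by (simp add: eq k_def)
  next
    case False
    define a where "a = norm (x - y)"
    define b where "b = norm (x - y - \<alpha> *\<^sub>R k)"
    have a: "0 < a" using False by (simp add: a_def)
    have "2 * a * b \<le> a\<^sup>2 + b\<^sup>2" by (rule sum_squares_bound)
    then have "2 * a * b \<le> 2 * a\<^sup>2 - \<alpha> * D" using sq by (simp add: a_def b_def)
    then have "b \<le> a - \<alpha> / 2 * D / a" using a by (simp add: field_simps power2_eq_square)
    then show ?thesis by (simp add: eq a_def b_def)
  qed
qed

text \<open>The perturbation bound leaves in the mean of \<open>D\<close> at least the share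
  \<open>1 - \<theta>\<close> of the monotonicity of \<open>h\<close>, and for small
  \<open>t\<close> the derivative of \<open>h\<close> in direction \<open>v\<close> supplies
  \<open>lam\<close>. Where no curvature is available, \<open>lam = 0\<close> records plain
  nonexpansiveness.\<close>

lemma expected_step_le:
  assumes \<alpha>: "0 < \<alpha>" "\<alpha> * L \<le> 1" and \<xi>: "\<xi> \<in> \<Xi>"
    and lam: "0 \<le> lam" "lam = 0 \<or> (\<forall>v. lam * (norm v)\<^sup>2 \<le> v \<bullet> h' x v)" and e: "0 < e"
  shows "\<exists>\<delta>>0. \<forall>t. 0 \<le> t \<and> t < \<delta> \<longrightarrow>
    (\<integral>\<^sup>+u. ennreal (norm (X1 \<alpha> x \<xi> u - X1 \<alpha> (x + t *\<^sub>R v) \<xi> u)) \<partial>N) \<le> ennreal (t * (norm v * (1 - \<alpha> * ((1 - \<theta>) / 2) * lam) + e))"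
proof (cases "v = 0 \<or> lam = 0")
  case True
  have "(\<integral>\<^sup>+u. ennreal (norm (X1 \<alpha> x \<xi> u - X1 \<alpha> (x + t *\<^sub>R v) \<xi> u)) \<partial>N) \<le> ennreal (t * (norm v * (1 - \<alpha> * ((1 - \<theta>) / 2) * lam) + e))"
    if "0 \<le> t" for t
  proof -
    have "(\<integral>\<^sup>+u. ennreal (norm (X1 \<alpha> x \<xi> u - X1 \<alpha> (x + t *\<^sub>R v) \<xi> u)) \<partial>N) \<le> (\<integral>\<^sup>+u. ennreal (t * norm v) \<partial>N)"
    proof (intro nn_integral_mono ennreal_leI)
      fix u assume "u \<in> space N"
      from step_nonexpansive(2)[OF \<alpha> \<xi> this, of x "x + t *\<^sub>R v"]
      show "norm (X1 \<alpha> x \<xi> u - X1 \<alpha> (x + t *\<^sub>R v) \<xi> u) \<le> t * norm v" using that by simp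
    qed
    also have "\<dots> = ennreal (t * norm v)" by (simp add: emeasure_space_1)
    also have "\<dots> \<le> ennreal (t * (norm v * (1 - \<alpha> * ((1 - \<theta>) / 2) * lam) + e))"
      using True that e by (intro ennreal_leI mult_left_mono) auto
    finally show ?thesis .
  qed
  then show ?thesis by (intro exI[of _ 1]) auto
next
  case False
  then have v: "v \<noteq> 0" and lam': "lam * (norm v)\<^sup>2 \<le> v \<bullet> h' x v" using lam by auto
  define q where "q = (1 - \<theta>) / 2"
  have q: "0 < q" using \<theta> by (simp add: q_def)
  \<comment> \<open>The error allowed in the directional derivative: multiplied by
    \<open>\<alpha> * q * t / norm v\<close> it becomes \<open>t * e\<close>.\<close>
  define e' where "e' = e * norm v / (\<alpha> * q)"
  have e': "0 < e'" using e v \<alpha> q by (simp add: e'_def)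
  have "((\<lambda>t. x + t *\<^sub>R v) has_derivative (\<lambda>t. t *\<^sub>R v)) (at 0)"
    by (auto intro!: derivative_eq_intros)
  moreover have "(h has_derivative h' x) (at (x + 0 *\<^sub>R v))" using h_deriv by simp
  ultimately have "((\<lambda>t. h (x + t *\<^sub>R v)) has_derivative (\<lambda>t. h' x (t *\<^sub>R v))) (at 0)"
    by (rule has_derivative_compose)
  then have "((\<lambda>t. v \<bullet> h (x + t *\<^sub>R v)) has_derivative (\<lambda>t. v \<bullet> h' x (t *\<^sub>R v))) (at 0)"
    by (rule has_derivative_inner_right)
  moreover have "v \<bullet> h' x (t *\<^sub>R v) = (v \<bullet> h' x v) * t" for t
    using linear_scale[OF has_derivative_linear[OF h_deriv[of x]], of t v] by simp
  ultimately have "((\<lambda>t. v \<bullet> h (x + t *\<^sub>R v)) has_real_derivative (v \<bullet> h' x v)) (at 0)"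
    by (simp add: has_field_derivative_def)
  then have "((\<lambda>t. (v \<bullet> h (x + t *\<^sub>R v) - v \<bullet> h x) / t) \<longlongrightarrow> v \<bullet> h' x v) (at 0)"
    by (simp add: has_field_derivative_iff)
  then have "\<forall>\<^sub>F t in at 0. v \<bullet> h' x v - e' < (v \<bullet> h (x + t *\<^sub>R v) - v \<bullet> h x) / t"
    by (rule order_tendstoD) (use e' in simp)
  then obtain \<delta> where \<delta>: "0 < \<delta>" "\<And>t. t \<noteq> 0 \<Longrightarrow> \<bar>t\<bar> < \<delta> \<Longrightarrow> v \<bullet> h' x v - e' < (v \<bullet> h (x + t *\<^sub>R v) - v \<bullet> h x) / t"
    unfolding eventually_at by (auto simp: dist_real_def)
  have "(\<integral>\<^sup>+u. ennreal (norm (X1 \<alpha> x \<xi> u - X1 \<alpha> (x + t *\<^sub>R v) \<xi> u)) \<partial>N) \<le> ennreal (t * (norm v * (1 - \<alpha> * q * lam) + e))"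
    if t: "0 \<le> t" "t < \<delta>" for t
  proof (cases "t = 0")
    case False
    then have t0: "0 < t" using t by simp
    let ?y = "x + t *\<^sub>R v"
    define D where "D = (\<lambda>u. (x - ?y) \<bullet> ((h x + g x (\<Phi> \<xi> u)) - (h ?y + g ?y (\<Phi> \<xi> u))))"
    have nv: "norm (x - ?y) = t * norm v" using t0 by simp
    have Dint: "integrable N D"
      unfolding D_def
      by (intro integrable_inner_right Bochner_Integration.integrable_diff Bochner_Integration.integrable_add integrable_const g_integrable[OF \<xi>])
    have ED: "expectation D = (x - ?y) \<bullet> (h x - h ?y) + (x - ?y) \<bullet> (expectation (\<lambda>u. g x (\<Phi> \<xi> u)) - expectation (\<lambda>u. g ?y (\<Phi> \<xi> u)))"
    proof -
      have "D = (\<lambda>u. (x - ?y) \<bullet> (h x - h ?y) + (x - ?y) \<bullet> (g x (\<Phi> \<xi> u) - g ?y (\<Phi> \<xi> u)))"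
        by (rule ext) (simp add: D_def inner_add_right inner_diff_right algebra_simps)
      then show ?thesis
        using g_integrable[OF \<xi>] by (simp add: prob_space)
    qed
    have "(1 - \<theta>) * ((x - ?y) \<bullet> (h x - h ?y)) \<le> expectation D"
      using perturbation[OF \<xi>, of x ?y] unfolding ED by (simp add: algebra_simps)
    moreover have "(x - ?y) \<bullet> (h x - h ?y) = t * (v \<bullet> h ?y - v \<bullet> h x)"
      by (simp add: inner_diff_right algebra_simps)
    moreover have "(lam * (norm v)\<^sup>2 - e') * t \<le> v \<bullet> h ?y - v \<bullet> h x"
    proof -
      have "lam * (norm v)\<^sup>2 - e' \<le> (v \<bullet> h ?y - v \<bullet> h x) / t"
        using \<delta>(2)[of t] t0 t lam' by simp
      then show ?thesis using t0 by (simp add: pos_le_divide_eq)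
    qed
    ultimately have EDge: "(1 - \<theta>) * (t * ((lam * (norm v)\<^sup>2 - e') * t)) \<le> expectation D"
      using t0 \<theta> by (smt (verit) mult_left_mono)
    let ?b = "\<lambda>u. t * norm v - \<alpha> / 2 * D u / (t * norm v)"
    have bint: "integrable N ?b" using Dint by (intro Bochner_Integration.integrable_diff integrable_const integrable_divide_zero integrable_mult_right) auto
    have le: "norm (X1 \<alpha> x \<xi> u - X1 \<alpha> ?y \<xi> u) \<le> ?b u" if "u \<in> space N" for u
      using step_nonexpansive(3)[OF \<alpha> \<xi> that, of x ?y] unfolding nv D_def by simp
    have "(\<integral>\<^sup>+u. ennreal (norm (X1 \<alpha> x \<xi> u - X1 \<alpha> ?y \<xi> u)) \<partial>N) \<le> (\<integral>\<^sup>+u. ennreal (?b u) \<partial>N)"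
      by (intro nn_integral_mono ennreal_leI le)
    also have "\<dots> = ennreal (expectation ?b)"
      by (intro nn_integral_eq_integral bint AE_I2) (use le norm_ge_zero order_trans in blast)
    also have "expectation ?b = t * norm v - \<alpha> / 2 * expectation D / (t * norm v)"
      using Dint by (simp add: prob_space)
    also have "\<dots> \<le> t * norm v - \<alpha> / 2 * ((1 - \<theta>) * (t * ((lam * (norm v)\<^sup>2 - e') * t))) / (t * norm v)"
      using EDge \<alpha> t0 v by (intro diff_left_mono divide_right_mono mult_left_mono) auto
    also have "\<dots> = t * (norm v * (1 - \<alpha> * q * lam) + e)"
      using t0 v \<alpha> q by (simp add: q_def e'_def field_simps power2_eq_square)
    finally show ?thesis by (simp add: ennreal_leI)
  qed simp
  then show ?thesis using \<delta>(1) unfolding q_def by blast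
qed

section \<open>Infinitesimal contraction of the weighted cost\<close>

text \<open>\<open>condA\<close> treats displacements of the first coordinate. There
  \<open>V (X1 \<alpha> x \<xi> u)\<close> and the new displacement \<open>\<Delta> u\<close> are
  dependent, so the weight is split at \<open>s\<close>: the part \<open>s\<close> meets a
  displacement that shrinks in mean, the excess over \<open>s\<close>, of mean at most
  \<open>t\<close>, one that never grows. \<open>condB\<close> treats displacements of the noise
  state, which cost \<open>inverse \<alpha>\<close> per unit: the image costs
  \<open>\<alpha> * Lg + inverse \<alpha> * L\<Phi> u\<close> per unit, and the ratio is
  \<open>\<alpha>\<^sup>2 * Lg + L\<Phi> u\<close>.\<close>

lemma local_contraction:
  assumes \<alpha>: "0 < \<alpha>" "\<alpha> * L \<le> 1" and \<rho>: "0 < \<rho>"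
    and V: "continuous_on UNIV V" "\<And>x. 1 \<le> V x" "0 \<le> \<Lambda>" "\<And>x y. V y \<le> exp (\<Lambda> * norm (y - x)) * V x"
    and condA: "0 \<le> s" "0 \<le> lam" "lam = 0 \<or> (\<forall>v. lam * (norm v)\<^sup>2 \<le> v \<bullet> h' x v)" "0 \<le> t"
      "(\<integral>\<^sup>+u. ennreal (V (X1 \<alpha> x \<xi> u) - s) \<partial>N) \<le> ennreal t"
      "s * (1 - \<alpha> * ((1 - \<theta>) / 2) * lam) + t \<le> \<rho> * V x"
      "\<alpha> * ((1 - \<theta>) / 2) * lam \<le> 1"
    and condB: "(\<integral>\<^sup>+u. ennreal (V (X1 \<alpha> x \<xi> u) * (\<alpha>\<^sup>2 * Lg + L\<Phi> u)) \<partial>N) \<le> ennreal (\<rho> * V x)"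
    and \<xi>: "\<xi> \<in> \<Xi>" and e: "0 < e"
  shows "\<exists>\<delta>>0. \<forall>r. 0 \<le> r \<and> r < \<delta> \<and> (x, \<xi>) + r *\<^sub>R w \<in> Zs \<longrightarrow>
    (\<integral>\<^sup>+u. path_metric \<Xi> (\<lambda>z. V (fst z)) \<alpha> (F \<alpha> u (x, \<xi>)) (F \<alpha> u ((x, \<xi>) + r *\<^sub>R w)) \<partial>N)
      \<le> ennreal (r * (\<rho> * V x * scaled_norm \<alpha> w + e))"
proof -
  interpret W: weighted_path_metric \<Xi> "\<lambda>z. V (fst z)" \<alpha>
    using \<Xi> V(2) \<alpha> by unfold_locales (auto intro!: continuous_on_compose2[OF V(1)] continuous_intros)
  have [measurable]: "V \<in> borel_measurable borel" by (rule borel_measurable_continuous_onI[OF V(1)])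
  note [measurable] = L\<Phi>_meas X1_meas[OF \<xi>]
  obtain v \<eta> where w: "w = (v, \<eta>)" by (cases w)
  define e1 where "e1 = e / (2 * (1 + s))"
  have e1: "0 < e1" "s * e1 \<le> e / 2" using e condA(1) by (auto simp: e1_def field_simps)
  obtain \<delta>1 where \<delta>1: "0 < \<delta>1" "\<And>r. 0 \<le> r \<Longrightarrow> r < \<delta>1 \<Longrightarrow>
    (\<integral>\<^sup>+u. ennreal (norm (X1 \<alpha> x \<xi> u - X1 \<alpha> (x + r *\<^sub>R v) \<xi> u)) \<partial>N) \<le> ennreal (r * (norm v * (1 - \<alpha> * ((1 - \<theta>) / 2) * lam) + e1))"
    using expected_step_le[OF \<alpha> \<xi> condA(2,3) e1(1), of v] by blast
  \<comment> \<open>\<open>r * K\<close> bounds the length of the first coordinate of the segment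
    between the images. Along it the weight varies at most by the factor
    \<open>exp (\<Lambda> * (r * K))\<close>, which tends to 1.\<close>
  define K where "K = norm v + \<alpha> * Lg * norm \<eta>"
  define m where "m = \<rho> * V x * scaled_norm \<alpha> w + e / 2"
  have V0: "0 < V x" using V(2)[of x] by simp
  have m: "0 < m" using \<rho> V0 W.N_nonneg[of w] e by (simp add: m_def add_nonneg_pos)
  have "((\<lambda>r. exp (\<Lambda> * (r * K)) * m) \<longlongrightarrow> exp (\<Lambda> * (0 * K)) * m) (at 0)"
    by (intro tendsto_intros)
  then have "\<forall>\<^sub>F r in at 0. exp (\<Lambda> * (r * K)) * m < m + e / 2"
    by (rule order_tendstoD) (use e in simp)
  then obtain \<delta>2 where \<delta>2: "0 < \<delta>2" "\<And>r. r \<noteq> 0 \<Longrightarrow> \<bar>r\<bar> < \<delta>2 \<Longrightarrow> exp (\<Lambda> * (r * K)) * m < m + e / 2"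
    unfolding eventually_at by (auto simp: dist_real_def)
  show ?thesis
  proof (intro exI[of _ "min \<delta>1 \<delta>2"] conjI allI impI)
    show "0 < min \<delta>1 \<delta>2" using \<delta>1 \<delta>2 by simp
    fix r assume r: "0 \<le> r \<and> r < min \<delta>1 \<delta>2 \<and> (x, \<xi>) + r *\<^sub>R w \<in> Zs"
    define y \<zeta> where "y = x + r *\<^sub>R v" and "\<zeta> = \<xi> + r *\<^sub>R \<eta>"
    have z': "(x, \<xi>) + r *\<^sub>R w = (y, \<zeta>)" by (simp add: w y_def \<zeta>_def)
    have \<zeta>: "\<zeta> \<in> \<Xi>" using r unfolding z' by simp
    have n: "norm (x - y) = r * norm v" "norm (\<xi> - \<zeta>) = r * norm \<eta>" using r by (simp_all add: y_def \<zeta>_def)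
    define \<Delta> where "\<Delta> = (\<lambda>u. norm (X1 \<alpha> x \<xi> u - X1 \<alpha> y \<xi> u))"
    have \<Delta>m [measurable]: "\<Delta> \<in> borel_measurable N" unfolding \<Delta>_def using X1_meas[OF \<xi>] by measurable
    define E where "E = exp (\<Lambda> * (r * K))"
    have E: "0 < E" by (simp add: E_def)
    define b where "b = (\<lambda>u. V (X1 \<alpha> x \<xi> u) * (\<Delta> u + (\<alpha> * Lg + inverse \<alpha> * L\<Phi> u) * (r * norm \<eta>)))"
    have pt: "W.d (F \<alpha> u (x, \<xi>)) (F \<alpha> u (y, \<zeta>)) \<le> ennreal (E * b u)" if u: "u \<in> space N" for u
    proof -
      let ?p = "F \<alpha> u (x, \<xi>)" and ?p' = "F \<alpha> u (y, \<zeta>)"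
      \<comment> \<open>First the position changes at the noise state \<open>\<xi>\<close>, then the
        noise state changes at the position \<open>y\<close>, so that each hypothesis sees one
        change at a time.\<close>
      have split: "norm (X1 \<alpha> x \<xi> u - X1 \<alpha> y \<zeta> u) \<le> \<Delta> u + \<alpha> * Lg * (r * norm \<eta>)"
      proof -
        have "X1 \<alpha> x \<xi> u - X1 \<alpha> y \<zeta> u = (X1 \<alpha> x \<xi> u - X1 \<alpha> y \<xi> u) - \<alpha> *\<^sub>R (g y (\<Phi> \<xi> u) - g y (\<Phi> \<zeta> u))"
          by (simp add: X1_def algebra_simps)
        also have "norm \<dots> \<le> \<Delta> u + norm (\<alpha> *\<^sub>R (g y (\<Phi> \<xi> u) - g y (\<Phi> \<zeta> u)))"
          unfolding \<Delta>_def by (rule norm_triangle_ineq4)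
        also have "norm (\<alpha> *\<^sub>R (g y (\<Phi> \<xi> u) - g y (\<Phi> \<zeta> u))) \<le> \<alpha> * (Lg * (r * norm \<eta>))"
          using Lg(2)[OF \<xi> \<zeta> u, of y] \<alpha> by (simp add: n)
        finally show ?thesis by (simp add: mult.assoc)
      qed
      have \<Delta>le: "\<Delta> u \<le> r * norm v"
        using step_nonexpansive(2)[OF \<alpha> \<xi> u, of x y] by (simp add: \<Delta>_def n)
      have inZ: "?p \<in> Zs" "?p' \<in> Zs" using \<Phi>_in[OF \<xi> u] \<Phi>_in[OF \<zeta> u] by (auto simp: F_def)
      have seg: "V (fst p) \<le> E * V (X1 \<alpha> x \<xi> u)" if p: "p \<in> closed_segment ?p ?p'" for p
      proof -
        obtain l where l: "0 \<le> l" "l \<le> 1" "p = (1 - l) *\<^sub>R ?p + l *\<^sub>R ?p'"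
          using p by (auto simp: closed_segment_def)
        have "fst p - X1 \<alpha> x \<xi> u = l *\<^sub>R (X1 \<alpha> y \<zeta> u - X1 \<alpha> x \<xi> u)"
          by (simp add: l(3) F_def algebra_simps)
        then have "norm (fst p - X1 \<alpha> x \<xi> u) = l * norm (X1 \<alpha> x \<xi> u - X1 \<alpha> y \<zeta> u)"
          using l by (simp add: norm_minus_commute)
        also have "\<dots> \<le> 1 * norm (X1 \<alpha> x \<xi> u - X1 \<alpha> y \<zeta> u)" using l by (intro mult_right_mono) auto
        also have "\<dots> \<le> r * K" using split \<Delta>le by (simp add: K_def algebra_simps)
        finally have "exp (\<Lambda> * norm (fst p - X1 \<alpha> x \<xi> u)) \<le> E"
          unfolding E_def using V(3) by (simp add: mult_left_mono)
        then have "exp (\<Lambda> * norm (fst p - X1 \<alpha> x \<xi> u)) * V (X1 \<alpha> x \<xi> u) \<le> E * V (X1 \<alpha> x \<xi> u)"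
          using V(2)[of "X1 \<alpha> x \<xi> u"] by (intro mult_right_mono) auto
        with V(4)[of "fst p" "X1 \<alpha> x \<xi> u"] show ?thesis by linarith
      qed
      have "W.N (?p' - ?p) = norm (X1 \<alpha> x \<xi> u - X1 \<alpha> y \<zeta> u) + inverse \<alpha> * norm (\<Phi> \<xi> u - \<Phi> \<zeta> u)"
        by (simp add: scaled_norm_def F_def norm_minus_commute)
      also have "\<dots> \<le> (\<Delta> u + \<alpha> * Lg * (r * norm \<eta>)) + inverse \<alpha> * (L\<Phi> u * (r * norm \<eta>))"
        using \<Phi>_lip[OF \<xi> \<zeta> u] \<alpha> split by (intro add_mono mult_left_mono) (auto simp: n)
      finally have Nle: "W.N (?p' - ?p) \<le> \<Delta> u + (\<alpha> * Lg + inverse \<alpha> * L\<Phi> u) * (r * norm \<eta>)"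
        by (simp add: algebra_simps)
      have "W.d ?p ?p' \<le> ennreal (E * V (X1 \<alpha> x \<xi> u) * W.N (?p' - ?p))"
        by (rule W.d_segment_le[OF inZ seg])
      also have "\<dots> \<le> ennreal (E * b u)"
        unfolding b_def mult.assoc using E V(2)[of "X1 \<alpha> x \<xi> u"] Nle
        by (intro ennreal_leI mult_left_mono) auto
      finally show ?thesis .
    qed
    have A: "(\<integral>\<^sup>+u. ennreal (V (X1 \<alpha> x \<xi> u) * \<Delta> u) \<partial>N) \<le> ennreal (r * (norm v * (\<rho> * V x) + e / 2))"
    proof -
      have "(\<integral>\<^sup>+u. ennreal (V (X1 \<alpha> x \<xi> u) * \<Delta> u) \<partial>N) \<le> (\<integral>\<^sup>+u. ennreal s * ennreal (\<Delta> u) + ennreal (r * norm v) * ennreal (V (X1 \<alpha> x \<xi> u) - s) \<partial>N)"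
      proof (rule nn_integral_mono)
        fix u assume u: "u \<in> space N"
        have d: "0 \<le> \<Delta> u" "\<Delta> u \<le> r * norm v"
          using step_nonexpansive(2)[OF \<alpha> \<xi> u, of x y] by (auto simp: \<Delta>_def n)
        have "V (X1 \<alpha> x \<xi> u) * \<Delta> u \<le> s * \<Delta> u + r * norm v * max 0 (V (X1 \<alpha> x \<xi> u) - s)"
        proof -
          have "(V (X1 \<alpha> x \<xi> u) - s) * \<Delta> u \<le> max 0 (V (X1 \<alpha> x \<xi> u) - s) * \<Delta> u"
            using d by (intro mult_right_mono) auto
          also have "\<dots> \<le> max 0 (V (X1 \<alpha> x \<xi> u) - s) * (r * norm v)"
            using d by (intro mult_left_mono) auto
          finally show ?thesis by (simp add: algebra_simps)
        qed
        then have "ennreal (V (X1 \<alpha> x \<xi> u) * \<Delta> u) \<le> ennreal (s * \<Delta> u + r * norm v * max 0 (V (X1 \<alpha> x \<xi> u) - s))"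
          by (rule ennreal_leI)
        also have "\<dots> = ennreal (s * \<Delta> u) + ennreal (r * norm v * max 0 (V (X1 \<alpha> x \<xi> u) - s))"
          using d condA(1) r by (intro ennreal_plus) auto
        also have "\<dots> = ennreal s * ennreal (\<Delta> u) + ennreal (r * norm v) * ennreal (max 0 (V (X1 \<alpha> x \<xi> u) - s))"
          using d condA(1) r by (simp only: ennreal_mult' zero_le_mult_iff norm_ge_zero) (simp add: ennreal_mult')
        also have "ennreal (max 0 (V (X1 \<alpha> x \<xi> u) - s)) = ennreal (V (X1 \<alpha> x \<xi> u) - s)"
          by (simp add: ennreal_max_0)
        finally show "ennreal (V (X1 \<alpha> x \<xi> u) * \<Delta> u) \<le> ennreal s * ennreal (\<Delta> u) + ennreal (r * norm v) * ennreal (V (X1 \<alpha> x \<xi> u) - s)" .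
      qed
      also have "\<dots> = ennreal s * (\<integral>\<^sup>+u. ennreal (\<Delta> u) \<partial>N) + ennreal (r * norm v) * (\<integral>\<^sup>+u. ennreal (V (X1 \<alpha> x \<xi> u) - s) \<partial>N)"
        by (subst nn_integral_add) (simp_all add: nn_integral_cmult)
      also have "\<dots> \<le> ennreal s * ennreal (r * (norm v * (1 - \<alpha> * ((1 - \<theta>) / 2) * lam) + e1)) + ennreal (r * norm v) * ennreal t"
        using \<delta>1(2)[of r] r condA(5) by (intro add_mono mult_left_mono) (auto simp: \<Delta>_def y_def)
      also have "\<dots> = ennreal (s * (r * (norm v * (1 - \<alpha> * ((1 - \<theta>) / 2) * lam) + e1))) + ennreal (r * norm v * t)"
        using condA r by (simp add: ennreal_mult')
      also have "\<dots> \<le> ennreal (r * (norm v * (\<rho> * V x) + e / 2))"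
      proof -
        have True: "0 \<le> s * (r * (norm v * (1 - \<alpha> * ((1 - \<theta>) / 2) * lam) + e1))"
          using condA(1,7) r e1(1) by (intro mult_nonneg_nonneg add_nonneg_nonneg) auto
        have "norm v * (s * (1 - \<alpha> * ((1 - \<theta>) / 2) * lam) + t) \<le> norm v * (\<rho> * V x)"
          by (intro mult_left_mono condA) simp
        then have "r * (norm v * (s * (1 - \<alpha> * ((1 - \<theta>) / 2) * lam) + t) + s * e1) \<le> r * (norm v * (\<rho> * V x) + e / 2)"
          using r e1 by (intro mult_left_mono) auto
        moreover have "s * (r * (norm v * (1 - \<alpha> * ((1 - \<theta>) / 2) * lam) + e1)) + r * norm v * t = r * (norm v * (s * (1 - \<alpha> * ((1 - \<theta>) / 2) * lam) + t) + s * e1)"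
          by (simp add: algebra_simps)
        ultimately show ?thesis
          using True r condA(4) by (subst ennreal_plus[symmetric]) (auto intro!: ennreal_leI)
      qed
      finally show ?thesis .
    qed
    have B: "(\<integral>\<^sup>+u. ennreal (V (X1 \<alpha> x \<xi> u) * (\<alpha> * Lg + inverse \<alpha> * L\<Phi> u)) \<partial>N) \<le> ennreal (inverse \<alpha> * (\<rho> * V x))"
    proof -
      have "(\<integral>\<^sup>+u. ennreal (V (X1 \<alpha> x \<xi> u) * (\<alpha> * Lg + inverse \<alpha> * L\<Phi> u)) \<partial>N) =
          (\<integral>\<^sup>+u. ennreal (inverse \<alpha>) * ennreal (V (X1 \<alpha> x \<xi> u) * (\<alpha>\<^sup>2 * Lg + L\<Phi> u)) \<partial>N)"
        using \<alpha> by (intro nn_integral_cong) (subst ennreal_mult'[symmetric], auto simp: field_simps power2_eq_square)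
      also have "\<dots> = ennreal (inverse \<alpha>) * (\<integral>\<^sup>+u. ennreal (V (X1 \<alpha> x \<xi> u) * (\<alpha>\<^sup>2 * Lg + L\<Phi> u)) \<partial>N)"
        by (rule nn_integral_cmult) measurable
      also have "\<dots> \<le> ennreal (inverse \<alpha>) * ennreal (\<rho> * V x)" by (intro mult_left_mono condB) simp
      also have "\<dots> = ennreal (inverse \<alpha> * (\<rho> * V x))" using \<alpha> by (intro ennreal_mult'[symmetric]) simp
      finally show ?thesis .
    qed
    have "(\<integral>\<^sup>+u. W.d (F \<alpha> u (x, \<xi>)) (F \<alpha> u (y, \<zeta>)) \<partial>N) \<le> (\<integral>\<^sup>+u. ennreal E * (ennreal (V (X1 \<alpha> x \<xi> u) * \<Delta> u) +
        ennreal (r * norm \<eta>) * ennreal (V (X1 \<alpha> x \<xi> u) * (\<alpha> * Lg + inverse \<alpha> * L\<Phi> u))) \<partial>N)"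
    proof (rule nn_integral_mono)
      fix u assume u: "u \<in> space N"
      have n0: "0 \<le> V (X1 \<alpha> x \<xi> u) * \<Delta> u" "0 \<le> V (X1 \<alpha> x \<xi> u) * (\<alpha> * Lg + inverse \<alpha> * L\<Phi> u)"
        using V(2)[of "X1 \<alpha> x \<xi> u"] \<alpha> Lg(1) L\<Phi>(1)[OF u] by (auto simp: \<Delta>_def intro!: mult_nonneg_nonneg add_nonneg_nonneg)
      have "E * b u = E * (V (X1 \<alpha> x \<xi> u) * \<Delta> u + r * norm \<eta> * (V (X1 \<alpha> x \<xi> u) * (\<alpha> * Lg + inverse \<alpha> * L\<Phi> u)))"
        by (simp add: b_def algebra_simps)
      also have "ennreal \<dots> = ennreal E * (ennreal (V (X1 \<alpha> x \<xi> u) * \<Delta> u) +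
        ennreal (r * norm \<eta>) * ennreal (V (X1 \<alpha> x \<xi> u) * (\<alpha> * Lg + inverse \<alpha> * L\<Phi> u)))"
        using n0 E r by (subst ennreal_mult', simp, subst ennreal_plus, simp_all add: ennreal_mult'[symmetric])
      finally show "W.d (F \<alpha> u (x, \<xi>)) (F \<alpha> u (y, \<zeta>)) \<le> ennreal E * (ennreal (V (X1 \<alpha> x \<xi> u) * \<Delta> u) +
        ennreal (r * norm \<eta>) * ennreal (V (X1 \<alpha> x \<xi> u) * (\<alpha> * Lg + inverse \<alpha> * L\<Phi> u)))"
        using pt[OF u] by simp
    qed
    also have "\<dots> = ennreal E * ((\<integral>\<^sup>+u. ennreal (V (X1 \<alpha> x \<xi> u) * \<Delta> u) \<partial>N) +
        ennreal (r * norm \<eta>) * (\<integral>\<^sup>+u. ennreal (V (X1 \<alpha> x \<xi> u) * (\<alpha> * Lg + inverse \<alpha> * L\<Phi> u)) \<partial>N))"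
      by (simp add: nn_integral_cmult nn_integral_add)
    also have "\<dots> \<le> ennreal E * (ennreal (r * (norm v * (\<rho> * V x) + e / 2)) + ennreal (r * norm \<eta>) * ennreal (inverse \<alpha> * (\<rho> * V x)))"
      by (intro mult_left_mono add_mono A B) auto
    also have "\<dots> = ennreal (E * (r * m))"
    proof -
      have "r * (norm v * (\<rho> * V x) + e / 2) + r * norm \<eta> * (inverse \<alpha> * (\<rho> * V x)) = r * m"
        by (simp add: m_def scaled_norm_def w algebra_simps)
      moreover have "0 \<le> r * (norm v * (\<rho> * V x) + e / 2)" "0 \<le> r * norm \<eta>" "0 \<le> inverse \<alpha> * (\<rho> * V x)"
        using r \<rho> V0 \<alpha> e by auto
      ultimately show ?thesis
        using E by (simp add: ennreal_mult'[symmetric] ennreal_plus[symmetric] del: ennreal_plus)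
    qed
    also have "E * (r * m) \<le> r * (\<rho> * V x * scaled_norm \<alpha> w + e)"
    proof (cases "r = 0")
      case False
      then have "E * m < m + e / 2" unfolding E_def using \<delta>2(2)[of r] r by auto
      then have "r * (E * m) \<le> r * (m + e / 2)" using r by (intro mult_left_mono) auto
      then show ?thesis by (simp add: m_def algebra_simps)
    qed simp
    finally show "(\<integral>\<^sup>+u. W.d (F \<alpha> u (x, \<xi>)) (F \<alpha> u ((x, \<xi>) + r *\<^sub>R w)) \<partial>N) \<le> ennreal (r * (\<rho> * V x * scaled_norm \<alpha> w + e))"
      unfolding z' by (simp add: ennreal_leI)
  qed
qed

end

section \<open>A Lyapunov function for the subquadratic tail\<close>

text \<open>For \<open>b / a \<le> 1\<close> and \<open>q \<le> 1\<close> one has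
  \<open>b / a \<le> (b / a) powr q\<close>; multiplication by \<open>a powr q\<close> gives the
  bound.\<close>

lemma powr_diff_le:
  fixes a b q :: real
  assumes "0 < b" "b \<le> a" "q \<le> 1"
  shows "a powr q - b powr q \<le> (a - b) * a powr (q - 1)"
proof -
  define p where "p = a powr (q - 1)"
  have ap: "a powr q = a * p" using assms by (simp add: p_def powr_mult_base)
  have "b / a \<le> (b / a) powr q"
    using powr_mono'[of q 1 "b / a"] assms by simp
  then have "a powr q * (b / a) \<le> a powr q * (b / a) powr q" by (intro mult_left_mono) auto
  also have "\<dots> = b powr q" using assms by (simp add: powr_mult[symmetric])
  also have "a powr q * (b / a) = b * p" using assms by (simp add: ap)
  finally show ?thesis unfolding p_def[symmetric] ap by (simp add: left_diff_distrib)
qed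

lemma abs_powr_diff_le:
  fixes a b q :: real
  assumes "0 < a" "0 < b" "0 \<le> q" "q \<le> 1"
  shows "\<bar>b powr q - a powr q\<bar> \<le> \<bar>b - a\<bar> * a powr (q - 1)"
proof (cases "a \<le> b")
  case True
  have "b powr q - a powr q \<le> (b - a) * b powr (q - 1)" using powr_diff_le[of a b q] True assms by simp
  also have "\<dots> \<le> (b - a) * a powr (q - 1)"
    using True assms by (intro mult_left_mono powr_mono2') auto
  finally show ?thesis using True assms powr_mono2[of q a b] by simp
next
  case False
  then show ?thesis using powr_diff_le[of b a q] assms powr_mono2[of q b a] by simp
qed

text \<open>A concave power lies below its tangent: Bernoulli's inequality for \<open>s / t\<close>,
  obtained from Young's inequality with the second factor 1.\<close>

lemma powr_le_tangent:
  fixes s t p :: real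
  assumes "0 < s" "0 < t" "0 < p" "p \<le> 1"
  shows "s powr p - t powr p \<le> p * t powr (p - 1) * (s - t)"
proof -
  have "(s / t) powr p \<le> 1 + p * (s / t - 1)"
    using Youngs_inequality_0[of p "1 - p" "s / t" 1] assms by (simp add: algebra_simps)
  then have "t powr p * (s / t) powr p \<le> t powr p * (1 + p * (s / t - 1))" by (intro mult_left_mono) auto
  moreover have "t powr p * (s / t) powr p = s powr p" using assms by (simp add: powr_mult[symmetric])
  moreover have "t powr p * (1 + p * (s / t - 1)) = t powr p + p * (t powr p / t) * (s - t)"
    using assms by (simp add: field_simps)
  moreover have "t powr (p - 1) = t powr p / t" using assms by (simp add: powr_diff)
  ultimately show ?thesis by simp
qed

lemma powr_le_exp:
  fixes t b k :: real
  assumes "0 \<le> t" "0 < b" "0 < k"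
  shows "t powr k \<le> (k / b) powr k * exp (b * t)"
proof -
  have "b * t / k \<le> exp (b * t / k)" using exp_ge_add_one_self[of "b * t / k"] by linarith
  then have "(b * t / k) powr k \<le> exp (b * t / k) powr k" using assms by (intro powr_mono2) auto
  also have "\<dots> = exp (b * t)" using assms by (simp add: powr_def)
  finally have "(k / b) powr k * (b * t / k) powr k \<le> (k / b) powr k * exp (b * t)" by (intro mult_left_mono) auto
  moreover have "(k / b) powr k * (b * t / k) powr k = t powr k" using assms by (simp add: powr_mult[symmetric])
  ultimately show ?thesis by simp
qed

lemma exp_minus_one_le: "exp t - 1 \<le> t * exp t" for t :: real
proof -
  have "exp t * (1 - t) \<le> exp t * exp (- t)" using exp_ge_add_one_self[of "- t"] by (intro mult_left_mono) auto
  then show ?thesis by (simp add: exp_minus_inverse algebra_simps)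
qed

lemma exp_le_quadratic: "exp t \<le> 1 + t + t\<^sup>2 * exp \<bar>t\<bar>" for t :: real
proof (cases "0 \<le> t")
  case True
  have "exp t - 1 - t \<le> t * exp t - t" using exp_minus_one_le[of t] by simp
  also have "\<dots> = t * (exp t - 1)" by (simp add: algebra_simps)
  also have "\<dots> \<le> t * (t * exp t)" using True exp_minus_one_le[of t] by (intro mult_left_mono)
  finally show ?thesis using True by (simp add: power2_eq_square)
next
  case False
  define u where "u = - t"
  have u: "0 < u" "t = - u" using False by (auto simp: u_def)
  have "1 + u \<le> exp u" by (rule exp_ge_add_one_self)
  then have "exp (- u) \<le> 1 / (1 + u)" using u by (simp add: exp_minus field_simps)
  also have "\<dots> \<le> 1 - u + u\<^sup>2" using u by (simp add: field_simps power2_eq_square power3_eq_cube)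
  also have "\<dots> \<le> 1 - u + u\<^sup>2 * exp u" using u by simp
  finally show ?thesis using u by simp
qed

section \<open>The Lyapunov function and its drift\<close>

text \<open>The tail regime \<open>1 \<le> \<beta> < 2\<close>. Here \<open>W - 1\<close> is the noise rescaled by its admissible growth, and \<open>a\<close> is the norm,
  truncated from below so that the Lyapunov function is constant near the origin.\<close>

locale subquadratic_tail = prob_space N for N :: "'u measure" +
  fixes g :: "real ^ 'd \<Rightarrow> 'k \<Rightarrow> 'u \<Rightarrow> real ^ 'd" and h :: "real ^ 'd \<Rightarrow> real ^ 'd"
    and \<Xi> :: "'k set" and \<beta> R K cd lam0 Kexp :: real
  assumes \<beta>: "1 \<le> \<beta>" "\<beta> < 2" and R: "0 < R"
    and g_meas [measurable]: "\<xi> \<in> \<Xi> \<Longrightarrow> g x \<xi> \<in> borel_measurable N"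
    and g_integrable: "\<xi> \<in> \<Xi> \<Longrightarrow> integrable N (g x \<xi>)"
    and K: "1 \<le> K" "\<And>x. norm (h x) \<le> K * max (norm x) (R/2) powr (\<beta> - 1)"
      "\<And>x :: real ^ 'd. 1 + rpow (norm x) (\<beta> - 1) \<le> K * max (norm x) (R/2) powr (\<beta> - 1)"
    and diss: "0 < cd" "\<And>x \<xi>. \<xi> \<in> \<Xi> \<Longrightarrow> R \<le> norm x \<Longrightarrow> cd * norm x powr \<beta> \<le> x \<bullet> (h x + expectation (g x \<xi>))"
    and expint: "0 < lam0" "1 \<le> Kexp"
      "\<And>x \<xi>. \<xi> \<in> \<Xi> \<Longrightarrow> (\<integral>\<^sup>+u. ennreal (exp (lam0 * (norm (g x \<xi> u) / (1 + rpow (norm x) (\<beta> - 1))))) \<partial>N) \<le> ennreal Kexp"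
begin

definition "W x \<xi> u = 1 + norm (g x \<xi> u) / (1 + rpow (norm x) (\<beta> - 1))"
definition "a x = max (norm x) (R / 2)" for x :: "real ^ 'd"
text \<open>The exponent is dictated by the size of a step. The slope of \<open>w\<close> is of
  order \<open>a x powr (1 - \<beta>)\<close>, a step of order
  \<open>\<alpha> * W x \<xi> u * a x powr (\<beta> - 1)\<close>, so \<open>w\<close> changes by
  order \<open>\<alpha> * W x \<xi> u\<close> uniformly in \<open>x\<close>. With the same exponent
  a dissipativity of order \<open>norm x powr \<beta>\<close> yields a drift of constant
  size.\<close>

definition "q = 2 - \<beta>"
definition "w x = a x powr q - (R / 2) powr q"
definition "X \<alpha> x \<xi> u = x - \<alpha> *\<^sub>R (h x + g x \<xi> u)"
text \<open>Half of the admissible exponential rate; the other half absorbs powers of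
  \<open>W\<close> through \<open>powr_le_exp\<close>.\<close>

definition "b = lam0 / 2"

lemma basics: "0 < q" "q \<le> 1" "q - 1 = 1 - \<beta>" "0 < b" "0 < R / 2"
  using \<beta> R expint(1) by (auto simp: q_def b_def)

lemma a_pos: "0 < a x" "R / 2 \<le> a x" "norm x \<le> a x"
  using R by (auto simp: a_def)

lemma rpow_nonneg: "0 \<le> rpow t p"
  by (simp add: rpow_def)

lemma W_ge_1: "1 \<le> W x \<xi> u"
  by (simp add: W_def rpow_nonneg add_nonneg_nonneg)

lemma W_meas [measurable]: "\<xi> \<in> \<Xi> \<Longrightarrow> W x \<xi> \<in> borel_measurable N"
  unfolding W_def[abs_def] by measurable

lemma G_le: "norm (h x + g x \<xi> u) \<le> K * W x \<xi> u * a x powr (\<beta> - 1)"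
proof -
  have p: "0 < 1 + rpow (norm x) (\<beta> - 1)" using rpow_nonneg[of "norm x" "\<beta> - 1"] by simp
  have "norm (g x \<xi> u) = (W x \<xi> u - 1) * (1 + rpow (norm x) (\<beta> - 1))"
    using p by (simp add: W_def)
  also have "\<dots> \<le> (W x \<xi> u - 1) * (K * a x powr (\<beta> - 1))"
    using K(3)[of x] W_ge_1[of x \<xi> u] by (intro mult_left_mono) (auto simp: a_def)
  finally have "norm (h x + g x \<xi> u) \<le> K * a x powr (\<beta> - 1) + (W x \<xi> u - 1) * (K * a x powr (\<beta> - 1))"
    using K(2)[of x] norm_triangle_ineq[of "h x" "g x \<xi> u"] by (simp add: a_def)
  then show ?thesis by (simp add: algebra_simps)
qed

lemma w_Lipschitz: "\<bar>w y - w x\<bar> \<le> norm (y - x) * a x powr (1 - \<beta>)"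
proof -
  have "\<bar>w y - w x\<bar> = \<bar>a y powr q - a x powr q\<bar>" by (simp add: w_def)
  also have "\<dots> \<le> \<bar>a y - a x\<bar> * a x powr (q - 1)"
    using abs_powr_diff_le[of "a x" "a y" q] basics a_pos by simp
  also have "\<bar>a y - a x\<bar> \<le> norm (y - x)"
    using norm_triangle_ineq3[of y x] by (auto simp: a_def max_def)
  finally show ?thesis by (simp add: basics(3) mult_right_mono)
qed

lemma w_step: assumes "0 \<le> \<alpha>" shows "\<bar>w (X \<alpha> x \<xi> u) - w x\<bar> \<le> \<alpha> * K * W x \<xi> u"
proof -
  have "norm (X \<alpha> x \<xi> u - x) = \<alpha> * norm (h x + g x \<xi> u)"
    using assms by (simp add: X_def)
  then have "\<bar>w (X \<alpha> x \<xi> u) - w x\<bar> \<le> \<alpha> * norm (h x + g x \<xi> u) * a x powr (1 - \<beta>)"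
    using w_Lipschitz[of "X \<alpha> x \<xi> u" x] by simp
  also have "\<dots> \<le> \<alpha> * (K * W x \<xi> u * a x powr (\<beta> - 1)) * a x powr (1 - \<beta>)"
    using G_le assms by (intro mult_right_mono mult_left_mono) auto
  also have "\<dots> = \<alpha> * K * W x \<xi> u * (a x powr (\<beta> - 1) * a x powr (1 - \<beta>))" by (simp add: mult_ac)
  also have "a x powr (\<beta> - 1) * a x powr (1 - \<beta>) = 1"
    using a_pos[of x] by (simp add: powr_add[symmetric])
  finally show ?thesis by simp
qed

definition "Q k = (k / b) powr k * (exp lam0 * Kexp)"

lemma Q_pos: "0 < k \<Longrightarrow> 0 < Q k"
  using basics(4) expint(2) by (simp add: Q_def)

text \<open>One factor \<open>exp (b * W x \<xi> u)\<close> is given, a second one comes from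
  \<open>powr_le_exp\<close>, and together they have the exponent \<open>lam0 + lam0 * Y\<close>
  with \<open>Y\<close> the rescaled noise. Hence the factor \<open>exp lam0 * Kexp\<close> in
  \<open>Q\<close>.\<close>

lemma moment:
  assumes \<xi>: "\<xi> \<in> \<Xi>" and k: "0 < k"
  shows "(\<integral>\<^sup>+u. ennreal (W x \<xi> u powr k * exp (b * W x \<xi> u)) \<partial>N) \<le> ennreal (Q k)"
proof -
  let ?Y = "\<lambda>u. norm (g x \<xi> u) / (1 + rpow (norm x) (\<beta> - 1))"
  let ?c = "(k / b) powr k * exp lam0"
  have "(\<integral>\<^sup>+u. ennreal (W x \<xi> u powr k * exp (b * W x \<xi> u)) \<partial>N) \<le> (\<integral>\<^sup>+u. ennreal ?c * ennreal (exp (lam0 * ?Y u)) \<partial>N)"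
  proof (rule nn_integral_mono)
    fix u
    have "W x \<xi> u powr k * exp (b * W x \<xi> u) \<le> (k / b) powr k * exp (b * W x \<xi> u) * exp (b * W x \<xi> u)"
      using powr_le_exp[of "W x \<xi> u" b k] W_ge_1[of x \<xi> u] basics(4) k by (intro mult_right_mono) auto
    also have "\<dots> = ?c * exp (lam0 * ?Y u)"
    proof -
      define Y where "Y = ?Y u"
      have "b * W x \<xi> u + b * W x \<xi> u = lam0 + lam0 * Y"
        by (simp add: W_def b_def Y_def[symmetric] distrib_left)
      then show ?thesis
        by (simp add: exp_add[symmetric] Y_def mult.assoc)
    qed
    finally show "ennreal (W x \<xi> u powr k * exp (b * W x \<xi> u)) \<le> ennreal ?c * ennreal (exp (lam0 * ?Y u))"
      by (simp add: ennreal_mult'[symmetric] ennreal_leI)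
  qed
  also have "\<dots> = ennreal ?c * (\<integral>\<^sup>+u. ennreal (exp (lam0 * ?Y u)) \<partial>N)"
    using \<xi> by (intro nn_integral_cmult) measurable
  also have "\<dots> \<le> ennreal ?c * ennreal Kexp" by (intro mult_left_mono expint \<xi>) simp
  also have "\<dots> = ennreal (Q k)" by (simp add: Q_def ennreal_mult'[symmetric] mult.assoc)
  finally show ?thesis .
qed

lemma nn_integral_le_moment:
  assumes \<xi>: "\<xi> \<in> \<Xi>" and k: "0 < k" and c: "0 \<le> c"
    and f: "\<And>u. f u \<le> c * (W x \<xi> u powr k * exp (b * W x \<xi> u))"
  shows "(\<integral>\<^sup>+u. ennreal (f u) \<partial>N) \<le> ennreal (c * Q k)"
proof -
  have "(\<integral>\<^sup>+u. ennreal (f u) \<partial>N) \<le> (\<integral>\<^sup>+u. ennreal c * ennreal (W x \<xi> u powr k * exp (b * W x \<xi> u)) \<partial>N)"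
    using f c by (intro nn_integral_mono) (simp add: ennreal_mult'[symmetric] ennreal_leI)
  also have "\<dots> = ennreal c * (\<integral>\<^sup>+u. ennreal (W x \<xi> u powr k * exp (b * W x \<xi> u)) \<partial>N)"
    using \<xi> by (intro nn_integral_cmult) measurable
  also have "\<dots> \<le> ennreal c * ennreal (Q k)" by (intro mult_left_mono moment \<xi> k) simp
  also have "\<dots> = ennreal (c * Q k)" using c by (simp add: ennreal_mult')
  finally show ?thesis .
qed

definition "\<psi> s x = exp (s * w x)"

lemma w_cont: "continuous_on UNIV w"
  unfolding w_def[abs_def] a_def[abs_def] using R
  by (intro continuous_intros) auto

lemma w_eq_0: "norm x \<le> R / 2 \<Longrightarrow> w x = 0"
  by (simp add: w_def a_def)

lemma w_mono: "norm x \<le> norm y \<Longrightarrow> w x \<le> w y"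
  using basics a_pos[of x] by (auto simp: w_def a_def intro!: powr_mono2)

lemma w_nonneg: "0 \<le> w x"
  using basics a_pos[of x] R by (auto simp: w_def intro!: powr_mono2)

lemma \<psi>_log_Lipschitz:
  assumes "0 \<le> s" "s \<le> 1"
  shows "\<psi> s y \<le> exp ((R / 2) powr (1 - \<beta>) * norm (y - x)) * \<psi> s x"
proof -
  have "a x powr (1 - \<beta>) \<le> (R / 2) powr (1 - \<beta>)"
    using a_pos[of x] R \<beta> by (intro powr_mono2') auto
  then have "w y - w x \<le> norm (y - x) * (R / 2) powr (1 - \<beta>)"
    using w_Lipschitz[of y x] by (smt (verit) mult_left_mono norm_ge_zero)
  moreover have "s * (w y - w x) \<le> 1 * (norm (y - x) * (R / 2) powr (1 - \<beta>))"
  proof (cases "0 \<le> w y - w x")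
    case True
    then show ?thesis using calculation assms by (intro mult_mono) auto
  next
    case False
    then have "s * (w y - w x) \<le> 0" using assms by (simp add: mult_nonneg_nonpos)
    also have "0 \<le> 1 * (norm (y - x) * (R / 2) powr (1 - \<beta>))" by simp
    finally show ?thesis .
  qed
  ultimately have "s * w y \<le> (R / 2) powr (1 - \<beta>) * norm (y - x) + s * w x"
    by (simp add: algebra_simps)
  then show ?thesis by (simp add: \<psi>_def exp_add[symmetric])
qed

text \<open>\<open>ennreal\<close> truncates at 0, so this concerns the mean increase of
  \<open>\<psi>\<close>, with decreases discarded; only the size of the step in \<open>w\<close> is
  used. The factor \<open>s\<close> allows the increase to be made small against the curvature of a
  bounded annulus, where no drift is available.\<close>

lemma \<psi>_step_le:
  assumes \<xi>: "\<xi> \<in> \<Xi>" and s: "0 \<le> s" "s \<le> 1" and \<alpha>: "0 \<le> \<alpha>" "\<alpha> * K \<le> b"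
  shows "(\<integral>\<^sup>+u. ennreal (\<psi> s (X \<alpha> x \<xi> u) - \<psi> s x) \<partial>N) \<le> ennreal (s * (K * Q 1) * \<alpha> * \<psi> s x)"
proof -
  have "(\<integral>\<^sup>+u. ennreal (\<psi> s (X \<alpha> x \<xi> u) - \<psi> s x) \<partial>N) \<le> ennreal (\<psi> s x * s * \<alpha> * K * Q 1)"
  proof (rule nn_integral_le_moment[OF \<xi>])
    show "0 \<le> \<psi> s x * s * \<alpha> * K" using s \<alpha> K(1) by (simp add: \<psi>_def)
    fix u
    let ?T = "\<alpha> * K * W x \<xi> u"
    have W0: "0 \<le> W x \<xi> u" using W_ge_1[of x \<xi> u] by linarith
    have T: "0 \<le> s * ?T" "s * ?T \<le> b * W x \<xi> u"
    proof -
      show "0 \<le> s * ?T" using s \<alpha> K(1) W0 by simp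
      have "s * ?T \<le> 1 * ?T" using s \<alpha> K(1) W0 by (intro mult_right_mono) auto
      also have "\<dots> \<le> b * W x \<xi> u" using \<alpha> W0 by (simp add: mult_right_mono)
      finally show "s * ?T \<le> b * W x \<xi> u" .
    qed
    have "s * (w (X \<alpha> x \<xi> u) - w x) \<le> s * ?T"
      using w_step[OF \<alpha>(1), of x \<xi> u] s by (intro mult_left_mono) auto
    then have "\<psi> s (X \<alpha> x \<xi> u) \<le> \<psi> s x * exp (s * ?T)"
      by (simp add: \<psi>_def exp_add[symmetric] algebra_simps)
    then have "\<psi> s (X \<alpha> x \<xi> u) - \<psi> s x \<le> \<psi> s x * (exp (s * ?T) - 1)" by (simp add: algebra_simps)
    also have "\<dots> \<le> \<psi> s x * (s * ?T * exp (b * W x \<xi> u))"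
    proof (intro mult_left_mono)
      show "exp (s * ?T) - 1 \<le> s * ?T * exp (b * W x \<xi> u)"
        using exp_minus_one_le[of "s * ?T"] T by (smt (verit) exp_le_cancel_iff mult_left_mono)
    qed (simp add: \<psi>_def)
    also have "\<dots> = \<psi> s x * s * \<alpha> * K * (W x \<xi> u powr 1 * exp (b * W x \<xi> u))" using W0 by simp
    finally show "\<psi> s (X \<alpha> x \<xi> u) - \<psi> s x \<le> \<psi> s x * s * \<alpha> * K * (W x \<xi> u powr 1 * exp (b * W x \<xi> u))" .
  qed simp
  then show ?thesis by (simp add: mult_ac)
qed

text \<open>Here \<open>\<psi> s x = 1\<close>, and \<open>\<psi>\<close> can increase only if the
  step is longer than \<open>R / 4\<close>, that is, if
  \<open>c * \<alpha> * W x \<xi> u \<ge> 1\<close>. The indicator of this event is at most the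
  \<open>m\<close>-th power of that product. The exponent \<open>m\<close> makes the bound smaller
  by a factor \<open>\<alpha>\<close> than the bump height of order
  \<open>\<alpha> powr (m - 1)\<close>.\<close>

lemma \<psi>_jump_le:
  assumes \<xi>: "\<xi> \<in> \<Xi>" and s: "0 \<le> s" "s \<le> 1" and \<alpha>: "0 \<le> \<alpha>" "\<alpha> * K \<le> b" and m: "0 < m"
    and x: "norm x \<le> R / 4"
  defines "c \<equiv> 4 / R * (K * (R / 2) powr (\<beta> - 1))"
  shows "(\<integral>\<^sup>+u. ennreal (\<psi> s (X \<alpha> x \<xi> u) - \<psi> s x) \<partial>N) \<le> ennreal (c powr m * Q m * \<alpha> powr m)"
proof -
  have c: "0 < c" using R K(1) by (simp add: c_def)
  have "(\<integral>\<^sup>+u. ennreal (\<psi> s (X \<alpha> x \<xi> u) - \<psi> s x) \<partial>N) \<le> ennreal ((c * \<alpha>) powr m * Q m)"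
  proof (rule nn_integral_le_moment[OF \<xi> m])
    fix u
    have W0: "0 \<le> W x \<xi> u" using W_ge_1[of x \<xi> u] by linarith
    have ax: "a x = R / 2" using x R by (simp add: a_def)
    have wx: "w x = 0" using x R by (intro w_eq_0) simp
    show "\<psi> s (X \<alpha> x \<xi> u) - \<psi> s x \<le> (c * \<alpha>) powr m * (W x \<xi> u powr m * exp (b * W x \<xi> u))"
    proof (cases "norm (X \<alpha> x \<xi> u) \<le> R / 2")
      case True
      then show ?thesis by (simp add: \<psi>_def wx w_eq_0)
    next
      case False
      have "R / 4 \<le> norm (X \<alpha> x \<xi> u) - norm x" using False x by simp
      also have "\<dots> \<le> norm (X \<alpha> x \<xi> u - x)" by (rule norm_triangle_ineq2)
      also have "\<dots> = \<alpha> * norm (h x + g x \<xi> u)" using \<alpha> by (simp add: X_def)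
      also have "\<dots> \<le> \<alpha> * (K * W x \<xi> u * a x powr (\<beta> - 1))" using \<alpha> G_le by (intro mult_left_mono)
      finally have "1 \<le> c * \<alpha> * W x \<xi> u"
        using R by (simp add: ax c_def field_simps)
      then have one: "1 \<le> (c * \<alpha> * W x \<xi> u) powr m" using m by (simp add: ge_one_powr_ge_zero)
      have "s * w (X \<alpha> x \<xi> u) \<le> 1 * (\<alpha> * K * W x \<xi> u)"
        using w_step[OF \<alpha>(1), of x \<xi> u] s wx w_nonneg by (intro mult_mono) auto
      also have "\<dots> \<le> b * W x \<xi> u" using \<alpha> W0 by (simp add: mult_right_mono)
      finally have "\<psi> s (X \<alpha> x \<xi> u) \<le> exp (b * W x \<xi> u)" by (simp add: \<psi>_def)
      moreover have "\<psi> s x = 1" by (simp add: \<psi>_def wx)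
      ultimately have "\<psi> s (X \<alpha> x \<xi> u) - \<psi> s x \<le> 1 * exp (b * W x \<xi> u)"
        by linarith
      also have "\<dots> \<le> (c * \<alpha> * W x \<xi> u) powr m * exp (b * W x \<xi> u)"
        using one by (intro mult_right_mono) auto
      also have "(c * \<alpha> * W x \<xi> u) powr m = (c * \<alpha>) powr m * W x \<xi> u powr m"
        by (rule powr_mult)
      finally show ?thesis by (simp only: mult.assoc)
    qed
  qed simp
  also have "(c * \<alpha>) powr m * Q m = c powr m * Q m * \<alpha> powr m"
    using c \<alpha> by (simp add: powr_mult)
  finally show ?thesis .
qed

text \<open>If the step leaves the region where \<open>a = norm\<close>, it has length at least \<open>R / 2\<close>; this is absorbed by doubling the
  quadratic term.\<close>

lemma a_square_step_le:
  assumes "R \<le> norm x" "0 \<le> \<alpha>"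
  shows "(a (X \<alpha> x \<xi> u))\<^sup>2 \<le> (norm x)\<^sup>2 - 2 * \<alpha> * (x \<bullet> (h x + g x \<xi> u)) + 2 * (\<alpha>\<^sup>2 * (norm (h x + g x \<xi> u))\<^sup>2)"
proof -
  define G where "G = h x + g x \<xi> u"
  have eq: "(norm (X \<alpha> x \<xi> u))\<^sup>2 = (norm x)\<^sup>2 - 2 * \<alpha> * (x \<bullet> G) + \<alpha>\<^sup>2 * (norm G)\<^sup>2"
    unfolding X_def G_def[symmetric] power2_norm_eq_inner
    by (simp add: inner_diff_left inner_diff_right inner_commute power2_eq_square algebra_simps)
  show ?thesis
  proof (cases "R / 2 \<le> norm (X \<alpha> x \<xi> u)")
    case True
    then show ?thesis using eq by (simp add: a_def G_def)
  next
    case False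
    have "R / 2 \<le> norm x - norm (X \<alpha> x \<xi> u)" using False assms by simp
    also have "\<dots> \<le> norm (x - X \<alpha> x \<xi> u)" by (rule norm_triangle_ineq2)
    also have "\<dots> = \<alpha> * norm G" using assms by (simp add: X_def G_def)
    finally have "(R / 2)\<^sup>2 \<le> \<alpha>\<^sup>2 * (norm G)\<^sup>2" using R by (metis basics(5) less_imp_le power_mono power_mult_distrib)
    moreover have "0 \<le> (norm (X \<alpha> x \<xi> u))\<^sup>2" by simp
    moreover have a: "a (X \<alpha> x \<xi> u) = R / 2" using False by (simp add: a_def)
    ultimately show ?thesis using eq unfolding G_def[symmetric] a by linarith
  qed
qed

text \<open>Up to a constant, \<open>w\<close> is the power \<open>q / 2\<close> of the square of
  \<open>a\<close>, hence concave in that square. The tangent bound leaves the squared step as the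
  only second-order term, and the latter times \<open>norm x powr (- \<beta>)\<close> stays bounded
  in the tail because \<open>\<beta> < 2\<close>.\<close>

lemma w_drift:
  assumes x: "R \<le> norm x" and \<alpha>: "0 \<le> \<alpha>"
  shows "w (X \<alpha> x \<xi> u) - w x \<le> - (\<alpha> * q * norm x powr (- \<beta>) * (x \<bullet> (h x + g x \<xi> u))) + \<alpha>\<^sup>2 * K\<^sup>2 * R powr (\<beta> - 2) * (W x \<xi> u)\<^sup>2"
proof -
  define G where "G = h x + g x \<xi> u"
  have x0: "0 < norm x" using x R by linarith
  have ax: "a x = norm x" using x R by (simp add: a_def)
  have half: "(t\<^sup>2) powr (q / 2) = t powr q" if "0 < t" for t :: real
    using that by (simp add: powr_powr flip: powr_numeral)
  have sq: "(t\<^sup>2) powr (q / 2 - 1) = t powr (- \<beta>)" if "0 < t" for t :: real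
  proof -
    have "(t\<^sup>2) powr (q / 2 - 1) = t powr (2 * (q / 2 - 1))" using that by (simp add: powr_powr flip: powr_numeral)
    also have "2 * (q / 2 - 1) = - \<beta>" by (simp add: q_def field_simps)
    finally show ?thesis .
  qed
  have "w (X \<alpha> x \<xi> u) - w x = ((a (X \<alpha> x \<xi> u))\<^sup>2) powr (q / 2) - ((norm x)\<^sup>2) powr (q / 2)"
    using a_pos[of "X \<alpha> x \<xi> u"] x0 by (simp add: w_def ax half)
  also have "\<dots> \<le> q / 2 * ((norm x)\<^sup>2) powr (q / 2 - 1) * ((a (X \<alpha> x \<xi> u))\<^sup>2 - (norm x)\<^sup>2)"
    using a_pos[of "X \<alpha> x \<xi> u"] x0 basics by (intro powr_le_tangent) auto
  also have "\<dots> \<le> q / 2 * norm x powr (- \<beta>) * (- 2 * \<alpha> * (x \<bullet> G) + 2 * (\<alpha>\<^sup>2 * (norm G)\<^sup>2))"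
    unfolding sq[OF x0] using a_square_step_le[OF x \<alpha>, of \<xi> u] basics
    by (intro mult_left_mono) (auto simp: G_def)
  also have "\<dots> = - (\<alpha> * q * norm x powr (- \<beta>) * (x \<bullet> G)) + q * (\<alpha>\<^sup>2 * (norm x powr (- \<beta>) * (norm G)\<^sup>2))"
    by (simp add: field_simps)
  also have "q * (\<alpha>\<^sup>2 * (norm x powr (- \<beta>) * (norm G)\<^sup>2)) \<le> 1 * (\<alpha>\<^sup>2 * (K\<^sup>2 * (W x \<xi> u)\<^sup>2 * R powr (\<beta> - 2)))"
  proof -
    have "norm x powr (- \<beta>) * (norm G)\<^sup>2 \<le> norm x powr (- \<beta>) * (K * W x \<xi> u * norm x powr (\<beta> - 1))\<^sup>2"
      using G_le[of x \<xi> u] by (intro mult_left_mono power_mono) (auto simp: G_def ax)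
    also have "\<dots> = K\<^sup>2 * (W x \<xi> u)\<^sup>2 * (norm x powr (- \<beta>) * (norm x powr (\<beta> - 1) * norm x powr (\<beta> - 1)))"
      by (simp add: power_mult_distrib power2_eq_square mult_ac)
    also have "norm x powr (- \<beta>) * (norm x powr (\<beta> - 1) * norm x powr (\<beta> - 1)) = norm x powr (\<beta> - 2)"
      using x0 by (simp add: powr_add[symmetric])
    also have "K\<^sup>2 * (W x \<xi> u)\<^sup>2 * norm x powr (\<beta> - 2) \<le> K\<^sup>2 * (W x \<xi> u)\<^sup>2 * R powr (\<beta> - 2)"
      using x R \<beta> by (intro mult_left_mono powr_mono2') auto
    finally have "\<alpha>\<^sup>2 * (norm x powr (- \<beta>) * (norm G)\<^sup>2) \<le> \<alpha>\<^sup>2 * (K\<^sup>2 * (W x \<xi> u)\<^sup>2 * R powr (\<beta> - 2))"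
      by (rule mult_left_mono) simp
    then show ?thesis using basics by (intro mult_mono[of q 1]) auto
  qed
  finally show ?thesis by (simp add: G_def mult_ac)
qed

text \<open>The linear term of the exponential carries the noise with its sign, so its mean is
  governed by \<open>diss\<close>; the powers of \<open>norm x\<close> cancel and leave the drift
  \<open>s * q * cd * \<alpha>\<close>. All second-order terms are dominated by multiples of
  \<open>(W x \<xi> u)\<^sup>2 * exp (b * W x \<xi> u)\<close>, whose mean is at most
  \<open>Q 2\<close>.\<close>

lemma \<psi>_drift:
  assumes \<xi>: "\<xi> \<in> \<Xi>" and s: "0 \<le> s" "s \<le> 1" and \<alpha>: "0 \<le> \<alpha>" "\<alpha> * K \<le> b" and x: "R \<le> norm x"
  shows "(\<integral>\<^sup>+u. ennreal (\<psi> s (X \<alpha> x \<xi> u)) \<partial>N) \<le>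
    ennreal (\<psi> s x * (1 - s * q * cd * \<alpha> + \<alpha>\<^sup>2 * (K\<^sup>2 * (R powr (\<beta> - 2) + 1) * Q 2)))"
proof -
  define C3 where "C3 = K\<^sup>2 * (R powr (\<beta> - 2) + 1)"
  define A where "A = s * \<alpha> * q * norm x powr (- \<beta>)"
  define f where "f = (\<lambda>u. 1 - A * (x \<bullet> (h x + g x \<xi> u)) + \<alpha>\<^sup>2 * C3 * ((W x \<xi> u)\<^sup>2 * exp (b * W x \<xi> u)))"
  have x0: "0 < norm x" using x R by linarith
  have C3: "0 \<le> C3" by (simp add: C3_def)
  have A: "0 \<le> A" using s \<alpha> basics by (simp add: A_def)
  have pt: "\<psi> s (X \<alpha> x \<xi> u) \<le> \<psi> s x * f u" for u
  proof -
    let ?\<Delta> = "w (X \<alpha> x \<xi> u) - w x" and ?W = "W x \<xi> u"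
    have W1: "1 \<le> ?W" by (rule W_ge_1)
    have step: "\<bar>?\<Delta>\<bar> \<le> \<alpha> * K * ?W" by (rule w_step[OF \<alpha>(1)])
    have sD: "\<bar>s * ?\<Delta>\<bar> \<le> \<alpha> * K * ?W"
    proof -
      have "\<bar>s * ?\<Delta>\<bar> = s * \<bar>?\<Delta>\<bar>" using s by (simp add: abs_mult)
      also have "\<dots> \<le> 1 * \<bar>?\<Delta>\<bar>" using s by (intro mult_right_mono) auto
      finally show ?thesis using step by simp
    qed
    have "exp (s * ?\<Delta>) \<le> 1 + s * ?\<Delta> + (s * ?\<Delta>)\<^sup>2 * exp \<bar>s * ?\<Delta>\<bar>" by (rule exp_le_quadratic)
    also have "(s * ?\<Delta>)\<^sup>2 * exp \<bar>s * ?\<Delta>\<bar> \<le> (\<alpha> * K * ?W)\<^sup>2 * exp (b * ?W)"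
    proof (intro mult_mono)
      show "(s * ?\<Delta>)\<^sup>2 \<le> (\<alpha> * K * ?W)\<^sup>2" using sD by (simp add: abs_le_square_iff[symmetric])
      have "\<alpha> * K * ?W \<le> b * ?W" using \<alpha> W1 by (intro mult_right_mono) auto
      then show "exp \<bar>s * ?\<Delta>\<bar> \<le> exp (b * ?W)" using sD by simp
    qed auto
    also have "s * ?\<Delta> \<le> - (A * (x \<bullet> (h x + g x \<xi> u))) + \<alpha>\<^sup>2 * K\<^sup>2 * R powr (\<beta> - 2) * ?W\<^sup>2"
    proof -
      have "s * ?\<Delta> \<le> s * (- (\<alpha> * q * norm x powr (- \<beta>) * (x \<bullet> (h x + g x \<xi> u))) + \<alpha>\<^sup>2 * K\<^sup>2 * R powr (\<beta> - 2) * ?W\<^sup>2)"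
        using w_drift[OF x \<alpha>(1), of \<xi> u] s by (intro mult_left_mono)
      also have "\<dots> = - (A * (x \<bullet> (h x + g x \<xi> u))) + s * (\<alpha>\<^sup>2 * K\<^sup>2 * R powr (\<beta> - 2) * ?W\<^sup>2)"
        by (simp add: A_def algebra_simps)
      also have "s * (\<alpha>\<^sup>2 * K\<^sup>2 * R powr (\<beta> - 2) * ?W\<^sup>2) \<le> 1 * (\<alpha>\<^sup>2 * K\<^sup>2 * R powr (\<beta> - 2) * ?W\<^sup>2)"
        using s by (intro mult_right_mono) auto
      finally show ?thesis by simp
    qed
    also have "\<alpha>\<^sup>2 * K\<^sup>2 * R powr (\<beta> - 2) * ?W\<^sup>2 \<le> \<alpha>\<^sup>2 * K\<^sup>2 * R powr (\<beta> - 2) * (?W\<^sup>2 * exp (b * ?W))"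
    proof (intro mult_left_mono)
      have "1 \<le> exp (b * ?W)" using basics W1 by simp
      then show "?W\<^sup>2 \<le> ?W\<^sup>2 * exp (b * ?W)" by (simp add: mult_le_cancel_left1)
    qed auto
    finally have "exp (s * ?\<Delta>) \<le> f u"
      by (simp add: f_def C3_def algebra_simps power_mult_distrib)
    moreover have "\<psi> s (X \<alpha> x \<xi> u) = \<psi> s x * exp (s * ?\<Delta>)"
      by (simp add: \<psi>_def exp_add[symmetric] algebra_simps)
    ultimately show ?thesis by (simp add: \<psi>_def)
  qed
  let ?M = "\<lambda>u. (W x \<xi> u)\<^sup>2 * exp (b * W x \<xi> u)"
  have M2: "?M u = W x \<xi> u powr 2 * exp (b * W x \<xi> u)" for u
    using W_ge_1[of x \<xi> u] by simp
  have Mle: "(\<integral>\<^sup>+u. ennreal (?M u) \<partial>N) \<le> ennreal (Q 2)"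
    unfolding M2 by (rule moment[OF \<xi>]) simp
  have Mint: "integrable N ?M"
    using Mle \<xi> by (intro integrableI_nonneg) (auto simp: less_top[symmetric] top_unique)
  have Mexp: "expectation ?M \<le> Q 2"
    using Mle nn_integral_eq_integral[OF Mint] Q_pos[of 2] by (simp add: ennreal_le_iff)
  have gi: "integrable N (\<lambda>u. x \<bullet> (h x + g x \<xi> u))"
    using g_integrable[OF \<xi>] by (intro integrable_inner_right Bochner_Integration.integrable_add) auto
  have fint: "integrable N f"
    unfolding f_def using gi Mint
    by (intro Bochner_Integration.integrable_add Bochner_Integration.integrable_diff integrable_mult_right integrable_const)
  have Ef: "expectation f = 1 - A * (x \<bullet> (h x + expectation (g x \<xi>))) + \<alpha>\<^sup>2 * C3 * expectation ?M"
  proof -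
    have "expectation (\<lambda>u. x \<bullet> (h x + g x \<xi> u)) = x \<bullet> (h x + expectation (g x \<xi>))"
      using g_integrable[OF \<xi>] by (simp add: prob_space)
    then show ?thesis unfolding f_def using gi Mint by (simp add: prob_space)
  qed
  have "A * (cd * norm x powr \<beta>) \<le> A * (x \<bullet> (h x + expectation (g x \<xi>)))"
    using A diss(2)[OF \<xi> x] by (intro mult_left_mono)
  moreover have "A * (cd * norm x powr \<beta>) = s * q * cd * \<alpha>"
    using x0 by (simp add: A_def powr_minus field_simps)
  moreover have "\<alpha>\<^sup>2 * C3 * expectation ?M \<le> \<alpha>\<^sup>2 * C3 * Q 2" using Mexp C3 by (intro mult_left_mono) auto
  ultimately have Efle: "expectation f \<le> 1 - s * q * cd * \<alpha> + \<alpha>\<^sup>2 * (C3 * Q 2)"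
    unfolding Ef by (simp add: mult.assoc)
  have "(\<integral>\<^sup>+u. ennreal (\<psi> s (X \<alpha> x \<xi> u)) \<partial>N) \<le> (\<integral>\<^sup>+u. ennreal (\<psi> s x * f u) \<partial>N)"
    by (intro nn_integral_mono ennreal_leI pt)
  also have "\<dots> = ennreal (expectation (\<lambda>u. \<psi> s x * f u))"
  proof (intro nn_integral_eq_integral integrable_mult_right fint AE_I2)
    fix u have "0 \<le> \<psi> s (X \<alpha> x \<xi> u)" by (simp add: \<psi>_def)
    then show "0 \<le> \<psi> s x * f u" using pt[of u] by linarith
  qed
  also have "\<dots> \<le> ennreal (\<psi> s x * (1 - s * q * cd * \<alpha> + \<alpha>\<^sup>2 * (C3 * Q 2)))"
    using Efle fint by (intro ennreal_leI) (auto simp: \<psi>_def intro!: mult_left_mono)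
  finally show ?thesis by (simp add: C3_def)
qed

text \<open>This controls the mean cost of the first step from the origin, where the gradient
  vanishes and the chain moves by \<open>\<alpha>\<close> times the noise.\<close>

lemma start_moment:
  assumes \<xi>: "\<xi> \<in> \<Xi>" and s: "0 \<le> s" "s \<le> 1" and \<alpha>: "0 \<le> \<alpha>" "\<alpha> * (2 * (R / 2) powr (1 - \<beta>)) \<le> b"
  shows "(\<integral>\<^sup>+u. ennreal (\<psi> s (\<alpha> *\<^sub>R g 0 \<xi> u) * norm (g 0 \<xi> u)) \<partial>N) < \<infinity>"
proof -
  have "(\<integral>\<^sup>+u. ennreal (\<psi> s (\<alpha> *\<^sub>R g 0 \<xi> u) * norm (g 0 \<xi> u)) \<partial>N) \<le> ennreal (2 * Q 1)"
  proof (rule nn_integral_le_moment[OF \<xi>])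
    fix u
    have W0: "0 \<le> W 0 \<xi> u" using W_ge_1[of 0 \<xi> u] by linarith
    define Z where "Z = norm (g 0 \<xi> u) / (1 + rpow (norm (0::real ^ 'd)) (\<beta> - 1))"
    \<comment> \<open>By the convention for \<open>rpow\<close> the denominator at the origin is 2
      if \<open>\<beta> = 1\<close> and 1 otherwise; the factor 2 in \<open>gW\<close> covers both
      cases.\<close>
    have r: "rpow (norm (0::real ^ 'd)) (\<beta> - 1) \<le> 1" "0 \<le> rpow (norm (0::real ^ 'd)) (\<beta> - 1)" by (auto simp: rpow_def)
    then have "norm (g 0 \<xi> u) / 2 \<le> Z"
      unfolding Z_def by (intro divide_left_mono) auto
    moreover have "W 0 \<xi> u = 1 + Z" by (simp add: W_def Z_def)
    ultimately have gW: "norm (g 0 \<xi> u) \<le> 2 * W 0 \<xi> u" by linarith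
    have w0: "w 0 = 0" using R by (intro w_eq_0) simp
    have "a 0 = R / 2" using R by (simp add: a_def)
    then have "w (\<alpha> *\<^sub>R g 0 \<xi> u) \<le> norm (\<alpha> *\<^sub>R g 0 \<xi> u - 0) * (R / 2) powr (1 - \<beta>)"
      using w_Lipschitz[of "\<alpha> *\<^sub>R g 0 \<xi> u" 0] w0 abs_ge_self[of "w (\<alpha> *\<^sub>R g 0 \<xi> u) - w 0"] by (simp only: diff_0_right)
    also have "\<dots> = \<alpha> * norm (g 0 \<xi> u) * (R / 2) powr (1 - \<beta>)" using \<alpha> by simp
    also have "\<dots> \<le> \<alpha> * (2 * W 0 \<xi> u) * (R / 2) powr (1 - \<beta>)"
      using gW \<alpha> by (intro mult_right_mono mult_left_mono) auto
    also have "\<dots> = \<alpha> * (2 * (R / 2) powr (1 - \<beta>)) * W 0 \<xi> u" by simp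
    also have "\<dots> \<le> b * W 0 \<xi> u" using \<alpha> W0 by (intro mult_right_mono)
    finally have "s * w (\<alpha> *\<^sub>R g 0 \<xi> u) \<le> 1 * (b * W 0 \<xi> u)"
      using s w_nonneg by (intro mult_mono) auto
    then have "\<psi> s (\<alpha> *\<^sub>R g 0 \<xi> u) \<le> exp (b * W 0 \<xi> u)" by (simp add: \<psi>_def)
    then have "\<psi> s (\<alpha> *\<^sub>R g 0 \<xi> u) * norm (g 0 \<xi> u) \<le> exp (b * W 0 \<xi> u) * (2 * W 0 \<xi> u)"
      using gW by (intro mult_mono) auto
    then show "\<psi> s (\<alpha> *\<^sub>R g 0 \<xi> u) * norm (g 0 \<xi> u) \<le> 2 * (W 0 \<xi> u powr 1 * exp (b * W 0 \<xi> u))"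
      using W0 by (simp add: mult_ac)
  qed auto
  also have "\<dots> < \<infinity>" by simp
  finally show ?thesis .
qed

end

section \<open>The weight\<close>

definition cutoff :: "real \<Rightarrow> real" where "cutoff t = max 0 (min 1 (2 - t))"

lemma cutoff: "0 \<le> cutoff t" "cutoff t \<le> 1" "t \<le> 1 \<Longrightarrow> cutoff t = 1" "2 \<le> t \<Longrightarrow> cutoff t = 0"
  "cutoff s \<le> cutoff t + \<bar>s - t\<bar>"
  by (auto simp: cutoff_def)

lemma continuous_on_cutoff [continuous_intros]: "continuous_on S f \<Longrightarrow> continuous_on S (\<lambda>x. cutoff (f x))"
  unfolding cutoff_def by (intro continuous_intros)

text \<open>The weight is \<open>V = \<psi> + B\<close>. The Lyapunov function \<open>\<psi>\<close> makes up for the missing curvature in the tail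
  (the region \<open>far\<close>). The bump \<open>B\<close>, of height \<open>\<kappa> \<alpha>\<^sup>m\<^sup>-\<^sup>1\<close> and radius of order \<open>\<alpha>\<close>, makes up for the vanishing curvature at
  the origin when \<open>m > 2\<close>: from there the nondegenerate noise leaves the support of \<open>B\<close> with positive probability.\<close>

locale sgd_lyapunov = sgd N \<Xi> \<Phi> g h h' L\<Phi> Lg L \<theta>
  for N :: "'u measure" and \<Xi> :: "(real ^ 'e) set" and \<Phi> and g :: "real ^ 'd \<Rightarrow> real ^ 'e \<Rightarrow> real ^ 'd"
    and h h' L\<Phi> Lg L \<theta> +
  fixes \<psi> :: "real ^ 'd \<Rightarrow> real" and far :: "real ^ 'd \<Rightarrow> bool"
    and m R0 cin kmid c' C \<alpha>1 \<Lambda> \<epsilon> p :: real and \<xi>s :: "real ^ 'e"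
  assumes m: "2 \<le> m" and R0: "0 < R0" and par_pos: "0 < cin" "0 < kmid" "0 < c'" "0 \<le> C" "0 < \<alpha>1" "0 \<le> \<Lambda>" "0 < \<epsilon>" "0 < p"
    and \<psi>: "continuous_on UNIV \<psi>" "\<And>x. 1 \<le> \<psi> x" "\<And>x y. \<psi> y \<le> exp (\<Lambda> * norm (y - x)) * \<psi> x"
      "\<And>x y. norm x \<le> norm y \<Longrightarrow> \<psi> x \<le> \<psi> y"
    and inner_convex: "norm x \<le> R0 \<Longrightarrow> x \<noteq> 0 \<or> m = 2 \<Longrightarrow> cin * rpow (norm x) (m - 2) * (norm v)\<^sup>2 \<le> v \<bullet> h' x v"
    and mid_convex: "R0 < norm x \<Longrightarrow> \<not> far x \<Longrightarrow> kmid * (norm v)\<^sup>2 \<le> v \<bullet> h' x v"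
    and near: "norm x \<le> R0 \<Longrightarrow> \<psi> x = 1"
    and jump: "norm x \<le> R0 \<Longrightarrow> \<xi> \<in> \<Xi> \<Longrightarrow> 0 < \<alpha> \<Longrightarrow> \<alpha> \<le> \<alpha>1 \<Longrightarrow>
      (\<integral>\<^sup>+u. ennreal (\<psi> (X1 \<alpha> x \<xi> u) - \<psi> x) \<partial>N) \<le> ennreal (C * \<alpha> powr m)"
    and mid: "\<not> far x \<Longrightarrow> \<xi> \<in> \<Xi> \<Longrightarrow> 0 < \<alpha> \<Longrightarrow> \<alpha> \<le> \<alpha>1 \<Longrightarrow>
      (\<integral>\<^sup>+u. ennreal (\<psi> (X1 \<alpha> x \<xi> u) - \<psi> x) \<partial>N) \<le> ennreal (((1 - \<theta>) / 2) * kmid / 4 * \<alpha> * \<psi> x)"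
    and everywhere: "\<xi> \<in> \<Xi> \<Longrightarrow> 0 < \<alpha> \<Longrightarrow> \<alpha> \<le> \<alpha>1 \<Longrightarrow>
      (\<integral>\<^sup>+u. ennreal (\<psi> (X1 \<alpha> x \<xi> u) - \<psi> x) \<partial>N) \<le> ennreal (C * \<alpha> * \<psi> x)"
    and drift: "far x \<Longrightarrow> \<xi> \<in> \<Xi> \<Longrightarrow> 0 < \<alpha> \<Longrightarrow> \<alpha> \<le> \<alpha>1 \<Longrightarrow>
      (\<integral>\<^sup>+u. ennreal (\<psi> (X1 \<alpha> x \<xi> u)) \<partial>N) \<le> ennreal ((1 - c' * \<alpha>) * \<psi> x)"
    and nondeg: "2 < m \<Longrightarrow> \<xi> \<in> \<Xi> \<Longrightarrow> p \<le> measure N {u \<in> space N. \<epsilon> \<le> norm (g 0 (\<Phi> \<xi> u))}"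
    and \<xi>s: "\<xi>s \<in> \<Xi>" "integrable N (\<lambda>u. norm (\<Phi> \<xi>s u - \<xi>s))"
    and start: "0 < \<alpha> \<Longrightarrow> \<alpha> \<le> \<alpha>1 \<Longrightarrow> (\<integral>\<^sup>+u. ennreal (\<psi> (\<alpha> *\<^sub>R g 0 (\<Phi> \<xi>s u)) * norm (g 0 (\<Phi> \<xi>s u))) \<partial>N) < \<infinity>"
begin

lemma \<psi>_meas [measurable]: "\<psi> \<in> borel_measurable borel"
  by (rule borel_measurable_continuous_onI[OF \<psi>(1)])

section \<open>The weight for a fixed stepsize\<close>

context
  fixes \<alpha> c r \<kappa> A \<gamma> l \<rho> :: real
  defines "\<gamma> \<equiv> (1 - \<theta>) / 2" and "A \<equiv> \<alpha> powr (m - 1)" and "l \<equiv> expectation L\<Phi>" and "\<rho> \<equiv> 1 - c * A"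
  assumes \<alpha>: "0 < \<alpha>" "\<alpha> < 1" "\<alpha> \<le> \<alpha>1" "\<alpha> * L \<le> 1"
    and c: "0 < c" "c < 1" and r: "0 < r" "r \<le> 1" "2 < m \<Longrightarrow> 3 * r \<le> \<epsilon>" "r * \<alpha> \<le> R0" and \<kappa>: "0 < \<kappa>"
    and \<kappa>_le: "\<kappa> \<le> \<gamma> * cin * rpow r (m - 2) / 4" "\<kappa> \<le> \<gamma> * kmid / 4" "\<kappa> \<le> c' / 2"
    and c_le: "c * (1 + \<kappa>) \<le> \<kappa> * p / 2" "c \<le> \<gamma> * cin * rpow r (m - 2) / 2" "c \<le> \<gamma> * kmid / 2" "c \<le> c' / 2" "c \<le> (1 - l) / 2"
    and \<alpha>_le: "C * \<alpha> \<le> \<kappa> * p / 2" "C * \<alpha> \<le> \<gamma> * cin * rpow r (m - 2) / 4" "\<alpha> * (Lg + (C + \<kappa>) * (Lg + 1)) \<le> (1 - l) / 2"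
      "\<alpha> * kmid \<le> 1" "\<alpha> * cin \<le> 1"
begin

definition "B x = \<kappa> * A * cutoff (norm x / (r * \<alpha>))" for x :: "real ^ 'd"
definition "V x = \<psi> x + B x"

lemma \<gamma>: "0 < \<gamma>" "\<gamma> \<le> 1 / 2" using \<theta> by (auto simp: \<gamma>_def)

lemma A: "0 < A" "A \<le> \<alpha>" "A \<le> 1" "\<alpha> * rpow \<alpha> (m - 2) = A" "\<alpha> powr m = \<alpha> * A"
proof -
  show "0 < A" using \<alpha> by (simp add: A_def)
  have "\<alpha> powr (m - 1) \<le> \<alpha> powr 1" using \<alpha> m by (intro powr_mono') auto
  then show "A \<le> \<alpha>" using \<alpha> by (simp add: A_def)
  then show "A \<le> 1" using \<alpha> by simp
  show "\<alpha> * rpow \<alpha> (m - 2) = A" using \<alpha> by (auto simp: rpow_def A_def powr_mult_base)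
  show "\<alpha> powr m = \<alpha> * A" using \<alpha> by (simp add: A_def powr_mult_base)
qed

lemma B: "0 \<le> B x" "B x \<le> \<kappa> * A" "norm x \<le> r * \<alpha> \<Longrightarrow> B x = \<kappa> * A" "2 * (r * \<alpha>) \<le> norm x \<Longrightarrow> B x = 0"
proof -
  have ra: "0 < r * \<alpha>" using r \<alpha> by simp
  have kA: "0 \<le> \<kappa> * A" using \<kappa> A by simp
  show "0 \<le> B x" using kA cutoff(1) by (simp add: B_def)
  show "B x \<le> \<kappa> * A" using mult_left_mono[OF cutoff(2) kA] by (simp add: B_def)
  show "B x = \<kappa> * A" if "norm x \<le> r * \<alpha>"
    using cutoff(3)[of "norm x / (r * \<alpha>)"] ra that by (simp add: B_def)
  show "B x = 0" if "2 * (r * \<alpha>) \<le> norm x"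
    using cutoff(4)[of "norm x / (r * \<alpha>)"] ra that by (simp add: B_def pos_le_divide_eq)
qed

lemma B_cont: "continuous_on UNIV B"
  using r \<alpha> unfolding B_def[abs_def] by (intro continuous_intros) auto

lemma B_meas [measurable]: "B \<in> borel_measurable borel"
  by (rule borel_measurable_continuous_onI[OF B_cont])

lemma V_cont: "continuous_on UNIV V"
  unfolding V_def[abs_def] by (intro continuous_intros \<psi> B_cont)

lemma V_ge_1: "1 \<le> V x" using \<psi>(2)[of x] B(1)[of x] by (simp add: V_def)

text \<open>Since \<open>V x \<ge> 1\<close>, the additive Lipschitz bound of the bump turns into a
  multiplicative one. The size of the constant is immaterial, as it enters only through
  infinitesimal displacements.\<close>

lemma V_log_Lipschitz: "V y \<le> exp ((\<Lambda> + \<kappa> * A / (r * \<alpha>)) * norm (y - x)) * V x"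
proof -
  define k where "k = \<kappa> * A / (r * \<alpha>)"
  define n where "n = norm (y - x)"
  have ra: "0 < r * \<alpha>" using r \<alpha> by simp
  have k: "0 \<le> k" using \<kappa> A ra by (simp add: k_def)
  have n: "0 \<le> n" by (simp add: n_def)
  have "\<bar>norm y / (r * \<alpha>) - norm x / (r * \<alpha>)\<bar> = \<bar>norm y - norm x\<bar> / (r * \<alpha>)"
    using ra by (simp add: diff_divide_distrib[symmetric])
  also have "\<dots> \<le> n / (r * \<alpha>)" using ra norm_triangle_ineq3[of y x] by (intro divide_right_mono) (auto simp: n_def)
  finally have "cutoff (norm y / (r * \<alpha>)) \<le> cutoff (norm x / (r * \<alpha>)) + n / (r * \<alpha>)"
    using cutoff(5)[of "norm y / (r * \<alpha>)" "norm x / (r * \<alpha>)"] by linarith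
  then have "\<kappa> * A * cutoff (norm y / (r * \<alpha>)) \<le> \<kappa> * A * (cutoff (norm x / (r * \<alpha>)) + n / (r * \<alpha>))"
    using \<kappa> A by (intro mult_left_mono) auto
  then have Bd: "B y \<le> B x + k * n" by (simp add: B_def k_def distrib_left)
  have "V y \<le> exp (\<Lambda> * n) * \<psi> x + B x + k * n" using \<psi>(3)[of y x] Bd by (simp add: V_def n_def)
  also have "\<dots> \<le> exp (\<Lambda> * n) * (V x + k * n)"
  proof -
    have "1 \<le> exp (\<Lambda> * n)" using par_pos n by simp
    then have "1 * (B x + k * n) \<le> exp (\<Lambda> * n) * (B x + k * n)" using B(1)[of x] k n by (intro mult_right_mono) auto
    then show ?thesis by (simp add: V_def algebra_simps)
  qed
  also have "\<dots> \<le> exp (\<Lambda> * n) * (V x * exp (k * n))"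
  proof (intro mult_left_mono)
    have "V x + k * n \<le> V x * (1 + k * n)"
      using V_ge_1[of x] mult_right_mono[of 1 "V x" "k * n"] k n by (simp add: distrib_left)
    also have "\<dots> \<le> V x * exp (k * n)" using V_ge_1[of x] by (intro mult_left_mono exp_ge_add_one_self) auto
    finally show "V x + k * n \<le> V x * exp (k * n)" .
  qed simp
  also have "\<dots> = exp ((\<Lambda> + k) * n) * V x" by (simp add: distrib_right exp_add)
  finally show ?thesis by (simp add: k_def n_def)
qed

lemma nn_integral_shifted_le:
  assumes \<xi>: "\<xi> \<in> \<Xi>" and f: "\<And>u. u \<in> space N \<Longrightarrow> f u \<le> (\<psi> (X1 \<alpha> x \<xi> u) - \<psi> x) + b" and b: "0 \<le> b" "0 \<le> a"
    and int: "(\<integral>\<^sup>+u. ennreal (\<psi> (X1 \<alpha> x \<xi> u) - \<psi> x) \<partial>N) \<le> ennreal a"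
  shows "(\<integral>\<^sup>+u. ennreal (f u) \<partial>N) \<le> ennreal (a + b)"
proof -
  note [measurable] = X1_meas[OF \<xi>]
  have "(\<integral>\<^sup>+u. ennreal (f u) \<partial>N) \<le> (\<integral>\<^sup>+u. ennreal (\<psi> (X1 \<alpha> x \<xi> u) - \<psi> x) + ennreal b \<partial>N)"
  proof (rule nn_integral_mono)
    fix u assume u: "u \<in> space N"
    have "ennreal (f u) \<le> ennreal (max 0 (\<psi> (X1 \<alpha> x \<xi> u) - \<psi> x) + b)" using f[OF u] by (intro ennreal_leI) simp
    also have "\<dots> = ennreal (\<psi> (X1 \<alpha> x \<xi> u) - \<psi> x) + ennreal b" using b by (simp add: ennreal_plus)
    finally show "ennreal (f u) \<le> \<dots>" .
  qed
  also have "\<dots> = (\<integral>\<^sup>+u. ennreal (\<psi> (X1 \<alpha> x \<xi> u) - \<psi> x) \<partial>N) + ennreal b"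
    by (subst nn_integral_add) (auto simp: emeasure_space_1)
  also have "\<dots> \<le> ennreal a + ennreal b" by (intro add_right_mono int)
  also have "\<dots> = ennreal (a + b)" using b by (simp add: ennreal_plus)
  finally show ?thesis .
qed

lemma V_le: "V x \<le> \<psi> x + \<kappa> * A" using B(2)[of x] by (simp add: V_def)

text \<open>If \<open>\<epsilon> \<le> norm (g 0 (\<Phi> \<xi> u))\<close>, the step from 0 ends at
  distance at least \<open>3 * (r * \<alpha>)\<close> from 0. Steps do not expand distances, so the
  step from \<open>x\<close> ends within \<open>r * \<alpha>\<close> of that point, hence outside
  the support of the bump. This is the origin of the factor 3 in
  \<open>3 * r \<le> \<epsilon>\<close>.\<close>

lemma leave_bump:
  assumes m2: "2 < m" and \<xi>: "\<xi> \<in> \<Xi>" and x: "norm x \<le> r * \<alpha>"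
  shows "(\<integral>\<^sup>+u. ennreal (V (X1 \<alpha> x \<xi> u)) \<partial>N) \<le> ennreal (1 + C * \<alpha> * A + \<kappa> * A * (1 - p))"
proof -
  note [measurable] = X1_meas[OF \<xi>]
  let ?E = "{u \<in> space N. \<epsilon> \<le> norm (g 0 (\<Phi> \<xi> u))}"
  have xR: "norm x \<le> R0" using x r(4) by linarith
  have [measurable]: "?E \<in> sets N" using g_meas1[OF \<xi>, of 0] by measurable
  have pE: "p \<le> prob ?E" by (rule nondeg[OF m2 \<xi>])
  then have p1: "p \<le> 1" using prob_le_1[of ?E] by linarith
  have pt: "ennreal (V (X1 \<alpha> x \<xi> u)) \<le> ennreal (\<psi> (X1 \<alpha> x \<xi> u) - \<psi> x) + (1 + ennreal (\<kappa> * A) * indicator (space N - ?E) u)"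
    if u: "u \<in> space N" for u
  proof -
    have BE: "B (X1 \<alpha> x \<xi> u) \<le> \<kappa> * A * indicator (space N - ?E) u"
    proof (cases "u \<in> ?E")
      case True
      have "norm (X1 \<alpha> x \<xi> u - X1 \<alpha> 0 \<xi> u) \<le> norm (x - 0)"
        using \<alpha> \<xi> u by (intro step_nonexpansive(2))
      moreover have "norm (X1 \<alpha> 0 \<xi> u) = \<alpha> * norm (g 0 (\<Phi> \<xi> u))" using \<alpha> by (simp add: X1_def h_0)
      moreover have "\<alpha> * (3 * r) \<le> \<alpha> * norm (g 0 (\<Phi> \<xi> u))" using True r(3)[OF m2] \<alpha> by (intro mult_left_mono) auto
      moreover have "norm (X1 \<alpha> 0 \<xi> u) \<le> norm (X1 \<alpha> x \<xi> u) + norm (X1 \<alpha> x \<xi> u - X1 \<alpha> 0 \<xi> u)"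
        using norm_triangle_sub[of "X1 \<alpha> 0 \<xi> u" "X1 \<alpha> x \<xi> u"] by (simp add: norm_minus_commute)
      moreover have "\<alpha> * (3 * r) = 3 * (r * \<alpha>)" by simp
      ultimately have "2 * (r * \<alpha>) \<le> norm (X1 \<alpha> x \<xi> u)" using x by simp
      then show ?thesis using B(4) \<kappa> A by simp
    next
      case False
      then show ?thesis using u B(2)[of "X1 \<alpha> x \<xi> u"] by simp
    qed
    have "ennreal (V (X1 \<alpha> x \<xi> u)) \<le> ennreal (max 0 (\<psi> (X1 \<alpha> x \<xi> u) - \<psi> x) + (1 + \<kappa> * A * indicator (space N - ?E) u))"
      using BE near[OF xR] by (intro ennreal_leI) (simp add: V_def)
    also have "\<dots> = ennreal (\<psi> (X1 \<alpha> x \<xi> u) - \<psi> x) + (1 + ennreal (\<kappa> * A * indicator (space N - ?E) u))"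
      using \<kappa> A by (simp add: ennreal_plus)
    also have "ennreal (\<kappa> * A * indicator (space N - ?E) u) = ennreal (\<kappa> * A) * indicator (space N - ?E) u"
      by (simp add: indicator_def)
    finally show ?thesis .
  qed
  have "(\<integral>\<^sup>+u. ennreal (V (X1 \<alpha> x \<xi> u)) \<partial>N) \<le>
    (\<integral>\<^sup>+u. ennreal (\<psi> (X1 \<alpha> x \<xi> u) - \<psi> x) + (1 + ennreal (\<kappa> * A) * indicator (space N - ?E) u) \<partial>N)"
    by (rule nn_integral_mono) (rule pt)
  also have "\<dots> = (\<integral>\<^sup>+u. ennreal (\<psi> (X1 \<alpha> x \<xi> u) - \<psi> x) \<partial>N) + (1 + ennreal (\<kappa> * A) * emeasure N (space N - ?E))"
    by (simp add: nn_integral_add nn_integral_cmult emeasure_space_1)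
  also have "emeasure N (space N - ?E) = ennreal (1 - prob ?E)"
    by (simp add: emeasure_eq_measure prob_compl)
  also have "(\<integral>\<^sup>+u. ennreal (\<psi> (X1 \<alpha> x \<xi> u) - \<psi> x) \<partial>N) + (1 + ennreal (\<kappa> * A) * ennreal (1 - prob ?E)) \<le>
      ennreal (C * \<alpha> powr m) + (1 + ennreal (\<kappa> * A) * ennreal (1 - p))"
    using jump[OF xR \<xi> \<alpha>(1,3)] pE by (intro add_mono mult_left_mono ennreal_leI order_refl) auto
  also have "\<dots> = ennreal (1 + C * \<alpha> * A + \<kappa> * A * (1 - p))"
    using p1 \<kappa> A par_pos \<alpha> by (simp add: ennreal_mult'[symmetric] ennreal_plus[symmetric] ennreal_1[symmetric] add_ac mult.assoc del: ennreal_plus ennreal_1)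
  finally show ?thesis .
qed



lemma \<rho>: "0 < \<rho>" "\<rho> < 1" "c * A \<le> c * \<alpha>"
proof -
  have "c * A \<le> c * 1" using c A by (intro mult_left_mono) auto
  then show "0 < \<rho>" using c unfolding \<rho>_def by linarith
  show "\<rho> < 1" using c A by (simp add: \<rho>_def)
  show "c * A \<le> c * \<alpha>" using c A by simp
qed

text \<open>Supplies \<open>condA\<close> of \<open>local_contraction\<close> in four regions. In
  each a gain pays for the rate \<open>c * A\<close> and for what \<open>\<psi>\<close> and the bump
  may add. On the bump the gain is the chance of leaving it; elsewhere near the origin and in the
  annulus it is curvature; in the far region it is the drift of \<open>\<psi>\<close>.\<close>

lemma weighted_step:
  assumes \<xi>: "\<xi> \<in> \<Xi>"
  obtains s lam t where "0 \<le> s" "0 \<le> lam" "lam = 0 \<or> (\<forall>v. lam * (norm v)\<^sup>2 \<le> v \<bullet> h' x v)" "0 \<le> t"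
    "(\<integral>\<^sup>+u. ennreal (V (X1 \<alpha> x \<xi> u) - s) \<partial>N) \<le> ennreal t"
    "s * (1 - \<alpha> * ((1 - \<theta>) / 2) * lam) + t \<le> \<rho> * V x" "\<alpha> * ((1 - \<theta>) / 2) * lam \<le> 1"
proof -
  have \<psi>1: "1 \<le> \<psi> x" by (rule \<psi>(2))
  have small: "\<alpha> * \<gamma> * lam \<le> 1" if "\<alpha> * lam \<le> 1" "0 \<le> lam" for lam
  proof -
    have "\<gamma> * (\<alpha> * lam) \<le> 1 * (\<alpha> * lam)" using \<gamma> \<alpha> that by (intro mult_right_mono) auto
    then show ?thesis using that by (simp add: mult_ac)
  qed
  consider (bump) "norm x \<le> R0" "2 < m" "norm x < r * \<alpha>" | (inner) "norm x \<le> R0" "m = 2 \<or> r * \<alpha> \<le> norm x"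
    | (mid) "R0 < norm x" "\<not> far x" | (far) "far x" using m by (cases "norm x \<le> R0"; cases "m = 2") force+
  then show thesis
  proof cases
    \<comment> \<open>The Hessian may vanish at the origin, so no shrinking is claimed and
      \<open>s = 0\<close> puts the whole weight into \<open>t\<close>. The mean loss
      \<open>\<kappa> * p * A\<close> is divided equally between the jump
      \<open>C * \<alpha> * A\<close> of \<open>\<psi>\<close> and the rate
      \<open>c * (1 + \<kappa>) * A\<close>.\<close>
    case bump
    have p1: "p \<le> 1" using nondeg[OF bump(2) \<xi>] prob_le_1 order_trans by blast
    have Vx: "V x = 1 + \<kappa> * A" using bump B(3)[of x] near by (simp add: V_def)
    have "C * \<alpha> * A + c * (1 + \<kappa>) * A \<le> \<kappa> * p * A"
      using add_mono[OF \<alpha>_le(1) c_le(1)] A by (simp flip: distrib_right)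
    moreover have "c * \<kappa> * A * A \<le> c * \<kappa> * A" using c \<kappa> A mult_left_le[of A "c * \<kappa> * A"] by simp
    ultimately have "1 + C * \<alpha> * A + \<kappa> * A * (1 - p) \<le> \<rho> * V x"
      unfolding Vx \<rho>_def by (simp add: algebra_simps)
    moreover have "0 \<le> 1 + C * \<alpha> * A + \<kappa> * A * (1 - p)" using p1 \<kappa> A par_pos \<alpha> by simp
    ultimately show ?thesis using that[of 0 0 "1 + C * \<alpha> * A + \<kappa> * A * (1 - p)"] leave_bump[OF bump(2) \<xi>, of x] bump(3) by simp
  next
    \<comment> \<open>The curvature at radius \<open>r * \<alpha>\<close> gives the gain
      \<open>\<gamma> * cin * rpow r (m - 2) * A\<close>: a quarter pays for the jump of
      \<open>\<psi>\<close>, a quarter for landing on the bump, a half for the rate. For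
      \<open>m = 2\<close> this curvature persists down to the origin.\<close>
    case inner
    define lam where "lam = cin * rpow (r * \<alpha>) (m - 2)"
    have rp: "rpow (r * \<alpha>) (m - 2) = rpow r (m - 2) * rpow \<alpha> (m - 2)" by (auto simp: rpow_def powr_mult)
    have ra: "0 < r * \<alpha>" "r * \<alpha> \<le> 1" using r \<alpha> mult_mono[of r 1 \<alpha> 1] by auto
    have lam0: "0 \<le> lam" using par_pos by (simp add: lam_def rpow_def)
    have "rpow (r * \<alpha>) (m - 2) \<le> 1" using ra m by (auto simp: rpow_def powr_le1)
    then have "lam \<le> cin" using par_pos by (simp add: lam_def)
    then have "\<alpha> * lam \<le> \<alpha> * cin" using \<alpha> by simp
    then have "\<alpha> * lam \<le> 1" using \<alpha>_le(5) by linarith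
    have agl: "\<alpha> * \<gamma> * lam = \<gamma> * cin * rpow r (m - 2) * A"
      unfolding lam_def rp A(4)[symmetric] by (simp add: mult_ac)
    have conv: "lam * (norm v)\<^sup>2 \<le> v \<bullet> h' x v" for v
    proof -
      have x0: "x \<noteq> 0 \<or> m = 2" using inner ra by auto
      have "rpow (r * \<alpha>) (m - 2) \<le> rpow (norm x) (m - 2)"
        using inner(2) ra m by (auto simp: rpow_def intro!: powr_mono2)
      then have "lam * (norm v)\<^sup>2 \<le> cin * rpow (norm x) (m - 2) * (norm v)\<^sup>2"
        using par_pos by (simp add: lam_def mult_right_mono)
      then show ?thesis using inner_convex[OF inner(1) x0, of v] by linarith
    qed
    show ?thesis
    proof (rule that[of 1 lam "C * \<alpha> powr m + \<kappa> * A"])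
      show "(\<integral>\<^sup>+u. ennreal (V (X1 \<alpha> x \<xi> u) - 1) \<partial>N) \<le> ennreal (C * \<alpha> powr m + \<kappa> * A)"
      proof (rule nn_integral_shifted_le[OF \<xi> _ _ _ jump[OF inner(1) \<xi> \<alpha>(1,3)]])
        show "V (X1 \<alpha> x \<xi> u) - 1 \<le> \<psi> (X1 \<alpha> x \<xi> u) - \<psi> x + \<kappa> * A" for u
          using V_le[of "X1 \<alpha> x \<xi> u"] near[OF inner(1)] by simp
      qed (use \<kappa> A(1) par_pos in auto)
      have "(C * \<alpha> + \<kappa> + c) * A \<le> (\<gamma> * cin * rpow r (m - 2)) * A"
        using \<alpha>_le(2) \<kappa>_le(1) c_le(2) A by (intro mult_right_mono) auto
      then have "1 * (1 - \<alpha> * \<gamma> * lam) + (C * \<alpha> powr m + \<kappa> * A) \<le> \<rho> * 1"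
        unfolding agl A(5) \<rho>_def by (simp add: algebra_simps)
      also have "\<dots> \<le> \<rho> * V x" using \<rho> V_ge_1 by (intro mult_left_mono) auto
      finally show "1 * (1 - \<alpha> * ((1 - \<theta>) / 2) * lam) + (C * \<alpha> powr m + \<kappa> * A) \<le> \<rho> * V x" by (simp add: \<gamma>_def)
      show "\<alpha> * ((1 - \<theta>) / 2) * lam \<le> 1" using small[OF \<open>\<alpha> * lam \<le> 1\<close> lam0] by (simp add: \<gamma>_def)
    qed (use lam0 conv par_pos \<kappa> A in auto)
  next
    \<comment> \<open>The split is at the current value of \<open>\<psi>\<close>. The gain
      \<open>\<gamma> * kmid * \<alpha> * \<psi> x\<close> is shared in the same proportions; it is
      of order \<open>\<alpha>\<close>, and \<open>A \<le> \<alpha>\<close>.\<close>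
    case mid
    show ?thesis
    proof (rule that[of "\<psi> x" kmid "\<gamma> * kmid / 4 * \<alpha> * \<psi> x + \<kappa> * A"])
      have "(\<integral>\<^sup>+u. ennreal (\<psi> (X1 \<alpha> x \<xi> u) - \<psi> x) \<partial>N) \<le> ennreal (\<gamma> * kmid / 4 * \<alpha> * \<psi> x)"
        using sgd_lyapunov.mid[OF sgd_lyapunov_axioms mid(2) \<xi> \<alpha>(1,3)] by (simp add: \<gamma>_def)
      then show "(\<integral>\<^sup>+u. ennreal (V (X1 \<alpha> x \<xi> u) - \<psi> x) \<partial>N) \<le> ennreal (\<gamma> * kmid / 4 * \<alpha> * \<psi> x + \<kappa> * A)"
        using B(2) \<kappa> A par_pos \<gamma> \<alpha> \<psi>1 by (intro nn_integral_shifted_le[OF \<xi>]) (auto simp: V_def)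
      have "\<kappa> * A \<le> \<kappa> * \<alpha>" using \<kappa> A by simp
      also have "\<dots> \<le> \<gamma> * kmid / 4 * \<alpha>" using \<kappa>_le(2) \<alpha> by (intro mult_right_mono) auto
      also have "\<dots> = \<gamma> * kmid / 4 * \<alpha> * 1" by simp
      also have "\<dots> \<le> \<gamma> * kmid / 4 * \<alpha> * \<psi> x" using \<psi>1 \<gamma> par_pos \<alpha> by (intro mult_left_mono) auto
      finally have 1: "\<kappa> * A \<le> \<gamma> * kmid / 4 * \<alpha> * \<psi> x" .
      have "c * A \<le> \<gamma> * kmid / 2 * \<alpha>" using \<rho>(3) mult_right_mono[OF c_le(3), of \<alpha>] \<alpha> by linarith
      then have "c * A * \<psi> x \<le> \<gamma> * kmid / 2 * \<alpha> * \<psi> x" using \<psi>1 by (intro mult_right_mono) auto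
      with 1 have "\<psi> x * (1 - \<alpha> * \<gamma> * kmid) + (\<gamma> * kmid / 4 * \<alpha> * \<psi> x + \<kappa> * A) \<le> \<rho> * \<psi> x"
        unfolding \<rho>_def by (simp add: algebra_simps)
      also have "\<dots> \<le> \<rho> * V x" using \<rho> B(1) by (intro mult_left_mono) (auto simp: V_def)
      finally show "\<psi> x * (1 - \<alpha> * ((1 - \<theta>) / 2) * kmid) + (\<gamma> * kmid / 4 * \<alpha> * \<psi> x + \<kappa> * A) \<le> \<rho> * V x"
        by (simp add: \<gamma>_def)
      show "\<alpha> * ((1 - \<theta>) / 2) * kmid \<le> 1" using small[OF \<alpha>_le(4)] par_pos by (simp add: \<gamma>_def)
    qed (use mid mid_convex[of x] par_pos \<kappa> A \<psi>1 \<gamma> \<alpha> in auto)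
  next
    case far
    note [measurable] = X1_meas[OF \<xi>]
    have d: "(\<integral>\<^sup>+u. ennreal (\<psi> (X1 \<alpha> x \<xi> u)) \<partial>N) \<le> ennreal ((1 - c' * \<alpha>) * \<psi> x)" by (rule drift[OF far \<xi> \<alpha>(1,3)])
    \<comment> \<open>The sign of \<open>1 - c' * \<alpha>\<close> is not known beforehand. As
      \<open>\<psi> \<ge> 1\<close>, the drift bound itself forces its product with
      \<open>\<psi> x\<close> to be at least 1.\<close>
    have "(1::ennreal) = (\<integral>\<^sup>+u. 1 \<partial>N)" by (simp add: emeasure_space_1)
    also have "\<dots> \<le> (\<integral>\<^sup>+u. ennreal (\<psi> (X1 \<alpha> x \<xi> u)) \<partial>N)" using \<psi>(2) by (intro nn_integral_mono) simp
    also note d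
    finally have pos: "1 \<le> (1 - c' * \<alpha>) * \<psi> x" by simp
    have "(\<integral>\<^sup>+u. ennreal (V (X1 \<alpha> x \<xi> u) - 0) \<partial>N) \<le> (\<integral>\<^sup>+u. ennreal (\<psi> (X1 \<alpha> x \<xi> u)) + ennreal (\<kappa> * A) \<partial>N)"
    proof (rule nn_integral_mono)
      fix u
      have "ennreal (V (X1 \<alpha> x \<xi> u) - 0) \<le> ennreal (\<psi> (X1 \<alpha> x \<xi> u) + \<kappa> * A)"
        using V_le by (intro ennreal_leI) simp
      also have "\<dots> = ennreal (\<psi> (X1 \<alpha> x \<xi> u)) + ennreal (\<kappa> * A)"
        using \<psi>(2)[of "X1 \<alpha> x \<xi> u"] \<kappa> A(1) by (intro ennreal_plus) auto
      finally show "ennreal (V (X1 \<alpha> x \<xi> u) - 0) \<le> \<dots>" .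
    qed
    also have "\<dots> = (\<integral>\<^sup>+u. ennreal (\<psi> (X1 \<alpha> x \<xi> u)) \<partial>N) + ennreal (\<kappa> * A)"
      by (subst nn_integral_add) (auto simp: emeasure_space_1)
    also have "\<dots> \<le> ennreal ((1 - c' * \<alpha>) * \<psi> x) + ennreal (\<kappa> * A)" by (intro add_right_mono d)
    also have "\<dots> = ennreal ((1 - c' * \<alpha>) * \<psi> x + \<kappa> * A)" using pos \<kappa> A by (simp add: ennreal_plus)
    finally have int: "(\<integral>\<^sup>+u. ennreal (V (X1 \<alpha> x \<xi> u) - 0) \<partial>N) \<le> ennreal ((1 - c' * \<alpha>) * \<psi> x + \<kappa> * A)" .
    have "\<kappa> * A \<le> \<kappa> * \<alpha>" using \<kappa> A by simp
    also have "\<dots> \<le> c' / 2 * \<alpha>" using \<kappa>_le(3) \<alpha> by (intro mult_right_mono) auto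
    also have "\<dots> \<le> c' / 2 * \<alpha> * \<psi> x" using \<psi>1 par_pos \<alpha> mult_left_mono[of 1 "\<psi> x" "c' / 2 * \<alpha>"] by simp
    finally have 1: "\<kappa> * A \<le> c' / 2 * \<alpha> * \<psi> x" .
    have "c * A \<le> c' / 2 * \<alpha>" using \<rho>(3) mult_right_mono[OF c_le(4), of \<alpha>] \<alpha> by linarith
    then have "c * A * \<psi> x \<le> c' / 2 * \<alpha> * \<psi> x" using \<psi>1 by (intro mult_right_mono) auto
    with 1 have "(1 - c' * \<alpha>) * \<psi> x + \<kappa> * A \<le> \<rho> * \<psi> x"
      unfolding \<rho>_def by (simp add: algebra_simps)
    also have "\<dots> \<le> \<rho> * V x" using \<rho> B(1) by (intro mult_left_mono) (auto simp: V_def)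
    finally show ?thesis using that[of 0 0 "(1 - c' * \<alpha>) * \<psi> x + \<kappa> * A"] int pos \<kappa> A by simp
  qed
qed

text \<open>To leading order the left side is \<open>l * \<psi> x\<close> with \<open>l < 1\<close>,
  so a gap independent of \<open>\<alpha>\<close> is available: half of it pays for
  \<open>c\<close>, half for the terms of order \<open>\<alpha>\<close>. As \<open>L\<Phi> u\<close>
  and the increase of \<open>\<psi>\<close> are dependent, the second factor is bounded by
  \<open>Lg + 1\<close> wherever it meets that increase.\<close>

lemma weighted_noise_step:
  assumes \<xi>: "\<xi> \<in> \<Xi>"
  shows "(\<integral>\<^sup>+u. ennreal (V (X1 \<alpha> x \<xi> u) * (\<alpha>\<^sup>2 * Lg + L\<Phi> u)) \<partial>N) \<le> ennreal (\<rho> * V x)"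
proof -
  note [measurable] = X1_meas[OF \<xi>] L\<Phi>_meas
  have \<psi>1: "1 \<le> \<psi> x" by (rule \<psi>(2))
  have kA: "0 < \<kappa> * A" using \<kappa> A by simp
  have L\<Phi>_int: "integrable N L\<Phi>" using L\<Phi>(1) by (intro integrable_const_bound[of _ 1]) auto
  have l: "0 \<le> l" "l < 1" using L\<Phi> unfolding l_def by (auto intro!: integral_nonneg_AE)
  have a2: "\<alpha>\<^sup>2 \<le> \<alpha>" "\<alpha>\<^sup>2 \<le> 1" using \<alpha> by (auto simp: power2_eq_square mult_left_le mult_le_one)
  have pt: "ennreal (V (X1 \<alpha> x \<xi> u) * (\<alpha>\<^sup>2 * Lg + L\<Phi> u)) \<le>
    ennreal (\<psi> x) * ennreal (\<alpha>\<^sup>2 * Lg + L\<Phi> u) + ennreal (Lg + 1) * (ennreal (\<psi> (X1 \<alpha> x \<xi> u) - \<psi> x) + ennreal (\<kappa> * A))"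
    if u: "u \<in> space N" for u
  proof -
    define e where "e = max 0 (\<psi> (X1 \<alpha> x \<xi> u) - \<psi> x) + \<kappa> * A"
    define n where "n = \<alpha>\<^sup>2 * Lg + L\<Phi> u"
    have e: "0 \<le> e" using kA by (simp add: e_def)
    have "\<alpha>\<^sup>2 * Lg \<le> 1 * Lg" using a2 Lg(1) by (intro mult_right_mono) auto
    then have n: "0 \<le> n" "n \<le> Lg + 1" using L\<Phi>(1)[OF u] Lg(1) by (auto simp: n_def intro: add_mono)
    have "V (X1 \<alpha> x \<xi> u) * n \<le> (\<psi> x + e) * n"
      using V_le[of "X1 \<alpha> x \<xi> u"] n by (intro mult_right_mono) (auto simp: e_def)
    also have "\<dots> \<le> \<psi> x * n + (Lg + 1) * e"
      using mult_right_mono[OF n(2) e] by (simp add: algebra_simps)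
    finally have "ennreal (V (X1 \<alpha> x \<xi> u) * n) \<le> ennreal (\<psi> x * n + (Lg + 1) * e)" by (rule ennreal_leI)
    also have "\<dots> = ennreal (\<psi> x) * ennreal n + ennreal (Lg + 1) * ennreal e"
      using \<psi>1 n e Lg(1) by (simp add: ennreal_plus ennreal_mult')
    also have "ennreal e = ennreal (\<psi> (X1 \<alpha> x \<xi> u) - \<psi> x) + ennreal (\<kappa> * A)"
      using kA by (simp add: e_def ennreal_plus)
    finally show ?thesis by (simp add: n_def)
  qed
  have "(\<integral>\<^sup>+u. ennreal (V (X1 \<alpha> x \<xi> u) * (\<alpha>\<^sup>2 * Lg + L\<Phi> u)) \<partial>N) \<le>
    (\<integral>\<^sup>+u. ennreal (\<psi> x) * ennreal (\<alpha>\<^sup>2 * Lg + L\<Phi> u) + ennreal (Lg + 1) * (ennreal (\<psi> (X1 \<alpha> x \<xi> u) - \<psi> x) + ennreal (\<kappa> * A)) \<partial>N)"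
    by (rule nn_integral_mono) (rule pt)
  also have "\<dots> = ennreal (\<psi> x) * (\<integral>\<^sup>+u. ennreal (\<alpha>\<^sup>2 * Lg + L\<Phi> u) \<partial>N) +
      ennreal (Lg + 1) * ((\<integral>\<^sup>+u. ennreal (\<psi> (X1 \<alpha> x \<xi> u) - \<psi> x) \<partial>N) + ennreal (\<kappa> * A))"
    by (simp add: nn_integral_add nn_integral_cmult emeasure_space_1)
  also have "(\<integral>\<^sup>+u. ennreal (\<alpha>\<^sup>2 * Lg + L\<Phi> u) \<partial>N) = ennreal (expectation (\<lambda>u. \<alpha>\<^sup>2 * Lg + L\<Phi> u))"
    using L\<Phi>_int L\<Phi>(1) Lg(1) by (intro nn_integral_eq_integral) auto
  also have "expectation (\<lambda>u. \<alpha>\<^sup>2 * Lg + L\<Phi> u) = \<alpha>\<^sup>2 * Lg + l"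
    using L\<Phi>_int by (simp add: l_def prob_space)
  also have "ennreal (\<psi> x) * ennreal (\<alpha>\<^sup>2 * Lg + l) +
      ennreal (Lg + 1) * ((\<integral>\<^sup>+u. ennreal (\<psi> (X1 \<alpha> x \<xi> u) - \<psi> x) \<partial>N) + ennreal (\<kappa> * A)) \<le>
    ennreal (\<psi> x) * ennreal (\<alpha>\<^sup>2 * Lg + l) + ennreal (Lg + 1) * (ennreal (C * \<alpha> * \<psi> x) + ennreal (\<kappa> * A))"
    by (intro add_left_mono mult_left_mono add_right_mono everywhere[OF \<xi> \<alpha>(1,3)]) auto
  also have "\<dots> = ennreal (\<psi> x * (\<alpha>\<^sup>2 * Lg + l) + (Lg + 1) * (C * \<alpha> * \<psi> x + \<kappa> * A))"
    using \<psi>1 kA l Lg(1) par_pos \<alpha> by (simp add: ennreal_plus ennreal_mult')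
  also have "\<dots> \<le> ennreal (\<rho> * V x)"
  proof (rule ennreal_leI)
    have "\<kappa> * A \<le> \<kappa> * \<alpha>" using \<kappa> A by simp
    also have "\<dots> \<le> \<kappa> * \<alpha> * \<psi> x" using \<psi>1 \<kappa> \<alpha> mult_left_mono[of 1 "\<psi> x" "\<kappa> * \<alpha>"] by simp
    finally have "(Lg + 1) * (C * \<alpha> * \<psi> x + \<kappa> * A) \<le> (Lg + 1) * (C * \<alpha> * \<psi> x + \<kappa> * \<alpha> * \<psi> x)"
      using Lg(1) by (intro mult_left_mono) auto
    moreover have "\<psi> x * (\<alpha>\<^sup>2 * Lg) \<le> \<psi> x * (\<alpha> * Lg)" using \<psi>1 a2 Lg(1) by (intro mult_left_mono mult_right_mono) auto
    ultimately have "\<psi> x * (\<alpha>\<^sup>2 * Lg + l) + (Lg + 1) * (C * \<alpha> * \<psi> x + \<kappa> * A) \<le> \<psi> x * (l + \<alpha> * (Lg + (C + \<kappa>) * (Lg + 1)))"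
      by (simp add: algebra_simps)
    also have "\<dots> \<le> \<psi> x * (1 - c)" using \<alpha>_le(3) c_le(5) \<psi>1 by (intro mult_left_mono) auto
    also have "\<dots> \<le> \<psi> x * \<rho>" using \<psi>1 A(3) c unfolding \<rho>_def by (intro mult_left_mono) (auto simp: mult_left_le)
    also have "\<dots> \<le> V x * \<rho>" using \<rho> B(1) by (intro mult_right_mono) (auto simp: V_def)
    finally show "\<psi> x * (\<alpha>\<^sup>2 * Lg + l) + (Lg + 1) * (C * \<alpha> * \<psi> x + \<kappa> * A) \<le> \<rho> * V x" by (simp add: mult.commute)
  qed
  finally show ?thesis .
qed

lemma ex_weight: "\<exists>V. contracting_weight \<alpha> (1 - c * \<alpha> powr (m - 1)) V"
proof -
  define V' where "V' = (\<lambda>z :: (real ^ 'd) \<times> (real ^ 'e). V (fst z))"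
  interpret W: weighted_path_metric \<Xi> V' \<alpha>
    using \<Xi> V_ge_1 \<alpha> unfolding V'_def
    by unfold_locales (auto intro!: continuous_on_compose2[OF V_cont] continuous_intros)
  define z0 :: "(real ^ 'd) \<times> (real ^ 'e)" where "z0 = (0, \<xi>s)"
  have z0: "z0 \<in> Zs" using \<xi>s by (simp add: z0_def)
  have F1: "(\<lambda>u. F \<alpha> u z) \<in> N \<rightarrow>\<^sub>M restrict_space borel Zs" if "z \<in> Zs" for z
  proof -
    have "z \<in> space (restrict_space borel Zs)" using that by (simp only: space_restrict_space space_borel) simp
    from measurable_compose[OF measurable_Pair1'[OF this] F_meas] show ?thesis by simp
  qed
  have FZ: "F \<alpha> u z \<in> Zs" if "z \<in> Zs" "u \<in> space N" for u z
    using measurable_space[OF F1[OF that(1)] that(2)] by (simp only: space_restrict_space space_borel Int_UNIV_left Int_UNIV_right)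
  have dm: "(\<lambda>u. W.d (F \<alpha> u z) (F \<alpha> u z')) \<in> borel_measurable N" if "z \<in> Zs" "z' \<in> Zs" for z z'
    using measurable_compose[OF measurable_Pair[OF F1[OF that(1)] F1[OF that(2)]] W.measurable_d] by simp
  have contr: "(\<integral>\<^sup>+u. W.d (F \<alpha> u z) (F \<alpha> u z') \<partial>N) \<le> ennreal \<rho> * W.d z z'" if z: "z \<in> Zs" "z' \<in> Zs" for z z'
  proof (rule W.local_to_global_contraction[OF \<rho>(1) _ _ _ z, of "\<lambda>z z'. \<integral>\<^sup>+u. W.d (F \<alpha> u z) (F \<alpha> u z') \<partial>N"])
    fix z z' z'' :: "(real ^ 'd) \<times> (real ^ 'e)" assume "z \<in> Zs" "z' \<in> Zs" "z'' \<in> Zs"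
    then show "(\<integral>\<^sup>+u. W.d (F \<alpha> u z) (F \<alpha> u z'') \<partial>N) \<le> (\<integral>\<^sup>+u. W.d (F \<alpha> u z) (F \<alpha> u z') \<partial>N) + (\<integral>\<^sup>+u. W.d (F \<alpha> u z') (F \<alpha> u z'') \<partial>N)"
      by (subst nn_integral_add[symmetric]) (auto intro!: dm nn_integral_mono W.d_triangle simp del: mem_Times_iff)
  next
    fix z z' :: "(real ^ 'd) \<times> (real ^ 'e)"
    show "(\<integral>\<^sup>+u. W.d (F \<alpha> u z) (F \<alpha> u z') \<partial>N) = (\<integral>\<^sup>+u. W.d (F \<alpha> u z') (F \<alpha> u z) \<partial>N)"
      by (simp only: W.d_sym[of "F \<alpha> _ z"])
  next
    fix z w :: "(real ^ 'd) \<times> (real ^ 'e)" and e :: real assume zw: "z \<in> Zs" "0 < e"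
    obtain x \<xi> where zx: "z = (x, \<xi>)" "\<xi> \<in> \<Xi>" using zw(1) by (cases z) auto
    obtain s lam t where st: "0 \<le> s" "0 \<le> lam" "lam = 0 \<or> (\<forall>v. lam * (norm v)\<^sup>2 \<le> v \<bullet> h' x v)" "0 \<le> t"
      "(\<integral>\<^sup>+u. ennreal (V (X1 \<alpha> x \<xi> u) - s) \<partial>N) \<le> ennreal t"
      "s * (1 - \<alpha> * ((1 - \<theta>) / 2) * lam) + t \<le> \<rho> * V x" "\<alpha> * ((1 - \<theta>) / 2) * lam \<le> 1"
      by (rule weighted_step[OF zx(2)])
    have "0 \<le> \<Lambda> + \<kappa> * A / (r * \<alpha>)" using par_pos \<kappa> A r \<alpha> by simp
    from local_contraction[OF \<alpha>(1,4) \<rho>(1) V_cont V_ge_1 this V_log_Lipschitz st weighted_noise_step[OF zx(2)] zx(2) zw(2), of w]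
    show "\<exists>\<delta>>0. \<forall>h. 0 \<le> h \<and> h < \<delta> \<and> z + h *\<^sub>R w \<in> Zs \<longrightarrow>
      (\<integral>\<^sup>+u. W.d (F \<alpha> u z) (F \<alpha> u (z + h *\<^sub>R w)) \<partial>N) \<le> ennreal (h * (\<rho> * V' z * W.N w + e))"
      unfolding zx(1) V'_def fst_conv .
  qed
  have start_fin: "(\<integral>\<^sup>+u. W.d z0 (F \<alpha> u z0) \<partial>N) < \<infinity>"
  proof -
    let ?G = "\<lambda>u. g 0 (\<Phi> \<xi>s u)"
    define k where "k = (1 + \<kappa> * A) * \<alpha>"
    have k: "0 \<le> k" using \<kappa> A \<alpha> by (simp add: k_def)
    note [measurable] = g_meas1[OF \<xi>s(1)] borel_measurable_integrable[OF \<xi>s(2)]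
    \<comment> \<open>The path runs first along the noise coordinate, where the weight is constantly
      \<open>V 0\<close>, and then along the first coordinate, where monotonicity of
      \<open>\<psi>\<close> in the norm bounds the weight by its value at the far end plus the
      height of the bump.\<close>
    have pt: "W.d z0 (F \<alpha> u z0) \<le> ennreal (V 0 * inverse \<alpha>) * ennreal (norm (\<Phi> \<xi>s u - \<xi>s)) + ennreal k * ennreal (\<psi> (\<alpha> *\<^sub>R ?G u) * norm (?G u))"
      if u: "u \<in> space N" for u
    proof -
      have X: "X1 \<alpha> 0 \<xi>s u = - (\<alpha> *\<^sub>R ?G u)" by (simp add: X1_def h_0)
      have in_Z: "(0, \<Phi> \<xi>s u) \<in> Zs" "(X1 \<alpha> 0 \<xi>s u, \<Phi> \<xi>s u) \<in> Zs" using \<Phi>_in[OF \<xi>s(1) u] by auto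
      have "W.d z0 (0, \<Phi> \<xi>s u) \<le> ennreal (V 0 * W.N ((0, \<Phi> \<xi>s u) - z0))"
      proof (rule W.d_segment_le[OF z0 in_Z(1)])
        fix y assume "y \<in> closed_segment z0 (0, \<Phi> \<xi>s u)"
        then have "fst y = 0" by (auto simp: closed_segment_def z0_def)
        then show "V' y \<le> V 0" by (simp add: V'_def)
      qed
      also have "V 0 * W.N ((0, \<Phi> \<xi>s u) - z0) = V 0 * inverse \<alpha> * norm (\<Phi> \<xi>s u - \<xi>s)"
        by (simp add: z0_def scaled_norm_def mult.assoc)
      also have "ennreal (V 0 * inverse \<alpha> * norm (\<Phi> \<xi>s u - \<xi>s)) = ennreal (V 0 * inverse \<alpha>) * ennreal (norm (\<Phi> \<xi>s u - \<xi>s))"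
        by (intro ennreal_mult'') simp
      finally have 1: "W.d z0 (0, \<Phi> \<xi>s u) \<le> \<dots>" .
      have "W.d (0, \<Phi> \<xi>s u) (X1 \<alpha> 0 \<xi>s u, \<Phi> \<xi>s u) \<le>
        ennreal ((\<psi> (\<alpha> *\<^sub>R ?G u) + \<kappa> * A) * W.N ((X1 \<alpha> 0 \<xi>s u, \<Phi> \<xi>s u) - (0, \<Phi> \<xi>s u)))"
      proof (rule W.d_segment_le[OF in_Z])
        fix y assume "y \<in> closed_segment (0, \<Phi> \<xi>s u) (X1 \<alpha> 0 \<xi>s u, \<Phi> \<xi>s u)"
        then obtain t where t: "0 \<le> t" "t \<le> 1" "fst y = t *\<^sub>R X1 \<alpha> 0 \<xi>s u" by (auto simp: closed_segment_def)
        have "norm (fst y) \<le> norm (\<alpha> *\<^sub>R ?G u)"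
          using t(1,2) unfolding t(3) X norm_scaleR norm_minus_cancel by (intro mult_left_le_one_le) auto
        from \<psi>(4)[OF this] show "V' y \<le> \<psi> (\<alpha> *\<^sub>R ?G u) + \<kappa> * A" using V_le[of "fst y"] by (simp add: V'_def)
      qed
      also have "W.N ((X1 \<alpha> 0 \<xi>s u, \<Phi> \<xi>s u) - (0, \<Phi> \<xi>s u)) = \<alpha> * norm (?G u)"
        using \<alpha> by (simp add: scaled_norm_def X)
      also have "ennreal ((\<psi> (\<alpha> *\<^sub>R ?G u) + \<kappa> * A) * (\<alpha> * norm (?G u))) \<le> ennreal (k * (\<psi> (\<alpha> *\<^sub>R ?G u) * norm (?G u)))"
      proof (rule ennreal_leI)
        have "\<kappa> * A * 1 \<le> \<kappa> * A * \<psi> (\<alpha> *\<^sub>R ?G u)" using \<psi>(2) \<kappa> A by (intro mult_left_mono) auto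
        then have "(\<psi> (\<alpha> *\<^sub>R ?G u) + \<kappa> * A) * (\<alpha> * norm (?G u)) \<le> ((1 + \<kappa> * A) * \<psi> (\<alpha> *\<^sub>R ?G u)) * (\<alpha> * norm (?G u))"
          using \<alpha> by (intro mult_right_mono) (auto simp: distrib_right)
        then show "(\<psi> (\<alpha> *\<^sub>R ?G u) + \<kappa> * A) * (\<alpha> * norm (?G u)) \<le> k * (\<psi> (\<alpha> *\<^sub>R ?G u) * norm (?G u))"
          by (simp add: k_def mult_ac)
      qed
      also have "\<dots> = ennreal k * ennreal (\<psi> (\<alpha> *\<^sub>R ?G u) * norm (?G u))" using k by (rule ennreal_mult')
      finally have 2: "W.d (0, \<Phi> \<xi>s u) (X1 \<alpha> 0 \<xi>s u, \<Phi> \<xi>s u) \<le> \<dots>" .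
      have "F \<alpha> u z0 = (X1 \<alpha> 0 \<xi>s u, \<Phi> \<xi>s u)" by (simp add: F_def z0_def)
      then show ?thesis using order_trans[OF W.d_triangle add_mono[OF 1 2]] by simp
    qed
    have "(\<integral>\<^sup>+u. W.d z0 (F \<alpha> u z0) \<partial>N) \<le>
      (\<integral>\<^sup>+u. ennreal (V 0 * inverse \<alpha>) * ennreal (norm (\<Phi> \<xi>s u - \<xi>s)) + ennreal k * ennreal (\<psi> (\<alpha> *\<^sub>R ?G u) * norm (?G u)) \<partial>N)"
      by (rule nn_integral_mono) (rule pt)
    also have "\<dots> = ennreal (V 0 * inverse \<alpha>) * (\<integral>\<^sup>+u. ennreal (norm (\<Phi> \<xi>s u - \<xi>s)) \<partial>N) +
        ennreal k * (\<integral>\<^sup>+u. ennreal (\<psi> (\<alpha> *\<^sub>R ?G u) * norm (?G u)) \<partial>N)"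
      by (simp add: nn_integral_add nn_integral_cmult)
    also have "(\<integral>\<^sup>+u. ennreal (norm (\<Phi> \<xi>s u - \<xi>s)) \<partial>N) = ennreal (expectation (\<lambda>u. norm (\<Phi> \<xi>s u - \<xi>s)))"
      using \<xi>s(2) by (intro nn_integral_eq_integral) auto
    also have "ennreal (V 0 * inverse \<alpha>) * \<dots> + ennreal k * (\<integral>\<^sup>+u. ennreal (\<psi> (\<alpha> *\<^sub>R ?G u) * norm (?G u)) \<partial>N) < \<infinity>"
      using start[OF \<alpha>(1,3)] by (simp add: ennreal_mult_less_top)
    finally show ?thesis .
  qed
  obtain Cd where Cd: "0 < Cd" "\<And>z :: (real ^ 'd) \<times> (real ^ 'e). norm z \<le> Cd * W.N z" using W.N_ge_dist by blast
  have Zcl: "closed Zs" using \<Xi> by (intro closed_Times) auto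
  have lim: "(\<lambda>n. W.d (zs n) z) \<longlonglongrightarrow> 0" if zs: "\<And>n. zs n \<in> Zs" "z \<in> Zs" "zs \<longlonglongrightarrow> z" for zs z
  proof -
    have "(\<lambda>n. enn2real (W.d (fst (zs n, z)) (snd (zs n, z)))) \<longlonglongrightarrow> enn2real (W.d (fst (z, z)) (snd (z, z)))"
      by (rule continuous_on_tendsto_compose[OF W.continuous_on_enn2real_d])
        (auto intro!: tendsto_intros SigmaI zs eventuallyI simp del: mem_Times_iff)
    then have "(\<lambda>n. ennreal (enn2real (W.d (zs n) z))) \<longlonglongrightarrow> ennreal 0"
      using W.d_refl[OF zs(2)] by (intro tendsto_ennrealI) simp
    then show ?thesis using W.d_eq_ennreal[OF zs(1) zs(2)] by (simp flip: ennreal_0)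
  qed
  have dist_le: "ennreal (dist z z') \<le> ennreal Cd * W.d z z'" for z z'
  proof -
    have "ennreal (dist z z') \<le> ennreal (Cd * W.N (z' - z))"
      using Cd(2)[of "z' - z"] by (intro ennreal_leI) (simp add: dist_norm norm_minus_commute)
    also have "\<dots> = ennreal Cd * ennreal (W.N (z' - z))" using Cd by (intro ennreal_mult') simp
    also have "\<dots> \<le> ennreal Cd * W.d z z'" by (intro mult_left_mono W.d_ge) simp
    finally show ?thesis .
  qed
  interpret R: contracting_random_maps N Zs "F \<alpha>" W.d \<rho> Cd z0
    by unfold_locales
      (use Zcl z0 F_meas W.measurable_d W.d_sym W.d_triangle W.d_refl W.d_finite Cd(1) dist_le lim \<rho> contr start_fin in \<open>(assumption | simp only: less_imp_le)+\<close>)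
  have ker: "R.P = kernel \<alpha>"
    by (rule ext) (simp only: R.P_def aug_space_def kernel_def)
  have \<rho>_eq: "1 - c * \<alpha> powr (m - 1) = \<rho>" by (simp only: \<rho>_def A_def)
  have S: "aug_space \<Xi> = R.S" by (simp only: aug_space_def)
  show ?thesis
    unfolding contracting_weight_def \<rho>_eq S ker[symmetric]
  proof (intro exI[of _ V'] conjI ballI allI R.unique_invariant_law W.V_cont)
    show "1 \<le> V' z" for z by (simp add: V'_def V_ge_1)
  qed (use R.wasserstein_iterate_le(1,3) in blast)+
qed

end

section \<open>Choice of the constants\<close>

lemma eventually_mult_le_at_right_0:
  fixes a b :: real
  assumes "0 < b"
  shows "\<forall>\<^sub>F t in at_right 0. a * t \<le> b"
proof -
  have "((\<lambda>t. a * t) \<longlongrightarrow> a * 0) (at_right 0)" by (intro tendsto_intros)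
  then have "\<forall>\<^sub>F t in at_right 0. a * t < b" by (rule order_tendstoD) (use assms in simp)
  then show ?thesis by eventually_elim simp
qed

lemma ex_stepsize_bound:
  "\<exists>\<alpha>0>0. \<exists>c\<in>{0<..<1}. \<forall>\<alpha>\<in>{0<..<1}. \<alpha> \<le> \<alpha>0 \<longrightarrow> (\<exists>V. contracting_weight \<alpha> (1 - c * \<alpha> powr (m - 1)) V)"
proof -
  define \<gamma> where "\<gamma> = (1 - \<theta>) / 2"
  define l where "l = expectation L\<Phi>"
  define r where "r = min 1 (\<epsilon> / 3)"
  define k where "k = \<gamma> * cin * rpow r (m - 2)"
  \<comment> \<open>The bump may consume a quarter of each curvature gain and half of the
    drift.\<close>
  define \<kappa> where "\<kappa> = min (k / 4) (min (\<gamma> * kmid / 4) (c' / 2))"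
  \<comment> \<open>Half of each gain is left for the rate; the entry with \<open>p\<close> solves
    \<open>c * (1 + \<kappa>) \<le> \<kappa> * p / 2\<close>. No entry involves the stepsize, whose
    conditions come last and hold for all small \<open>\<alpha>\<close>.\<close>
  define c where "c = min (1 / 2) (min (\<kappa> * p / (2 * (1 + \<kappa>))) (min (k / 2) (min (\<gamma> * kmid / 2) (min (c' / 2) ((1 - l) / 2)))))"
  have \<gamma>: "0 < \<gamma>" using \<theta> by (simp add: \<gamma>_def)
  have l: "l < 1" using L\<Phi>(2) by (simp add: l_def)
  have r: "0 < r" "r \<le> 1" "3 * r \<le> \<epsilon>" using par_pos by (auto simp: r_def)
  have k: "0 < k" using \<gamma> par_pos r by (simp add: k_def rpow_def)
  have \<kappa>: "0 < \<kappa>" "\<kappa> \<le> k / 4" "\<kappa> \<le> \<gamma> * kmid / 4" "\<kappa> \<le> c' / 2"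
    using \<gamma> k par_pos unfolding \<kappa>_def by auto
  have c: "0 < c" "c < 1" "c \<le> \<kappa> * p / (2 * (1 + \<kappa>))" "c \<le> k / 2" "c \<le> \<gamma> * kmid / 2" "c \<le> c' / 2" "c \<le> (1 - l) / 2"
  proof -
    have "0 < \<kappa> * p / (2 * (1 + \<kappa>))" "0 < \<gamma> * kmid / 2" "0 < k / 2" "0 < c' / 2" "0 < (1 - l) / 2"
      using \<gamma> k par_pos l \<kappa>(1) by simp_all
    then show "0 < c" unfolding c_def by simp
    show "c < 1" unfolding c_def by linarith
    show "c \<le> \<kappa> * p / (2 * (1 + \<kappa>))" "c \<le> k / 2" "c \<le> \<gamma> * kmid / 2" "c \<le> c' / 2" "c \<le> (1 - l) / 2"
      unfolding c_def by linarith+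
  qed
  have c2: "c * (1 + \<kappa>) \<le> \<kappa> * p / 2" using c(3) \<kappa>(1) by (simp add: field_simps)
  have "\<forall>\<^sub>F \<alpha> in at_right 0. 1 * \<alpha> \<le> \<alpha>1 \<and> L * \<alpha> \<le> 1 \<and> r * \<alpha> \<le> R0 \<and> C * \<alpha> \<le> \<kappa> * p / 2 \<and> C * \<alpha> \<le> k / 4 \<and>
      (Lg + (C + \<kappa>) * (Lg + 1)) * \<alpha> \<le> (1 - l) / 2 \<and> kmid * \<alpha> \<le> 1 \<and> cin * \<alpha> \<le> 1"
    by (intro eventually_conj eventually_mult_le_at_right_0) (use par_pos R0 \<kappa>(1) k l in auto)
  then obtain \<delta> where \<delta>: "0 < \<delta>" "\<And>\<alpha>. 0 < \<alpha> \<Longrightarrow> \<alpha> < \<delta> \<Longrightarrow> 1 * \<alpha> \<le> \<alpha>1 \<and> L * \<alpha> \<le> 1 \<and> r * \<alpha> \<le> R0 \<and> C * \<alpha> \<le> \<kappa> * p / 2 \<and> C * \<alpha> \<le> k / 4 \<and>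
      (Lg + (C + \<kappa>) * (Lg + 1)) * \<alpha> \<le> (1 - l) / 2 \<and> kmid * \<alpha> \<le> 1 \<and> cin * \<alpha> \<le> 1"
    unfolding eventually_at_right_field by blast
  show ?thesis
  proof (intro exI[of _ "\<delta> / 2"] conjI bexI[of _ c] ballI impI)
    fix \<alpha> :: real assume a: "\<alpha> \<in> {0<..<1}" "\<alpha> \<le> \<delta> / 2"
    then have "0 < \<alpha>" "\<alpha> < \<delta>" using \<delta>(1) by auto
    note d = \<delta>(2)[OF this]
    show "\<exists>V. contracting_weight \<alpha> (1 - c * \<alpha> powr (m - 1)) V"
      by (rule ex_weight[where \<alpha> = \<alpha> and c = c and r = r and \<kappa> = \<kappa>])
        (use a d r \<kappa> c c2 in \<open>simp_all add: \<gamma>_def k_def l_def mult_ac\<close>)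
  qed (use \<delta>(1) c in auto)
qed

end

section \<open>From the assumptions to a weight\<close>

lemma rpow_pos: "0 < t \<Longrightarrow> 0 < rpow t a"
  by (simp add: rpow_def)

lemma rpow_eq_powr: "0 < t \<or> a \<noteq> 0 \<Longrightarrow> rpow t a = t powr a"
  by (auto simp: rpow_def)

lemma rpow_mono: "0 \<le> s \<Longrightarrow> s \<le> t \<Longrightarrow> 0 \<le> a \<Longrightarrow> rpow s a \<le> rpow t a"
  by (auto simp: rpow_def intro: powr_mono2)

lemma grad_eq_0_at_min:
  fixes f :: "'a::euclidean_space \<Rightarrow> real"
  assumes diff: "f differentiable (at x)" and min: "\<And>y. f x \<le> f y"
  shows "grad f x = 0"
proof -
  obtain D where D: "(f has_derivative D) (at x)" using diff by (auto simp: differentiable_def)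
  have "D = (\<lambda>v. 0)"
    by (rule differential_zero_maxmin[of x UNIV f]) (use D min in auto)
  with D have D0: "(f has_derivative (\<lambda>v. 0)) (at x)" by simp
  show ?thesis unfolding grad_def
  proof (rule the_equality)
    show "GDERIV f x :> 0" using D0 by (simp add: gderiv_def)
    fix E assume "GDERIV f x :> E"
    then have "(\<lambda>v. v \<bullet> E) = (\<lambda>v. 0)" using D0 has_derivative_unique by (auto simp: gderiv_def)
    then have "E \<bullet> E = 0" by metis
    then show "E = 0" by simp
  qed
qed

lemma loewner_ge_scaled_identity:
  fixes A :: "real ^ 'd ^ 'd"
  assumes "loewner_ge A (c *\<^sub>R mat 1)"
  shows "c * (norm v)\<^sup>2 \<le> v \<bullet> (A *v v)"
proof -
  have "0 \<le> v \<bullet> ((A - c *\<^sub>R mat 1) *v v)" using assms by (simp add: loewner_ge_def)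
  also have "\<dots> = v \<bullet> (A *v v) - c * (v \<bullet> v)"
    by (simp add: matrix_vector_mult_diff_rdistrib scaleR_matrix_vector_assoc[symmetric] inner_diff_right)
  finally show ?thesis by (simp add: power2_norm_eq_inner)
qed

lemma lipschitz_of_cocoercive:
  fixes a b :: "'a::real_inner"
  assumes L: "0 < L" and co: "inverse L * (norm b)\<^sup>2 \<le> a \<bullet> b"
  shows "norm b \<le> L * norm a"
proof (cases "b = 0")
  case False
  have "inverse L * (norm b)\<^sup>2 \<le> norm a * norm b" using co Cauchy_Schwarz_ineq2[of a b] by linarith
  then have "inverse L * norm b \<le> norm a" using False by (simp add: power2_eq_square)
  then show ?thesis using L by (simp add: field_simps)
qed (use L in simp)

section \<open>Passage to the law of one innovation\<close>

locale markovian_sgd =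
  fixes M :: "'w measure" and \<U> :: "'u measure" and U :: "nat \<Rightarrow> 'w \<Rightarrow> 'u"
    and \<Xi> :: "(real ^ ('e::finite)) set"
    and \<Phi> :: "real ^ 'e \<Rightarrow> 'u \<Rightarrow> real ^ 'e"
    and g :: "real ^ ('d::finite) \<Rightarrow> real ^ 'e \<Rightarrow> real ^ 'd"
    and H :: "real ^ 'd \<Rightarrow> real"
    and m \<beta> R_H :: real
  assumes iid: "iid_innovations M \<U> U"
    and data: "sgd_data \<Xi> \<U> \<Phi> g"
    and m: "2 \<le> m" and \<beta>: "1 \<le> \<beta>" "\<beta> \<le> 2"
    and objective: "objective_assms H m \<beta> R_H"
    and update: "stochastic_update_assms M \<U> (U 1) \<Xi> \<Phi> g H m \<beta> R_H"
begin

definition N :: "'u measure" where "N = distr M \<U> (U 1)"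

sublocale M: prob_space M using iid by (simp add: iid_innovations_def)

lemma U1_meas [measurable]: "U 1 \<in> M \<rightarrow>\<^sub>M \<U>"
  using iid by (auto simp: iid_innovations_def M.indep_vars_def2)

lemma sets_N [measurable_cong, simp]: "sets N = sets \<U>" by (simp add: N_def)
lemma space_N [simp]: "space N = space \<U>" by (simp add: N_def)

sublocale N: prob_space N unfolding N_def by (rule M.prob_space_distr[OF U1_meas])

lemma meas_N: "f \<in> borel_measurable N \<longleftrightarrow> f \<in> borel_measurable \<U>"
  by (rule arg_cong[where f = "\<lambda>A. f \<in> A"], rule measurable_cong_sets) simp_all

lemma integral_N: "f \<in> borel_measurable \<U> \<Longrightarrow> integral\<^sup>L N f = (\<integral>\<omega>. f (U 1 \<omega>) \<partial>M)"
  for f :: "'u \<Rightarrow> 'b::{banach, second_countable_topology}"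
  unfolding N_def by (rule integral_distr[OF U1_meas])

lemma integrable_N: "f \<in> borel_measurable \<U> \<Longrightarrow> integrable N f \<longleftrightarrow> integrable M (\<lambda>\<omega>. f (U 1 \<omega>))"
  for f :: "'u \<Rightarrow> 'b::{banach, second_countable_topology}"
  unfolding N_def by (rule integrable_distr_eq[OF U1_meas])

lemma nn_integral_N: "f \<in> borel_measurable \<U> \<Longrightarrow> integral\<^sup>N N f = (\<integral>\<^sup>+\<omega>. f (U 1 \<omega>) \<partial>M)"
  unfolding N_def by (rule nn_integral_distr[OF U1_meas]) simp

lemma \<Xi>: "\<Xi> \<noteq> {}" "closed \<Xi>" "convex \<Xi>" using data by (auto simp: sgd_data_def)

lemma \<Phi>_meas: "(\<lambda>(\<xi>, u). \<Phi> \<xi> u) \<in> restrict_space borel \<Xi> \<Otimes>\<^sub>M N \<rightarrow>\<^sub>M restrict_space borel \<Xi>"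
proof -
  have "sets (restrict_space borel \<Xi> \<Otimes>\<^sub>M N) = sets (restrict_space borel \<Xi> \<Otimes>\<^sub>M \<U>)"
    by (rule sets_pair_measure_cong) simp_all
  note eq = measurable_cong_sets[OF this refl]
  show ?thesis using data unfolding sgd_data_def eq by blast
qed

lemma \<Phi>_meas1: "\<xi> \<in> \<Xi> \<Longrightarrow> (\<lambda>u. \<Phi> \<xi> u) \<in> \<U> \<rightarrow>\<^sub>M restrict_space borel \<Xi>"
proof -
  assume "\<xi> \<in> \<Xi>"
  then have "\<xi> \<in> space (restrict_space borel \<Xi>)" by (simp add: space_restrict_space)
  from measurable_compose[OF measurable_Pair1'[OF this, of \<U>], of "\<lambda>(\<xi>, u). \<Phi> \<xi> u"] data
  show ?thesis by (simp add: sgd_data_def)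
qed

lemma \<Phi>_in: "\<xi> \<in> \<Xi> \<Longrightarrow> u \<in> space \<U> \<Longrightarrow> \<Phi> \<xi> u \<in> \<Xi>"
  using measurable_space[OF \<Phi>_meas1, of \<xi> u] by (simp add: space_restrict_space)

lemma \<Phi>_borel: "\<xi> \<in> \<Xi> \<Longrightarrow> (\<lambda>u. \<Phi> \<xi> u) \<in> borel_measurable \<U>"
  using \<Phi>_meas1 by (simp add: measurable_restrict_space2_iff)

lemma g\<Phi>_meas [measurable]: "\<xi> \<in> \<Xi> \<Longrightarrow> (\<lambda>u. g x (\<Phi> \<xi> u)) \<in> borel_measurable \<U>"
proof -
  assume \<xi>: "\<xi> \<in> \<Xi>"
  have "(\<lambda>u. (x, \<Phi> \<xi> u)) \<in> \<U> \<rightarrow>\<^sub>M borel \<Otimes>\<^sub>M borel" using \<Phi>_borel[OF \<xi>] by measurable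
  then have "(\<lambda>u. (x, \<Phi> \<xi> u)) \<in> \<U> \<rightarrow>\<^sub>M restrict_space borel (UNIV \<times> \<Xi>)"
    using \<Phi>_in[OF \<xi>] by (intro measurable_restrict_space2) (auto simp: borel_prod)
  from measurable_compose[OF this, of "\<lambda>(x, \<xi>). g x \<xi>"] data show ?thesis by (simp add: sgd_data_def)
qed

definition "h' x v = hessian H x *v v"

lemma grad_deriv: "(grad H has_derivative h' x) (at x)"
proof -
  have "grad H differentiable (at x)"
    using objective by (auto simp: objective_assms_def regularity_def C2_fun_def C1_map_def differentiable_def)
  then show ?thesis unfolding h'_def[abs_def] hessian_def by (simp add: jacobian_works)
qed

lemma grad_0: "grad H 0 = 0"
  using objective by (intro grad_eq_0_at_min) (auto simp: objective_assms_def regularity_def C2_fun_def)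

lemma R_pos: "0 < R_H" using objective by (simp add: objective_assms_def local_flatness_def)

lemma ex_inner_convex:
  obtains cin where "0 < cin"
    "\<And>x v. norm x \<le> R_H \<Longrightarrow> x \<noteq> 0 \<or> m = 2 \<Longrightarrow> cin * rpow (norm x) (m - 2) * (norm v)\<^sup>2 \<le> v \<bullet> h' x v"
proof -
  obtain cin where cin: "0 < cin" "\<And>x. norm x \<le> R_H \<and> (x \<noteq> 0 \<or> m = 2) \<Longrightarrow>
      loewner_ge (hessian H x) ((cin * rpow (norm x) (m - 2)) *\<^sub>R mat 1)"
    using objective by (auto simp: objective_assms_def local_flatness_def)
  show thesis
    by (rule that[OF cin(1)]) (simp add: h'_def loewner_ge_scaled_identity cin(2))
qed

lemma cocoercive:
  obtains L \<theta> where "1 \<le> L" "0 \<le> \<theta>" "\<theta> < 1"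
    "\<And>x y \<xi>. \<xi> \<in> \<Xi> \<Longrightarrow> inverse L * (norm ((grad H x + g x \<xi>) - (grad H y + g y \<xi>)))\<^sup>2
      \<le> (x - y) \<bullet> ((grad H x + g x \<xi>) - (grad H y + g y \<xi>))"
    "\<And>x y \<xi>. \<xi> \<in> \<Xi> \<Longrightarrow> - \<theta> * ((x - y) \<bullet> (grad H x - grad H y)) \<le>
      (x - y) \<bullet> ((\<integral>u. g x (\<Phi> \<xi> u) \<partial>N) - (\<integral>u. g y (\<Phi> \<xi> u) \<partial>N))"
proof -
  have "cocoercivity M (U 1) \<Xi> \<Phi> g H" using update by (simp add: stochastic_update_assms_def)
  then obtain L \<theta> where *: "1 \<le> L" "\<theta> \<in> {0..<1}" "\<forall>x y. \<forall>\<xi>\<in>\<Xi>.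
      inverse L * (norm ((grad H x + g x \<xi>) - (grad H y + g y \<xi>)))\<^sup>2
        \<le> (x - y) \<bullet> ((grad H x + g x \<xi>) - (grad H y + g y \<xi>)) \<and>
      - \<theta> * ((x - y) \<bullet> (grad H x - grad H y)) \<le> (x - y) \<bullet> (noise_mean M (U 1) \<Phi> g x \<xi> - noise_mean M (U 1) \<Phi> g y \<xi>)"
    unfolding cocoercivity_def Let_def by blast
  have nm: "noise_mean M (U 1) \<Phi> g x \<xi> = (\<integral>u. g x (\<Phi> \<xi> u) \<partial>N)" if "\<xi> \<in> \<Xi>" for x \<xi>
    using integral_N[OF g\<Phi>_meas[OF that]] by (simp add: noise_mean_def)
  show thesis by (rule that[of L \<theta>]) (use * nm in auto)
qed

lemma lipschitz:
  obtains Lg where "0 < Lg" "\<And>x \<xi> \<eta> u. \<xi> \<in> \<Xi> \<Longrightarrow> \<eta> \<in> \<Xi> \<Longrightarrow> u \<in> space \<U> \<Longrightarrow> norm (g x (\<Phi> \<xi> u) - g x (\<Phi> \<eta> u)) \<le> Lg * norm (\<xi> - \<eta>)"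
  using update unfolding stochastic_update_assms_def lipschitz_noise_def by metis

lemma exponential_moment:
  assumes "\<beta> < 2"
  obtains lam0 Kexp where "0 < lam0" "1 \<le> Kexp"
    "\<And>x \<xi>. \<xi> \<in> \<Xi> \<Longrightarrow> (\<integral>\<^sup>+u. ennreal (exp (lam0 * (norm (g x (\<Phi> \<xi> u)) / (1 + rpow (norm x) (\<beta> - 1))))) \<partial>N) \<le> ennreal Kexp"
proof -
  have "exponential_integrability M (U 1) \<Xi> \<Phi> g \<beta>" using update \<beta> assms by (simp add: stochastic_update_assms_def)
  then obtain lam0 where lam0: "0 < lam0" and fin: "(SUP x. SUP \<xi>\<in>\<Xi>. \<integral>\<^sup>+\<omega>. ennreal (exp (lam0 *
        (norm (g x (\<Phi> \<xi> (U 1 \<omega>))) / (1 + rpow (norm x) (\<beta> - 1))))) \<partial>M) < \<infinity>" (is "?S < \<infinity>")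
    unfolding exponential_integrability_def by blast
  show thesis
  proof (rule that[OF lam0, of "max 1 (enn2real ?S)"])
    fix x \<xi> assume \<xi>: "\<xi> \<in> \<Xi>"
    note [measurable] = g\<Phi>_meas[OF \<xi>, of x]
    have "(\<integral>\<^sup>+u. ennreal (exp (lam0 * (norm (g x (\<Phi> \<xi> u)) / (1 + rpow (norm x) (\<beta> - 1))))) \<partial>N) =
      (\<integral>\<^sup>+\<omega>. ennreal (exp (lam0 * (norm (g x (\<Phi> \<xi> (U 1 \<omega>))) / (1 + rpow (norm x) (\<beta> - 1))))) \<partial>M)"
      by (rule nn_integral_N) measurable
    also have "\<dots> \<le> (SUP \<xi>\<in>\<Xi>. \<integral>\<^sup>+\<omega>. ennreal (exp (lam0 *
        (norm (g x (\<Phi> \<xi> (U 1 \<omega>))) / (1 + rpow (norm x) (\<beta> - 1))))) \<partial>M)"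
      by (rule SUP_upper[OF \<xi>])
    also have "\<dots> \<le> ?S" by (rule SUP_upper) simp
    also have "\<dots> = ennreal (enn2real ?S)" using fin by (simp add: less_top)
    also have "\<dots> \<le> ennreal (max 1 (enn2real ?S))" by (intro ennreal_leI) simp
    finally show "(\<integral>\<^sup>+u. ennreal (exp (lam0 * (norm (g x (\<Phi> \<xi> u)) / (1 + rpow (norm x) (\<beta> - 1))))) \<partial>N)
      \<le> ennreal (max 1 (enn2real ?S))" .
  qed simp
qed

lemma reference:
  obtains \<xi>s where "\<xi>s \<in> \<Xi>" "integrable N (\<lambda>u. norm (\<Phi> \<xi>s u - \<xi>s))"
    "\<beta> = 2 \<Longrightarrow> integrable N (\<lambda>u. norm (g 0 (\<Phi> \<xi>s u)))"
proof -
  obtain \<xi>s where \<xi>s: "\<xi>s \<in> \<Xi>" "integrable M (\<lambda>\<omega>. norm (\<Phi> \<xi>s (U 1 \<omega>) - \<xi>s))"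
      "\<beta> = 2 \<longrightarrow> integrable M (\<lambda>\<omega>. norm (g 0 (\<Phi> \<xi>s (U 1 \<omega>))))"
    using update by (auto simp: stochastic_update_assms_def reference_point_def)
  note [measurable] = g\<Phi>_meas[OF \<xi>s(1), of 0] \<Phi>_borel[OF \<xi>s(1)]
  have i: "integrable N (\<lambda>u. norm (\<Phi> \<xi>s u - \<xi>s)) \<longleftrightarrow> integrable M (\<lambda>\<omega>. norm (\<Phi> \<xi>s (U 1 \<omega>) - \<xi>s))"
    "integrable N (\<lambda>u. norm (g 0 (\<Phi> \<xi>s u))) \<longleftrightarrow> integrable M (\<lambda>\<omega>. norm (g 0 (\<Phi> \<xi>s (U 1 \<omega>))))"
    by (rule integrable_N; measurable)+
  show thesis by (rule that[OF \<xi>s(1)]) (use i \<xi>s in auto)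
qed

text \<open>For \<open>\<beta> = 2\<close> a mean is given only at the origin and the reference
  state. The Lipschitz bound changes the noise state, and co-coercivity makes
  \<open>grad H x + g x \<xi>\<close> Lipschitz in \<open>x\<close>, which changes the position. For
  \<open>\<beta> < 2\<close> the exponential moment dominates the norm.\<close>

lemma g_integrable: assumes \<xi>: "\<xi> \<in> \<Xi>" shows "integrable N (\<lambda>u. g x (\<Phi> \<xi> u))"
proof (cases "\<beta> = 2")
  case True
  obtain \<xi>s where \<xi>s: "\<xi>s \<in> \<Xi>" "integrable N (\<lambda>u. norm (g 0 (\<Phi> \<xi>s u)))" using reference True by metis
  obtain L \<theta> where L: "1 \<le> L" "\<And>x y \<xi>. \<xi> \<in> \<Xi> \<Longrightarrow> inverse L * (norm ((grad H x + g x \<xi>) - (grad H y + g y \<xi>)))\<^sup>2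
      \<le> (x - y) \<bullet> ((grad H x + g x \<xi>) - (grad H y + g y \<xi>))" using cocoercive by metis
  obtain Lg where Lg: "\<And>x \<xi> \<eta> u. \<xi> \<in> \<Xi> \<Longrightarrow> \<eta> \<in> \<Xi> \<Longrightarrow> u \<in> space \<U> \<Longrightarrow> norm (g x (\<Phi> \<xi> u) - g x (\<Phi> \<eta> u)) \<le> Lg * norm (\<xi> - \<eta>)"
    using lipschitz by metis
  let ?B = "\<lambda>u. norm (g 0 (\<Phi> \<xi>s u)) + (Lg * norm (\<xi> - \<xi>s) + L * norm x + norm (grad H x))"
  have "integrable N ?B" using \<xi>s(2) by (intro Bochner_Integration.integrable_add) auto
  then show ?thesis
  proof (rule Bochner_Integration.integrable_bound)
    show "(\<lambda>u. g x (\<Phi> \<xi> u)) \<in> borel_measurable N" using g\<Phi>_meas[OF \<xi>] by (simp only: meas_N)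
    show "AE u in N. norm (g x (\<Phi> \<xi> u)) \<le> norm (?B u)"
    proof (rule AE_I2)
      fix u assume "u \<in> space N"
      then have u: "u \<in> space \<U>" by simp
      have 1: "norm (g 0 (\<Phi> \<xi> u) - g 0 (\<Phi> \<xi>s u)) \<le> Lg * norm (\<xi> - \<xi>s)" by (rule Lg[OF \<xi> \<xi>s(1) u])
      have "norm ((grad H x + g x (\<Phi> \<xi> u)) - (grad H 0 + g 0 (\<Phi> \<xi> u))) \<le> L * norm (x - 0)"
        using L(1) by (intro lipschitz_of_cocoercive L(2) \<Phi>_in[OF \<xi> u]) simp
      then have 2: "norm (grad H x + (g x (\<Phi> \<xi> u) - g 0 (\<Phi> \<xi> u))) \<le> L * norm x" by (simp add: grad_0 algebra_simps)
      have "norm (g x (\<Phi> \<xi> u)) = norm ((grad H x + (g x (\<Phi> \<xi> u) - g 0 (\<Phi> \<xi> u))) + ((g 0 (\<Phi> \<xi> u) - g 0 (\<Phi> \<xi>s u)) + (g 0 (\<Phi> \<xi>s u) - grad H x)))" by simp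
      also have "\<dots> \<le> norm (grad H x + (g x (\<Phi> \<xi> u) - g 0 (\<Phi> \<xi> u))) + (norm (g 0 (\<Phi> \<xi> u) - g 0 (\<Phi> \<xi>s u)) + (norm (g 0 (\<Phi> \<xi>s u)) + norm (grad H x)))"
        by (intro norm_triangle_mono norm_triangle_ineq4 order_refl)
      also have "\<dots> \<le> ?B u" using 1 2 by linarith
      also have "\<dots> \<le> norm (?B u)" by (simp add: abs_ge_self)
      finally show "norm (g x (\<Phi> \<xi> u)) \<le> norm (?B u)" .
    qed
  qed
next
  case False
  then have "\<beta> < 2" using \<beta> by simp
  then obtain lam0 Kexp where e: "0 < lam0"
    "\<And>x \<xi>. \<xi> \<in> \<Xi> \<Longrightarrow> (\<integral>\<^sup>+u. ennreal (exp (lam0 * (norm (g x (\<Phi> \<xi> u)) / (1 + rpow (norm x) (\<beta> - 1))))) \<partial>N) \<le> ennreal Kexp"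
    using exponential_moment by metis
  define D where "D = 1 + rpow (norm x) (\<beta> - 1)"
  have D: "0 < D" by (auto simp: D_def rpow_def intro: add_pos_nonneg)
  have [measurable]: "(\<lambda>u. g x (\<Phi> \<xi> u)) \<in> borel_measurable N" using g\<Phi>_meas[OF \<xi>] by (simp only: meas_N)
  have "integrable N (\<lambda>u. exp (lam0 * (norm (g x (\<Phi> \<xi> u)) / D)))"
    using e(2)[OF \<xi>, of x] unfolding D_def[symmetric]
    by (intro integrableI_nonneg) (auto intro: order.strict_trans1)
  then have "integrable N (\<lambda>u. D / lam0 * exp (lam0 * (norm (g x (\<Phi> \<xi> u)) / D)))" by (rule integrable_mult_right)
  then show ?thesis
  proof (rule Bochner_Integration.integrable_bound)
    show "AE u in N. norm (g x (\<Phi> \<xi> u)) \<le> norm (D / lam0 * exp (lam0 * (norm (g x (\<Phi> \<xi> u)) / D)))"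
    proof (rule AE_I2)
      fix u
      let ?t = "lam0 * (norm (g x (\<Phi> \<xi> u)) / D)"
      have "norm (g x (\<Phi> \<xi> u)) = D / lam0 * ?t" using D e(1) by simp
      also have "\<dots> \<le> D / lam0 * exp ?t"
      proof (rule mult_left_mono)
        show "?t \<le> exp ?t" using exp_ge_add_one_self[of ?t] by linarith
      qed (use D e(1) in simp)
      also have "\<dots> \<le> norm (D / lam0 * exp ?t)" by (simp only: real_norm_def abs_ge_self)
      finally show "norm (g x (\<Phi> \<xi> u)) \<le> norm (D / lam0 * exp ?t)" .
    qed
  qed measurable
qed

lemma ex_sgd: "\<exists>L\<Phi> Lg L \<theta>. sgd N \<Xi> \<Phi> g (grad H) h' L\<Phi> Lg L \<theta>"
proof -
  obtain L \<theta> where L: "1 \<le> L" "0 \<le> \<theta>" "\<theta> < 1"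
    "\<And>x y \<xi>. \<xi> \<in> \<Xi> \<Longrightarrow> inverse L * (norm ((grad H x + g x \<xi>) - (grad H y + g y \<xi>)))\<^sup>2
      \<le> (x - y) \<bullet> ((grad H x + g x \<xi>) - (grad H y + g y \<xi>))"
    "\<And>x y \<xi>. \<xi> \<in> \<Xi> \<Longrightarrow> - \<theta> * ((x - y) \<bullet> (grad H x - grad H y)) \<le>
      (x - y) \<bullet> ((\<integral>u. g x (\<Phi> \<xi> u) \<partial>N) - (\<integral>u. g y (\<Phi> \<xi> u) \<partial>N))" by (rule cocoercive, rule that)
  obtain Lg where Lg: "0 < Lg" "\<And>x \<xi> \<eta> u. \<xi> \<in> \<Xi> \<Longrightarrow> \<eta> \<in> \<Xi> \<Longrightarrow> u \<in> space \<U> \<Longrightarrow> norm (g x (\<Phi> \<xi> u) - g x (\<Phi> \<eta> u)) \<le> Lg * norm (\<xi> - \<eta>)"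
    by (rule lipschitz) blast
  obtain L\<Phi> where L\<Phi>: "L\<Phi> \<in> borel_measurable \<U>" "\<And>u. u \<in> space \<U> \<Longrightarrow> 0 \<le> L\<Phi> u \<and> L\<Phi> u \<le> 1"
    "\<And>\<xi> \<eta> u. \<xi> \<in> \<Xi> \<Longrightarrow> \<eta> \<in> \<Xi> \<Longrightarrow> u \<in> space \<U> \<Longrightarrow> norm (\<Phi> \<xi> u - \<Phi> \<eta> u) \<le> L\<Phi> u * norm (\<xi> - \<eta>)"
    "(\<integral>\<omega>. L\<Phi> (U 1 \<omega>) \<partial>M) < 1"
    using update unfolding stochastic_update_assms_def driving_contraction_def by blast
  have gm: "(\<lambda>(x, \<xi>). g x \<xi>) \<in> borel_measurable (restrict_space borel (UNIV \<times> \<Xi>))" using data by (simp add: sgd_data_def)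
  have "sgd N \<Xi> \<Phi> g (grad H) h' L\<Phi> Lg L \<theta>"
  proof (unfold_locales, goal_cases)
    case 7 show ?case using L\<Phi>(1) by (simp only: meas_N)
  next
    case 9 show ?case using L\<Phi>(4) by (simp only: integral_N[OF L\<Phi>(1)])
  qed (use \<Xi> \<Phi>_meas gm grad_deriv grad_0 L\<Phi>(2,3) Lg L g_integrable in \<open>auto simp del: split_paired_All\<close>)
  then show ?thesis by blast
qed

lemma ex_nondegenerate:
  obtains \<epsilon> p where "0 < \<epsilon>" "0 < p" "\<And>\<xi>. 2 < m \<Longrightarrow> \<xi> \<in> \<Xi> \<Longrightarrow> p \<le> measure N {u \<in> space N. \<epsilon> \<le> norm (g 0 (\<Phi> \<xi> u))}"
proof (cases "2 < m")
  case True
  then obtain \<epsilon> p where ep: "0 < \<epsilon>" "0 < p" "p \<le> (INF \<xi>\<in>\<Xi>. measure M {\<omega>\<in>space M. \<epsilon> \<le> norm (g 0 (\<Phi> \<xi> (U 1 \<omega>)))})"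
    using update unfolding stochastic_update_assms_def nondegeneracy_def by blast
  show thesis
  proof (rule that[OF ep(1,2)])
    fix \<xi> assume \<xi>: "\<xi> \<in> \<Xi>"
    note [measurable] = g\<Phi>_meas[OF \<xi>, of 0]
    have "p \<le> (INF \<xi>\<in>\<Xi>. measure M {\<omega>\<in>space M. \<epsilon> \<le> norm (g 0 (\<Phi> \<xi> (U 1 \<omega>)))})" by (rule ep(3))
    also have "\<dots> \<le> measure M {\<omega>\<in>space M. \<epsilon> \<le> norm (g 0 (\<Phi> \<xi> (U 1 \<omega>)))}"
      by (intro cINF_lower \<xi> bdd_belowI[of _ 0]) auto
    also have "\<dots> = measure N {u \<in> space \<U>. \<epsilon> \<le> norm (g 0 (\<Phi> \<xi> u))}"
      unfolding N_def using measurable_space[OF U1_meas]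
      by (subst measure_distr[OF U1_meas]) (measurable, auto intro!: arg_cong[where f = "measure M"])
    finally show "p \<le> measure N {u \<in> space N. \<epsilon> \<le> norm (g 0 (\<Phi> \<xi> u))}" by simp
  qed
\<comment> \<open>For \<open>m = 2\<close> the probability bound is vacuous, so any positive
  constants serve.\<close>
qed (use that[of 1 1] in simp)

section \<open>Lyapunov data for the two kinds of tail\<close>

text \<open>Strong convexity in the tail allows \<open>\<psi> = 1\<close> with an empty far region:
  beyond radius \<open>R_H / 4\<close> the Hessian is bounded below by \<open>kmid\<close>.
  Increments of \<open>\<psi>\<close> vanish, so \<open>C = 0\<close>, and the drift condition is
  vacuous, so \<open>c'\<close> may be any positive number.\<close>

lemma ex_lyapunov_quadratic_tail:
  assumes \<beta>2: "\<beta> = 2"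
  shows "\<exists>L\<Phi> Lg L \<theta> \<psi> far R0 cin kmid c' C \<alpha>1 \<Lambda> \<epsilon> p \<xi>s.
    sgd_lyapunov N \<Xi> \<Phi> g (grad H) h' L\<Phi> Lg L \<theta> \<psi> far m R0 cin kmid c' C \<alpha>1 \<Lambda> \<epsilon> p \<xi>s"
proof -
  obtain L\<Phi> Lg L \<theta> where S: "sgd N \<Xi> \<Phi> g (grad H) h' L\<Phi> Lg L \<theta>" using ex_sgd by blast
  then interpret S: sgd N \<Xi> \<Phi> g "grad H" h' L\<Phi> Lg L \<theta> .
  obtain cin where cin: "0 < cin" "\<And>x v. norm x \<le> R_H \<Longrightarrow> x \<noteq> 0 \<or> m = 2 \<Longrightarrow> cin * rpow (norm x) (m - 2) * (norm v)\<^sup>2 \<le> v \<bullet> h' x v"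
    by (rule ex_inner_convex) blast
  obtain cout where cout: "0 < cout" "\<And>x. R_H \<le> norm x \<Longrightarrow> loewner_ge (hessian H x) (cout *\<^sub>R mat 1)"
    using objective \<beta>2 by (auto simp: objective_assms_def tail_growth_def)
  obtain \<epsilon> p where nd: "0 < \<epsilon>" "0 < p" "\<And>\<xi>. 2 < m \<Longrightarrow> \<xi> \<in> \<Xi> \<Longrightarrow> p \<le> measure N {u \<in> space N. \<epsilon> \<le> norm (g 0 (\<Phi> \<xi> u))}"
    by (rule ex_nondegenerate, rule that)
  obtain \<xi>s where \<xi>s: "\<xi>s \<in> \<Xi>" "integrable N (\<lambda>u. norm (\<Phi> \<xi>s u - \<xi>s))" "integrable N (\<lambda>u. norm (g 0 (\<Phi> \<xi>s u)))"
    using reference \<beta>2 by metis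
  define kmid where "kmid = min (cin * rpow (R_H / 4) (m - 2)) cout"
  have kmid: "0 < kmid" using cin cout R_pos by (simp add: kmid_def rpow_pos)
  have mid: "kmid * (norm v)\<^sup>2 \<le> v \<bullet> h' x v" if x: "R_H / 4 < norm x" for x v
  proof (cases "norm x \<le> R_H")
    case True
    have "rpow (R_H / 4) (m - 2) \<le> rpow (norm x) (m - 2)" using x R_pos m by (intro rpow_mono) auto
    then have "cin * rpow (R_H / 4) (m - 2) \<le> cin * rpow (norm x) (m - 2)" using cin(1) by (intro mult_left_mono) auto
    then have "kmid \<le> cin * rpow (norm x) (m - 2)" by (simp add: kmid_def)
    then have "kmid * (norm v)\<^sup>2 \<le> cin * rpow (norm x) (m - 2) * (norm v)\<^sup>2" by (rule mult_right_mono) simp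
    also have "\<dots> \<le> v \<bullet> h' x v" using x R_pos True by (intro cin(2)) auto
    finally show ?thesis .
  next
    case False
    have "kmid * (norm v)\<^sup>2 \<le> cout * (norm v)\<^sup>2" by (intro mult_right_mono) (auto simp: kmid_def)
    also have "\<dots> \<le> v \<bullet> h' x v" using False by (auto simp: h'_def intro!: loewner_ge_scaled_identity cout(2))
    finally show ?thesis .
  qed
  have start: "(\<integral>\<^sup>+u. ennreal (1 * norm (g 0 (\<Phi> \<xi>s u))) \<partial>N) < \<infinity>"
  proof -
    have "(\<integral>\<^sup>+u. ennreal (1 * norm (g 0 (\<Phi> \<xi>s u))) \<partial>N) = ennreal (\<integral>u. norm (g 0 (\<Phi> \<xi>s u)) \<partial>N)"
      using \<xi>s(3) by (subst nn_integral_eq_integral) auto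
    then show ?thesis by simp
  qed
  have "sgd_lyapunov N \<Xi> \<Phi> g (grad H) h' L\<Phi> Lg L \<theta> (\<lambda>_. 1) (\<lambda>_. False) m (R_H / 4) cin kmid 1 0 1 0 \<epsilon> p \<xi>s"
  proof (rule sgd_lyapunov.intro[OF S], rule sgd_lyapunov_axioms.intro)
    show "cin * rpow (norm x) (m - 2) * (norm v)\<^sup>2 \<le> v \<bullet> h' x v" if "norm x \<le> R_H / 4" "x \<noteq> 0 \<or> m = 2" for x v
      using that R_pos by (intro cin(2)) auto
  qed (use m R_pos cin(1) kmid nd mid \<xi>s start in auto)
  then show ?thesis by blast
qed

lemma ex_subquadratic_tail:
  assumes \<beta>2: "\<beta> < 2"
  obtains K cd lam0 Kexp where "subquadratic_tail N (\<lambda>x \<xi> u. g x (\<Phi> \<xi> u)) (grad H) \<Xi> \<beta> R_H K cd lam0 Kexp"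
proof -
  obtain lam0 Kexp where e: "0 < lam0" "1 \<le> Kexp"
    "\<And>x \<xi>. \<xi> \<in> \<Xi> \<Longrightarrow> (\<integral>\<^sup>+u. ennreal (exp (lam0 * (norm (g x (\<Phi> \<xi> u)) / (1 + rpow (norm x) (\<beta> - 1))))) \<partial>N) \<le> ennreal Kexp"
    by (rule exponential_moment[OF \<beta>2]) blast
  obtain cd where cd: "0 < cd" "\<And>x \<xi>. \<xi> \<in> \<Xi> \<Longrightarrow> R_H \<le> norm x \<Longrightarrow> cd * rpow (norm x) \<beta> \<le> x \<bullet> (grad H x + noise_mean M (U 1) \<Phi> g x \<xi>)"
    using update \<beta> \<beta>2 unfolding stochastic_update_assms_def tail_dissipativity_def by blast
  obtain Cout where Cout: "0 < Cout" "\<And>x. R_H \<le> norm x \<Longrightarrow> norm (grad H x) \<le> Cout * rpow (norm x) (\<beta> - 1)"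
    using objective \<beta> \<beta>2 unfolding objective_assms_def tail_growth_def by blast
  have "continuous_on (cball 0 R_H) (grad H)"
    by (intro continuous_at_imp_continuous_on ballI has_derivative_continuous[OF grad_deriv])
  then have "bounded (grad H ` cball 0 R_H)" by (intro compact_imp_bounded compact_continuous_image) auto
  then obtain b where b: "0 < b" "\<And>x. norm x \<le> R_H \<Longrightarrow> norm (grad H x) \<le> b"
    unfolding bounded_pos by (auto simp: mem_cball dist_norm)
  \<comment> \<open>\<open>q0\<close> is the reciprocal of the least value of
    \<open>max (norm x) (R_H / 2) powr (\<beta> - 1)\<close>. It turns the constant bounds,
    \<open>b\<close> for the gradient in the ball and 1, into multiples of that power;
    \<open>Cout\<close> covers the gradient in the tail.\<close>
  define q0 where "q0 = (R_H / 2) powr (1 - \<beta>)"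
  define K where "K = 1 + Cout + (b + 1) * q0"
  have q0: "0 < q0" using R_pos by (simp add: q0_def)
  have one: "1 \<le> q0 * max (norm x) (R_H / 2) powr (\<beta> - 1)" for x :: "real ^ 'd"
  proof -
    have "q0 * (R_H / 2) powr (\<beta> - 1) = 1" using R_pos by (simp add: q0_def powr_add[symmetric])
    moreover have "q0 * (R_H / 2) powr (\<beta> - 1) \<le> q0 * max (norm x) (R_H / 2) powr (\<beta> - 1)"
      using R_pos \<beta> q0 by (intro mult_left_mono powr_mono2) auto
    ultimately show ?thesis by simp
  qed
  have rp: "rpow (norm x) (\<beta> - 1) \<le> max (norm x) (R_H / 2) powr (\<beta> - 1)" for x :: "real ^ 'd"
    using rpow_mono[of "norm x" "max (norm x) (R_H / 2)" "\<beta> - 1"] \<beta> R_pos by (simp add: rpow_eq_powr less_max_iff_disj)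
  have "subquadratic_tail N (\<lambda>x \<xi> u. g x (\<Phi> \<xi> u)) (grad H) \<Xi> \<beta> R_H K cd lam0 Kexp"
  proof
    show "1 \<le> \<beta>" "\<beta> < 2" "0 < R_H" "0 < cd" "0 < lam0" "1 \<le> Kexp" using \<beta> \<beta>2 R_pos cd e by auto
    show "1 \<le> K" using Cout b q0 by (simp add: K_def)
    fix x :: "real ^ 'd"
    let ?M = "max (norm x) (R_H / 2) powr (\<beta> - 1)"
    have KM: "K * ?M = ?M + Cout * ?M + b * (q0 * ?M) + q0 * ?M" by (simp add: K_def algebra_simps)
    have M: "0 \<le> ?M" by simp
    have bM: "b \<le> b * (q0 * ?M)" using one[of x] b(1) mult_left_mono[of 1 "q0 * ?M" b] by simp
    have CM: "0 \<le> Cout * ?M" using Cout(1) by simp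
    show "norm (grad H x) \<le> K * ?M"
    proof (cases "norm x \<le> R_H")
      case True
      then show ?thesis using b(2)[OF True] KM M bM CM one[of x] by linarith
    next
      case False
      then have "norm (grad H x) \<le> Cout * rpow (norm x) (\<beta> - 1)" by (intro Cout(2)) simp
      also have "\<dots> \<le> Cout * ?M" using rp Cout(1) by (intro mult_left_mono) auto
      finally show ?thesis using KM M bM b(1) one[of x] by linarith
    qed
    show "1 + rpow (norm x) (\<beta> - 1) \<le> K * ?M" using rp[of x] one[of x] KM CM bM b(1) by linarith
    fix \<xi> assume \<xi>: "\<xi> \<in> \<Xi>"
    show "(\<lambda>u. g x (\<Phi> \<xi> u)) \<in> borel_measurable N" using g\<Phi>_meas[OF \<xi>] by (simp only: meas_N)
    show "integrable N (\<lambda>u. g x (\<Phi> \<xi> u))" by (rule g_integrable[OF \<xi>])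
    show "(\<integral>\<^sup>+u. ennreal (exp (lam0 * (norm (g x (\<Phi> \<xi> u)) / (1 + rpow (norm x) (\<beta> - 1))))) \<partial>N) \<le> ennreal Kexp"
      by (rule e(3)[OF \<xi>])
    assume x: "R_H \<le> norm x"
    have "noise_mean M (U 1) \<Phi> g x \<xi> = (\<integral>u. g x (\<Phi> \<xi> u) \<partial>N)"
      using integral_N[OF g\<Phi>_meas[OF \<xi>]] by (simp add: noise_mean_def)
    then show "cd * norm x powr \<beta> \<le> x \<bullet> (grad H x + (\<integral>u. g x (\<Phi> \<xi> u) \<partial>N))"
      using cd(2)[OF \<xi> x] \<beta> by (simp add: rpow_eq_powr)
  qed
  then show thesis by (rule that)
qed

lemma ex_lyapunov_subquadratic_tail:
  assumes \<beta>2: "\<beta> < 2"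
  shows "\<exists>L\<Phi> Lg L \<theta> \<psi> far R0 cin kmid c' C \<alpha>1 \<Lambda> \<epsilon> p \<xi>s.
    sgd_lyapunov N \<Xi> \<Phi> g (grad H) h' L\<Phi> Lg L \<theta> \<psi> far m R0 cin kmid c' C \<alpha>1 \<Lambda> \<epsilon> p \<xi>s"
proof -
  obtain L\<Phi> Lg L \<theta> where S: "sgd N \<Xi> \<Phi> g (grad H) h' L\<Phi> Lg L \<theta>" using ex_sgd by blast
  then interpret S: sgd N \<Xi> \<Phi> g "grad H" h' L\<Phi> Lg L \<theta> .
  obtain K cd lam0 Kexp where T: "subquadratic_tail N (\<lambda>x \<xi> u. g x (\<Phi> \<xi> u)) (grad H) \<Xi> \<beta> R_H K cd lam0 Kexp"
    by (rule ex_subquadratic_tail[OF \<beta>2])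
  then interpret T: subquadratic_tail N "\<lambda>x \<xi> u. g x (\<Phi> \<xi> u)" "grad H" \<Xi> \<beta> R_H K cd lam0 Kexp .
  obtain cin where cin: "0 < cin" "\<And>x v. norm x \<le> R_H \<Longrightarrow> x \<noteq> 0 \<or> m = 2 \<Longrightarrow> cin * rpow (norm x) (m - 2) * (norm v)\<^sup>2 \<le> v \<bullet> h' x v"
    by (rule ex_inner_convex) blast
  obtain \<epsilon> p where nd: "0 < \<epsilon>" "0 < p" "\<And>\<xi>. 2 < m \<Longrightarrow> \<xi> \<in> \<Xi> \<Longrightarrow> p \<le> measure N {u \<in> space N. \<epsilon> \<le> norm (g 0 (\<Phi> \<xi> u))}"
    by (rule ex_nondegenerate, rule that)
  obtain \<xi>s where \<xi>s: "\<xi>s \<in> \<Xi>" "integrable N (\<lambda>u. norm (\<Phi> \<xi>s u - \<xi>s))"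
    using reference by metis
  define kmid where "kmid = cin * rpow (R_H / 4) (m - 2)"
  define c2 where "c2 = ((1 - \<theta>) / 2) * kmid / 4"
  \<comment> \<open>Between the radii \<open>R_H / 4\<close> and \<open>R_H\<close> the function
    \<open>\<psi>\<close> may grow without any drift. The exponent is scaled by \<open>s\<close> so
    that its mean increase there, \<open>s * (K * T.Q 1) * \<alpha>\<close> relative to
    \<open>\<psi>\<close>, stays below a quarter of the curvature gain.\<close>
  define s where "s = min 1 (c2 / (K * T.Q 1))"
  define C1 where "C1 = (4 / R_H * (K * (R_H / 2) powr (\<beta> - 1))) powr m * T.Q m"
  define C where "C = max C1 (K * T.Q 1)"
  define C4 where "C4 = K\<^sup>2 * (R_H powr (\<beta> - 2) + 1) * T.Q 2"
  \<comment> \<open>Half of the drift; the other half absorbs the second-order term once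
    \<open>\<alpha> * C4 \<le> c'\<close>.\<close>
  define c' where "c' = s * T.q * cd / 2"
  define \<alpha>1 where "\<alpha>1 = min (T.b / K) (min (c' / (C4 + 1)) (T.b / (2 * (R_H / 2) powr (1 - \<beta>))))"
  have kmid: "0 < kmid" using cin R_pos by (simp add: kmid_def rpow_pos)
  have K0: "0 < K" using T.K(1) by simp
  have KQ: "0 < K * T.Q 1" using K0 T.Q_pos[of 1] by simp
  have c2: "0 < c2" using kmid S.\<theta> by (simp add: c2_def)
  have s: "0 < s" "s \<le> 1" "s * (K * T.Q 1) \<le> c2" "0 \<le> s"
  proof -
    show "0 < s" "s \<le> 1" using c2 KQ by (auto simp: s_def)
    then show "0 \<le> s" by simp
    have "s * (K * T.Q 1) \<le> c2 / (K * T.Q 1) * (K * T.Q 1)" using KQ by (intro mult_right_mono) (auto simp: s_def)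
    moreover have "c2 / k * k = c2" if "0 < k" for k using that by simp
    ultimately show "s * (K * T.Q 1) \<le> c2" using KQ by metis
  qed
  have C4: "0 \<le> C4" using T.Q_pos[of 2] by (simp add: C4_def)
  have c': "0 < c'" using s T.basics T.diss(1) by (simp add: c'_def)
  have \<alpha>1: "0 < \<alpha>1" using T.basics K0 c' C4 R_pos by (simp add: \<alpha>1_def)
  have C: "0 \<le> C" using KQ by (simp add: C_def)
  have a1: "\<alpha> * K \<le> T.b" "\<alpha> * C4 \<le> c'" "\<alpha> * (2 * (R_H / 2) powr (1 - \<beta>)) \<le> T.b" if "0 < \<alpha>" "\<alpha> \<le> \<alpha>1" for \<alpha>
  proof -
    have a: "\<alpha> \<le> T.b / K" "\<alpha> \<le> c' / (C4 + 1)" "\<alpha> \<le> T.b / (2 * (R_H / 2) powr (1 - \<beta>))"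
      using that by (auto simp: \<alpha>1_def)
    show "\<alpha> * K \<le> T.b" using a(1) K0 by (simp add: pos_le_divide_eq)
    have "\<alpha> * (C4 + 1) \<le> c'" using a(2) C4 by (simp add: pos_le_divide_eq)
    then show "\<alpha> * C4 \<le> c'" using that by (simp add: distrib_left)
    show "\<alpha> * (2 * (R_H / 2) powr (1 - \<beta>)) \<le> T.b" using a(3) R_pos by (simp add: pos_le_divide_eq)
  qed
  have X: "S.X1 = T.X" by (intro ext) (simp add: S.X1_def T.X_def)
  have conv: "kmid * (norm v)\<^sup>2 \<le> v \<bullet> h' x v" if x: "R_H / 4 < norm x" "\<not> R_H \<le> norm x" for x v
  proof -
    have "rpow (R_H / 4) (m - 2) \<le> rpow (norm x) (m - 2)" using x R_pos m by (intro rpow_mono) auto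
    then have "kmid \<le> cin * rpow (norm x) (m - 2)" using cin(1) unfolding kmid_def by (intro mult_left_mono) auto
    then have "kmid * (norm v)\<^sup>2 \<le> cin * rpow (norm x) (m - 2) * (norm v)\<^sup>2" by (rule mult_right_mono) simp
    also have "\<dots> \<le> v \<bullet> h' x v" using x R_pos by (intro cin(2)) auto
    finally show ?thesis .
  qed
  have \<psi>1: "1 \<le> T.\<psi> s x" for x using s T.w_nonneg[of x] by (simp add: T.\<psi>_def)
  have step: "(\<integral>\<^sup>+u. ennreal (T.\<psi> s (S.X1 \<alpha> x \<xi> u) - T.\<psi> s x) \<partial>N) \<le> ennreal (k * \<alpha> * T.\<psi> s x)"
    if "\<xi> \<in> \<Xi>" "0 < \<alpha>" "\<alpha> \<le> \<alpha>1" "s * (K * T.Q 1) \<le> k" for \<alpha> x \<xi> k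
  proof -
    have "(\<integral>\<^sup>+u. ennreal (T.\<psi> s (T.X \<alpha> x \<xi> u) - T.\<psi> s x) \<partial>N) \<le> ennreal (s * (K * T.Q 1) * \<alpha> * T.\<psi> s x)"
      using that a1(1) s by (intro T.\<psi>_step_le) auto
    also have "\<dots> \<le> ennreal (k * \<alpha> * T.\<psi> s x)"
      using that \<psi>1[of x] by (intro ennreal_leI mult_right_mono) auto
    finally show ?thesis by (simp only: X)
  qed
  have "sgd_lyapunov N \<Xi> \<Phi> g (grad H) h' L\<Phi> Lg L \<theta> (T.\<psi> s) (\<lambda>x. R_H \<le> norm x) m (R_H / 4) cin kmid c' C \<alpha>1
    ((R_H / 2) powr (1 - \<beta>)) \<epsilon> p \<xi>s"
  proof (rule sgd_lyapunov.intro[OF S], rule sgd_lyapunov_axioms.intro)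
    show "continuous_on UNIV (T.\<psi> s)" unfolding T.\<psi>_def[abs_def] by (intro continuous_intros T.w_cont)
    show "T.\<psi> s y \<le> exp ((R_H / 2) powr (1 - \<beta>) * norm (y - x)) * T.\<psi> s x" for x y
      using s by (intro T.\<psi>_log_Lipschitz) auto
    show "T.\<psi> s x \<le> T.\<psi> s y" if "norm x \<le> norm y" for x y
      using s T.w_mono[OF that] by (simp add: T.\<psi>_def mult_left_mono)
    show "cin * rpow (norm x) (m - 2) * (norm v)\<^sup>2 \<le> v \<bullet> h' x v" if "norm x \<le> R_H / 4" "x \<noteq> 0 \<or> m = 2" for x v
      using that R_pos by (intro cin(2)) auto
    show "T.\<psi> s x = 1" if "norm x \<le> R_H / 4" for x
      using that R_pos T.w_eq_0[of x] by (simp add: T.\<psi>_def)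
    show "(\<integral>\<^sup>+u. ennreal (T.\<psi> s (S.X1 \<alpha> x \<xi> u) - T.\<psi> s x) \<partial>N) \<le> ennreal (C * \<alpha> powr m)"
      if "norm x \<le> R_H / 4" "\<xi> \<in> \<Xi>" "0 < \<alpha>" "\<alpha> \<le> \<alpha>1" for x \<xi> \<alpha>
    proof -
      have "(\<integral>\<^sup>+u. ennreal (T.\<psi> s (T.X \<alpha> x \<xi> u) - T.\<psi> s x) \<partial>N) \<le> ennreal (C1 * \<alpha> powr m)"
        unfolding C1_def using that a1(1) s m by (intro T.\<psi>_jump_le) auto
      also have "\<dots> \<le> ennreal (C * \<alpha> powr m)" by (intro ennreal_leI mult_right_mono) (auto simp: C_def)
      finally show ?thesis by (simp only: X)
    qed
    show "(\<integral>\<^sup>+u. ennreal (T.\<psi> s (S.X1 \<alpha> x \<xi> u) - T.\<psi> s x) \<partial>N) \<le> ennreal ((1 - \<theta>) / 2 * kmid / 4 * \<alpha> * T.\<psi> s x)"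
      if "\<xi> \<in> \<Xi>" "0 < \<alpha>" "\<alpha> \<le> \<alpha>1" for x \<xi> \<alpha>
      using that by (rule step) (use s in \<open>simp only: c2_def\<close>)
    show "(\<integral>\<^sup>+u. ennreal (T.\<psi> s (S.X1 \<alpha> x \<xi> u) - T.\<psi> s x) \<partial>N) \<le> ennreal (C * \<alpha> * T.\<psi> s x)"
      if "\<xi> \<in> \<Xi>" "0 < \<alpha>" "\<alpha> \<le> \<alpha>1" for x \<xi> \<alpha>
    proof (rule step[OF that])
      have "s * (K * T.Q 1) \<le> 1 * (K * T.Q 1)" using s KQ by (intro mult_right_mono) auto
      then show "s * (K * T.Q 1) \<le> C" by (simp add: C_def)
    qed
    show "(\<integral>\<^sup>+u. ennreal (T.\<psi> s (S.X1 \<alpha> x \<xi> u)) \<partial>N) \<le> ennreal ((1 - c' * \<alpha>) * T.\<psi> s x)"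
      if "R_H \<le> norm x" "\<xi> \<in> \<Xi>" "0 < \<alpha>" "\<alpha> \<le> \<alpha>1" for x \<xi> \<alpha>
    proof -
      have "(\<integral>\<^sup>+u. ennreal (T.\<psi> s (T.X \<alpha> x \<xi> u)) \<partial>N) \<le> ennreal (T.\<psi> s x * (1 - s * T.q * cd * \<alpha> + \<alpha>\<^sup>2 * C4))"
        unfolding C4_def using that a1(1) s by (intro T.\<psi>_drift) auto
      also have "\<dots> \<le> ennreal ((1 - c' * \<alpha>) * T.\<psi> s x)"
      proof (rule ennreal_leI)
        have "\<alpha> * (\<alpha> * C4) \<le> \<alpha> * c'" using a1(2) that by (intro mult_left_mono) auto
        then have "1 - s * T.q * cd * \<alpha> + \<alpha>\<^sup>2 * C4 \<le> 1 - c' * \<alpha>"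
          by (simp add: c'_def power2_eq_square algebra_simps)
        then show "T.\<psi> s x * (1 - s * T.q * cd * \<alpha> + \<alpha>\<^sup>2 * C4) \<le> (1 - c' * \<alpha>) * T.\<psi> s x"
          using \<psi>1[of x] by (subst mult.commute) (intro mult_right_mono, auto)
      qed
      finally show ?thesis by (simp only: X)
    qed
    show "(\<integral>\<^sup>+u. ennreal (T.\<psi> s (\<alpha> *\<^sub>R g 0 (\<Phi> \<xi>s u)) * norm (g 0 (\<Phi> \<xi>s u))) \<partial>N) < \<infinity>" if "0 < \<alpha>" "\<alpha> \<le> \<alpha>1" for \<alpha>
      using T.start_moment[OF \<xi>s(1) s(4,2) less_imp_le[OF that(1)] a1(3)[OF that]] .
    show "kmid * (norm v)\<^sup>2 \<le> v \<bullet> h' x v" if "R_H / 4 < norm x" "\<not> R_H \<le> norm x" for x v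
      using conv[OF that] .
  qed (use m R_pos cin(1) kmid c' C \<alpha>1 nd \<xi>s \<psi>1 in auto)
  then show ?thesis by blast
qed

lemma ex_lyapunov:
  "\<exists>L\<Phi> Lg L \<theta> \<psi> far R0 cin kmid c' C \<alpha>1 \<Lambda> \<epsilon> p \<xi>s.
    sgd_lyapunov N \<Xi> \<Phi> g (grad H) h' L\<Phi> Lg L \<theta> \<psi> far m R0 cin kmid c' C \<alpha>1 \<Lambda> \<epsilon> p \<xi>s"
proof (cases "\<beta> = 2")
  case True
  then show ?thesis by (rule ex_lyapunov_quadratic_tail)
next
  case False
  with \<beta> have "\<beta> < 2" by simp
  then show ?thesis by (rule ex_lyapunov_subquadratic_tail)
qed

end

theorem theorem2p7:
  fixes M :: "'w measure" and \<U> :: "'u measure" and U :: "nat \<Rightarrow> 'w \<Rightarrow> 'u"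
    and \<Xi> :: "(real ^ ('e::finite)) set"
    and \<Phi> :: "real ^ 'e \<Rightarrow> 'u \<Rightarrow> real ^ 'e"
    and g :: "real ^ ('d::finite) \<Rightarrow> real ^ 'e \<Rightarrow> real ^ 'd"
    and H :: "real ^ 'd \<Rightarrow> real"
    and m \<beta> R_H :: real
  assumes "iid_innovations M \<U> U"
    and "sgd_data \<Xi> \<U> \<Phi> g"
    and "2 \<le> m" and "1 \<le> \<beta>" and "\<beta> \<le> 2"
    and "objective_assms H m \<beta> R_H"
    and "stochastic_update_assms M \<U> (U 1) \<Xi> \<Phi> g H m \<beta> R_H"
  shows "\<exists>\<alpha>0>0. \<exists>c\<in>{0<..<1}. \<forall>\<alpha>\<in>{0<..<1}. \<alpha> \<le> \<alpha>0 \<longrightarrow>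
    (\<exists>V. continuous_on (UNIV \<times> \<Xi>) V \<and> (\<forall>z\<in>UNIV \<times> \<Xi>. 1 \<le> V z) \<and>
      (let P = aug_kernel M U \<Xi> \<alpha> H \<Phi> g;
           W = wasserstein1 (path_metric \<Xi> V \<alpha>)
       in (\<exists>!\<pi>. \<pi> \<in> laws1 (aug_space \<Xi>) (path_metric \<Xi> V \<alpha>) \<and> \<pi> \<bind> P = \<pi>) \<and>
          (\<forall>\<mu>\<in>laws (aug_space \<Xi>). \<forall>\<nu>\<in>laws (aug_space \<Xi>). W \<mu> \<nu> < \<infinity> \<longrightarrow>
             (\<forall>n. W (((\<lambda>\<rho>. \<rho> \<bind> P) ^^ n) \<mu>) (((\<lambda>\<rho>. \<rho> \<bind> P) ^^ n) \<nu>)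
                \<le> ennreal ((1 - c * \<alpha> powr (m - 1)) ^ n) * W \<mu> \<nu>))))"
proof -
  interpret markovian_sgd M \<U> U \<Xi> \<Phi> g H m \<beta> R_H by unfold_locales (use assms in auto)
  obtain L\<Phi> Lg L \<theta> \<psi> far R0 cin kmid c' C \<alpha>1 \<Lambda> \<epsilon> p \<xi>s where
    "sgd_lyapunov N \<Xi> \<Phi> g (grad H) h' L\<Phi> Lg L \<theta> \<psi> far m R0 cin kmid c' C \<alpha>1 \<Lambda> \<epsilon> p \<xi>s"
    using ex_lyapunov by blast
  then interpret S: sgd_lyapunov N \<Xi> \<Phi> g "grad H" h' L\<Phi> Lg L \<theta> \<psi> far m R0 cin kmid c' C \<alpha>1 \<Lambda> \<epsilon> p \<xi>s .
  \<comment> \<open>\<open>S.kernel\<close> is a pushforward of \<open>N\<close>,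
    \<open>aug_kernel\<close> one of \<open>M\<close>. They are compared on the augmented space,
    where the one-step map is measurable in the innovation; laws live on that space, so both give
    the same bind.\<close>
  have kernel: "aug_kernel M U \<Xi> \<alpha> H \<Phi> g z = S.kernel \<alpha> z" if "z \<in> space (aug_space \<Xi>)" for z \<alpha>
  proof -
    have "(\<lambda>u. S.F \<alpha> u z) \<in> N \<rightarrow>\<^sub>M aug_space \<Xi>"
      using measurable_compose[OF measurable_Pair1'[of z "aug_space \<Xi>" N] S.F_meas[folded aug_space_def]] that by simp
    then have "(\<lambda>u. S.F \<alpha> u z) \<in> \<U> \<rightarrow>\<^sub>M aug_space \<Xi>" by simp
    then have "distr N (aug_space \<Xi>) (\<lambda>u. S.F \<alpha> u z) = distr M (aug_space \<Xi>) (\<lambda>\<omega>. S.F \<alpha> (U 1 \<omega>) z)"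
      unfolding N_def using distr_distr[OF _ U1_meas] by (simp only: comp_def)
    then show ?thesis by (simp add: S.kernel_def aug_kernel_def aug_map_def S.F_def S.X1_def case_prod_unfold)
  qed
  have bind_eq: "\<mu> \<bind> aug_kernel M U \<Xi> \<alpha> H \<Phi> g = \<mu> \<bind> S.kernel \<alpha>"
    if "\<mu> \<in> laws (aug_space \<Xi>)" for \<mu> \<alpha>
    using that kernel sets_eq_imp_space_eq[of \<mu> "aug_space \<Xi>"] by (intro bind_cong) (auto simp: laws_def simp del: split_paired_All)
  obtain \<alpha>0 c where \<alpha>0: "0 < \<alpha>0" "c \<in> {0<..<1}"
    "\<And>\<alpha>. \<alpha> \<in> {0<..<1} \<Longrightarrow> \<alpha> \<le> \<alpha>0 \<Longrightarrow> \<exists>V. S.contracting_weight \<alpha> (1 - c * \<alpha> powr (m - 1)) V"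
    using S.ex_stepsize_bound by metis
  show ?thesis
  proof (intro exI[of _ \<alpha>0] conjI bexI[of _ c] ballI impI \<alpha>0(1,2))
    fix \<alpha> :: real assume \<alpha>: "\<alpha> \<in> {0<..<1}" "\<alpha> \<le> \<alpha>0"
    define P where "P = aug_kernel M U \<Xi> \<alpha> H \<Phi> g"
    define Q where "Q = S.kernel \<alpha>"
    have PQ: "\<mu> \<bind> P = \<mu> \<bind> Q" if "\<mu> \<in> laws (aug_space \<Xi>)" for \<mu>
      unfolding P_def Q_def by (rule bind_eq[OF that])
    obtain V where "S.contracting_weight \<alpha> (1 - c * \<alpha> powr (m - 1)) V" using \<alpha>0(3)[OF \<alpha>] by blast
    note V = this[unfolded S.contracting_weight_def, folded Q_def]
    have Q: "((\<lambda>\<mu>. \<mu> \<bind> Q) ^^ n) \<mu> \<in> laws (aug_space \<Xi>)" if "\<mu> \<in> laws (aug_space \<Xi>)" for \<mu> n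
      using V that by blast
    \<comment> \<open>Each exchange of kernels requires the previous iterate to be a law, which
      \<open>contracting_weight\<close> provides.\<close>
    have iter: "((\<lambda>\<mu>. \<mu> \<bind> P) ^^ n) \<mu> = ((\<lambda>\<mu>. \<mu> \<bind> Q) ^^ n) \<mu>" if \<mu>: "\<mu> \<in> laws (aug_space \<Xi>)" for \<mu> n
      by (induction n) (simp_all add: PQ[OF Q[OF \<mu>]])
    have inv: "\<pi> \<in> laws1 (aug_space \<Xi>) (path_metric \<Xi> V \<alpha>) \<and> \<pi> \<bind> P = \<pi> \<longleftrightarrow>
      \<pi> \<in> laws1 (aug_space \<Xi>) (path_metric \<Xi> V \<alpha>) \<and> \<pi> \<bind> Q = \<pi>" for \<pi>
      using PQ[of \<pi>] by (auto simp: laws1_def)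
    have ex1: "\<exists>!\<pi>. \<pi> \<in> laws1 (aug_space \<Xi>) (path_metric \<Xi> V \<alpha>) \<and> \<pi> \<bind> P = \<pi>"
      unfolding inv using V by blast
    show "\<exists>V. continuous_on (UNIV \<times> \<Xi>) V \<and> (\<forall>z\<in>UNIV \<times> \<Xi>. 1 \<le> V z) \<and>
      (let P = aug_kernel M U \<Xi> \<alpha> H \<Phi> g;
           W = wasserstein1 (path_metric \<Xi> V \<alpha>)
       in (\<exists>!\<pi>. \<pi> \<in> laws1 (aug_space \<Xi>) (path_metric \<Xi> V \<alpha>) \<and> \<pi> \<bind> P = \<pi>) \<and>
          (\<forall>\<mu>\<in>laws (aug_space \<Xi>). \<forall>\<nu>\<in>laws (aug_space \<Xi>). W \<mu> \<nu> < \<infinity> \<longrightarrow>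
             (\<forall>n. W (((\<lambda>\<rho>. \<rho> \<bind> P) ^^ n) \<mu>) (((\<lambda>\<rho>. \<rho> \<bind> P) ^^ n) \<nu>)
                \<le> ennreal ((1 - c * \<alpha> powr (m - 1)) ^ n) * W \<mu> \<nu>)))"
      unfolding Let_def P_def[symmetric]
    proof (intro exI[of _ V] conjI ex1 ballI impI allI)
      fix \<mu> \<nu> :: "((real ^ 'd) \<times> (real ^ 'e)) measure" and n
      assume \<mu>\<nu>: "\<mu> \<in> laws (aug_space \<Xi>)" "\<nu> \<in> laws (aug_space \<Xi>)"
      show "wasserstein1 (path_metric \<Xi> V \<alpha>) (((\<lambda>\<rho>. \<rho> \<bind> P) ^^ n) \<mu>) (((\<lambda>\<rho>. \<rho> \<bind> P) ^^ n) \<nu>)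
        \<le> ennreal ((1 - c * \<alpha> powr (m - 1)) ^ n) * wasserstein1 (path_metric \<Xi> V \<alpha>) \<mu> \<nu>"
        unfolding iter[OF \<mu>\<nu>(1)] iter[OF \<mu>\<nu>(2)] using V \<mu>\<nu> by blast
    qed (use V in auto)
  qed
qed

end
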